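(* For every $\lambda\in\mathbb C$, every $s\in\mathbb R$ and every admissible $p,q$, the operator $L_\lambda$ is a topological isomorphism $$L_\lambda:\mathcal X^{s+1}_{p,q}(\mathbb D^d)\longrightarrow\mathcal X^s_{p,q}(\mathbb D^d).$$ Hence the equation $L_\lambda u=f$ has a unique solution $u\in\mathcal X^{s+1}_{p,q}(\mathbb D^d)$ for every $f\in\mathcal X^s_{p,q}(\mathbb D^d)$, and $$\|u\|_{\mathcal X^{s+1}_{p,q}}\le C_{\lambda,s,p,q}\|f\|_{\mathcal X^s_{p,q}}.$$
   Context: Fix $d\in\mathbb N$; $\mathbb T^d=\mathbb R^d/(2\pi\mathbb Z)^d$, $\mathbb D^d=\{z\in\mathbb C^d:|z_j|<1\text{ for all }j\}$. For $\lambda\in\mathbb C$ and $u$ holomorphic on $\mathbb D^d$, $$L_\lambda u(z)=J_du(z)+\lambda z_1u(z),\qquad J_d=d+\sum_{j=1}^dz_j\partial_{z_j}.$$ $\mathcal X^s_{p,q}(\mathbb D^d)$ denotes either $\mathcal B^s_{p,q}(\mathbb D^d)$, with admissible range $0<p,q\le\infty$, or $\mathcal F^s_{p,q}(\mathbb D^d)$, with admissible range $0<p<\infty$, $0<q\le\infty$ (the same choice on both sides), defined as follows. $\widehat f(n)=(2\pi)^{-d}\int_{[0,2\pi]^d}f(x)e^{-in\cdot x}\,dx$, extended by duality to periodic distributions $\mathcal D'(\mathbb T^d)$. $\mathcal D'_+(\mathbb T^d)=\{f\in\mathcal D'(\mathbb T^d):\widehat f(n)=0\text{ for }n\notin\mathbb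 N_0^d\}$. Choose $\varphi_0,\varphi\in C_c^\infty(\mathbb R^d)$ with $\operatorname{supp}\varphi_0\subset\{|\xi|\le2\}$, $\operatorname{supp}\varphi\subset\{1/2\le|\xi|\le2\}$, $\varphi_0(\xi)+\sum_{j\ge1}\varphi(2^{-j}\xi)=1$; $\varphi_j=\varphi(2^{-j}\cdot)$ for $j\ge1$; $\Delta_jf=\sum_n\varphi_j(n)\widehat f(n)e^{in\cdot x}$. Then $\|f\|_{B^s_{p,q}(\mathbb T^d)}=\|\{2^{js}\|\Delta_jf\|_{L^p(\mathbb T^d)}\}_{j\ge0}\|_{\ell^q}$ and $\|f\|_{F^s_{p,q}(\mathbb T^d)}=\big\|\,\|\{2^{js}\Delta_jf(x)\}_{j\ge0}\|_{\ell^q}\big\|_{L^p_x(\mathbb T^d)}$; the spaces consist of the $f\in\mathcal D'(\mathbb T^d)$ with finite quasi-norm. $B^s_{p,q,+}=B^s_{p,q}\cap\mathcal D'_+$, $F^s_{p,q,+}=F^s_{p,q}\cap\mathcal D'_+$. $\mathcal B^s_{p,q}(\mathbb D^d)$ (resp. $\mathcal F^s_{p,q}(\mathbb D^d)$) is the set of holomorphic functions $f(z)=\sum_{n\in\mathbb N_0^d}c_nz^n$ on $\mathbb D^d$ whose distributional boundary value $\sum_{n\in\mathbb N_0^d}c_ne^{in\cdot x}$ belongs to $B^s_{p,q,+}(\mathbb T^d)$ (resp. $F^s_{p,q,+}(\mathbb T^d)$), with the quasi-norm of the boundary value. *)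

theory Defs
  imports "HOL-Analysis.Analysis" "HOL-Probability.Essential_Supremum"
begin

section \<open>Quasi-norms with values in the extended half-line\<close>

definition epowr :: "ennreal \<Rightarrow> real \<Rightarrow> ennreal"  (* only used with positive exponents *)
  where "epowr x r = (if x = \<infinity> then \<infinity> else ennreal (enn2real x powr r))"

definition Lp_qnorm :: "ennreal \<Rightarrow> 'a measure \<Rightarrow> ('a \<Rightarrow> ennreal) \<Rightarrow> ennreal"
  where "Lp_qnorm p M g =
    (if p = \<infinity> then esssup M g
     else epowr (\<integral>\<^sup>+ x. epowr (g x) (enn2real p) \<partial>M) (1 / enn2real p))"

definition lq_qnorm :: "ennreal \<Rightarrow> (nat \<Rightarrow> ennreal) \<Rightarrow> ennreal"
  where "lq_qnorm q a =
    (if q = \<infinity> then (SUP j. a j)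
     else epowr (\<Sum>j. epowr (a j) (enn2real q)) (1 / enn2real q))"


section \<open>Smooth functions and periodic distributions\<close>

definition partial_deriv :: "'d \<Rightarrow> (real^'d::finite \<Rightarrow> complex) \<Rightarrow> real^'d \<Rightarrow> complex"
  where "partial_deriv i f x = frechet_derivative f (at x) (axis i 1)"

text \<open>Iterated partial derivatives are indexed by lists of coordinates instead of multi-indices.\<close>

primrec iter_partial :: "'d list \<Rightarrow> (real^'d::finite \<Rightarrow> complex) \<Rightarrow> real^'d \<Rightarrow> complex" where
  "iter_partial [] f = f"
| "iter_partial (i # is) f = partial_deriv i (iter_partial is f)"

definition C_infinity :: "(real^'d::finite \<Rightarrow> complex) \<Rightarrow> bool"
  where "C_infinity f \<longleftrightarrow> (\<forall>is x. iter_partial is f differentiable (at x))"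

definition int_vec :: "int^'d \<Rightarrow> real^'d::finite"
  where "int_vec n = (\<chi> i. real_of_int (n $ i))"

definition nat_vec :: "nat^'d \<Rightarrow> int^'d::finite"
  where "nat_vec n = (\<chi> i. int (n $ i))"

text \<open>Functions on the torus are \<open>2\<pi>\<close>-periodic functions on \<open>\<real>\<^sup>d\<close>.\<close>

definition torus_test :: "(real^'d::finite \<Rightarrow> complex) set"
  where "torus_test = {\<phi>. C_infinity \<phi> \<and> (\<forall>x n. \<phi> (x + (2 * pi) *\<^sub>R int_vec n) = \<phi> x)}"

definition torus_measure :: "(real^'d::finite) measure"
  where "torus_measure = restrict_space lborel (cbox 0 (\<chi> i. 2 * pi))"

definition torus_char :: "int^'d \<Rightarrow> real^'d::finite \<Rightarrow> complex"
  where "torus_char n x = cis (int_vec n \<bullet> x)"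

text \<open>
  The continuous linear functionals on the Frechet space \<open>torus_test\<close>. They are set to \<open>0\<close>
  outside \<open>torus_test\<close>, so that equality of distributions is equality of functions.
\<close>

definition torus_distributions :: "((real^'d::finite \<Rightarrow> complex) \<Rightarrow> complex) set"
  where "torus_distributions = {T.
    (\<forall>\<phi>\<in>torus_test. \<forall>\<psi>\<in>torus_test. T (\<lambda>x. \<phi> x + \<psi> x) = T \<phi> + T \<psi>) \<and>
    (\<forall>a. \<forall>\<phi>\<in>torus_test. T (\<lambda>x. a * \<phi> x) = a * T \<phi>) \<and>
    (\<exists>C N. \<forall>\<phi>\<in>torus_test.
       norm (T \<phi>) \<le> C * (\<Sum>is | length is \<le> N. SUP x. norm (iter_partial is \<phi> x))) \<and>
    (\<forall>\<phi>. \<phi> \<notin> torus_test \<longrightarrow> T \<phi> = 0)}"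

definition fourier_coeff :: "((real^'d::finite \<Rightarrow> complex) \<Rightarrow> complex) \<Rightarrow> int^'d \<Rightarrow> complex"
  where "fourier_coeff T n = T (torus_char (- n)) / of_real ((2 * pi) ^ CARD('d))"

definition torus_distributions_plus :: "((real^'d::finite \<Rightarrow> complex) \<Rightarrow> complex) set"
  where "torus_distributions_plus =
    {T \<in> torus_distributions. \<forall>n. (\<exists>i. n $ i < 0) \<longrightarrow> fourier_coeff T n = 0}"


section \<open>Besov and Triebel--Lizorkin quasi-norms on the torus\<close>

definition dyadic :: "(real^'d::finite \<Rightarrow> complex) \<Rightarrow> (real^'d \<Rightarrow> complex) \<Rightarrow> nat \<Rightarrow> real^'d \<Rightarrow> complex"
  where "dyadic \<phi>0 \<phi> j \<xi> = (if j = 0 then \<phi>0 \<xi> else \<phi> ((1 / 2 ^ j) *\<^sub>R \<xi>))"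

definition dyadic_resolution :: "(real^'d::finite \<Rightarrow> complex) \<Rightarrow> (real^'d \<Rightarrow> complex) \<Rightarrow> bool"
  where "dyadic_resolution \<phi>0 \<phi> \<longleftrightarrow>
    C_infinity \<phi>0 \<and> closure {\<xi>. \<phi>0 \<xi> \<noteq> 0} \<subseteq> {\<xi>. norm \<xi> \<le> 2} \<and>
    C_infinity \<phi> \<and> closure {\<xi>. \<phi> \<xi> \<noteq> 0} \<subseteq> {\<xi>. 1 / 2 \<le> norm \<xi> \<and> norm \<xi> \<le> 2} \<and>
    (\<forall>\<xi>. (\<lambda>j. dyadic \<phi>0 \<phi> j \<xi>) sums 1)"

text \<open>The sum has only finitely many non-zero terms.\<close>

definition LP_block ::
    "(real^'d::finite \<Rightarrow> complex) \<Rightarrow> (real^'d \<Rightarrow> complex) \<Rightarrow> nat \<Rightarrow>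
     ((real^'d \<Rightarrow> complex) \<Rightarrow> complex) \<Rightarrow> real^'d \<Rightarrow> complex"
  where "LP_block \<phi>0 \<phi> j T x =
    (\<Sum>\<^sub>\<infinity>n. dyadic \<phi>0 \<phi> j (int_vec n) * fourier_coeff T n * torus_char n x)"

datatype scale = Besov | Triebel_Lizorkin

fun admissible :: "scale \<Rightarrow> ennreal \<Rightarrow> ennreal \<Rightarrow> bool" where
  "admissible Besov p q \<longleftrightarrow> 0 < p \<and> 0 < q"
| "admissible Triebel_Lizorkin p q \<longleftrightarrow> 0 < p \<and> p < \<infinity> \<and> 0 < q"

fun torus_qnorm ::
    "scale \<Rightarrow> (real^'d::finite \<Rightarrow> complex) \<Rightarrow> (real^'d \<Rightarrow> complex) \<Rightarrow> real \<Rightarrow> ennreal \<Rightarrow> ennreal \<Rightarrow>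
     ((real^'d \<Rightarrow> complex) \<Rightarrow> complex) \<Rightarrow> ennreal" where
  "torus_qnorm Besov \<phi>0 \<phi> s p q T =
     lq_qnorm q (\<lambda>j. ennreal (2 powr (real j * s)) *
       Lp_qnorm p torus_measure (\<lambda>x. ennreal (norm (LP_block \<phi>0 \<phi> j T x))))"
| "torus_qnorm Triebel_Lizorkin \<phi>0 \<phi> s p q T =
     Lp_qnorm p torus_measure (\<lambda>x.
       lq_qnorm q (\<lambda>j. ennreal (2 powr (real j * s) * norm (LP_block \<phi>0 \<phi> j T x))))"

definition torus_space_plus ::
    "scale \<Rightarrow> (real^'d::finite \<Rightarrow> complex) \<Rightarrow> (real^'d \<Rightarrow> complex) \<Rightarrow> real \<Rightarrow> ennreal \<Rightarrow> ennreal \<Rightarrow>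
     ((real^'d \<Rightarrow> complex) \<Rightarrow> complex) set"
  where "torus_space_plus A \<phi>0 \<phi> s p q =
    {T \<in> torus_distributions_plus. torus_qnorm A \<phi>0 \<phi> s p q T < \<infinity>}"


section \<open>Function spaces on the polydisc\<close>

definition polydisc :: "(complex^'d::finite) set"
  where "polydisc = {z. \<forall>i. norm (z $ i) < 1}"

text \<open>
  Functions on the polydisc are extended by \<open>0\<close>, so that equality of functions on the polydisc
  is equality in the function type.
\<close>

definition holomorphic_polydisc :: "(complex^'d::finite \<Rightarrow> complex) set"
  where "holomorphic_polydisc = {u.
    (\<forall>z\<in>polydisc. \<exists>D. (u has_derivative D) (at z) \<and> (\<forall>a v. D (a *s v) = a * D v)) \<and>
    (\<forall>z. z \<notin> polydisc \<longrightarrow> u z = 0)}"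

definition power_series_of :: "(complex^'d::finite \<Rightarrow> complex) \<Rightarrow> (nat^'d \<Rightarrow> complex) \<Rightarrow> bool"
  where "power_series_of u c \<longleftrightarrow>
    (\<forall>z\<in>polydisc. ((\<lambda>n. c n * (\<Prod>i\<in>UNIV. z $ i ^ (n $ i))) has_sum u z) UNIV)"

text \<open>
  A function \<open>g\<close> on the torus is identified with the distribution sending \<open>\<phi>\<close> to the integral
  of \<open>g \<phi>\<close>; the series \<open>\<Sum> c\<^sub>n e\<^bsup>in\<cdot>x\<^esup>\<close> converges in the sense of distributions.
\<close>

definition is_boundary_value ::
    "(complex^'d::finite \<Rightarrow> complex) \<Rightarrow> ((real^'d \<Rightarrow> complex) \<Rightarrow> complex) \<Rightarrow> bool"
  where "is_boundary_value u T \<longleftrightarrow> T \<in> torus_distributions \<and>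
    (\<exists>c. power_series_of u c \<and>
      (\<forall>\<phi>\<in>torus_test.
        ((\<lambda>n. c n * (LINT x|torus_measure. torus_char (nat_vec n) x * \<phi> x)) has_sum T \<phi>) UNIV))"

definition boundary_value ::
    "(complex^'d::finite \<Rightarrow> complex) \<Rightarrow> (real^'d \<Rightarrow> complex) \<Rightarrow> complex"
  where "boundary_value u = (THE T. is_boundary_value u T)"

definition disc_space ::
    "scale \<Rightarrow> (real^'d::finite \<Rightarrow> complex) \<Rightarrow> (real^'d \<Rightarrow> complex) \<Rightarrow> real \<Rightarrow> ennreal \<Rightarrow> ennreal \<Rightarrow>
     (complex^'d \<Rightarrow> complex) set"
  where "disc_space A \<phi>0 \<phi> s p q =
    {u \<in> holomorphic_polydisc. \<exists>T. is_boundary_value u T \<and> T \<in> torus_space_plus A \<phi>0 \<phi> s p q}"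

definition disc_qnorm ::
    "scale \<Rightarrow> (real^'d::finite \<Rightarrow> complex) \<Rightarrow> (real^'d \<Rightarrow> complex) \<Rightarrow> real \<Rightarrow> ennreal \<Rightarrow> ennreal \<Rightarrow>
     (complex^'d \<Rightarrow> complex) \<Rightarrow> ennreal"
  where "disc_qnorm A \<phi>0 \<phi> s p q u = torus_qnorm A \<phi>0 \<phi> s p q (boundary_value u)"

text \<open>The topology defined by the quasi-norm.\<close>

definition disc_topology ::
    "scale \<Rightarrow> (real^'d::finite \<Rightarrow> complex) \<Rightarrow> (real^'d \<Rightarrow> complex) \<Rightarrow> real \<Rightarrow> ennreal \<Rightarrow> ennreal \<Rightarrow>
     (complex^'d \<Rightarrow> complex) topology"
  where "disc_topology A \<phi>0 \<phi> s p q = topology (\<lambda>U.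
    U \<subseteq> disc_space A \<phi>0 \<phi> s p q \<and>
    (\<forall>u\<in>U. \<exists>\<epsilon>>0. \<forall>v\<in>disc_space A \<phi>0 \<phi> s p q.
       disc_qnorm A \<phi>0 \<phi> s p q (\<lambda>z. v z - u z) < ennreal \<epsilon> \<longrightarrow> v \<in> U))"

lemma openin_disc_topology:
  "openin (disc_topology A \<phi>0 \<phi> s p q) U \<longleftrightarrow>
    U \<subseteq> disc_space A \<phi>0 \<phi> s p q \<and>
    (\<forall>u\<in>U. \<exists>\<epsilon>>0. \<forall>v\<in>disc_space A \<phi>0 \<phi> s p q.
       disc_qnorm A \<phi>0 \<phi> s p q (\<lambda>z. v z - u z) < ennreal \<epsilon> \<longrightarrow> v \<in> U)"
proof -
  let ?X = "disc_space A \<phi>0 \<phi> s p q" and ?N = "disc_qnorm A \<phi>0 \<phi> s p q"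
  let ?P = "\<lambda>U u \<epsilon>. \<forall>v\<in>?X. ?N (\<lambda>z. v z - u z) < ennreal \<epsilon> \<longrightarrow> v \<in> U"
  have "istopology (\<lambda>U. U \<subseteq> ?X \<and> (\<forall>u\<in>U. \<exists>\<epsilon>>0. ?P U u \<epsilon>))"
    unfolding istopology_def
  proof (intro conjI allI impI)
    fix S T assume S: "S \<subseteq> ?X \<and> (\<forall>u\<in>S. \<exists>\<epsilon>>0. ?P S u \<epsilon>)" and T: "T \<subseteq> ?X \<and> (\<forall>u\<in>T. \<exists>\<epsilon>>0. ?P T u \<epsilon>)"
    show "S \<inter> T \<subseteq> ?X" using S by blast
    show "\<forall>u\<in>S \<inter> T. \<exists>\<epsilon>>0. ?P (S \<inter> T) u \<epsilon>"
    proof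
      fix u assume u: "u \<in> S \<inter> T"
      obtain a where a: "a > 0" "?P S u a" using S u by blast
      obtain b where b: "b > 0" "?P T u b" using T u by blast
      have "ennreal (min a b) \<le> ennreal a" "ennreal (min a b) \<le> ennreal b"
        by (simp_all add: ennreal_leI)
      then have "?P (S \<inter> T) u (min a b)" using a(2) b(2) by (meson IntI order_less_le_trans)
      then show "\<exists>\<epsilon>>0. ?P (S \<inter> T) u \<epsilon>" using a b by (intro exI[of _ "min a b"]) simp
    qed
  next
    fix K assume K: "\<forall>S\<in>K. S \<subseteq> ?X \<and> (\<forall>u\<in>S. \<exists>\<epsilon>>0. ?P S u \<epsilon>)"
    show "\<Union> K \<subseteq> ?X" using K by blast
    show "\<forall>u\<in>\<Union> K. \<exists>\<epsilon>>0. ?P (\<Union> K) u \<epsilon>"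
    proof
      fix u assume "u \<in> \<Union> K"
      then obtain S where S: "S \<in> K" "u \<in> S" by blast
      then obtain a where a: "a > 0" "?P S u a" using K by blast
      then have "?P (\<Union> K) u a" using S by blast
      then show "\<exists>\<epsilon>>0. ?P (\<Union> K) u \<epsilon>" using a by blast
    qed
  qed
  then show ?thesis unfolding disc_topology_def by (simp add: topology_inverse')
qed

lemma topspace_disc_topology [simp]:
  "topspace (disc_topology A \<phi>0 \<phi> s p q) = disc_space A \<phi>0 \<phi> s p q"
proof (rule antisym)
  show "topspace (disc_topology A \<phi>0 \<phi> s p q) \<subseteq> disc_space A \<phi>0 \<phi> s p q"
    using openin_topspace openin_disc_topology by blast
  have "openin (disc_topology A \<phi>0 \<phi> s p q) (disc_space A \<phi>0 \<phi> s p q)"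
    unfolding openin_disc_topology using zero_less_one by blast
  then show "disc_space A \<phi>0 \<phi> s p q \<subseteq> topspace (disc_topology A \<phi>0 \<phi> s p q)"
    by (rule openin_subset)
qed


section \<open>The operator\<close>

definition complex_partial :: "'d \<Rightarrow> (complex^'d::finite \<Rightarrow> complex) \<Rightarrow> complex^'d \<Rightarrow> complex"
  where "complex_partial j u z = deriv (\<lambda>w. u (\<chi> i. if i = j then w else z $ i)) (z $ j)"

definition J_op :: "(complex^'d::finite \<Rightarrow> complex) \<Rightarrow> complex^'d \<Rightarrow> complex"
  where "J_op u z = of_nat CARD('d) * u z + (\<Sum>j\<in>UNIV. z $ j * complex_partial j u z)"

text \<open>
  The coordinates are indexed by an arbitrary finite type; \<open>k\<close> is the index of the
  coordinate called \<open>z\<^sub>1\<close>.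
\<close>

definition L_op :: "'d \<Rightarrow> complex \<Rightarrow> (complex^'d::finite \<Rightarrow> complex) \<Rightarrow> complex^'d \<Rightarrow> complex"
  where "L_op k lam u z = (if z \<in> polydisc then J_op u z + lam * z $ k * u z else 0)"

end

theory Submission
  imports Defs
begin

text \<open>
  The operator is governed by an integrating factor: multiplication by \<open>exp (\<lambda> z\<^sub>1)\<close> turns
  \<open>J\<^sub>d u + \<lambda> z\<^sub>1 u\<close> into \<open>J\<^sub>d\<close> of the product, that is
  \<open>L\<^sub>\<lambda> = exp (- \<lambda> z\<^sub>1) J\<^sub>d exp (\<lambda> z\<^sub>1)\<close>. The operator \<open>J\<^sub>d\<close> multiplies the \<open>n\<close>-th coefficient by
  \<open>|n| + d\<close>, which is never \<open>0\<close> for \<open>n \<ge> 0\<close>, so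
  \<open>exp (- \<lambda> z\<^sub>1) J\<^sub>d\<^sup>-\<^sup>1 exp (\<lambda> z\<^sub>1)\<close> is the inverse, and everything reduces to three
  boundedness statements for coefficient sequences supported in \<open>n \<ge> 0\<close>: \<open>J\<^sub>d\<close> loses one
  derivative, \<open>J\<^sub>d\<^sup>-\<^sup>1\<close> gains one, and multiplication by \<open>exp (\<lambda> z\<^sub>1)\<close> preserves smoothness.

  All three are instances of one principle. If the \<open>j\<close>-th dyadic block of \<open>T a\<close> is dominated by
  the maximal functions (of Peetre type) of the blocks of \<open>a\<close> with weights
  \<open>2\<^bsup>\<sigma>k\<^esup> 2\<^bsup>-M|j - k|\<^esup>\<close>, for \<open>k \<le> j + 2\<close> and arbitrarily large \<open>M\<close>, then \<open>T\<close> maps order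
  \<open>s + \<sigma>\<close> to order \<open>s\<close> on both scales (\<open>seq_qnorm_estimate\<close>). The symbol \<open>|n| + d\<close> and its
  inverse are, up to the factor \<open>2\<^bsup>\<plusminus>j\<^esup>\<close>, a fixed smooth function of
  \<open>2\<^sup>-\<^sup>j(|n| + d)\<close> on the \<open>j\<close>-th block, so only neighbouring blocks interact. The exponential
  series shifts frequencies upwards; to reach block \<open>j\<close> from a much lower block \<open>k\<close> needs a shift
  of size about \<open>2\<^sup>j\<close>, and the terms of that size are smaller than any power of \<open>2\<^sup>-\<^sup>j\<close> because of
  the factorials.

  The maximal functions are averages of \<open>r\<close>-th powers of the modulus of a block, against kernels
  with polynomial decay at the scale \<open>2\<^sup>-\<^sup>k\<close> of the block; they dominate the block since its spectrum
  is bounded (Peetre's inequality, valid for every \<open>r > 0\<close>). For the Besov scale it is enough that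
  the kernels have bounded mass. For the Triebel-Lizorkin scale with \<open>q < \<infinity>\<close> one takes \<open>r = q\<close> and
  has to compare a sum of averages of functions with the sum of the functions in \<open>L\<^sup>t\<close>,
  \<open>t = p/q\<close>. The power of the sum is telescoped, and the kernel of each average is moved by symmetry
  to the remaining factor, which is built from coarser averages and varies slowly at the scale of
  the kernel; this works for \<open>t \<ge> 1\<close> and, because the averages dominate the functions, also for
  \<open>t \<le> 1\<close>. For \<open>q = \<infinity>\<close> one takes \<open>r = p/2\<close> and bounds a maximum of averages in \<open>L\<^sup>2\<close> by duality.
  Covering arguments and the vector-valued maximal theorem are thereby avoided.

  The passage between functions and sequences is separate: a function belongs to one of the spaces
  exactly if it is the power series of a polynomially bounded sequence of finite quasi-norm, since
  the Fourier coefficients of a distribution are polynomially bounded and, conversely, integration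
  by parts makes the Fourier coefficients of a test function decay rapidly.
\<close>

lemma space_torus [simp]: "space (torus_measure :: (real^'d::finite) measure) = cbox 0 (\<chi> i. 2 * pi)"
  by (simp add: torus_measure_def space_restrict_space)

lemma Basis_vec_eq: "(Basis :: (real^'d::finite) set) = (\<lambda>i. axis i 1) ` UNIV"
  by (auto simp: Basis_vec_def)

lemma inj_axis_1: "inj (\<lambda>i::'d::finite. axis i (1::real))"
  by (auto simp: inj_on_def axis_eq_axis)

lemma prod_Basis_vec: "(\<Prod>b\<in>(Basis :: (real^'d::finite) set). f b) = (\<Prod>i\<in>UNIV. f (axis i 1))"
  unfolding Basis_vec_eq by (subst prod.reindex[OF inj_axis_1]) simp

lemma ball_Basis_vec: "(\<forall>b\<in>(Basis :: (real^'d::finite) set). P b) = (\<forall>i. P (axis i 1))"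
  unfolding Basis_vec_eq by simp

lemma emeasure_torus: "emeasure (torus_measure :: (real^'d::finite) measure) (cbox 0 (\<chi> i. 2 * pi)) = ennreal ((2 * pi) ^ CARD('d))"
proof -
  have "emeasure lborel (cbox (0::real^'d) (\<chi> i. 2 * pi)) = ennreal ((2 * pi) ^ CARD('d))"
    by (simp add: emeasure_lborel_cbox_eq ball_Basis_vec prod_Basis_vec inner_axis)
  then show ?thesis unfolding torus_measure_def
    by (subst emeasure_restrict_space) auto
qed

lemma finite_measure_torus: "finite_measure (torus_measure :: (real^'d::finite) measure)"
  by (rule finite_measureI) (simp add: emeasure_torus)

interpretation torus: finite_measure "torus_measure :: (real^'d::finite) measure"
  by (rule finite_measure_torus)

lemma borel_measurable_torus [measurable (raw)]:
  "f \<in> borel_measurable borel \<Longrightarrow> f \<in> borel_measurable (torus_measure :: (real^'d::finite) measure)"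
  unfolding torus_measure_def by (rule measurable_restrict_space1) simp

lemma id_measurable_torus: "(\<lambda>x. x) \<in> borel_measurable (torus_measure :: (real^'d::finite) measure)"
  by (rule borel_measurable_torus) simp

lemma integrable_torus_bounded:
  fixes f :: "real^'d::finite \<Rightarrow> 'b::{banach, second_countable_topology}"
  assumes "f \<in> borel_measurable borel" and "\<And>x. norm (f x) \<le> B"
  shows "integrable torus_measure f"
  by (rule torus.integrable_const_bound[where B = B]) (use assms in auto)

lemma integrable_torus_continuous:
  fixes f :: "real^'d::finite \<Rightarrow> complex"
  assumes "continuous_on UNIV f"
  shows "integrable torus_measure f"
proof -
  have "compact (f ` cbox 0 (\<chi> i. 2 * pi))"
    by (intro compact_continuous_image continuous_on_subset[OF assms]) auto
  then obtain B where B: "\<And>x. x \<in> cbox 0 (\<chi> i. 2 * pi) \<Longrightarrow> norm (f x) \<le> B"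
    using compact_imp_bounded by (metis bounded_iff imageI)
  have "f \<in> borel_measurable borel" by (rule borel_measurable_continuous_onI[OF assms])
  then show ?thesis
    by (intro torus.integrable_const_bound[where B = B]) (auto intro!: AE_I2 B)
qed

lemma integral_torus_eq_0_slice:
  fixes f :: "real^'d::finite \<Rightarrow> complex"
  assumes f: "continuous_on UNIV f"
    and slice: "\<And>x. (LINT t:{0..2*pi}|lborel. f (x + t *\<^sub>R axis i 1)) = 0"
  shows "(LINT x|torus_measure. f x) = 0"
proof -
  let ?Q = "cbox 0 (\<chi> i. 2 * pi) :: (real^'d) set"
  let ?b = "axis i 1 :: real^'d"
  let ?F = "\<lambda>x. indicator ?Q x *\<^sub>R f x"
  let ?S = "\<lambda>g. \<Sum>b\<in>Basis. g b *\<^sub>R b :: real^'d"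
  interpret product_sigma_finite "\<lambda>b::real^'d. lborel :: real measure"
    by (simp add: product_sigma_finite_def sigma_finite_lborel)
  have [measurable]: "f \<in> borel_measurable borel" by (rule borel_measurable_continuous_onI[OF f])
  have bB: "?b \<in> Basis" by (simp add: axis_in_Basis_iff)
  have ins: "insert ?b (Basis - {?b}) = (Basis :: (real^'d) set)" using bB by auto
  have Sm: "?S \<in> measurable (Pi\<^sub>M Basis (\<lambda>b. lborel)) borel" by measurable
  have "integrable lborel ?F"
    using integrable_torus_continuous[OF f] unfolding torus_measure_def
    by (subst (asm) integrable_restrict_space) auto
  then have "integrable (distr (Pi\<^sub>M Basis (\<lambda>b. lborel)) borel ?S) ?F"
    by (subst (asm) lborel_eq)
  then have int: "integrable (Pi\<^sub>M Basis (\<lambda>b. lborel)) (\<lambda>g. ?F (?S g))"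
    by (subst (asm) integrable_distr_eq[OF Sm]) auto
  have Supd: "?S (g(?b := t)) = ?S (g(?b := 0)) + t *\<^sub>R ?b" for g :: "real^'d \<Rightarrow> real" and t
  proof -
    have "?S (g(?b := t)) = t *\<^sub>R ?b + (\<Sum>b\<in>Basis - {?b}. g b *\<^sub>R b)" for t
      by (subst sum.remove[OF _ bB]) auto
    from this[of t] this[of 0] show ?thesis by simp
  qed
  have inner0: "(LINT t|lborel. ?F (?S (g(?b := t)))) = 0" for g
  proof -
    let ?x = "?S (g(?b := 0))"
    have x: "?x $ j = (if j = i then 0 else g (axis j 1))" for j
    proof -
      have "?x $ j = ?x \<bullet> axis j 1" by (simp add: inner_axis)
      also have "\<dots> = (g(?b := 0)) (axis j 1)"
        by (subst inner_sum_left_Basis) (auto simp: axis_in_Basis_iff)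
      finally show ?thesis by (auto simp: axis_eq_axis)
    qed
    let ?c = "if \<forall>j. j \<noteq> i \<longrightarrow> 0 \<le> ?x $ j \<and> ?x $ j \<le> 2 * pi then 1 else 0 :: real"
    have ind: "indicator ?Q (?x + t *\<^sub>R ?b) = ?c * (indicator {0..2*pi} t :: real)" for t
    proof -
      have "?x + t *\<^sub>R ?b \<in> ?Q \<longleftrightarrow> (\<forall>j. 0 \<le> (?x + t *\<^sub>R ?b) $ j \<and> (?x + t *\<^sub>R ?b) $ j \<le> 2 * pi)"
        by (auto simp: mem_box_cart)
      moreover have "(?x + t *\<^sub>R ?b) $ j = (if j = i then t else ?x $ j)" for j
        using x[of i] by (simp only: vector_add_component vector_scaleR_component) (simp add: axis_def)
      ultimately have "?x + t *\<^sub>R ?b \<in> ?Q \<longleftrightarrow>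
          (\<forall>j. j \<noteq> i \<longrightarrow> 0 \<le> ?x $ j \<and> ?x $ j \<le> 2 * pi) \<and> t \<in> {0..2*pi}"
        by auto
      then show ?thesis by (simp only: indicator_def) simp
    qed
    have "?F (?S (g(?b := t))) = ?c *\<^sub>R (indicator {0..2*pi} t *\<^sub>R f (?x + t *\<^sub>R ?b))" for t
      by (subst (1 2) Supd[of g t], subst ind) (rule scaleR_scaleR[symmetric])
    then have "(LINT t|lborel. ?F (?S (g(?b := t)))) = (LINT t|lborel. ?c *\<^sub>R (indicator {0..2*pi} t *\<^sub>R f (?x + t *\<^sub>R ?b)))"
      by (rule Bochner_Integration.integral_cong[OF refl])
    also have "\<dots> = 0" using slice[of ?x] by (simp add: set_lebesgue_integral_def)
    finally show ?thesis .
  qed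
  have "(LINT x|torus_measure. f x) = (LINT x|lborel. ?F x)"
    unfolding torus_measure_def by (subst integral_restrict_space) auto
  also have "\<dots> = (LINT g|Pi\<^sub>M Basis (\<lambda>b. lborel). ?F (?S g))"
    by (subst lborel_eq, subst integral_distr[OF Sm]) auto
  also have "\<dots> = (LINT g|Pi\<^sub>M (insert ?b (Basis - {?b})) (\<lambda>b. lborel). ?F (?S g))"
    by (simp only: ins)
  also have "\<dots> = (LINT g|Pi\<^sub>M (Basis - {?b}) (\<lambda>b. lborel). LINT t|lborel. ?F (?S (g(?b := t))))"
    by (rule product_integral_insert) (use int in \<open>auto simp only: ins finite_Diff finite_Basis\<close>)
  also have "\<dots> = 0" by (simp only: inner0) simp
  finally show ?thesis .
qed

text \<open>By Fubini it suffices to integrate over one period in the direction \<open>i\<close>, where the fundamental theorem of calculus applies.\<close>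

lemma integral_torus_periodic_derivative:
  fixes F F' :: "real^'d::finite \<Rightarrow> complex"
  assumes cont: "continuous_on UNIV F'"
    and der: "\<And>x t. ((\<lambda>t. F (x + t *\<^sub>R axis i 1)) has_vector_derivative F' (x + t *\<^sub>R axis i 1)) (at t)"
    and per: "\<And>x. F (x + (2 * pi) *\<^sub>R axis i 1) = F x"
  shows "(LINT x|torus_measure. F' x) = 0"
proof (rule integral_torus_eq_0_slice[OF cont, of i])
  fix x
  have c: "continuous_on {0..2*pi} (\<lambda>t. F' (x + t *\<^sub>R axis i 1))"
    by (intro continuous_on_compose2[OF cont] continuous_intros) auto
  have "(LINT t|lborel. indicator {0..2*pi} t *\<^sub>R F' (x + t *\<^sub>R axis i 1)) =
    F (x + (2*pi) *\<^sub>R axis i 1) - F (x + 0 *\<^sub>R axis i 1)"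
    by (rule integral_FTC_Icc[OF _ _ c]) (auto intro!: has_vector_derivative_at_within der)
  then show "(LINT t:{0..2*pi}|lborel. F' (x + t *\<^sub>R axis i 1)) = 0"
    using per[of x] by (simp add: set_lebesgue_integral_def)
qed

lemma int_vec_add: "int_vec (m + n) = int_vec m + int_vec n"
  by (simp add: int_vec_def vec_eq_iff)
lemma int_vec_uminus: "int_vec (- n) = - int_vec n"
  by (simp add: int_vec_def vec_eq_iff)
lemma int_vec_diff: "int_vec (m - n) = int_vec m - int_vec n"
  by (simp add: int_vec_def vec_eq_iff)
lemma int_vec_nth [simp]: "int_vec n $ i = real_of_int (n $ i)"
  by (simp add: int_vec_def)
lemma int_vec_0 [simp]: "int_vec 0 = 0"
  by (simp add: int_vec_def vec_eq_iff)
lemma int_vec_axis: "int_vec (axis i m) = axis i (real_of_int m)"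
  by (simp add: int_vec_def vec_eq_iff axis_def)

lemma torus_char_add: "torus_char (m + n) x = torus_char m x * torus_char n x"
  by (simp add: torus_char_def int_vec_add inner_add_left cis_mult)
lemma torus_char_add_right: "torus_char n (x + y) = torus_char n x * torus_char n y"
  by (simp add: torus_char_def inner_add_right cis_mult)
lemma torus_char_diff_right: "torus_char n (x - y) = torus_char n x * torus_char (- n) y"
  by (simp add: torus_char_def inner_diff_right int_vec_uminus cis_mult)
lemma torus_char_0 [simp]: "torus_char 0 x = 1"
  by (simp add: torus_char_def)
lemma norm_torus_char [simp]: "norm (torus_char n x) = 1"
  by (simp add: torus_char_def)
lemma torus_char_axis: "torus_char (axis i m) x = cis (real_of_int m * x $ i)"
  by (simp add: torus_char_def int_vec_axis inner_axis')

lemma continuous_on_torus_char [continuous_intros]: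
  "continuous_on A f \<Longrightarrow> continuous_on A (\<lambda>x. torus_char n (f x))"
  unfolding torus_char_def cis_conv_exp by (intro continuous_intros)

lemma borel_measurable_torus_char [measurable]: "torus_char n \<in> borel_measurable borel"
  by (intro borel_measurable_continuous_onI continuous_intros)

lemma has_vector_derivative_torus_char:
  "((\<lambda>t. torus_char n (x + t *\<^sub>R axis i 1)) has_vector_derivative
     (\<i> * of_int (n $ i) * torus_char n (x + t *\<^sub>R axis i 1))) (at t)"
proof -
  have eq: "torus_char n (x + t *\<^sub>R axis i 1) = exp (t *\<^sub>R (\<i> * of_int (n $ i))) * torus_char n x" for t
    unfolding torus_char_def cis_conv_exp exp_add[symmetric]
    by (rule arg_cong[where f=exp])
       (simp add: inner_add_right inner_axis ring_distribs, simp add: scaleR_conv_of_real mult_ac)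
  show ?thesis unfolding eq
    by (rule has_vector_derivative_eq_rhs, rule derivative_intros)
       (rule exp_scaleR_has_vector_derivative_right, simp add: mult_ac)
qed

lemma torus_char_periodic: "torus_char n (x + (2 * pi) *\<^sub>R int_vec m) = torus_char n x"
proof -
  have *: "int_vec n \<bullet> ((2 * pi) *\<^sub>R int_vec m) = 2 * pi * real_of_int (\<Sum>i\<in>UNIV. n $ i * m $ i)"
    by (simp add: inner_vec_def sum_distrib_left mult_ac)
  have "torus_char n ((2 * pi) *\<^sub>R int_vec m) = 1"
    unfolding torus_char_def * by (rule cis_multiple_2pi) (rule Ints_of_int)
  then show ?thesis by (simp add: torus_char_add_right)
qed

lemma integral_torus_char:
  "(LINT x|torus_measure. torus_char n x) = (if n = 0 then of_real ((2 * pi) ^ CARD('d)) else 0)"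
  for n :: "int^'d::finite"
proof (cases "n = 0")
  case True
  then show ?thesis
    by (simp add: measure_def emeasure_torus scaleR_conv_of_real)
next
  case False
  then obtain i where i: "n $ i \<noteq> 0" by (auto simp: vec_eq_iff)
  let ?c = "\<i> * of_int (n $ i) :: complex"
  have "(LINT x|torus_measure. ?c * torus_char n x) = 0"
  proof (rule integral_torus_periodic_derivative[where i = i])
    show "continuous_on UNIV (\<lambda>x. ?c * torus_char n x)" by (intro continuous_intros)
    show "torus_char n (x + (2 * pi) *\<^sub>R axis i 1) = torus_char n x" for x
      using torus_char_periodic[of n x "axis i 1"] by (simp add: int_vec_axis)
  qed (rule has_vector_derivative_torus_char)
  then show ?thesis using False i by simp
qed

lemma integral_torus_sum:
  fixes f :: "'i \<Rightarrow> real^'d::finite \<Rightarrow> complex"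
  assumes "\<And>i. i \<in> I \<Longrightarrow> continuous_on UNIV (f i)"
  shows "(LINT x|torus_measure. (\<Sum>i\<in>I. f i x)) = (\<Sum>i\<in>I. LINT x|torus_measure. f i x)"
  by (rule Bochner_Integration.integral_sum) (rule integrable_torus_continuous, rule assms)

text \<open>Convolution with a trigonometric polynomial multiplies the Fourier coefficients.\<close>

lemma trig_convolution:
  fixes \<psi> b :: "int^'d::finite \<Rightarrow> complex"
  assumes A: "finite A" and B: "finite B" and b: "\<And>n. n \<in> A - B \<Longrightarrow> b n = 0 \<or> \<psi> n = 0"
  shows "(LINT y|torus_measure. (\<Sum>n\<in>A. \<psi> n * torus_char n (x - y)) * (\<Sum>n\<in>B. b n * torus_char n y))
    = of_real ((2 * pi) ^ CARD('d)) * (\<Sum>n\<in>A. \<psi> n * b n * torus_char n x)"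
proof -
  let ?P = "of_real ((2 * pi) ^ CARD('d)) :: complex"
  have "(LINT y|torus_measure. (\<Sum>n\<in>A. \<psi> n * torus_char n (x - y)) * (\<Sum>n\<in>B. b n * torus_char n y))
    = (LINT y|torus_measure. (\<Sum>n\<in>A. \<Sum>m\<in>B. (\<psi> n * b m * torus_char n x) * torus_char (m - n) y))"
  proof -
    have "torus_char n (x - y) * torus_char m y = torus_char n x * torus_char (m - n) y" for n m y
      using torus_char_add[of m "- n" y] by (simp add: torus_char_diff_right mult_ac)
    then have "(\<psi> n * torus_char n (x - y)) * (b m * torus_char m y)
        = (\<psi> n * b m * torus_char n x) * torus_char (m - n) y" for n m y
      by (metis (no_types, opaque_lifting) mult.assoc mult.left_commute)
    then show ?thesis by (simp only: sum_product)
  qed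
  also have "\<dots> = (\<Sum>n\<in>A. \<Sum>m\<in>B. (\<psi> n * b m * torus_char n x) * (if m - n = 0 then ?P else 0))"
  proof -
    have *: "(LINT y|torus_measure. (\<psi> n * b m * torus_char n x) * torus_char (m - n) y)
        = (\<psi> n * b m * torus_char n x) * (if m - n = 0 then ?P else 0)" for n m
      unfolding integral_torus_char[symmetric] by (rule integral_mult_right_zero)
    have "(LINT y|torus_measure. (\<Sum>n\<in>A. \<Sum>m\<in>B. (\<psi> n * b m * torus_char n x) * torus_char (m - n) y))
      = (\<Sum>n\<in>A. LINT y|torus_measure. (\<Sum>m\<in>B. (\<psi> n * b m * torus_char n x) * torus_char (m - n) y))"
      by (rule integral_torus_sum) (intro continuous_intros)
    also have "\<dots> = (\<Sum>n\<in>A. \<Sum>m\<in>B. LINT y|torus_measure. (\<psi> n * b m * torus_char n x) * torus_char (m - n) y)"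
      by (intro sum.cong refl integral_torus_sum continuous_intros)
    finally show ?thesis by (simp only: *)
  qed
  also have "\<dots> = (\<Sum>n\<in>A. if n \<in> B then \<psi> n * b n * torus_char n x * ?P else 0)"
  proof (rule sum.cong[OF refl])
    fix n
    have "(\<Sum>m\<in>B. (\<psi> n * b m * torus_char n x) * (if m - n = 0 then ?P else 0))
      = (\<Sum>m\<in>B. if m = n then (\<psi> n * b m * torus_char n x) * ?P else 0)"
      by (intro sum.cong) auto
    then show "(\<Sum>m\<in>B. (\<psi> n * b m * torus_char n x) * (if m - n = 0 then ?P else 0)) =
      (if n \<in> B then \<psi> n * b n * torus_char n x * ?P else 0)"
      using B by (simp add: sum.delta')
  qed
  also have "\<dots> = (\<Sum>n\<in>A. ?P * (\<psi> n * b n * torus_char n x))"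
  proof (rule sum.cong[OF refl])
    fix n assume "n \<in> A"
    then show "(if n \<in> B then \<psi> n * b n * torus_char n x * ?P else 0) = ?P * (\<psi> n * b n * torus_char n x)"
      using b[of n] by (cases "n \<in> B") (auto simp: mult.commute)
  qed
  finally show ?thesis by (simp only: sum_distrib_left)
qed

section \<open>Smooth functions and their finite differences\<close>

lemma C_infinity_differentiable: "C_infinity f \<Longrightarrow> iter_partial is f differentiable (at x)"
  by (simp add: C_infinity_def)

lemma C_infinity_continuous: "C_infinity f \<Longrightarrow> continuous_on A (iter_partial is f)"
  by (rule continuous_at_imp_continuous_on)
     (auto intro: differentiable_imp_continuous_within C_infinity_differentiable)

lemma iter_partial_append: "iter_partial is (iter_partial js f) = iter_partial (is @ js) f"
  by (induction "is") auto

lemma C_infinity_iter_partial: "C_infinity f \<Longrightarrow> C_infinity (iter_partial is f)"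
  by (simp add: C_infinity_def iter_partial_append)

lemma has_vector_derivative_line:
  assumes "f differentiable (at (x + t *\<^sub>R axis i 1))"
  shows "((\<lambda>t. f (x + t *\<^sub>R axis i 1)) has_vector_derivative partial_deriv i f (x + t *\<^sub>R axis i 1)) (at t)"
proof -
  let ?y = "x + t *\<^sub>R axis i 1"
  let ?D = "frechet_derivative f (at ?y)"
  have D: "(f has_derivative ?D) (at ?y)"
    using assms frechet_derivative_works by blast
  have lin: "linear ?D" using D has_derivative_linear by blast
  have "((\<lambda>t. x + t *\<^sub>R axis i 1) has_derivative (\<lambda>h. h *\<^sub>R axis i 1)) (at t)"
    by (auto intro!: derivative_eq_intros)
  then have "((\<lambda>t. f (x + t *\<^sub>R axis i 1)) has_derivative (\<lambda>h. ?D (h *\<^sub>R axis i 1))) (at t)"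
    using has_derivative_compose D by fastforce
  then show ?thesis
    by (simp add: has_vector_derivative_def partial_deriv_def linear_cmul[OF lin])
qed

lemma partial_deriv_eqI: "(f has_derivative D) (at x) \<Longrightarrow> partial_deriv i f x = D (axis i 1)"
  by (simp add: partial_deriv_def frechet_derivative_at[symmetric])

lemma partial_deriv_add:
  assumes "f differentiable (at x)" "g differentiable (at x)"
  shows "partial_deriv i (\<lambda>x. f x + g x) x = partial_deriv i f x + partial_deriv i g x"
  using assms unfolding frechet_derivative_works
  by (subst partial_deriv_eqI[OF has_derivative_add]) (auto simp: partial_deriv_def)

lemma partial_deriv_cmult:
  assumes "f differentiable (at x)"
  shows "partial_deriv i (\<lambda>x. c * f x) x = c * partial_deriv i f x"
  using assms unfolding frechet_derivative_works
  by (subst partial_deriv_eqI[OF has_derivative_mult_right]) (auto simp: partial_deriv_def)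

lemma iter_partial_add:
  assumes "C_infinity f" "C_infinity g"
  shows "iter_partial is (\<lambda>x. f x + g x) = (\<lambda>x. iter_partial is f x + iter_partial is g x)"
proof (induction "is")
  case (Cons i "is")
  show ?case
    by (simp only: iter_partial.simps Cons.IH)
       (simp add: fun_eq_iff partial_deriv_add C_infinity_differentiable assms)
qed simp

lemma iter_partial_cmult:
  assumes "C_infinity f"
  shows "iter_partial is (\<lambda>x. c * f x) = (\<lambda>x. c * iter_partial is f x)"
proof (induction "is")
  case (Cons i "is")
  show ?case
    by (simp only: iter_partial.simps Cons.IH)
       (simp add: fun_eq_iff partial_deriv_cmult C_infinity_differentiable assms)
qed simp

lemma C_infinity_add: "C_infinity f \<Longrightarrow> C_infinity g \<Longrightarrow> C_infinity (\<lambda>x. f x + g x)"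
  by (auto simp: C_infinity_def iter_partial_add intro!: differentiable_add)

lemma C_infinity_cmult: "C_infinity f \<Longrightarrow> C_infinity (\<lambda>x. c * f x)"
  unfolding C_infinity_def[of "\<lambda>x. c * f x"]
  by (auto simp: iter_partial_cmult intro!: differentiable_mult C_infinity_differentiable)

lemma has_derivative_torus_char:
  "(torus_char n has_derivative (\<lambda>h. \<i> * of_real (int_vec n \<bullet> h) * torus_char n x)) (at x)"
proof -
  have lin: "((\<lambda>x. \<i> * complex_of_real (int_vec n \<bullet> x)) has_derivative
      (\<lambda>h. \<i> * complex_of_real (int_vec n \<bullet> h))) (at x)"
    by (intro has_derivative_mult_right has_derivative_of_real has_derivative_inner_right has_derivative_ident)
  have "((\<lambda>x. exp (\<i> * complex_of_real (int_vec n \<bullet> x))) has_derivative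
      (\<lambda>h. exp (\<i> * complex_of_real (int_vec n \<bullet> x)) * (\<i> * complex_of_real (int_vec n \<bullet> h)))) (at x)"
    using has_derivative_compose[OF lin, of exp "(*) (exp (\<i> * complex_of_real (int_vec n \<bullet> x)))"]
      DERIV_exp[of "\<i> * complex_of_real (int_vec n \<bullet> x)"]
    by (simp add: has_field_derivative_def)
  then show ?thesis
    unfolding torus_char_def cis_conv_exp by (simp add: mult.commute)
qed

lemma iter_partial_torus_char:
  "iter_partial is (torus_char n) = (\<lambda>x. (\<Prod>i\<leftarrow>is. \<i> * of_int (n $ i)) * torus_char n x)"
proof (induction "is")
  case (Cons i "is")
  have "partial_deriv i (torus_char n) x = \<i> * of_int (n $ i) * torus_char n x" for x
    by (subst partial_deriv_eqI[OF has_derivative_torus_char]) (simp add: inner_axis)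
  moreover have "torus_char n differentiable (at x)" for x
    using has_derivative_torus_char by (auto simp: differentiable_def)
  ultimately show ?case
    by (simp only: iter_partial.simps Cons.IH fun_eq_iff) (simp add: partial_deriv_cmult)
qed simp

lemma torus_char_test: "torus_char n \<in> torus_test"
proof -
  have "torus_char n differentiable (at x)" for x
    using has_derivative_torus_char by (auto simp: differentiable_def)
  then show ?thesis
    by (auto simp: torus_test_def torus_char_periodic C_infinity_def iter_partial_torus_char
        intro!: differentiable_mult)
qed

lemma partial_deriv_periodic:
  assumes "\<And>x. f (x + v) = f x" and "f differentiable (at (x + v))"
  shows "partial_deriv i f (x + v) = partial_deriv i f x"
proof -
  obtain D where D: "(f has_derivative D) (at (x + v))" using assms(2) by (auto simp: differentiable_def)
  have "((\<lambda>y. y + v) has_derivative (\<lambda>h. h)) (at x)" by (auto intro!: derivative_eq_intros)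
  then have "((\<lambda>y. f (y + v)) has_derivative (\<lambda>h. D h)) (at x)"
    using has_derivative_compose D by fastforce
  then have "(f has_derivative D) (at x)" by (simp add: assms(1))
  then show ?thesis using D by (simp add: partial_deriv_eqI)
qed

lemma iter_partial_periodic:
  assumes "C_infinity f" "\<And>x. f (x + v) = f x"
  shows "iter_partial is f (x + v) = iter_partial is f x"
  by (induction "is" arbitrary: x) (auto simp: assms intro!: partial_deriv_periodic C_infinity_differentiable)

lemma torus_test_iter_partial: "\<phi> \<in> torus_test \<Longrightarrow> iter_partial is \<phi> \<in> torus_test"
  by (auto simp: torus_test_def C_infinity_iter_partial iter_partial_periodic)

lemma torus_test_add: "\<phi> \<in> torus_test \<Longrightarrow> \<psi> \<in> torus_test \<Longrightarrow> (\<lambda>x. \<phi> x + \<psi> x) \<in> torus_test"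
  by (auto simp: torus_test_def C_infinity_add)

lemma torus_test_cmult: "\<phi> \<in> torus_test \<Longrightarrow> (\<lambda>x. c * \<phi> x) \<in> torus_test"
  by (auto simp: torus_test_def C_infinity_cmult)

lemma torus_test_continuous: "\<phi> \<in> torus_test \<Longrightarrow> continuous_on A \<phi>"
  using C_infinity_continuous[of \<phi> A "[]"] by (simp add: torus_test_def)

lemma periodic_continuous_bounded:
  fixes f :: "real^'d::finite \<Rightarrow> 'b::real_normed_vector"
  assumes "continuous_on UNIV f" and per: "\<And>x n. f (x + (2 * pi) *\<^sub>R int_vec n) = f x"
  shows "bounded (range f)"
proof -
  let ?Q = "cbox 0 (\<chi> i. 2 * pi) :: (real^'d) set"
  have "f x \<in> f ` ?Q" for x
  proof -
    let ?n = "\<chi> i. - \<lfloor>x $ i / (2 * pi)\<rfloor>"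
    have "0 \<le> (x + (2 * pi) *\<^sub>R int_vec ?n) $ i \<and> (x + (2 * pi) *\<^sub>R int_vec ?n) $ i \<le> 2 * pi" for i
    proof -
      have "real_of_int \<lfloor>x $ i / (2 * pi)\<rfloor> * (2 * pi) \<le> x $ i"
        using of_int_floor_le[of "x $ i / (2 * pi)"] pi_gt_zero by (simp only: pos_le_divide_eq mult_pos_pos zero_less_numeral)
      moreover have "x $ i \<le> (real_of_int \<lfloor>x $ i / (2 * pi)\<rfloor> + 1) * (2 * pi)"
        using real_of_int_floor_add_one_ge[of "x $ i / (2 * pi)"] pi_gt_zero
        by (simp only: pos_divide_le_eq mult_pos_pos zero_less_numeral)
      ultimately show ?thesis by (simp add: algebra_simps)
    qed
    then have "x + (2 * pi) *\<^sub>R int_vec ?n \<in> ?Q" unfolding mem_box_cart by simp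
    then show ?thesis using per[of x ?n] by (metis image_eqI)
  qed
  then have "range f = f ` ?Q" by blast
  moreover have "compact (f ` ?Q)"
    by (intro compact_continuous_image continuous_on_subset[OF assms(1)]) auto
  ultimately show ?thesis by (simp add: compact_imp_bounded)
qed

lemma torus_test_bdd_above:
  assumes "\<phi> \<in> torus_test"
  shows "bdd_above (range (\<lambda>x. norm (\<phi> x)))"
proof -
  have "bounded (range \<phi>)"
    by (rule periodic_continuous_bounded)
       (use assms in \<open>auto simp: torus_test_continuous, simp add: torus_test_def\<close>)
  then show ?thesis unfolding bounded_iff bdd_above_def by fast
qed

lemma torus_test_le_SUP: "\<phi> \<in> torus_test \<Longrightarrow> norm (\<phi> x) \<le> (SUP x. norm (\<phi> x))"
  by (rule cSUP_upper[OF UNIV_I]) (rule torus_test_bdd_above)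

text \<open>
  A family of functions on the line whose derivatives up to order \<open>N\<close> are bounded uniformly
  over the family.
\<close>

primrec unif_smooth :: "nat \<Rightarrow> ('a \<Rightarrow> real \<Rightarrow> complex) \<Rightarrow> bool" where
  "unif_smooth 0 F \<longleftrightarrow> (\<exists>B. \<forall>a t. norm (F a t) \<le> B)"
| "unif_smooth (Suc N) F \<longleftrightarrow> (\<exists>B. \<forall>a t. norm (F a t) \<le> B) \<and>
     (\<exists>F'. (\<forall>a t. (F a has_vector_derivative F' a t) (at t)) \<and> unif_smooth N F')"

lemma unif_smooth_SucI:
  assumes "\<exists>B. \<forall>a t. norm (F a t) \<le> B"
    and "\<And>a t. (F a has_vector_derivative F' a t) (at t)" and "unif_smooth N F'"
  shows "unif_smooth (Suc N) F"
  using assms by auto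

lemma unif_smooth_bounded: "unif_smooth N F \<Longrightarrow> \<exists>B. \<forall>a t. norm (F a t) \<le> B"
  by (cases N) auto

lemma unif_smooth_Suc: "unif_smooth (Suc N) F \<Longrightarrow> unif_smooth N F"
proof (induction N arbitrary: F)
  case (Suc N)
  from Suc.prems obtain F' where "\<forall>a t. (F a has_vector_derivative F' a t) (at t)" "unif_smooth (Suc N) F'"
    by auto
  with Suc show ?case by auto
qed auto

lemma unif_smooth_add:
  "unif_smooth N F \<Longrightarrow> unif_smooth N G \<Longrightarrow> unif_smooth N (\<lambda>a t. F a t + G a t)"
proof (induction N arbitrary: F G)
  case 0
  then obtain B C where "\<forall>a t. norm (F a t) \<le> B" "\<forall>a t. norm (G a t) \<le> C" by auto
  then have "norm (F a t + G a t) \<le> B + C" for a t by (meson add_mono norm_triangle_ineq order_trans)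
  then show ?case by auto
next
  case (Suc N)
  from Suc.prems obtain F' G' where *: "\<forall>a t. (F a has_vector_derivative F' a t) (at t)" "unif_smooth N F'"
     "\<forall>a t. (G a has_vector_derivative G' a t) (at t)" "unif_smooth N G'" by auto
  obtain B C where "\<forall>a t. norm (F a t) \<le> B" "\<forall>a t. norm (G a t) \<le> C" using Suc.prems by auto
  then have "norm (F a t + G a t) \<le> B + C" for a t by (meson add_mono norm_triangle_ineq order_trans)
  moreover have "((\<lambda>t. F a t + G a t) has_vector_derivative F' a t + G' a t) (at t)" for a t
    using * by (auto intro!: has_vector_derivative_add)
  moreover have "unif_smooth N (\<lambda>a t. F' a t + G' a t)" using Suc.IH * by auto
  ultimately show ?case by (intro unif_smooth_SucI) blast+
qed

lemma unif_smooth_mult: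
  "unif_smooth N F \<Longrightarrow> unif_smooth N G \<Longrightarrow> unif_smooth N (\<lambda>a t. F a t * G a t)"
proof (induction N arbitrary: F G)
  case 0
  then obtain B C where "\<forall>a t. norm (F a t) \<le> B" "\<forall>a t. norm (G a t) \<le> C" by auto
  then have "norm (F a t * G a t) \<le> B * C" for a t
    unfolding norm_mult by (meson mult_mono norm_ge_zero order_trans)
  then show ?case by auto
next
  case (Suc N)
  from Suc.prems obtain F' G' where *: "\<forall>a t. (F a has_vector_derivative F' a t) (at t)" "unif_smooth N F'"
     "\<forall>a t. (G a has_vector_derivative G' a t) (at t)" "unif_smooth N G'" by auto
  obtain B C where "\<forall>a t. norm (F a t) \<le> B" "\<forall>a t. norm (G a t) \<le> C" using Suc.prems by auto
  then have "norm (F a t * G a t) \<le> B * C" for a t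
    unfolding norm_mult by (meson mult_mono norm_ge_zero order_trans)
  moreover have "((\<lambda>t. F a t * G a t) has_vector_derivative F a t * G' a t + F' a t * G a t) (at t)" for a t
    using * by (auto intro!: has_vector_derivative_mult)
  moreover have "unif_smooth N (\<lambda>a t. F a t * G' a t + F' a t * G a t)"
    by (intro unif_smooth_add Suc.IH *(2,4) Suc.prems[THEN unif_smooth_Suc])
  ultimately show ?case by (intro unif_smooth_SucI) blast+
qed

lemma unif_smooth_const: "(\<And>a t. F a t = c) \<Longrightarrow> unif_smooth N F"
proof (induction N arbitrary: F c)
  case (Suc N)
  have F: "F = (\<lambda>a t. c)" using Suc.prems by auto
  have "unif_smooth N (\<lambda>(a::'a) (t::real). 0)" by (rule Suc.IH) simp
  then show ?case unfolding F by (auto intro!: exI[of _ "\<lambda>a t. 0"] derivative_eq_intros)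
qed auto

lemma unif_smooth_cmult: "unif_smooth N F \<Longrightarrow> unif_smooth N (\<lambda>a t. c * F a t)"
  by (rule unif_smooth_mult[OF unif_smooth_const[of "\<lambda>a t. c" c]]) auto

lemma unif_smooth_diff:
  assumes "unif_smooth N F" "unif_smooth N G"
  shows "unif_smooth N (\<lambda>a t. F a t - G a t)"
  using unif_smooth_add[OF assms(1) unif_smooth_cmult[OF assms(2), of "-1"]] by simp

text \<open>
  The class is closed under division by \<open>t\<close> for functions that vanish near \<open>0\<close>, because
  \<open>(f/t)' = (f' - f/t)/t\<close>, and under multiplication by \<open>t\<close> for functions of compact support.
\<close>

lemma unif_smooth_divide:
  assumes "unif_smooth N F" and "\<And>a t. \<bar>t\<bar> < c \<Longrightarrow> F a t = 0" and c: "c > 0"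
  shows "unif_smooth N (\<lambda>a t. F a t / of_real t)"
  using assms(1,2)
proof (induction N arbitrary: F)
  case (0 F)
  then obtain B where B: "\<forall>a t. norm (F a t) \<le> B" by auto
  have "norm (F a t / of_real t) \<le> B / c" for a t
  proof (cases "\<bar>t\<bar> < c")
    case True
    moreover have "0 \<le> B" using B norm_ge_zero order_trans by blast
    ultimately show ?thesis using 0 c by simp
  next
    case False
    then show ?thesis using B[rule_format, of a t] c order_trans[OF norm_ge_zero B[rule_format, of a t]]
      by (simp add: norm_divide frac_le)
  qed
  then show ?case by auto
next
  case (Suc N F)
  from Suc.prems obtain F' where F': "\<forall>a t. (F a has_vector_derivative F' a t) (at t)" "unif_smooth N F'"
    by auto
  have F'0: "F' a t = 0" if "\<bar>t\<bar> < c" for a t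
  proof -
    have "(F a has_vector_derivative 0) (at t)"
    proof (rule has_vector_derivative_transform_within_open[where f = "\<lambda>_. 0" and S = "{-c<..<c}"])
      show "0 = F a y" if "y \<in> {-c<..<c}" for y using that Suc.prems(2)[of y a] by auto
    qed (use that in auto)
    then show ?thesis using F'(1) vector_derivative_unique_at by blast
  qed
  have IH: "unif_smooth N (\<lambda>a t. F a t / of_real t)"
    by (rule Suc.IH) (use Suc.prems(2) unif_smooth_Suc[OF Suc.prems(1)] in blast)+
  have B: "\<exists>B. \<forall>a t. norm (F a t / of_real t) \<le> B" using IH unif_smooth_bounded by blast
  have "((\<lambda>t. F a t / of_real t) has_vector_derivative (F' a t - F a t / of_real t) / of_real t) (at t)" for a t
  proof (cases "t = 0")
    case True
    have "((\<lambda>t. F a t / of_real t) has_vector_derivative 0) (at t)"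
    proof (rule has_vector_derivative_transform_within_open[where f = "\<lambda>_. 0" and S = "{-c<..<c}"])
      show "0 = F a y / of_real y" if "y \<in> {-c<..<c}" for y using that Suc.prems(2)[of y a] by auto
    qed (use True c in auto)
    then show ?thesis using True by simp
  next
    case False
    have "((\<lambda>t. inverse t *\<^sub>R F a t) has_vector_derivative
        inverse t *\<^sub>R F' a t + (- (inverse t * 1 * inverse t)) *\<^sub>R F a t) (at t)"
      by (intro has_vector_derivative_scaleR DERIV_inverse' derivative_intros False)
         (use F' in blast)
    moreover have "(\<lambda>t. inverse t *\<^sub>R F a t) = (\<lambda>t. F a t / of_real t)"
      by (auto simp: scaleR_conv_of_real divide_simps)
    ultimately show ?thesis using False
      by (simp add: scaleR_conv_of_real field_simps)
  qed
  moreover have "unif_smooth N (\<lambda>a t. (F' a t - F a t / of_real t) / of_real t)"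
  proof (rule Suc.IH)
    show "unif_smooth N (\<lambda>a t. F' a t - F a t / of_real t)" by (rule unif_smooth_diff[OF F'(2) IH])
    show "F' a t - F a t / of_real t = 0" if "\<bar>t\<bar> < c" for a t
      by (simp add: F'0[OF that] Suc.prems(2)[OF that])
  qed
  ultimately show ?case using B by (intro unif_smooth_SucI) blast+
qed

lemma unif_smooth_times:
  assumes "unif_smooth N F" and "\<And>a t. \<bar>t\<bar> > R \<Longrightarrow> F a t = 0" and R: "R > 0"
  shows "unif_smooth N (\<lambda>a t. of_real t * F a t)"
  using assms(1,2)
proof (induction N arbitrary: F)
  case (0 F)
  then obtain B where B: "\<forall>a t. norm (F a t) \<le> B" by auto
  have "norm (of_real t * F a t) \<le> R * B" for a t
  proof (cases "\<bar>t\<bar> > R")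
    case True
    moreover have "0 \<le> B" using B norm_ge_zero order_trans by blast
    ultimately show ?thesis using 0 R by simp
  next
    case False
    then show ?thesis using B by (simp add: norm_mult mult_mono)
  qed
  then show ?case by auto
next
  case (Suc N F)
  from Suc.prems obtain F' where F': "\<forall>a t. (F a has_vector_derivative F' a t) (at t)" "unif_smooth N F'"
    by auto
  have F'0: "F' a t = 0" if "\<bar>t\<bar> > R" for a t
  proof -
    have "(F a has_vector_derivative 0) (at t)"
    proof (rule has_vector_derivative_transform_within_open[where f = "\<lambda>_. 0" and S = "- {-R..R}"])
      show "0 = F a y" if "y \<in> - {-R..R}" for y using that Suc.prems(2)[of y a] by auto
    qed (use that in auto)
    then show ?thesis using F'(1) vector_derivative_unique_at by blast
  qed
  have IH: "unif_smooth N (\<lambda>a t. of_real t * F a t)"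
    by (rule Suc.IH) (use Suc.prems(2) unif_smooth_Suc[OF Suc.prems(1)] in blast)+
  have B: "\<exists>B. \<forall>a t. norm (of_real t * F a t) \<le> B" using IH unif_smooth_bounded by blast
  have "((\<lambda>t. of_real t * F a t) has_vector_derivative (of_real t * F' a t + F a t)) (at t)" for a t
  proof -
    have "((\<lambda>t. t *\<^sub>R F a t) has_vector_derivative t *\<^sub>R F' a t + 1 *\<^sub>R F a t) (at t)"
      by (intro has_vector_derivative_scaleR derivative_intros) (use F' in blast)
    then show ?thesis by (simp add: scaleR_conv_of_real)
  qed
  moreover have "unif_smooth N (\<lambda>a t. of_real t * F' a t + F a t)"
    by (intro unif_smooth_add Suc.IH) (use F' F'0 Suc.prems(2) unif_smooth_Suc[OF Suc.prems(1)] in blast)+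
  ultimately show ?case using B by (intro unif_smooth_SucI) blast+
qed

definition fdiff :: "real \<Rightarrow> (real \<Rightarrow> complex) \<Rightarrow> real \<Rightarrow> complex"
  where "fdiff h f t = f (t + h) - f t"

lemma unif_smooth_difference_quotient:
  "unif_smooth (Suc N) F \<Longrightarrow> unif_smooth N (\<lambda>a t. fdiff (h a) (F a) t / of_real (h a))"
proof (induction N arbitrary: F)
  case (0 F)
  then obtain F' B where F': "\<forall>a t. (F a has_vector_derivative F' a t) (at t)" "\<forall>a t. norm (F' a t) \<le> B"
    by auto
  have "norm (fdiff (h a) (F a) t / of_real (h a)) \<le> B" for a t
  proof -
    have "norm (F a (t + h a) - F a t) \<le> B * norm (t + h a - t)"
    proof (rule differentiable_bound[of UNIV "F a" "\<lambda>t h. h *\<^sub>R F' a t"])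
      show "onorm (\<lambda>h. h *\<^sub>R F' a t) \<le> B" for t
        by (rule onorm_le) (use F'(2) in \<open>simp add: mult.commute[of B] mult_left_mono\<close>)
    qed (use F'(1) in \<open>auto simp: has_vector_derivative_def\<close>)
    moreover have "0 \<le> B" using F'(2) norm_ge_zero order_trans by blast
    ultimately show ?thesis by (cases "h a = 0") (auto simp: fdiff_def norm_divide divide_simps)
  qed
  then show ?case by auto
next
  case (Suc N F)
  from Suc.prems obtain F' where F': "\<And>a t. (F a has_vector_derivative F' a t) (at t)" "unif_smooth (Suc N) F'"
    by (auto simp del: unif_smooth.simps(2) simp: unif_smooth.simps(2)[of "Suc N"])
  have B: "\<exists>B. \<forall>a t. norm (fdiff (h a) (F a) t / of_real (h a)) \<le> B"
    using Suc.IH[OF unif_smooth_Suc[OF Suc.prems]] unif_smooth_bounded by blast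
  have "((\<lambda>t. fdiff (h a) (F a) t / of_real (h a)) has_vector_derivative fdiff (h a) (F' a) t / of_real (h a)) (at t)" for a t
  proof -
    have "((\<lambda>t. t + h a) has_vector_derivative 1) (at t)" by (auto intro!: derivative_eq_intros)
    from vector_diff_chain_at[OF this, of "F a" "F' a (t + h a)"]
    have "((\<lambda>t. F a (t + h a)) has_vector_derivative F' a (t + h a)) (at t)"
      using F'(1) by (simp add: o_def)
    then show ?thesis unfolding fdiff_def using F'(1)
      by (auto intro!: has_vector_derivative_divide has_vector_derivative_diff)
  qed
  then show ?case using B Suc.IH[OF F'(2)] by (intro unif_smooth_SucI) blast+
qed

lemma unif_smooth_fdiff:
  "unif_smooth N F \<Longrightarrow> \<exists>B\<ge>0. \<forall>a t. h a \<ge> 0 \<longrightarrow> norm ((fdiff (h a) ^^ N) (F a) t) \<le> B * h a ^ N"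
proof (induction N arbitrary: F)
  case 0
  then obtain B where B: "\<forall>a t. norm (F a t) \<le> B" by auto
  then have "0 \<le> B" using norm_ge_zero order_trans by blast
  with B show ?case by auto
next
  case (Suc N)
  from Suc.IH[OF unif_smooth_difference_quotient[OF Suc.prems, of h]]
  obtain B where B: "B \<ge> 0" "\<And>a t. h a \<ge> 0 \<Longrightarrow>
      norm ((fdiff (h a) ^^ N) (\<lambda>t. fdiff (h a) (F a) t / of_real (h a)) t) \<le> B * h a ^ N"
    by blast
  have scale: "(fdiff h ^^ N) (\<lambda>t. c * f t) = (\<lambda>t. c * (fdiff h ^^ N) f t)" for h c f N
    by (induction N) (auto simp: fdiff_def algebra_simps)
  have "norm ((fdiff (h a) ^^ Suc N) (F a) t) \<le> B * h a ^ Suc N" if "h a \<ge> 0" for a t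
  proof -
    have eq: "(\<lambda>t. of_real (h a) * (fdiff (h a) (F a) t / of_real (h a))) = fdiff (h a) (F a)"
      by (cases "h a = 0") (auto simp: fdiff_def)
    have "(fdiff (h a) ^^ Suc N) (F a) t =
        of_real (h a) * (fdiff (h a) ^^ N) (\<lambda>t. fdiff (h a) (F a) t / of_real (h a)) t"
      using fun_cong[OF scale[where h = "h a" and N = N and c = "of_real (h a)" and f = "\<lambda>t. fdiff (h a) (F a) t / of_real (h a)"], of t]
      by (simp only: eq funpow_Suc_right o_apply)
    then show ?thesis using mult_left_mono[OF B(2)[OF that, of t] that] that
      by (simp add: norm_mult mult_ac)
  qed
  with B(1) show ?case by blast
qed

section \<open>Averaging kernels on the torus\<close>

text \<open>
  The sum of the chord lengths in the coordinate circles: it is periodic by construction and its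
  summands are exactly the factors produced by summation by parts.
\<close>

definition torus_dist :: "real^'d::finite \<Rightarrow> real^'d \<Rightarrow> real"
  where "torus_dist x y = (\<Sum>i\<in>UNIV. norm (cis (x $ i) - cis (y $ i)))"

lemma torus_dist_nonneg [simp]: "0 \<le> torus_dist x y"
  by (simp add: torus_dist_def sum_nonneg)

lemma torus_dist_refl [simp]: "torus_dist x x = 0"
  by (simp add: torus_dist_def)

lemma torus_dist_commute: "torus_dist x y = torus_dist y x"
  by (simp add: torus_dist_def norm_minus_commute)

lemma torus_dist_triangle: "torus_dist x z \<le> torus_dist x y + torus_dist y z"
  unfolding torus_dist_def sum.distrib[symmetric]
  by (intro sum_mono) (metis dist_norm dist_triangle)

lemma torus_dist_le: "torus_dist x y \<le> 2 * real CARD('d)" for x y :: "real^'d::finite"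
proof -
  have "torus_dist x y \<le> (\<Sum>i\<in>(UNIV::'d set). 2)"
    unfolding torus_dist_def
    by (intro sum_mono order_trans[OF norm_triangle_ineq4]) simp
  then show ?thesis by simp
qed

lemma borel_measurable_torus_dist [measurable (raw)]:
  assumes [measurable]: "f \<in> borel_measurable M" "g \<in> borel_measurable M"
  shows "(\<lambda>p. torus_dist (f p) (g p)) \<in> borel_measurable M"
proof -
  have [measurable]: "(\<lambda>x::real^'d::finite. cis (x $ i)) \<in> borel_measurable borel" for i
    unfolding cis_conv_exp by (intro borel_measurable_continuous_onI continuous_intros)
  show ?thesis unfolding torus_dist_def by measurable
qed

lemma abs_le_norm_cis:
  assumes "\<bar>\<theta>\<bar> \<le> pi"
  shows "\<bar>\<theta>\<bar> / 4 \<le> norm (cis \<theta> - 1)"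
proof -
  have sin2: "y / 2 \<le> sin y" if "0 \<le> y" "y \<le> pi / 2" for y
  proof (cases "y \<le> pi / 3")
    case True
    have "\<exists>z. 0 \<le> z \<and> z \<le> y \<and> sin y - sin 0 = (y - 0) * cos z"
    proof (cases "y = 0")
      case False
      then have "0 < y" using that by simp
      then obtain z where "0 < z" "z < y" "sin y - sin 0 = (y - 0) * cos z"
        using MVT2[of 0 y sin cos] by (auto intro: DERIV_sin)
      then show ?thesis by (intro exI[of _ z]) auto
    qed auto
    then obtain z where z: "0 \<le> z" "z \<le> y" "sin y = y * cos z" by auto
    have "cos (pi / 3) \<le> cos z" by (rule cos_monotone_0_pi_le) (use z True pi_gt_zero in auto)
    then have "1 / 2 \<le> cos z" by (simp add: cos_60)
    then have "y * (1 / 2) \<le> y * cos z" by (rule mult_left_mono) (rule that)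
    then show ?thesis using z by simp
  next
    case False
    have "sin (pi / 3) \<le> sin y"
      by (rule sin_monotone_2pi_le) (use that False pi_gt_zero in auto)
    moreover have "sqrt 3 \<ge> 17 / 10" by (rule real_le_rsqrt) (simp add: power2_eq_square)
    moreover have "y \<le> 16 / 10"
    proof -
      have "pi \<le> 32 / 10" using pi_approx(2) by simp
      with that show ?thesis by simp
    qed
    ultimately show ?thesis by (simp add: sin_60)
  qed
  have sq: "(norm (cis \<theta> - 1))\<^sup>2 = (2 * sin (\<theta> / 2))\<^sup>2"
  proof -
    have "(norm (cis \<theta> - 1))\<^sup>2 = (cos \<theta> - 1)\<^sup>2 + (sin \<theta>)\<^sup>2"
      by (simp add: cmod_power2)
    also have "\<dots> = 2 - 2 * cos \<theta>"
      using sin_cos_squared_add[of \<theta>] by (simp add: power2_eq_square algebra_simps)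
    also have "cos \<theta> = 1 - 2 * (sin (\<theta> / 2))\<^sup>2"
      using cos_double_sin[of "\<theta> / 2"] by simp
    finally show ?thesis by (simp add: power_mult_distrib)
  qed
  have "\<bar>\<theta>\<bar> / 4 \<le> sin (\<bar>\<theta>\<bar> / 2)" using sin2[of "\<bar>\<theta>\<bar> / 2"] assms by simp
  moreover have "\<bar>sin (\<theta> / 2)\<bar> = \<bar>sin (\<bar>\<theta>\<bar> / 2)\<bar>" by (simp add: abs_if)
  ultimately have "\<bar>\<theta>\<bar> / 4 \<le> \<bar>2 * sin (\<theta> / 2)\<bar>" by linarith
  also have "\<dots> = norm (cis \<theta> - 1)"
    by (rule power2_eq_imp_eq) (use sq in auto)
  finally show ?thesis .
qed

lemma nn_integral_exp_abs:
  assumes l: "l > 0"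
  shows "(\<integral>\<^sup>+y. ennreal (exp (- l * \<bar>y - b\<bar>)) \<partial>lborel) \<le> ennreal (2 / l)"
proof -
  let ?P = "\<integral>\<^sup>+y. ennreal (exp (- l * y)) * indicator {0..} y \<partial>lborel"
  have half: "?P = ennreal (1 / l)"
  proof -
    have "?P = ennreal (0 - (- exp (- l * 0) / l))"
    proof (rule nn_integral_FTC_atLeast)
      have "filterlim (\<lambda>x. - l * x) at_bot at_top"
        by (rule filterlim_tendsto_neg_mult_at_bot[OF tendsto_const _ filterlim_ident]) (use l in simp)
      then have "((\<lambda>x. exp (- l * x)) \<longlongrightarrow> 0) at_top" by (rule filterlim_compose[OF exp_at_bot])
      then have "((\<lambda>x. - exp (- l * x) / l) \<longlongrightarrow> - 0 / l) at_top" by (intro tendsto_intros) (use l in auto)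
      then show "((\<lambda>x. - exp (- l * x) / l) \<longlongrightarrow> 0) at_top" by simp
      show "((\<lambda>x. - exp (- l * x) / l) has_real_derivative exp (- l * x)) (at x)" for x
        using l by (auto intro!: derivative_eq_intros simp: field_simps)
    qed auto
    then show ?thesis by simp
  qed
  have "(\<integral>\<^sup>+y. ennreal (exp (- l * \<bar>y - b\<bar>)) \<partial>lborel) = (\<integral>\<^sup>+y. ennreal (exp (- l * \<bar>y\<bar>)) \<partial>lborel)"
    by (subst nn_integral_real_affine[where c = 1 and t = b]) auto
  also have "\<dots> \<le> (\<integral>\<^sup>+y. ennreal (exp (- l * y)) * indicator {0..} y + ennreal (exp (- l * (- y))) * indicator {0..} (- y) \<partial>lborel)"
    by (intro nn_integral_mono) (auto simp: indicator_def abs_if)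
  also have "\<dots> = ?P + (\<integral>\<^sup>+y. ennreal (exp (- l * (- y))) * indicator {0..} (- y) \<partial>lborel)"
    by (rule nn_integral_add) auto
  also have "(\<integral>\<^sup>+y. ennreal (exp (- l * (- y))) * indicator {0..} (- y) \<partial>lborel) = ?P"
    by (subst nn_integral_real_affine[where c = "-1" and t = 0 and f = "\<lambda>y. ennreal (exp (- l * y)) * indicator {0..} y"]) auto
  also have "?P + ?P = ennreal (2 / l)"
    unfolding half by (subst ennreal_plus[symmetric]) (use l in auto)
  finally show ?thesis .
qed

lemma exp_kernel_integral_1d:
  assumes l: "l > 0"
  shows "(\<integral>\<^sup>+y. ennreal (l * exp (- l * norm (cis a - cis y))) * indicator {0..2*pi} y \<partial>lborel) \<le> ennreal 24"
proof -
  define b where "b = a - 2 * pi * of_int \<lfloor>a / (2 * pi)\<rfloor>"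
  have b: "0 \<le> b" "b \<le> 2 * pi"
  proof -
    have "real_of_int \<lfloor>a / (2 * pi)\<rfloor> * (2 * pi) \<le> a"
      using of_int_floor_le[of "a / (2 * pi)"] pi_gt_zero by (simp only: pos_le_divide_eq mult_pos_pos zero_less_numeral)
    then show "0 \<le> b" by (simp add: b_def mult_ac)
    have "a \<le> (real_of_int \<lfloor>a / (2 * pi)\<rfloor> + 1) * (2 * pi)"
      using real_of_int_floor_add_one_ge[of "a / (2 * pi)"] pi_gt_zero
      by (simp only: pos_divide_le_eq mult_pos_pos zero_less_numeral)
    then show "b \<le> 2 * pi" by (simp add: b_def algebra_simps)
  qed
  have shift: "cis (t + 2 * pi * of_int k) = cis t" for t and k :: int
    using cis_mult[of t "2 * pi * of_int k"] cis_multiple_2pi[of "of_int k"] by simp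
  have cisb: "cis a = cis b" using shift[of b "\<lfloor>a / (2 * pi)\<rfloor>"] by (simp add: b_def)
  have norm_diff: "norm (cis b - cis y) = norm (cis (b - y + 2 * pi * of_int k) - 1)" for y k
  proof -
    have "cis b - cis y = cis y * (cis (b - y) - 1)" by (simp add: right_diff_distrib cis_mult)
    then show ?thesis by (simp add: norm_mult shift)
  qed
  have bound: "l * exp (- l * norm (cis a - cis y)) \<le> l * exp (- (l / 4) * \<bar>y - b\<bar>) +
      l * exp (- (l / 4) * \<bar>y - (b + 2 * pi)\<bar>) + l * exp (- (l / 4) * \<bar>y - (b - 2 * pi)\<bar>)"
    if "y \<in> {0..2*pi}" for y
  proof -
    have *: "l * exp (- l * norm (cis a - cis y)) \<le> l * exp (- (l / 4) * \<bar>y - (b + 2 * pi * of_int k)\<bar>)"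
      if "\<bar>b - y + 2 * pi * of_int k\<bar> \<le> pi" for k
    proof -
      have "\<bar>y - (b + 2 * pi * of_int k)\<bar> = \<bar>b - y + 2 * pi * of_int k\<bar>" by arith
      then have "\<bar>y - (b + 2 * pi * of_int k)\<bar> / 4 \<le> norm (cis a - cis y)"
        using abs_le_norm_cis[OF that] unfolding cisb norm_diff[of y k] by (simp only:)
      from mult_left_mono[OF this, of l] show ?thesis using l by simp
    qed
    consider "\<bar>b - y\<bar> \<le> pi" | "b - y < - pi" | "b - y > pi" by linarith
    then show ?thesis
    proof cases
      case 1
      from *[of 0] 1 show ?thesis using l by (simp add: add_increasing2)
    next
      case 2
      then have "\<bar>b - y + 2 * pi * of_int 1\<bar> \<le> pi" using b that by (simp add: abs_le_iff)
      from *[OF this] show ?thesis using l by (simp add: add_increasing2 add_increasing)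
    next
      case 3
      then have "\<bar>b - y + 2 * pi * of_int (-1)\<bar> \<le> pi" using b that by (simp add: abs_le_iff)
      from *[OF this] show ?thesis using l by (simp add: add_increasing2 add_increasing)
    qed
  qed
  have one: "(\<integral>\<^sup>+y. ennreal (l * exp (- (l / 4) * \<bar>y - c\<bar>)) \<partial>lborel) \<le> ennreal 8" for c
  proof -
    have "(\<integral>\<^sup>+y. ennreal (l * exp (- (l / 4) * \<bar>y - c\<bar>)) \<partial>lborel)
        = ennreal l * (\<integral>\<^sup>+y. ennreal (exp (- (l / 4) * \<bar>y - c\<bar>)) \<partial>lborel)"
      by (subst nn_integral_cmult[symmetric]) (use l in \<open>auto simp: ennreal_mult\<close>)
    also have "\<dots> \<le> ennreal l * ennreal (2 / (l / 4))"
      by (intro mult_left_mono nn_integral_exp_abs) (use l in auto)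
    also have "\<dots> = ennreal 8" using l by (simp add: ennreal_mult[symmetric])
    finally show ?thesis .
  qed
  have "(\<integral>\<^sup>+y. ennreal (l * exp (- l * norm (cis a - cis y))) * indicator {0..2*pi} y \<partial>lborel)
    \<le> (\<integral>\<^sup>+y. ennreal (l * exp (- (l / 4) * \<bar>y - b\<bar>)) +
      ennreal (l * exp (- (l / 4) * \<bar>y - (b + 2 * pi)\<bar>)) + ennreal (l * exp (- (l / 4) * \<bar>y - (b - 2 * pi)\<bar>)) \<partial>lborel)"
    using bound l by (intro nn_integral_mono) (auto simp: indicator_def ennreal_plus[symmetric] simp del: ennreal_plus intro!: ennreal_leI)
  also have "\<dots> \<le> ennreal 8 + ennreal 8 + ennreal 8"
  proof -
    have "(\<integral>\<^sup>+y. f y + g y + h y \<partial>lborel) = (\<integral>\<^sup>+y. f y \<partial>lborel) + (\<integral>\<^sup>+y. g y \<partial>lborel) + (\<integral>\<^sup>+y. h y \<partial>lborel)"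
      if [measurable]: "f \<in> borel_measurable lborel" "g \<in> borel_measurable lborel" "h \<in> borel_measurable lborel"
      for f g h :: "real \<Rightarrow> ennreal" by (simp add: nn_integral_add)
    then show ?thesis by (rule ord_eq_le_trans) (measurable, intro add_mono one)
  qed
  also have "\<dots> = ennreal 24" by (simp add: ennreal_plus[symmetric] del: ennreal_plus)
  finally show ?thesis .
qed

definition exp_kernel :: "real \<Rightarrow> real^'d::finite \<Rightarrow> real^'d \<Rightarrow> real"
  where "exp_kernel l x y = l ^ CARD('d) * exp (- l * torus_dist x y)"

lemma exp_kernel_integral:
  fixes x :: "real^'d::finite"
  assumes l: "l > 0"
  shows "(\<integral>\<^sup>+y. ennreal (exp_kernel l x y) \<partial>torus_measure) \<le> ennreal (24 ^ CARD('d))"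
proof -
  let ?Q = "cbox 0 (\<chi> i. 2 * pi) :: (real^'d) set"
  define f where "f = (\<lambda>b (t::real). ennreal (l * exp (- l * norm (cis (x \<bullet> b) - cis t))) * indicator {0..2*pi} t)"
  have [measurable]: "f b \<in> borel_measurable borel" for b
  proof -
    have [measurable]: "(\<lambda>t. cis t) \<in> borel_measurable borel"
      unfolding cis_conv_exp by (intro borel_measurable_continuous_onI continuous_intros)
    show ?thesis unfolding f_def by measurable
  qed
  have prod_f: "ennreal (exp_kernel l x y) * indicator ?Q y = (\<Prod>b\<in>Basis. f b (y \<bullet> b))" for y
  proof -
    have "exp_kernel l x y = (\<Prod>i\<in>UNIV. l * exp (- l * norm (cis (x $ i) - cis (y $ i))))"
      by (simp add: exp_kernel_def torus_dist_def prod.distrib exp_sum[symmetric] sum_distrib_left sum_negf)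
    then have "ennreal (exp_kernel l x y) = (\<Prod>i\<in>UNIV. ennreal (l * exp (- l * norm (cis (x $ i) - cis (y $ i)))))"
      using l by (subst prod_ennreal) auto
    moreover have "indicator ?Q y = (\<Prod>i\<in>UNIV. indicator {0..2*pi} (y $ i) :: ennreal)"
    proof (cases "y \<in> ?Q")
      case True then show ?thesis by (auto simp: mem_box_cart)
    next
      case False
      then obtain i where "y $ i \<notin> {0..2*pi}" by (auto simp: mem_box_cart)
      then have "\<exists>i\<in>UNIV. indicator {0..2*pi} (y $ i) = (0::ennreal)" by (auto simp: indicator_def)
      then have "(\<Prod>i\<in>UNIV. indicator {0..2*pi} (y $ i) :: ennreal) = 0" by (intro prod_zero) auto
      with False show ?thesis by simp
    qed
    ultimately show ?thesis using l
      by (simp add: f_def prod_Basis_vec inner_axis prod.distrib)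
  qed
  have "(\<integral>\<^sup>+y. ennreal (exp_kernel l x y) \<partial>torus_measure) = (\<integral>\<^sup>+y. ennreal (exp_kernel l x y) * indicator ?Q y \<partial>lborel)"
    unfolding torus_measure_def by (subst nn_integral_restrict_space) auto
  also have "\<dots> = (\<Prod>b\<in>Basis. \<integral>\<^sup>+t. f b t \<partial>lborel)"
    unfolding prod_f by (rule nn_integral_lborel_prod) auto
  also have "\<dots> = (\<Prod>i\<in>(UNIV::'d set). \<integral>\<^sup>+t. f (axis i 1) t \<partial>lborel)" by (rule prod_Basis_vec)
  also have "\<dots> \<le> (\<Prod>i\<in>(UNIV::'d set). ennreal 24)"
    unfolding f_def by (intro prod_mono_ennreal exp_kernel_integral_1d l)
  also have "\<dots> = ennreal 24 ^ CARD('d)" by (simp only: prod_constant)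
  also have "\<dots> = ennreal (24 ^ CARD('d))" by (rule ennreal_power) simp
  finally show ?thesis .
qed

lemma exp_kernel_nonneg [simp]: "l \<ge> 0 \<Longrightarrow> 0 \<le> exp_kernel l x y"
  by (simp add: exp_kernel_def)

lemma exp_kernel_commute: "exp_kernel l x y = exp_kernel l y x"
  by (simp add: exp_kernel_def torus_dist_commute)

lemma exp_kernel_measurable [measurable (raw)]:
  assumes [measurable]: "f \<in> borel_measurable M" "g \<in> borel_measurable M"
  shows "(\<lambda>p. exp_kernel l (f p) (g p)) \<in> borel_measurable M"
  unfolding exp_kernel_def by measurable

definition poly_kernel :: "real \<Rightarrow> real \<Rightarrow> real^'d::finite \<Rightarrow> real^'d \<Rightarrow> real"
  where "poly_kernel l m x y = l ^ CARD('d) * (1 + l * torus_dist x y) powr (- m)"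

lemma poly_kernel_nonneg [simp]: "l \<ge> 0 \<Longrightarrow> 0 \<le> poly_kernel l m x y"
  by (simp add: poly_kernel_def)

lemma poly_kernel_commute: "poly_kernel l m x y = poly_kernel l m y x"
  by (simp add: poly_kernel_def torus_dist_commute)

lemma poly_kernel_measurable [measurable (raw)]:
  assumes [measurable]: "f \<in> borel_measurable M" "g \<in> borel_measurable M"
  shows "(\<lambda>p. poly_kernel l m (f p) (g p)) \<in> borel_measurable M"
  unfolding poly_kernel_def by measurable

lemma one_plus_powr_le_exp:
  fixes u m :: real
  assumes "u \<ge> 0" "m > 0" "u \<le> 2 ^ n"
  obtains i :: nat where "i \<le> n" "(1 + u) powr (- m) \<le> exp 1 * 2 powr m * (2 powr (- m * real i) * exp (- (u / 2 ^ i)))"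
proof -
  define i where "i = (LEAST n::nat. u \<le> 2 ^ n)"
  have i: "u \<le> 2 ^ i" unfolding i_def by (rule LeastI[of _ n]) (rule assms(3))
  have i_le: "i \<le> n" unfolding i_def by (rule Least_le) (rule assms(3))
  have lower: "2 ^ i \<le> 2 * (1 + u)"
  proof (cases i)
    case 0 then show ?thesis using assms by simp
  next
    case (Suc j)
    then have "\<not> u \<le> 2 ^ j" unfolding i_def using not_less_Least by (metis lessI i_def)
    then show ?thesis using Suc by simp
  qed
  have "(1 + u) powr (- m) \<le> (2 ^ i / 2) powr (- m)"
    by (rule powr_mono2') (use assms lower in auto)
  also have "(2 ^ i / 2 :: real) = 2 powr (real i - 1)"
    by (simp add: powr_diff powr_realpow)
  also have "\<dots> powr (- m) = 2 powr m * 2 powr (- m * real i)"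
    by (simp add: powr_powr powr_add[symmetric] algebra_simps)
  also have "\<dots> = exp 1 * 2 powr m * (2 powr (- m * real i) * exp (- 1))"
    by (simp add: exp_minus)
  also have "\<dots> \<le> exp 1 * 2 powr m * (2 powr (- m * real i) * exp (- (u / 2 ^ i)))"
    by (intro mult_left_mono) (use i assms in \<open>auto simp: divide_le_eq\<close>)
  finally show thesis by (rule that[OF i_le])
qed

text \<open>A polynomially decaying kernel is a sum of exponential kernels at coarser scales.\<close>

lemma poly_kernel_le_exp_kernels:
  fixes x y :: "real^'d::finite" and l m :: real
  assumes l: "l > 0" and m: "m > 0" and n: "2 * l * CARD('d) \<le> 2 ^ n"
  shows "poly_kernel l m x y \<le>
    (\<Sum>i\<le>n. exp 1 * 2 powr m * 2 powr (- (m - CARD('d)) * real i) * exp_kernel (l / 2 ^ i) x y)"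
proof -
  have "l * torus_dist x y \<le> l * (2 * real CARD('d))"
    by (rule mult_left_mono[OF torus_dist_le]) (use l in simp)
  with n have u: "l * torus_dist x y \<le> 2 ^ n" by simp
  obtain i :: nat where i: "i \<le> n" "(1 + l * torus_dist x y) powr (- m) \<le>
      exp 1 * 2 powr m * (2 powr (- m * real i) * exp (- (l * torus_dist x y / 2 ^ i)))"
    by (rule one_plus_powr_le_exp[OF _ m u]) (use l in auto)
  have "poly_kernel l m x y \<le> l ^ CARD('d) * (exp 1 * 2 powr m * (2 powr (- m * real i) * exp (- (l * torus_dist x y / 2 ^ i))))"
    unfolding poly_kernel_def by (rule mult_left_mono[OF i(2)]) (use l in auto)
  also have "\<dots> = exp 1 * 2 powr m * 2 powr (- (m - CARD('d)) * real i) * exp_kernel (l / 2 ^ i) x y"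
  proof -
    have "2 powr (- (m - CARD('d)) * real i) = 2 powr (- m * real i) * (2 ^ i) ^ CARD('d)"
      by (simp add: powr_realpow[symmetric] powr_powr powr_add[symmetric] algebra_simps power_mult[symmetric])
    then show ?thesis using l by (simp add: exp_kernel_def power_divide)
  qed
  also have "\<dots> \<le> (\<Sum>i\<le>n. exp 1 * 2 powr m * 2 powr (- (m - CARD('d)) * real i) * exp_kernel (l / 2 ^ i) x y)"
    using i(1) l by (intro member_le_sum) auto
  finally show ?thesis .
qed

lemma sum_powr_bounded:
  fixes \<delta> :: real
  assumes "\<delta> > 0"
  obtains K where "K > 0" "\<And>n. (\<Sum>i\<le>n. 2 powr (- \<delta> * real i)) \<le> K"
proof -
  have q: "2 powr (- \<delta>) < 1" using assms by (simp add: powr_less_one)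
  have eq: "2 powr (- \<delta> * real i) = (2 powr (- \<delta>)) ^ i" for i
    by (simp add: powr_realpow[symmetric] powr_powr)
  have sm: "summable (\<lambda>i. (2 powr (- \<delta>)) ^ i)"
    by (intro summable_geometric) (use q in auto)
  have "(\<Sum>i\<le>n. 2 powr (- \<delta> * real i)) \<le> (\<Sum>i. (2 powr (- \<delta>)) ^ i) + 1" for n
    unfolding eq by (intro add_increasing2 sum_le_suminf sm) auto
  moreover have "0 < (\<Sum>i. (2 powr (- \<delta>)) ^ i) + 1"
    by (intro add_nonneg_pos suminf_nonneg sm) auto
  ultimately show ?thesis by (rule that[rotated])
qed

lemma poly_kernel_integral:
  assumes m: "m > real CARD('d::finite)"
  shows "\<exists>K>0. \<forall>l>0. \<forall>x::real^'d. (\<integral>\<^sup>+y. ennreal (poly_kernel l m x y) \<partial>torus_measure) \<le> ennreal K"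
proof -
  let ?c = "\<lambda>i. exp 1 * 2 powr m * 2 powr (- (m - CARD('d)) * real i)"
  have m0: "m > 0" using m by linarith
  obtain K where K: "K > 0" "\<And>n. (\<Sum>i\<le>n. 2 powr (- (m - CARD('d)) * real i)) \<le> K"
    using sum_powr_bounded[of "m - CARD('d)"] m by (metis diff_gt_0_iff_gt)
  let ?K = "exp 1 * 2 powr m * 24 ^ CARD('d) * K"
  have "(\<integral>\<^sup>+y. ennreal (poly_kernel l m x y) \<partial>torus_measure) \<le> ennreal ?K" if l: "l > 0" for l and x :: "real^'d"
  proof -
    obtain n where n: "2 * l * CARD('d) \<le> 2 ^ n"
      using real_arch_pow[of 2 "2 * l * CARD('d)"] by (auto intro: less_imp_le)
    have "(\<integral>\<^sup>+y. ennreal (poly_kernel l m x y) \<partial>torus_measure) \<le>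
        (\<integral>\<^sup>+y. ennreal (\<Sum>i\<le>n. ?c i * exp_kernel (l / 2 ^ i) x y) \<partial>torus_measure)"
      by (intro nn_integral_mono ennreal_leI poly_kernel_le_exp_kernels l m0 n)
    also have "\<dots> = (\<integral>\<^sup>+y. (\<Sum>i\<le>n. ennreal (?c i) * ennreal (exp_kernel (l / 2 ^ i) x y)) \<partial>torus_measure)"
      using l by (simp add: ennreal_mult[symmetric] sum_ennreal)
    also have "\<dots> = (\<Sum>i\<le>n. ennreal (?c i) * (\<integral>\<^sup>+y. ennreal (exp_kernel (l / 2 ^ i) x y) \<partial>torus_measure))"
      by (simp add: nn_integral_sum nn_integral_cmult)
    also have "\<dots> \<le> (\<Sum>i\<le>n. ennreal (?c i) * ennreal (24 ^ CARD('d)))"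
      by (intro sum_mono mult_left_mono exp_kernel_integral) (use l in auto)
    also have "\<dots> = ennreal (exp 1 * 2 powr m * 24 ^ CARD('d) * (\<Sum>i\<le>n. 2 powr (- (m - CARD('d)) * real i)))"
    proof -
      have "ennreal (?c i) * ennreal (24 ^ CARD('d)) = ennreal (?c i * 24 ^ CARD('d))" for i
        by (rule ennreal_mult[symmetric]) auto
      then have "(\<Sum>i\<le>n. ennreal (?c i) * ennreal (24 ^ CARD('d))) = ennreal (\<Sum>i\<le>n. ?c i * 24 ^ CARD('d))"
        by (simp only:) (rule sum_ennreal, simp)
      then show ?thesis by (simp only: sum_distrib_left mult_ac)
    qed
    also have "\<dots> \<le> ennreal ?K"
      by (intro ennreal_leI mult_left_mono K(2)) auto
    finally show ?thesis .
  qed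
  with K(1) show ?thesis by (intro exI[of _ ?K]) auto
qed

lemma poly_kernel_shift:
  fixes x y z :: "real^'d::finite"
  assumes "l \<ge> 0" "m \<ge> 0"
  shows "poly_kernel l m y z \<le> (1 + l * torus_dist x y) powr m * poly_kernel l m x z"
proof -
  have "1 + l * torus_dist x z \<le> (1 + l * torus_dist x y) * (1 + l * torus_dist y z)"
  proof -
    have "0 \<le> (l * torus_dist x y) * (l * torus_dist y z)" using assms by simp
    then show ?thesis using mult_left_mono[OF torus_dist_triangle[of x z y] assms(1)]
      by (simp add: algebra_simps)
  qed
  then have "((1 + l * torus_dist x y) * (1 + l * torus_dist y z)) powr (- m) \<le> (1 + l * torus_dist x z) powr (- m)"
    using assms by (intro powr_mono2') (auto simp: add_pos_nonneg)
  then have "(1 + l * torus_dist x y) powr m * (((1 + l * torus_dist x y) * (1 + l * torus_dist y z)) powr (- m))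
      \<le> (1 + l * torus_dist x y) powr m * (1 + l * torus_dist x z) powr (- m)"
    by (intro mult_left_mono) auto
  moreover have "(1 + l * torus_dist x y) powr m * (((1 + l * torus_dist x y) * (1 + l * torus_dist y z)) powr (- m))
      = (1 + l * torus_dist y z) powr (- m)"
  proof -
    have "1 + l * torus_dist x y > 0" using assms by (simp add: add_pos_nonneg)
    then show ?thesis using assms by (simp add: powr_mult powr_minus)
  qed
  ultimately show ?thesis using mult_left_mono[of _ _ "l ^ CARD('d)"] assms(1)
    by (simp add: poly_kernel_def mult.left_commute)
qed

lemma exp_kernel_shift:
  fixes x y z :: "real^'d::finite"
  assumes "0 \<le> l" "l \<le> k"
  shows "exp_kernel l y z \<le> exp (k * torus_dist x y) * exp_kernel l x z"
proof -
  have "l * torus_dist x z \<le> l * torus_dist x y + l * torus_dist y z"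
    using mult_left_mono[OF torus_dist_triangle[of x z y] assms(1)] by (simp add: algebra_simps)
  also have "l * torus_dist x y \<le> k * torus_dist x y" using assms by (simp add: mult_right_mono)
  finally have "exp (- l * torus_dist y z) \<le> exp (k * torus_dist x y) * exp (- l * torus_dist x z)"
    by (simp add: exp_add[symmetric])
  then show ?thesis using assms mult_left_mono[of _ _ "l ^ CARD('d)"]
    by (simp add: exp_kernel_def mult.left_commute)
qed

section \<open>Vector-valued inequalities for averaging operators\<close>

lemma powr_tangent:
  fixes a b t :: real
  assumes "a \<ge> 0" "b \<ge> 0" "t \<ge> 1"
  shows "b powr t + t * b powr (t - 1) * (a - b) \<le> a powr t"
proof (cases "a = 0 \<or> b = 0")
  case False
  then have ab: "a > 0" "b > 0" using assms by auto
  have "a powr t - b powr t \<ge> (t * b powr (t - 1)) * (a - b)"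
  proof (rule convex_on_imp_above_tangent[OF powr_convex[OF assms(3)]])
    show "((\<lambda>x. x powr t) has_real_derivative t * b powr (t - 1)) (at b within {0<..})"
      by (rule has_field_derivative_at_within, rule has_real_derivative_powr) (rule ab)
  qed (use ab in \<open>simp_all add: interior_open\<close>)
  then show ?thesis by simp
next
  case True
  have "b powr (t - 1) * b = b powr t" if "b > 0"
    using that powr_mult_base[of b "t - 1"] by (simp add: mult.commute)
  then show ?thesis using True assms
    by (cases "b = 0") (auto simp: algebra_simps mult_right_mono)
qed

lemma powr_diff_le:
  fixes a b t :: real
  assumes "0 \<le> a" "a \<le> b" "t \<ge> 1"
  shows "b powr t - a powr t \<le> t * (b - a) * b powr (t - 1)"
  using powr_tangent[of a b t] assms by (simp add: algebra_simps)

lemma sum_powr_le: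
  fixes x :: "'i \<Rightarrow> real"
  assumes I: "finite I" and x: "\<And>i. i \<in> I \<Longrightarrow> 0 \<le> x i" and s: "s \<ge> 0"
  shows "(\<Sum>i\<in>I. x i) powr s \<le> real (card I) powr s * (\<Sum>i\<in>I. x i powr s)"
proof (cases "I = {}")
  case False
  obtain k where k: "k \<in> I" "Max (x ` I) = x k"
    using Max_in[of "x ` I"] I False by fastforce
  have "(\<Sum>i\<in>I. x i) \<le> (\<Sum>i\<in>I. x k)"
    by (intro sum_mono) (metis I Max_ge finite_imageI imageI k(2))
  then have "(\<Sum>i\<in>I. x i) powr s \<le> (real (card I) * x k) powr s"
    by (intro powr_mono2) (use s x in \<open>auto intro: sum_nonneg\<close>)
  also have "\<dots> = real (card I) powr s * x k powr s" using x k by (simp add: powr_mult)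
  also have "\<dots> \<le> real (card I) powr s * (\<Sum>i\<in>I. x i powr s)"
    by (intro mult_left_mono member_le_sum k I) auto
  finally show ?thesis .
qed simp

lemma sum_of_powr_le_powr_sum:
  fixes x :: "'i \<Rightarrow> real"
  assumes I: "finite I" and x: "\<And>i. i \<in> I \<Longrightarrow> 0 \<le> x i" and t: "t \<ge> 1"
  shows "(\<Sum>i\<in>I. x i powr t) \<le> (\<Sum>i\<in>I. x i) powr t"
proof -
  let ?S = "\<Sum>i\<in>I. x i"
  have eq: "a powr t = a * a powr (t - 1)" if "a \<ge> 0" for a :: real
    using that powr_mult_base[of a "t - 1"] by (cases "a = 0") auto
  have "(\<Sum>i\<in>I. x i powr t) \<le> (\<Sum>i\<in>I. x i * ?S powr (t - 1))"
  proof (rule sum_mono)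
    fix i assume i: "i \<in> I"
    have "x i \<le> ?S" using i I x by (intro member_le_sum) auto
    then show "x i powr t \<le> x i * ?S powr (t - 1)"
      unfolding eq[OF x[OF i]] using x[OF i] t by (intro mult_left_mono powr_mono2) auto
  qed
  also have "\<dots> = ?S powr t"
    by (subst eq) (use x in \<open>auto intro: sum_nonneg simp: sum_distrib_right\<close>)
  finally show ?thesis .
qed

text \<open>Bounded non-negative measurable functions; every integral below is of this kind.\<close>

definition bounded_meas :: "(real^'d::finite \<Rightarrow> real) \<Rightarrow> bool"
  where "bounded_meas f \<longleftrightarrow> f \<in> borel_measurable borel \<and> (\<forall>x. 0 \<le> f x) \<and> (\<exists>B. \<forall>x. f x \<le> B)"

lemma bounded_measD:
  assumes "bounded_meas f"
  shows "f \<in> borel_measurable borel" "0 \<le> f x" "\<exists>B. \<forall>x. f x \<le> B"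
  using assms by (auto simp: bounded_meas_def)

lemma bounded_meas_integrable: "bounded_meas f \<Longrightarrow> integrable torus_measure f"
  by (auto simp: bounded_meas_def intro!: integrable_torus_bounded)

lemma bounded_meas_const: "c \<ge> 0 \<Longrightarrow> bounded_meas (\<lambda>x. c)"
  by (auto simp: bounded_meas_def)

lemma bounded_meas_add:
  assumes "bounded_meas f" "bounded_meas g" shows "bounded_meas (\<lambda>x. f x + g x)"
proof -
  obtain B C where "\<And>x. f x \<le> B" "\<And>x. g x \<le> C" using assms bounded_measD(3) by metis
  then have "f x + g x \<le> B + C" for x by (rule add_mono)
  then show ?thesis using assms by (auto simp: bounded_meas_def)
qed

lemma bounded_meas_mult:
  assumes "bounded_meas f" "bounded_meas g" shows "bounded_meas (\<lambda>x. f x * g x)"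
proof -
  obtain B C where *: "\<And>x. f x \<le> B" "\<And>x. g x \<le> C" using assms bounded_measD(3) by metis
  have "f x * g x \<le> B * C" for x
    by (rule mult_mono') (use * assms in \<open>auto simp: bounded_meas_def\<close>)
  then show ?thesis using assms by (auto simp: bounded_meas_def)
qed

lemma bounded_meas_powr:
  assumes "bounded_meas f" "t \<ge> 0" shows "bounded_meas (\<lambda>x. f x powr t)"
proof -
  obtain B where *: "\<And>x. f x \<le> B" using assms bounded_measD(3) by metis
  have "f x powr t \<le> B powr t" for x
    by (rule powr_mono2) (use * assms in \<open>auto simp: bounded_meas_def\<close>)
  then show ?thesis using assms by (auto simp: bounded_meas_def)
qed

lemma bounded_meas_sum:
  "(\<And>i. i \<in> I \<Longrightarrow> bounded_meas (f i)) \<Longrightarrow> bounded_meas (\<lambda>x. \<Sum>i\<in>I. f i x)"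
  by (induction I rule: infinite_finite_induct) (auto intro: bounded_meas_add bounded_meas_const)

lemma bounded_meas_le:
  assumes "bounded_meas g" "f \<in> borel_measurable borel" "\<And>x. 0 \<le> f x" "\<And>x. f x \<le> g x"
  shows "bounded_meas f"
  using assms unfolding bounded_meas_def by (meson order_trans)

lemmas bounded_meas_intros = bounded_meas_const bounded_meas_add bounded_meas_mult
  bounded_meas_powr bounded_meas_sum

lemma torus_integral_mono:
  "bounded_meas f \<Longrightarrow> bounded_meas g \<Longrightarrow> (\<And>x. f x \<le> g x) \<Longrightarrow>
    (LINT x|torus_measure. f x) \<le> (LINT x|torus_measure. g x)"
  by (intro integral_mono bounded_meas_integrable)

lemma torus_integral_nonneg: "bounded_meas f \<Longrightarrow> 0 \<le> (LINT x|torus_measure. f x)"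
  by (intro integral_nonneg_AE AE_I2) (auto simp: bounded_meas_def)

lemma torus_integral_sum:
  "(\<And>i. i \<in> I \<Longrightarrow> bounded_meas (f i)) \<Longrightarrow>
    (LINT x|torus_measure. (\<Sum>i\<in>I. f i x)) = (\<Sum>i\<in>I. LINT x|torus_measure. f i x)"
  by (intro Bochner_Integration.integral_sum bounded_meas_integrable)

definition kernel_avg :: "(real^'d::finite \<Rightarrow> real^'d \<Rightarrow> real) \<Rightarrow> (real^'d \<Rightarrow> real) \<Rightarrow> real^'d \<Rightarrow> real"
  where "kernel_avg \<kappa> f x = (LINT y|torus_measure. \<kappa> x y * f y)"

text \<open>Bounded symmetric kernels of mass at most \<open>K\<close>.\<close>

definition sym_kernel :: "real \<Rightarrow> (real^'d::finite \<Rightarrow> real^'d \<Rightarrow> real) \<Rightarrow> bool"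
  where "sym_kernel K \<kappa> \<longleftrightarrow> (\<lambda>(x, y). \<kappa> x y) \<in> borel_measurable (borel \<Otimes>\<^sub>M borel) \<and>
    (\<forall>x y. 0 \<le> \<kappa> x y \<and> \<kappa> x y = \<kappa> y x) \<and> (\<exists>B. \<forall>x y. \<kappa> x y \<le> B) \<and>
    (\<forall>x. (LINT y|torus_measure. \<kappa> x y) \<le> K)"

lemma sym_kernelD:
  assumes "sym_kernel K \<kappa>"
  shows "(\<lambda>(x, y). \<kappa> x y) \<in> borel_measurable (borel \<Otimes>\<^sub>M borel)" "0 \<le> \<kappa> x y" "\<kappa> x y = \<kappa> y x"
    "\<exists>B. \<forall>x y. \<kappa> x y \<le> B" "(LINT y|torus_measure. \<kappa> x y) \<le> K"
  using assms unfolding sym_kernel_def by blast+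

lemma sym_kernel_bounded_meas: "sym_kernel K \<kappa> \<Longrightarrow> bounded_meas (\<kappa> x)"
proof -
  assume k: "sym_kernel K \<kappa>"
  have "(\<lambda>y. (case (x, y) of (x, y) \<Rightarrow> \<kappa> x y)) \<in> borel_measurable borel"
    using sym_kernelD(1)[OF k] by measurable
  moreover obtain B where "\<And>x y. \<kappa> x y \<le> B" using sym_kernelD(4)[OF k] by blast
  ultimately show ?thesis using sym_kernelD(2)[OF k] by (auto simp: bounded_meas_def)
qed

lemma sym_kernel_nonneg: "sym_kernel K \<kappa> \<Longrightarrow> 0 \<le> K"
  using sym_kernelD(5) torus_integral_nonneg[OF sym_kernel_bounded_meas] order_trans by blast

lemma bounded_meas_kernel_avg:
  assumes k: "sym_kernel K \<kappa>" and f: "bounded_meas f"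
  shows "bounded_meas (kernel_avg \<kappa> f)"
proof -
  obtain B where B: "\<And>x. f x \<le> B" using bounded_measD(3)[OF f] by metis
  have B0: "0 \<le> B" using B bounded_measD(2)[OF f] order_trans by blast
  note [measurable] = sym_kernelD(1)[OF k] bounded_measD(1)[OF f]
  have "(\<lambda>p. (fst p, snd p)) \<in> measurable (borel \<Otimes>\<^sub>M torus_measure) (borel \<Otimes>\<^sub>M borel)"
    by (rule measurable_Pair[OF measurable_fst]) (rule measurable_compose[OF measurable_snd id_measurable_torus])
  from measurable_compose[OF this sym_kernelD(1)[OF k]]
  have "(\<lambda>p. \<kappa> (fst p) (snd p)) \<in> borel_measurable (borel \<Otimes>\<^sub>M torus_measure)" by simp
  then have m: "(\<lambda>p. \<kappa> (fst p) (snd p) * f (snd p)) \<in> borel_measurable (borel \<Otimes>\<^sub>M torus_measure)"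
    by (intro borel_measurable_times measurable_compose[OF measurable_snd]) (auto simp: borel_measurable_torus f bounded_measD)
  have meas: "kernel_avg \<kappa> f \<in> borel_measurable borel"
    unfolding kernel_avg_def
    by (rule torus.borel_measurable_lebesgue_integral) (use m in \<open>simp add: split_beta\<close>)
  have le: "kernel_avg \<kappa> f x \<le> B * K" for x
  proof -
    have "kernel_avg \<kappa> f x \<le> (LINT y|torus_measure. \<kappa> x y * B)" unfolding kernel_avg_def
      by (intro torus_integral_mono bounded_meas_intros sym_kernel_bounded_meas[OF k] f mult_left_mono B B0 sym_kernelD(2)[OF k])
    also have "\<dots> = B * (LINT y|torus_measure. \<kappa> x y)" by (simp add: mult.commute)
    also have "\<dots> \<le> B * K" by (intro mult_left_mono sym_kernelD(5)[OF k] B0)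
    finally show ?thesis .
  qed
  have "0 \<le> kernel_avg \<kappa> f x" for x unfolding kernel_avg_def
    by (intro torus_integral_nonneg bounded_meas_intros sym_kernel_bounded_meas[OF k] f)
  with meas le show ?thesis by (auto simp: bounded_meas_def)
qed

lemma kernel_avg_swap:
  assumes k: "sym_kernel K \<kappa>" and f: "bounded_meas f" and g: "bounded_meas g"
  shows "(LINT x|torus_measure. kernel_avg \<kappa> f x * g x) = (LINT x|torus_measure. f x * kernel_avg \<kappa> g x)"
proof -
  let ?M = "torus_measure :: (real^'a) measure"
  interpret pair_sigma_finite ?M ?M
    by (simp add: pair_sigma_finite_def torus.sigma_finite_measure_axioms)
  interpret fin: finite_measure "?M \<Otimes>\<^sub>M ?M"
    by (rule finite_measure_pair_measure) (rule finite_measure_torus)+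
  obtain A B C where bd: "\<And>x y. \<kappa> x y \<le> A" "\<And>x. f x \<le> B" "\<And>x. g x \<le> C"
    using sym_kernelD(4)[OF k] bounded_measD(3)[OF f] bounded_measD(3)[OF g] by metis
  have m1: "(\<lambda>p. \<kappa> (fst p) (snd p)) \<in> borel_measurable (?M \<Otimes>\<^sub>M ?M)"
  proof -
    have "(\<lambda>p. (fst p, snd p)) \<in> measurable (?M \<Otimes>\<^sub>M ?M) (borel \<Otimes>\<^sub>M borel)"
      by (intro measurable_Pair measurable_compose[OF measurable_fst id_measurable_torus] measurable_compose[OF measurable_snd id_measurable_torus])
    from measurable_compose[OF this sym_kernelD(1)[OF k]] show ?thesis by simp
  qed
  have m2: "(\<lambda>p. f (snd p)) \<in> borel_measurable (?M \<Otimes>\<^sub>M ?M)" "(\<lambda>p. g (fst p)) \<in> borel_measurable (?M \<Otimes>\<^sub>M ?M)"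
    using f g by (auto intro!: measurable_compose[OF measurable_snd] measurable_compose[OF measurable_fst] borel_measurable_torus dest: bounded_measD(1))
  have "norm (\<kappa> (fst p) (snd p) * f (snd p) * g (fst p)) \<le> A * B * C" for p
    unfolding real_norm_def abs_mult using sym_kernelD(2)[OF k] bounded_measD(2)[OF f] bounded_measD(2)[OF g] bd
    by (intro mult_mono') (auto simp: abs_of_nonneg)
  then have int: "integrable (?M \<Otimes>\<^sub>M ?M) (\<lambda>p. \<kappa> (fst p) (snd p) * f (snd p) * g (fst p))"
    by (intro fin.integrable_const_bound[where B = "A * B * C"] AE_I2 borel_measurable_times m1 m2) auto
  have "(LINT x|?M. kernel_avg \<kappa> f x * g x) = (LINT x|?M. LINT y|?M. \<kappa> x y * f y * g x)"
    by (simp add: kernel_avg_def)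
  also have "\<dots> = (LINT y|?M. LINT x|?M. \<kappa> x y * f y * g x)"
  proof (rule Fubini_integral[symmetric])
    show "integrable (?M \<Otimes>\<^sub>M ?M) (\<lambda>(x, y). \<kappa> x y * f y * g x)"
      unfolding split_beta' by (rule int)
  qed
  also have "\<dots> = (LINT y|?M. LINT x|?M. f y * (\<kappa> y x * g x))"
    using sym_kernelD(3)[OF k] by (intro Bochner_Integration.integral_cong refl) (metis mult.assoc mult.commute)
  also have "\<dots> = (LINT y|?M. f y * kernel_avg \<kappa> g y)"
    by (simp add: kernel_avg_def)
  finally show ?thesis .
qed

lemma kernel_avg_mono:
  assumes "sym_kernel K \<kappa>" "bounded_meas f" "bounded_meas g" "\<And>y. f y \<le> g y"
  shows "kernel_avg \<kappa> f x \<le> kernel_avg \<kappa> g x"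
  unfolding kernel_avg_def
  by (intro torus_integral_mono bounded_meas_mult sym_kernel_bounded_meas[OF assms(1)] assms(2,3)
      mult_left_mono assms(4) sym_kernelD(2)[OF assms(1)])

lemma kernel_avg_le_const:
  assumes "sym_kernel K \<kappa>" "bounded_meas f" "\<And>y. f y \<le> B"
  shows "kernel_avg \<kappa> f x \<le> B * K"
proof -
  have B0: "0 \<le> B" using assms(2,3) bounded_measD(2) order_trans by blast
  have "kernel_avg \<kappa> f x \<le> kernel_avg \<kappa> (\<lambda>y. B) x"
    by (rule kernel_avg_mono[OF assms(1,2) bounded_meas_const[OF B0] assms(3)])
  also have "\<dots> = B * (LINT y|torus_measure. \<kappa> x y)" by (simp add: kernel_avg_def mult.commute)
  also have "\<dots> \<le> B * K" by (intro mult_left_mono sym_kernelD(5)[OF assms(1)] B0)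
  finally show ?thesis .
qed

lemma integral_kernel_avg_le:
  assumes k: "sym_kernel K \<kappa>" and f: "bounded_meas f"
  shows "(LINT x|torus_measure. kernel_avg \<kappa> f x) \<le> K * (LINT x|torus_measure. f x)"
proof -
  have 1: "bounded_meas (\<lambda>x::real^'a. 1)" by (rule bounded_meas_const) simp
  have "(LINT x|torus_measure. kernel_avg \<kappa> f x) = (LINT x|torus_measure. f x * kernel_avg \<kappa> (\<lambda>x. 1) x)"
    using kernel_avg_swap[OF k f 1] by simp
  also have "\<dots> \<le> (LINT x|torus_measure. f x * K)"
  proof (intro torus_integral_mono bounded_meas_intros f bounded_meas_kernel_avg[OF k] sym_kernel_nonneg[OF k] mult_left_mono)
    show "kernel_avg \<kappa> (\<lambda>x. 1) x \<le> K" for x using kernel_avg_le_const[OF k 1, of 1] by simp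
  qed (use bounded_measD(2)[OF f] in auto)
  finally show ?thesis by (simp add: mult.commute)
qed

text \<open>Jensen's inequality, from the tangent of \<open>u\<^sup>t\<close> at the average.\<close>

lemma kernel_avg_powr_le:
  assumes k: "sym_kernel K \<kappa>" and K: "K > 0" and f: "bounded_meas f" and t: "t \<ge> 1"
  shows "kernel_avg \<kappa> f x powr t \<le> K powr (t - 1) * kernel_avg \<kappa> (\<lambda>y. f y powr t) x"
proof (cases "kernel_avg \<kappa> f x = 0")
  case True
  then show ?thesis
    using bounded_measD(2)[OF bounded_meas_kernel_avg[OF k bounded_meas_powr[OF f]], of t x] t by simp
next
  case False
  define A where "A = kernel_avg \<kappa> f x"
  have A: "A > 0" using False bounded_measD(2)[OF bounded_meas_kernel_avg[OF k f], of x] by (simp add: A_def)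
  define b where "b = A / K"
  have b: "b > 0" using A K by (simp add: b_def)
  note kx = sym_kernel_bounded_meas[OF k, of x]
  have int: "integrable torus_measure (\<lambda>y. \<kappa> x y)" "integrable torus_measure (\<lambda>y. \<kappa> x y * f y)"
    "integrable torus_measure (\<lambda>y. \<kappa> x y * f y powr t)"
    using t by (auto intro!: bounded_meas_integrable bounded_meas_intros kx f)
  have bt: "b powr t = b * b powr (t - 1)" using powr_mult_base[of b "t - 1"] b by simp
  have "(A / K) powr (t - 1) * A = t * b powr (t - 1) * A - (t - 1) * b powr t * K"
    using K b A by (simp add: bt) (simp add: b_def field_simps)
  also have "\<dots> \<le> t * b powr (t - 1) * A - (t - 1) * b powr t * (LINT y|torus_measure. \<kappa> x y)"
    using t b by (intro diff_left_mono mult_left_mono sym_kernelD(5)[OF k]) auto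
  also have "\<dots> = (LINT y|torus_measure. (t * b powr (t - 1)) * (\<kappa> x y * f y) - ((t - 1) * b powr t) * \<kappa> x y)"
    using int by (simp add: A_def kernel_avg_def)
  also have "\<dots> \<le> (LINT y|torus_measure. \<kappa> x y * f y powr t)"
  proof (rule integral_mono)
    fix y
    have "\<kappa> x y * (b powr t + t * b powr (t - 1) * (f y - b)) \<le> \<kappa> x y * f y powr t"
      using powr_tangent[OF bounded_measD(2)[OF f], of b t y] b t sym_kernelD(2)[OF k] by (intro mult_left_mono) auto
    then show "(t * b powr (t - 1)) * (\<kappa> x y * f y) - ((t - 1) * b powr t) * \<kappa> x y \<le> \<kappa> x y * f y powr t"
      by (simp add: bt algebra_simps)
  qed (use int in auto)
  finally have "K powr (t - 1) * ((A / K) powr (t - 1) * A) \<le> K powr (t - 1) * kernel_avg \<kappa> (\<lambda>y. f y powr t) x"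
    unfolding kernel_avg_def by (rule mult_left_mono) simp
  moreover have "K powr (t - 1) * ((A / K) powr (t - 1) * A) = A powr t"
    using A K powr_mult_base[of A "t - 1"] by (simp add: powr_divide mult.commute)
  ultimately show ?thesis by (simp add: A_def)
qed

lemma integral_kernel_avg_powr_le:
  assumes k: "sym_kernel K \<kappa>" and K: "K > 0" and f: "bounded_meas f" and t: "t \<ge> 1"
  shows "(LINT x|torus_measure. kernel_avg \<kappa> f x powr t) \<le> K powr t * (LINT x|torus_measure. f x powr t)"
proof -
  have ft: "bounded_meas (\<lambda>x. f x powr t)" using t f by (intro bounded_meas_powr) auto
  have "(LINT x|torus_measure. kernel_avg \<kappa> f x powr t) \<le>
      (LINT x|torus_measure. K powr (t - 1) * kernel_avg \<kappa> (\<lambda>y. f y powr t) x)"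
    using t by (intro torus_integral_mono kernel_avg_powr_le bounded_meas_intros bounded_meas_kernel_avg[OF k] ft f k K) auto
  also have "\<dots> \<le> K powr (t - 1) * (K * (LINT x|torus_measure. f x powr t))"
    using integral_kernel_avg_le[OF k ft] by (simp add: mult_left_mono)
  also have "\<dots> = K powr t * (LINT x|torus_measure. f x powr t)"
    using powr_mult_base[of K "t - 1"] K by (simp add: mult_ac)
  finally show ?thesis .
qed

lemma sym_kernel_exp:
  assumes l: "l > 0"
  shows "sym_kernel (24 ^ CARD('d)) (exp_kernel l :: real^'d::finite \<Rightarrow> _)"
proof -
  have le: "exp_kernel l x y \<le> l ^ CARD('d)" for x y :: "real^'d"
    using l by (simp add: exp_kernel_def mult_left_le)
  have "(LINT y|torus_measure. exp_kernel l x y) \<le> 24 ^ CARD('d)" for x :: "real^'d"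
  proof -
    have "integrable torus_measure (exp_kernel l x)"
      by (rule integrable_torus_bounded[where B = "l ^ CARD('d)"]) (use l le in auto)
    then have "ennreal (LINT y|torus_measure. exp_kernel l x y) \<le> ennreal (24 ^ CARD('d))"
      using exp_kernel_integral[OF l, of x] l by (subst nn_integral_eq_integral[symmetric]) auto
    then show ?thesis by (simp add: ennreal_le_iff)
  qed
  then show ?thesis using l le unfolding sym_kernel_def
    by (auto simp: split_beta exp_kernel_commute)
qed

lemma sym_kernel_poly:
  assumes m: "m > real CARD('d::finite)"
  obtains K where "K > 0" "\<And>l. l > 0 \<Longrightarrow> sym_kernel K (poly_kernel l m :: real^'d \<Rightarrow> _)"
proof -
  obtain K where K: "K > 0" "\<And>l x::real^'d. l > 0 \<Longrightarrow> (\<integral>\<^sup>+y. ennreal (poly_kernel l m x y) \<partial>torus_measure) \<le> ennreal K"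
    using poly_kernel_integral[OF m] by blast
  have "sym_kernel K (poly_kernel l m :: real^'d \<Rightarrow> _)" if l: "l > 0" for l
  proof -
    have le: "poly_kernel l m x y \<le> l ^ CARD('d)" for x y :: "real^'d"
    proof -
      have "(1 + l * torus_dist x y) powr (- m) \<le> 1 powr (- m)"
        by (rule powr_mono2') (use l m in auto)
      then show ?thesis using l by (simp add: poly_kernel_def mult_left_le)
    qed
    have "(LINT y|torus_measure. poly_kernel l m x y) \<le> K" for x :: "real^'d"
    proof -
      have "integrable torus_measure (poly_kernel l m x)"
        by (rule integrable_torus_bounded[where B = "l ^ CARD('d)"]) (use l le in auto)
      then have "ennreal (LINT y|torus_measure. poly_kernel l m x y) \<le> ennreal K"
        using K(2)[OF l, of x] l by (subst nn_integral_eq_integral[symmetric]) auto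
      then show ?thesis using K by (simp add: ennreal_le_iff)
    qed
    then show ?thesis using l le unfolding sym_kernel_def
      by (auto simp: split_beta poly_kernel_commute)
  qed
  with K(1) show ?thesis by (rule that)
qed

lemma sum_lessThan_split_window:
  fixes F :: "nat \<Rightarrow> real"
  shows "(\<Sum>j<Suc k. F j) = (\<Sum>j<Suc k - L. F j) + (\<Sum>i<L. if i \<le> k then F (k - i) else 0)"
proof (induction L)
  case (Suc L)
  show ?case
  proof (cases "L \<le> k")
    case True
    then have "Suc k - L = Suc (Suc k - Suc L)" by simp
    then have "(\<Sum>j<Suc k - L. F j) = (\<Sum>j<Suc k - Suc L. F j) + F (k - L)"
      by (simp only: sum.lessThan_Suc) simp
    then show ?thesis using Suc True by simp
  qed (use Suc in simp)
qed simp

lemma sum_window_le: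
  fixes f :: "nat \<Rightarrow> real"
  assumes f: "\<And>k. 0 \<le> f k"
  shows "(\<Sum>k<n. \<Sum>i<L. if i \<le> k then f (k - i) else 0) \<le> real L * (\<Sum>k<n. f k)"
proof -
  have "(\<Sum>k<n. if i \<le> k then f (k - i) else 0) \<le> (\<Sum>k<n. f k)" for i
  proof -
    have "(\<Sum>k<n. if i \<le> k then f (k - i) else 0) = (\<Sum>k\<in>{i..<n}. f (k - i))"
      by (rule sum.mono_neutral_cong_right) auto
    also have "\<dots> = (\<Sum>j<n - i. f j)"
      by (rule sum.reindex_bij_witness[of _ "\<lambda>j. j + i" "\<lambda>k. k - i"]) auto
    also have "\<dots> \<le> (\<Sum>k<n. f k)" by (rule sum_mono2) (use f in auto)
    finally show ?thesis .
  qed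
  then have "(\<Sum>i<L. \<Sum>k<n. if i \<le> k then f (k - i) else 0) \<le> (\<Sum>i<L. \<Sum>k<n. f k)"
    by (rule sum_mono)
  then show ?thesis by (subst sum.swap) simp
qed

lemma absorb_powr:
  fixes V S t e :: real
  assumes "V \<ge> 0" "S \<ge> 0" "t \<ge> 1" "e > 0"
  shows "V * S powr (t - 1) \<le> e * S powr t + e powr (1 - t) * V powr t"
proof -
  have eq: "a powr t = a * a powr (t - 1)" if "a \<ge> 0" for a :: real
    using that powr_mult_base[of a "t - 1"] by (cases "a = 0") auto
  show ?thesis
  proof (cases "V \<le> e * S")
    case True
    then have "V * S powr (t - 1) \<le> (e * S) * S powr (t - 1)" by (intro mult_right_mono) auto
    also have "\<dots> = e * S powr t" by (simp add: eq[OF assms(2)])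
    finally show ?thesis by (rule order_trans) (use assms in simp)
  next
    case False
    then have "S \<le> V / e" using assms by (simp add: pos_le_divide_eq mult.commute)
    then have "S powr (t - 1) \<le> (V / e) powr (t - 1)" using assms by (intro powr_mono2) auto
    also have "\<dots> = e powr (1 - t) * V powr (t - 1)"
      using assms by (simp add: powr_divide powr_diff divide_simps)
    finally have "V * S powr (t - 1) \<le> e powr (1 - t) * V powr t"
      using mult_left_mono[of "S powr (t - 1)" "e powr (1 - t) * V powr (t - 1)" V] assms
      by (simp add: eq[OF assms(1)] mult_ac)
    then show ?thesis by (rule order_trans) (use assms in simp)
  qed
qed

lemma bounded_meas_cmult: "c \<ge> 0 \<Longrightarrow> bounded_meas f \<Longrightarrow> bounded_meas (\<lambda>x. c * f x)"
  by (intro bounded_meas_mult bounded_meas_const)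

lemma bounded_meas_if: "bounded_meas f \<Longrightarrow> bounded_meas (\<lambda>x. if P then f x else 0)"
  by (cases P) (auto intro: bounded_meas_const)

text \<open>
  A sum of averages at scales above \<open>l\<close> varies slowly, hence is dominated by its value at the
  centre when it is averaged with the kernel of scale \<open>l\<close>.
\<close>

lemma exp_average_slow:
  fixes G :: "nat \<Rightarrow> real^'d::finite \<Rightarrow> real"
  assumes l: "l > 0" and G: "\<And>j. j < A \<Longrightarrow> bounded_meas (G j)"
    and s: "s \<ge> 0" and lj: "\<And>j. j < A \<Longrightarrow> 0 < lam j \<and> s * lam j \<le> l / 2"
  shows "kernel_avg (exp_kernel l) (\<lambda>x. (\<Sum>j<A. kernel_avg (exp_kernel (lam j)) (G j) x) powr s) y
    \<le> 2 ^ CARD('d) * 24 ^ CARD('d) * (\<Sum>j<A. kernel_avg (exp_kernel (lam j)) (G j) y) powr s"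
proof -
  define S where "S = (\<lambda>x. \<Sum>j<A. kernel_avg (exp_kernel (lam j)) (G j) x)"
  have bS: "bounded_meas S" unfolding S_def
    by (intro bounded_meas_sum bounded_meas_kernel_avg[OF sym_kernel_exp] G) (use lj in auto)
  have S0: "0 \<le> S x" for x using bounded_measD(2)[OF bS] .
  have slow: "S x powr s \<le> exp (l / 2 * torus_dist y x) * S y powr s" for x
  proof (cases "s = 0")
    case True
    show ?thesis
    proof (cases "S y = 0")
      case False
      then show ?thesis using True l by (auto simp: mult_nonneg_nonneg intro: order_trans[OF _ one_le_exp_iff[THEN iffD2]])
    next
      case 0: True
      have "S x \<le> 0"
      proof -
        have "kernel_avg (exp_kernel (lam j)) (G j) x \<le> exp (lam j * torus_dist y x) * kernel_avg (exp_kernel (lam j)) (G j) y"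
          if "j < A" for j
        proof -
          have "kernel_avg (exp_kernel (lam j)) (G j) x \<le> (LINT z|torus_measure. exp (lam j * torus_dist y x) * (exp_kernel (lam j) y z * G j z))"
            unfolding kernel_avg_def
          proof (intro torus_integral_mono bounded_meas_intros sym_kernel_bounded_meas[OF sym_kernel_exp])
            show "exp_kernel (lam j) x z * G j z \<le> exp (lam j * torus_dist y x) * (exp_kernel (lam j) y z * G j z)" for z
              using mult_right_mono[OF exp_kernel_shift[of "lam j" "lam j" x z y] bounded_measD(2)[OF G[OF that], of z]] lj[OF that]
              by (simp add: mult.assoc)
          qed (use lj[OF that] G[OF that] in auto)
          then show ?thesis by (simp add: kernel_avg_def)
        qed
        moreover have "kernel_avg (exp_kernel (lam j)) (G j) y = 0" if "j < A" for j
        proof -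
          have "\<And>j. j < A \<Longrightarrow> 0 \<le> kernel_avg (exp_kernel (lam j)) (G j) y"
            using bounded_measD(2)[OF bounded_meas_kernel_avg[OF sym_kernel_exp G]] lj by blast
          then show ?thesis using 0 that unfolding S_def by (subst (asm) sum_nonneg_eq_0_iff) auto
        qed
        ultimately have "kernel_avg (exp_kernel (lam j)) (G j) x \<le> 0" if "j < A" for j
          using that by (metis mult_zero_right)
        then show ?thesis unfolding S_def by (intro sum_nonpos) auto
      qed
      then show ?thesis using S0[of x] True 0 by simp
    qed
  next
    case False
    then have s0: "s > 0" using s by simp
    have "kernel_avg (exp_kernel (lam j)) (G j) x \<le> exp (l / (2 * s) * torus_dist y x) * kernel_avg (exp_kernel (lam j)) (G j) y"
      if "j < A" for j
    proof -
      have lj': "lam j \<le> l / (2 * s)" using lj[OF that] s0 by (simp add: field_simps)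
      have "kernel_avg (exp_kernel (lam j)) (G j) x \<le> (LINT z|torus_measure. exp (l / (2 * s) * torus_dist y x) * (exp_kernel (lam j) y z * G j z))"
        unfolding kernel_avg_def
      proof (intro torus_integral_mono bounded_meas_intros sym_kernel_bounded_meas[OF sym_kernel_exp])
        show "exp_kernel (lam j) x z * G j z \<le> exp (l / (2 * s) * torus_dist y x) * (exp_kernel (lam j) y z * G j z)" for z
          using mult_right_mono[OF exp_kernel_shift[of "lam j" "l / (2 * s)" x z y] bounded_measD(2)[OF G[OF that], of z]] lj[OF that] lj'
          by (simp add: mult.assoc)
      qed (use lj[OF that] G[OF that] in auto)
      then show ?thesis by (simp add: kernel_avg_def)
    qed
    then have "S x \<le> exp (l / (2 * s) * torus_dist y x) * S y"
      unfolding S_def sum_distrib_left by (intro sum_mono) auto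
    then have "S x powr s \<le> (exp (l / (2 * s) * torus_dist y x) * S y) powr s"
      using S0 s by (intro powr_mono2) auto
    also have "\<dots> = exp (l / 2 * torus_dist y x) * S y powr s"
      using s0 S0[of y] by (simp add: powr_mult exp_powr_real)
    finally show ?thesis .
  qed
  have "kernel_avg (exp_kernel l) (\<lambda>x. S x powr s) y \<le> (LINT x|torus_measure. 2 ^ CARD('d) * S y powr s * exp_kernel (l / 2) y x)"
    unfolding kernel_avg_def
  proof (intro torus_integral_mono bounded_meas_intros sym_kernel_bounded_meas[OF sym_kernel_exp] bS s)
    show "exp_kernel l y x * S x powr s \<le> 2 ^ CARD('d) * S y powr s * exp_kernel (l / 2) y x" for x
    proof -
      have "exp_kernel l y x * S x powr s \<le> exp_kernel l y x * (exp (l / 2 * torus_dist y x) * S y powr s)"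
        by (intro mult_left_mono slow) (use l in auto)
      also have "exp_kernel l y x * exp (l / 2 * torus_dist y x) = 2 ^ CARD('d) * exp_kernel (l / 2) y x"
        by (simp add: exp_kernel_def power_divide mult.assoc exp_add[symmetric])
      then have "exp_kernel l y x * (exp (l / 2 * torus_dist y x) * S y powr s) = 2 ^ CARD('d) * S y powr s * exp_kernel (l / 2) y x"
        by (metis mult.assoc mult.commute)
      finally show ?thesis .
    qed
  qed (use l in auto)
  also have "\<dots> = 2 ^ CARD('d) * S y powr s * (LINT x|torus_measure. exp_kernel (l / 2) y x)" by simp
  also have "\<dots> \<le> 2 ^ CARD('d) * S y powr s * 24 ^ CARD('d)"
    by (intro mult_left_mono sym_kernelD(5)[OF sym_kernel_exp]) (use l in auto)
  finally show ?thesis by (simp add: S_def mult_ac)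
qed

text \<open>
  Telescoping \<open>S\<^sup>t\<close> over the partial sums \<open>S\<^sub>k\<close> of the averages leaves terms
  \<open>F\<^sub>k S\<^sub>k\<^sup>t\<^sup>-\<^sup>1\<close>, where \<open>F\<^sub>k\<close> is an average at scale \<open>k\<close>. The symmetric kernel is moved from
  \<open>F\<^sub>k\<close> to the other factor, which after omission of the \<open>L\<close> finest scales is so slowly varying that
  averaging changes it only by a constant; the remaining \<open>S\<^sup>t\<^sup>-\<^sup>1\<close> is absorbed by Young's inequality.
\<close>

theorem exp_average_Lp:
  fixes t :: real
  assumes t: "t \<ge> 1"
  obtains C where "C > 0" "\<And>l0 n (G :: nat \<Rightarrow> real^'d::finite \<Rightarrow> real). l0 > 0 \<Longrightarrow>
    (\<And>k. k < n \<Longrightarrow> bounded_meas (G k)) \<Longrightarrow>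
    (LINT x|torus_measure. (\<Sum>k<n. kernel_avg (exp_kernel (l0 * 2 ^ k)) (G k) x) powr t)
      \<le> C * (LINT x|torus_measure. (\<Sum>k<n. G k x) powr t)"
proof -
  obtain L :: nat where L: "2 * (t - 1) \<le> 2 ^ L"
    using real_arch_pow[of 2 "2 * (t - 1)"] by (auto intro: less_imp_le)
  let ?d = "CARD('d)"
  define K :: real where "K = 24 ^ ?d"
  define K' :: real where "K' = 2 ^ ?d * 24 ^ ?d"
  define C1 :: real where "C1 = real (Suc L) powr (t - 1)"
  define e where "e = 1 / (2 * t * C1 * K')"
  define C where "C = 2 * t * C1 * (K' * e powr (1 - t) + 2 * real L * K powr t)"
  have K: "K > 0" "K' > 0" "C1 > 0" by (simp_all add: K_def K'_def C1_def)
  have e: "e > 0" using K t by (simp add: e_def)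
  have C: "C > 0" using K t e by (simp add: C_def add_pos_nonneg)
  have main: "(LINT x|torus_measure. (\<Sum>k<n. kernel_avg (exp_kernel (l0 * 2 ^ k)) (G k) x) powr t)
      \<le> C * (LINT x|torus_measure. (\<Sum>k<n. G k x) powr t)"
    if l0: "l0 > 0" and G0: "\<And>k. k < n \<Longrightarrow> bounded_meas (G k)" for l0 n and G :: "nat \<Rightarrow> real^'d \<Rightarrow> real"
  proof -
    let ?I = "\<lambda>f. LINT x|(torus_measure :: (real^'d) measure). f x"
    define E where "E = (\<lambda>k. exp_kernel (l0 * 2 ^ k) :: real^'d \<Rightarrow> real^'d \<Rightarrow> real)"
    define H where "H = (\<lambda>k. if k < n then G k else (\<lambda>x. 0))"
    have H: "bounded_meas (H k)" for k using G0 by (simp add: H_def bounded_meas_const)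
    have kE: "sym_kernel K (E k)" for k unfolding E_def K_def by (rule sym_kernel_exp) (use l0 in simp)
    define F where "F = (\<lambda>k. kernel_avg (E k) (H k))"
    have F: "bounded_meas (F k)" for k unfolding F_def by (rule bounded_meas_kernel_avg[OF kE H])
    have F0: "0 \<le> F k x" for k x using bounded_measD(2)[OF F] .
    define S where "S = (\<lambda>m x. \<Sum>k<m. F k x)"
    have S: "bounded_meas (S m)" for m unfolding S_def by (intro bounded_meas_sum F)
    have S0: "0 \<le> S m x" for m x using bounded_measD(2)[OF S] .
    have Smono: "S m x \<le> S m' x" if "m \<le> m'" for m m' x
      unfolding S_def by (rule sum_mono2) (use that F0 in auto)
    define V where "V = (\<lambda>x. \<Sum>k<n. H k x)"
    have V: "bounded_meas V" unfolding V_def by (intro bounded_meas_sum H)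
    have V0: "0 \<le> V x" for x using bounded_measD(2)[OF V] .
    have t1: "t - 1 \<ge> 0" "t \<ge> 0" using t by auto
    let ?W = "\<lambda>k x. \<Sum>i<L. if i \<le> k then F k x powr t + F (k - i) x powr t else 0"
    have pt: "S n x powr t \<le> t * C1 * (\<Sum>k<n. F k x * S (Suc k - L) x powr (t - 1) + ?W k x)" for x
    proof -
      have "S n x powr t = (\<Sum>k<n. S (Suc k) x powr t - S k x powr t)"
        by (subst sum_lessThan_telescope) (simp add: S_def)
      also have "\<dots> \<le> (\<Sum>k<n. t * C1 * (F k x * S (Suc k - L) x powr (t - 1) + ?W k x))"
      proof (rule sum_mono)
        fix k
        let ?y = "\<lambda>i. if i = L then S (Suc k - L) x else if i \<le> k then F (k - i) x else 0"
        have "S (Suc k) x = (\<Sum>i\<in>insert L {..<L}. ?y i)"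
          unfolding S_def by (subst sum_lessThan_split_window[of _ _ L], subst sum.insert) (auto intro!: sum.cong)
        then have "S (Suc k) x powr (t - 1) \<le> C1 * (\<Sum>i\<in>insert L {..<L}. ?y i powr (t - 1))"
          using sum_powr_le[of "insert L {..<L}" ?y "t - 1"] S0 F0 t by (simp add: C1_def)
        also have "(\<Sum>i\<in>insert L {..<L}. ?y i powr (t - 1)) = S (Suc k - L) x powr (t - 1) + (\<Sum>i<L. if i \<le> k then F (k - i) x powr (t - 1) else 0)"
          by (subst sum.insert) (auto intro!: sum.cong)
        finally have 1: "S (Suc k) x powr (t - 1) \<le> C1 * (S (Suc k - L) x powr (t - 1) + (\<Sum>i<L. if i \<le> k then F (k - i) x powr (t - 1) else 0))" .
        have ab: "a * b powr (t - 1) \<le> a powr t + b powr t" if "0 \<le> a" "0 \<le> b" for a b :: real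
          using absorb_powr[of a b t 1] that t by simp
        have "S (Suc k) x powr t - S k x powr t \<le> t * F k x * S (Suc k) x powr (t - 1)"
          using powr_diff_le[of "S k x" "S (Suc k) x" t] S0 Smono[of k "Suc k" x] t by (simp add: S_def)
        also have "\<dots> \<le> t * F k x * (C1 * (S (Suc k - L) x powr (t - 1) + (\<Sum>i<L. if i \<le> k then F (k - i) x powr (t - 1) else 0)))"
          by (rule mult_left_mono[OF 1]) (use t F0 in auto)
        also have "\<dots> = t * C1 * (F k x * S (Suc k - L) x powr (t - 1) + (\<Sum>i<L. if i \<le> k then F k x * F (k - i) x powr (t - 1) else 0))"
          by (simp add: algebra_simps sum_distrib_left if_distrib cong: if_cong)
        also have "\<dots> \<le> t * C1 * (F k x * S (Suc k - L) x powr (t - 1) + ?W k x)"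
          using t K F0 ab by (intro mult_left_mono add_left_mono sum_mono) auto
        finally show "S (Suc k) x powr t - S k x powr t \<le> t * C1 * (F k x * S (Suc k - L) x powr (t - 1) + ?W k x)" .
      qed
      finally show ?thesis by (simp add: sum_distrib_left)
    qed
    have b1: "bounded_meas (\<lambda>x. F k x * S m x powr (t - 1))" for k m
      using t1 by (intro bounded_meas_intros F S)
    have b2: "bounded_meas (\<lambda>x. if i \<le> k then F k x powr t + F j x powr t else 0)" for i k j
      using t1 by (intro bounded_meas_if bounded_meas_intros F)
    have part1: "?I (\<lambda>x. F k x * S (Suc k - L) x powr (t - 1)) \<le> K' * ?I (\<lambda>x. H k x * S n x powr (t - 1))" if k: "k < n" for k
    proof -
      have "?I (\<lambda>x. F k x * S (Suc k - L) x powr (t - 1)) = ?I (\<lambda>x. H k x * kernel_avg (E k) (\<lambda>x. S (Suc k - L) x powr (t - 1)) x)"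
        unfolding F_def by (rule kernel_avg_swap[OF kE H]) (use t1 S in \<open>auto intro: bounded_meas_intros\<close>)
      also have "\<dots> \<le> ?I (\<lambda>x. K' * (H k x * S n x powr (t - 1)))"
      proof (intro torus_integral_mono bounded_meas_intros H bounded_meas_kernel_avg[OF kE] S t1)
        fix x
        have "kernel_avg (E k) (\<lambda>x. S (Suc k - L) x powr (t - 1)) x \<le> K' * S (Suc k - L) x powr (t - 1)"
          unfolding S_def F_def E_def K'_def
        proof (rule exp_average_slow)
          fix j assume "j < Suc k - L"
          then have jk: "j + L \<le> k" by simp
          have "2 * (t - 1) * 2 ^ j \<le> 2 ^ L * 2 ^ j" using L by (rule mult_right_mono) simp
          also have "\<dots> \<le> 2 ^ k" using jk by (simp add: power_add[symmetric] add.commute)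
          finally have "(t - 1) * 2 ^ j \<le> 2 ^ k / 2" by linarith
          from mult_left_mono[OF this, of l0]
          show "0 < l0 * 2 ^ j \<and> (t - 1) * (l0 * 2 ^ j) \<le> l0 * 2 ^ k / 2" using l0
            by (simp only: mult_ac times_divide_eq_right) simp
        qed (use H l0 t1 in auto)
        also have "\<dots> \<le> K' * S n x powr (t - 1)"
          using K S0 t1 k by (intro mult_left_mono powr_mono2 Smono) auto
        finally have "kernel_avg (E k) (\<lambda>x. S (Suc k - L) x powr (t - 1)) x \<le> K' * S n x powr (t - 1)" .
        from mult_left_mono[OF this bounded_measD(2)[OF H]]
        show "H k x * kernel_avg (E k) (\<lambda>x. S (Suc k - L) x powr (t - 1)) x \<le> K' * (H k x * S n x powr (t - 1))"
          by (simp add: mult_ac)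
      qed (use K in auto)
      finally show ?thesis by simp
    qed
    have part2: "(\<Sum>k<n. ?I (?W k)) \<le> 2 * real L * K powr t * ?I (\<lambda>x. V x powr t)"
    proof -
      define f where "f = (\<lambda>k. ?I (\<lambda>x. F k x powr t))"
      have f0: "0 \<le> f k" for k unfolding f_def by (intro torus_integral_nonneg bounded_meas_powr F t1)
      have int: "integrable torus_measure (\<lambda>x. F k x powr t)" for k
        by (intro bounded_meas_integrable bounded_meas_powr F t1)
      have "?I (?W k) = (\<Sum>i<L. if i \<le> k then f k + f (k - i) else 0)" for k
        by (subst torus_integral_sum[OF b2]) (auto intro!: sum.cong simp: f_def int)
      then have "(\<Sum>k<n. ?I (?W k)) = (\<Sum>k<n. \<Sum>i<L. (if i \<le> k then f k else 0) + (if i \<le> k then f (k - i) else 0))"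
        by (auto intro!: sum.cong)
      also have "\<dots> \<le> (\<Sum>k<n. real L * f k + (\<Sum>i<L. if i \<le> k then f (k - i) else 0))"
      proof (rule sum_mono)
        fix k
        have "(\<Sum>i<L. if i \<le> k then f k else 0) \<le> (\<Sum>i<L. f k)" using f0 by (intro sum_mono) auto
        then show "(\<Sum>i<L. (if i \<le> k then f k else 0) + (if i \<le> k then f (k - i) else 0)) \<le> real L * f k + (\<Sum>i<L. if i \<le> k then f (k - i) else 0)"
          by (simp add: sum.distrib)
      qed
      also have "\<dots> \<le> real L * (\<Sum>k<n. f k) + real L * (\<Sum>k<n. f k)"
        unfolding sum.distrib sum_distrib_left[symmetric]
        by (intro add_left_mono sum_window_le f0)
      also have "\<dots> = 2 * real L * (\<Sum>k<n. f k)" by simp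
      also have "\<dots> \<le> 2 * real L * (\<Sum>k<n. K powr t * ?I (\<lambda>x. H k x powr t))"
        unfolding f_def F_def using K t by (intro mult_left_mono sum_mono integral_kernel_avg_powr_le kE H) auto
      also have "(\<Sum>k<n. K powr t * ?I (\<lambda>x. H k x powr t)) = K powr t * ?I (\<lambda>x. \<Sum>k<n. H k x powr t)"
        by (subst torus_integral_sum) (auto intro!: bounded_meas_powr H t1 simp: sum_distrib_left)
      also have "2 * real L * (K powr t * ?I (\<lambda>x. \<Sum>k<n. H k x powr t)) \<le> 2 * real L * (K powr t * ?I (\<lambda>x. V x powr t))"
        unfolding V_def using t1 t bounded_measD(2)[OF H]
        by (intro mult_left_mono torus_integral_mono bounded_meas_intros H sum_of_powr_le_powr_sum) auto
      finally show ?thesis by (simp add: mult_ac)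
    qed
    have IV0: "0 \<le> ?I (\<lambda>x. V x powr t)" by (intro torus_integral_nonneg bounded_meas_powr V t1)
    have IS0: "0 \<le> ?I (\<lambda>x. S n x powr t)" by (intro torus_integral_nonneg bounded_meas_powr S t1)
    have bW: "bounded_meas (?W k)" for k by (intro bounded_meas_sum b2)
    have "?I (\<lambda>x. S n x powr t) \<le> ?I (\<lambda>x. t * C1 * (\<Sum>k<n. F k x * S (Suc k - L) x powr (t - 1) + ?W k x))"
      by (intro torus_integral_mono pt bounded_meas_cmult bounded_meas_sum bounded_meas_add b1 bW bounded_meas_powr S t1)
         (use t K in auto)
    also have "\<dots> = t * C1 * (\<Sum>k<n. ?I (\<lambda>x. F k x * S (Suc k - L) x powr (t - 1)) + ?I (?W k))"
      using bounded_meas_integrable[OF b1] bounded_meas_integrable[OF bW]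
      by (subst integral_mult_right_zero, subst torus_integral_sum) (auto intro!: bounded_meas_add b1 bW)
    also have "\<dots> \<le> t * C1 * (K' * ?I (\<lambda>x. V x * S n x powr (t - 1)) + 2 * real L * K powr t * ?I (\<lambda>x. V x powr t))"
    proof (rule mult_left_mono)
      have "(\<Sum>k<n. ?I (\<lambda>x. F k x * S (Suc k - L) x powr (t - 1))) \<le> (\<Sum>k<n. K' * ?I (\<lambda>x. H k x * S n x powr (t - 1)))"
        by (rule sum_mono) (simp add: part1)
      also have "\<dots> = K' * ?I (\<lambda>x. \<Sum>k<n. H k x * S n x powr (t - 1))"
        by (subst torus_integral_sum) (auto intro!: bounded_meas_intros H S t1 simp: sum_distrib_left)
      also have "\<dots> = K' * ?I (\<lambda>x. V x * S n x powr (t - 1))" by (simp add: V_def sum_distrib_right)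
      finally show "(\<Sum>k<n. ?I (\<lambda>x. F k x * S (Suc k - L) x powr (t - 1)) + ?I (?W k)) \<le>
        K' * ?I (\<lambda>x. V x * S n x powr (t - 1)) + 2 * real L * K powr t * ?I (\<lambda>x. V x powr t)"
        using part2 by (simp add: sum.distrib)
    qed (use t K in auto)
    also have "?I (\<lambda>x. V x * S n x powr (t - 1)) \<le> ?I (\<lambda>x. e * S n x powr t + e powr (1 - t) * V x powr t)"
      using e t by (intro torus_integral_mono bounded_meas_intros V S t1 absorb_powr V0 S0) auto
    also have "\<dots> = e * ?I (\<lambda>x. S n x powr t) + e powr (1 - t) * ?I (\<lambda>x. V x powr t)"
      by (subst Bochner_Integration.integral_add) (auto intro!: bounded_meas_integrable bounded_meas_intros V S t1 simp: e less_imp_le)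
    finally have fin: "?I (\<lambda>x. S n x powr t) \<le> t * C1 * (K' * (e * ?I (\<lambda>x. S n x powr t) + e powr (1 - t) * ?I (\<lambda>x. V x powr t)) + 2 * real L * K powr t * ?I (\<lambda>x. V x powr t))"
      using t K by (simp add: mult_left_mono)
    have te: "t * C1 * (K' * e) = 1 / 2" using t K by (simp add: e_def)
    have "?I (\<lambda>x. S n x powr t) \<le> (t * C1 * (K' * e)) * ?I (\<lambda>x. S n x powr t) + C / 2 * ?I (\<lambda>x. V x powr t)"
    proof -
      have C2: "C / 2 = t * C1 * (K' * e powr (1 - t) + 2 * real L * K powr t)" by (simp add: C_def)
      show ?thesis using fin unfolding C2 by (simp add: algebra_simps)
    qed
    then have "?I (\<lambda>x. S n x powr t) \<le> C * ?I (\<lambda>x. V x powr t)" unfolding te by simp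
    moreover have "S n x = (\<Sum>k<n. kernel_avg (exp_kernel (l0 * 2 ^ k)) (G k) x)" for x
      by (simp add: S_def F_def E_def H_def)
    moreover have "V x = (\<Sum>k<n. G k x)" for x by (simp add: V_def H_def)
    ultimately show ?thesis by simp
  qed
  show thesis by (rule that[OF C main])
qed

text \<open>
  The polynomial kernel is a geometrically weighted sum of exponential kernels at coarser
  scales, and the constant of the exponential case does not depend on the base scale.
\<close>

theorem poly_average_Lp:
  fixes t m :: real
  assumes t: "t \<ge> 1" and m: "m > real CARD('d::finite)"
  obtains C where "C > 0" "\<And>n (G :: nat \<Rightarrow> real^'d \<Rightarrow> real).
    (\<And>k. k < n \<Longrightarrow> bounded_meas (G k)) \<Longrightarrow>
    (LINT x|torus_measure. (\<Sum>k<n. kernel_avg (poly_kernel (2 ^ k) m) (G k) x) powr t)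
      \<le> C * (LINT x|torus_measure. (\<Sum>k<n. G k x) powr t)"
proof -
  define \<delta> where "\<delta> = m - CARD('d)"
  have \<delta>: "\<delta> > 0" using m by (simp add: \<delta>_def)
  have m0: "m > 0" using m by linarith
  define c where "c = exp 1 * 2 powr m"
  have c: "c > 0" by (simp add: c_def)
  obtain C where C: "C > 0" "\<And>l0 n (G :: nat \<Rightarrow> real^'d \<Rightarrow> real). l0 > 0 \<Longrightarrow>
    (\<And>k. k < n \<Longrightarrow> bounded_meas (G k)) \<Longrightarrow>
    (LINT x|torus_measure. (\<Sum>k<n. kernel_avg (exp_kernel (l0 * 2 ^ k)) (G k) x) powr t)
      \<le> C * (LINT x|torus_measure. (\<Sum>k<n. G k x) powr t)"
    using exp_average_Lp[OF t, where 'd = 'd] by blast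
  obtain K where K: "K > 0" "\<And>n. (\<Sum>i\<le>n. 2 powr (- (\<delta> / 2) * real i)) \<le> K"
    using sum_powr_bounded[OF half_gt_zero[OF \<delta>]] by blast
  have "\<delta> * t / 2 > 0" using \<delta> t by simp
  then obtain K' where K': "K' > 0" "\<And>n. (\<Sum>i\<le>n. 2 powr (- (\<delta> * t / 2) * real i)) \<le> K'"
    using sum_powr_bounded by blast
  let ?I = "\<lambda>f. LINT x|(torus_measure :: (real^'d) measure). f x"
  have main: "?I (\<lambda>x. (\<Sum>k<n. kernel_avg (poly_kernel (2 ^ k) m) (G k) x) powr t)
      \<le> (c * K) powr t * (K' * C) * ?I (\<lambda>x. (\<Sum>k<n. G k x) powr t)"
    if G: "\<And>k. k < n \<Longrightarrow> bounded_meas (G k)" for n and G :: "nat \<Rightarrow> real^'d \<Rightarrow> real"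
  proof -
    obtain d' where d': "2 * real CARD('d) \<le> 2 ^ d'"
      using real_arch_pow[of 2 "2 * real CARD('d)"] by (auto intro: less_imp_le)
    define N where "N = n + d'"
    define X where "X = (\<lambda>i x. \<Sum>k<n. kernel_avg (exp_kernel (1 / 2 ^ i * 2 ^ k)) (G k) x)"
    have k_exp: "sym_kernel (24 ^ CARD('d)) (exp_kernel (1 / 2 ^ i * 2 ^ k) :: real^'d \<Rightarrow> _)" for i k :: nat
      by (rule sym_kernel_exp) simp
    have X: "bounded_meas (X i)" for i unfolding X_def
      by (intro bounded_meas_sum bounded_meas_kernel_avg[OF k_exp] G) auto
    have X0: "0 \<le> X i x" for i x using bounded_measD(2)[OF X] .
    obtain Kp where Kp: "\<And>l. l > 0 \<Longrightarrow> sym_kernel Kp (poly_kernel l m :: real^'d \<Rightarrow> _)"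
      using sym_kernel_poly[OF m] by blast
    have P: "bounded_meas (\<lambda>x. \<Sum>k<n. kernel_avg (poly_kernel (2 ^ k) m) (G k) x)"
      by (intro bounded_meas_sum bounded_meas_kernel_avg[OF Kp] G) auto
    have pt: "(\<Sum>k<n. kernel_avg (poly_kernel (2 ^ k) m) (G k) x) \<le> (\<Sum>i\<le>N. c * 2 powr (- \<delta> * real i) * X i x)" for x
    proof -
      have "kernel_avg (poly_kernel (2 ^ k) m) (G k) x \<le> (\<Sum>i\<le>N. c * 2 powr (- \<delta> * real i) * kernel_avg (exp_kernel (1 / 2 ^ i * 2 ^ k)) (G k) x)"
        if k: "k < n" for k
      proof -
        have bm: "bounded_meas (\<lambda>y. c * 2 powr (- \<delta> * real i) * (exp_kernel (1 / 2 ^ i * 2 ^ k) x y * G k y))" for i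
          using c by (intro bounded_meas_intros sym_kernel_bounded_meas[OF k_exp] G k) auto
        have "(2::real) ^ k * (2 * real CARD('d)) \<le> 2 ^ n * 2 ^ d'"
          by (intro mult_mono d' power_increasing) (use k in auto)
        then have N: "2 * 2 ^ k * real CARD('d) \<le> 2 ^ N" by (simp add: N_def power_add mult_ac)
        have "kernel_avg (poly_kernel (2 ^ k) m) (G k) x \<le>
          (LINT y|torus_measure. (\<Sum>i\<le>N. c * 2 powr (- \<delta> * real i) * (exp_kernel (1 / 2 ^ i * 2 ^ k) x y * G k y)))"
          unfolding kernel_avg_def
        proof (rule torus_integral_mono[OF bounded_meas_mult[OF sym_kernel_bounded_meas[OF Kp] G[OF k]] bounded_meas_sum[OF bm]])
          fix y
          have "poly_kernel (2 ^ k) m x y \<le> (\<Sum>i\<le>N. c * 2 powr (- \<delta> * real i) * exp_kernel (1 / 2 ^ i * 2 ^ k) x y)"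
            using poly_kernel_le_exp_kernels[OF _ m0 N, of x y] by (simp add: c_def \<delta>_def)
          from mult_right_mono[OF this bounded_measD(2)[OF G[OF k]]]
          show "poly_kernel (2 ^ k) m x y * G k y \<le> (\<Sum>i\<le>N. c * 2 powr (- \<delta> * real i) * (exp_kernel (1 / 2 ^ i * 2 ^ k) x y * G k y))"
            by (simp add: sum_distrib_right mult.assoc)
        qed auto
        also have "\<dots> = (\<Sum>i\<le>N. c * 2 powr (- \<delta> * real i) * kernel_avg (exp_kernel (1 / 2 ^ i * 2 ^ k)) (G k) x)"
          by (subst torus_integral_sum[OF bm]) (auto simp: kernel_avg_def)
        finally show ?thesis .
      qed
      then have "(\<Sum>k<n. kernel_avg (poly_kernel (2 ^ k) m) (G k) x) \<le>
          (\<Sum>k<n. \<Sum>i\<le>N. c * 2 powr (- \<delta> * real i) * kernel_avg (exp_kernel (1 / 2 ^ i * 2 ^ k)) (G k) x)"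
        by (intro sum_mono) auto
      also have "\<dots> = (\<Sum>i\<le>N. c * 2 powr (- \<delta> * real i) * X i x)"
        by (subst sum.swap) (simp add: X_def sum_distrib_left)
      finally show ?thesis .
    qed
    have pt2: "(\<Sum>k<n. kernel_avg (poly_kernel (2 ^ k) m) (G k) x) powr t \<le>
        (c * K) powr t * (\<Sum>i\<le>N. 2 powr (- (\<delta> * t / 2) * real i) * X i x powr t)" for x
    proof -
      define M where "M = Max ((\<lambda>i. 2 powr (- (\<delta> / 2) * real i) * X i x) ` {..N})"
      have "M \<in> (\<lambda>i. 2 powr (- (\<delta> / 2) * real i) * X i x) ` {..N}" unfolding M_def by (rule Max_in) auto
      then obtain k where k: "k \<le> N" "M = 2 powr (- (\<delta> / 2) * real k) * X k x" by auto
      have M: "2 powr (- (\<delta> / 2) * real i) * X i x \<le> M" if "i \<le> N" for i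
        unfolding M_def by (rule Max_ge) (use that in auto)
      have M0: "0 \<le> M" using k X0 by simp
      have "(\<Sum>i\<le>N. c * 2 powr (- \<delta> * real i) * X i x) \<le> (\<Sum>i\<le>N. c * (2 powr (- (\<delta> / 2) * real i) * M))"
      proof (rule sum_mono)
        fix i assume "i \<in> {..N}"
        then have le: "2 powr (- (\<delta> / 2) * real i) * X i x \<le> M" by (intro M) auto
        have "2 powr (- \<delta> * real i) = 2 powr (- (\<delta> / 2) * real i) * 2 powr (- (\<delta> / 2) * real i)"
          by (simp add: powr_add[symmetric])
        then have "c * 2 powr (- \<delta> * real i) * X i x
            = c * (2 powr (- (\<delta> / 2) * real i) * (2 powr (- (\<delta> / 2) * real i) * X i x))"
          by (simp only: mult.assoc)
        also have "\<dots> \<le> c * (2 powr (- (\<delta> / 2) * real i) * M)"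
          by (intro mult_left_mono le) (use c in auto)
        finally show "c * 2 powr (- \<delta> * real i) * X i x \<le> c * (2 powr (- (\<delta> / 2) * real i) * M)" .
      qed
      also have "\<dots> = c * M * (\<Sum>i\<le>N. 2 powr (- (\<delta> / 2) * real i))" by (simp add: sum_distrib_left mult_ac)
      also have "\<dots> \<le> c * M * K" by (intro mult_left_mono K) (use c M0 in auto)
      finally have "(\<Sum>k<n. kernel_avg (poly_kernel (2 ^ k) m) (G k) x) \<le> (c * K) * M"
        using pt[of x] by (simp add: mult_ac)
      then have "(\<Sum>k<n. kernel_avg (poly_kernel (2 ^ k) m) (G k) x) powr t \<le> ((c * K) * M) powr t"
        using t bounded_measD(2)[OF P] by (intro powr_mono2) auto
      also have "\<dots> = (c * K) powr t * (2 powr (- (\<delta> * t / 2) * real k) * X k x powr t)"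
        using c K M0 X0[of k x] by (simp add: k(2) powr_mult powr_powr mult_ac)
      also have "\<dots> \<le> (c * K) powr t * (\<Sum>i\<le>N. 2 powr (- (\<delta> * t / 2) * real i) * X i x powr t)"
        using k(1) by (intro mult_left_mono member_le_sum) auto
      finally show ?thesis .
    qed
    have bXt: "bounded_meas (\<lambda>x. 2 powr (- (\<delta> * t / 2) * real i) * X i x powr t)" for i
      by (intro bounded_meas_intros X) (use t in auto)
    have IG: "0 \<le> ?I (\<lambda>x. (\<Sum>k<n. G k x) powr t)"
      by (intro torus_integral_nonneg bounded_meas_powr bounded_meas_sum G) (use t in auto)
    have "?I (\<lambda>x. (\<Sum>k<n. kernel_avg (poly_kernel (2 ^ k) m) (G k) x) powr t) \<le>
      ?I (\<lambda>x. (c * K) powr t * (\<Sum>i\<le>N. 2 powr (- (\<delta> * t / 2) * real i) * X i x powr t))"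
      using t by (intro torus_integral_mono pt2 bounded_meas_cmult bounded_meas_sum bXt bounded_meas_powr[OF P]) auto
    also have "\<dots> = (c * K) powr t * (\<Sum>i\<le>N. 2 powr (- (\<delta> * t / 2) * real i) * ?I (\<lambda>x. X i x powr t))"
      by (subst integral_mult_right_zero, subst torus_integral_sum[OF bXt]) simp
    also have "\<dots> \<le> (c * K) powr t * (\<Sum>i\<le>N. 2 powr (- (\<delta> * t / 2) * real i) * (C * ?I (\<lambda>x. (\<Sum>k<n. G k x) powr t)))"
      unfolding X_def by (intro mult_left_mono sum_mono C(2) G) auto
    also have "\<dots> = (c * K) powr t * (C * ?I (\<lambda>x. (\<Sum>k<n. G k x) powr t) * (\<Sum>i\<le>N. 2 powr (- (\<delta> * t / 2) * real i)))"
      by (simp add: sum_distrib_left mult_ac)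
    also have "\<dots> \<le> (c * K) powr t * (C * ?I (\<lambda>x. (\<Sum>k<n. G k x) powr t) * K')"
      using C IG by (intro mult_left_mono K'(2)) auto
    finally show ?thesis by (simp add: mult_ac)
  qed
  show thesis
  proof (rule that[OF _ main])
    show "0 < (c * K) powr t * (K' * C)" using c K K' C by simp
  qed
qed

text \<open>
  The maximum is linearised by the functions \<open>H\<^sub>k\<close>, equal to it where the \<open>k\<close>-th average is the first
  to attain it. The square then pairs \<open>V\<close> with a sum of averages of the \<open>H\<^sub>k\<close>, to which the
  previous theorem applies with exponent \<open>2\<close>.
\<close>

theorem poly_average_max_L2:
  fixes m :: real
  assumes m: "m > real CARD('d::finite)"
  obtains C where "C > 0" "\<And>n (V :: real^'d \<Rightarrow> real) w. bounded_meas V \<Longrightarrow>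
    (\<And>k. k < n \<Longrightarrow> bounded_meas (w k)) \<Longrightarrow> (\<And>k x. k < n \<Longrightarrow> w k x \<le> kernel_avg (poly_kernel (2 ^ k) m) V x) \<Longrightarrow> n > 0 \<Longrightarrow>
    (LINT x|torus_measure. (Max ((\<lambda>k. w k x) ` {..<n}))\<^sup>2) \<le> C * (LINT x|torus_measure. (V x)\<^sup>2)"
proof -
  obtain C where C: "C > 0" "\<And>n (G :: nat \<Rightarrow> real^'d \<Rightarrow> real).
    (\<And>k. k < n \<Longrightarrow> bounded_meas (G k)) \<Longrightarrow>
    (LINT x|torus_measure. (\<Sum>k<n. kernel_avg (poly_kernel (2 ^ k) m) (G k) x) powr 2)
      \<le> C * (LINT x|torus_measure. (\<Sum>k<n. G k x) powr 2)"
    using poly_average_Lp[OF one_le_numeral m] by blast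
  obtain K where K: "\<And>l. l > 0 \<Longrightarrow> sym_kernel K (poly_kernel l m :: real^'d \<Rightarrow> _)"
    using sym_kernel_poly[OF m] by blast
  have kk: "sym_kernel K (poly_kernel (2 ^ k) m :: real^'d \<Rightarrow> _)" for k by (rule K) simp
  let ?I = "\<lambda>f. LINT x|(torus_measure :: (real^'d) measure). f x"
  have main: "?I (\<lambda>x. (Max ((\<lambda>k. w k x) ` {..<n}))\<^sup>2) \<le> C * ?I (\<lambda>x. (V x)\<^sup>2)"
    if V: "bounded_meas V" and w: "\<And>k. k < n \<Longrightarrow> bounded_meas (w k)"
      and le: "\<And>k x. k < n \<Longrightarrow> w k x \<le> kernel_avg (poly_kernel (2 ^ k) m) V x" and n: "n > 0" for n V w
  proof -
    define W where "W = (\<lambda>x. Max ((\<lambda>k. w k x) ` {..<n}))"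
    have W_in: "\<exists>k<n. W x = w k x" for x
    proof -
      have "W x \<in> (\<lambda>k. w k x) ` {..<n}" unfolding W_def by (rule Max_in) (use n in auto)
      then show ?thesis by auto
    qed
    have Wm: "W \<in> borel_measurable borel"
      unfolding W_def by (rule borel_measurable_Max) (use n w in \<open>auto simp: lessThan_empty_iff dest: bounded_measD(1)\<close>)
    have W: "bounded_meas W"
    proof (rule bounded_meas_le[OF bounded_meas_sum Wm])
      show "bounded_meas (w k)" if "k \<in> {..<n}" for k using w that by simp
      show "0 \<le> W x" for x using W_in[of x] w bounded_measD(2) by metis
      show "W x \<le> (\<Sum>k<n. w k x)" for x
      proof -
        obtain k where "k < n" "W x = w k x" using W_in by blast
        then show ?thesis using w bounded_measD(2) by (auto intro!: member_le_sum)
      qed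
    qed
    define H where "H = (\<lambda>k x. if w k x = W x \<and> (\<forall>j<k. w j x \<noteq> W x) then W x else 0)"
    have H: "bounded_meas (H k)" if k: "k < n" for k
    proof (rule bounded_meas_le[OF W])
      have [measurable]: "w j \<in> borel_measurable borel" if "j \<le> k" for j
        using w[of j] that k bounded_measD(1) by auto
      note Wm [measurable]
      have [measurable]: "Measurable.pred borel (\<lambda>x. \<forall>j\<in>{..<k}. w j x \<noteq> W x)"
        by (intro pred_intros_finite) auto
      then have [measurable]: "Measurable.pred borel (\<lambda>x. \<forall>j<k. w j x \<noteq> W x)" by (simp add: Ball_def)
      show "H k \<in> borel_measurable borel" unfolding H_def by measurable
      show "0 \<le> H k x" "H k x \<le> W x" for x using bounded_measD(2)[OF W, of x] by (auto simp: H_def)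
    qed
    have sumH: "(\<Sum>k<n. H k x) = W x" "(\<Sum>k<n. w k x * H k x) = (W x)\<^sup>2" for x
    proof -
      define k where "k = (LEAST k. w k x = W x)"
      obtain k1 where k1: "k1 < n" "w k1 x = W x" using W_in[of x] by metis
      have k: "w k x = W x" unfolding k_def by (rule LeastI[of _ k1]) (rule k1)
      have "k \<le> k1" unfolding k_def by (rule Least_le) (rule k1)
      then have kn: "k < n" using k1 by simp
      have least: "w j x \<noteq> W x" if "j < k" for j using that unfolding k_def by (rule not_less_Least)
      have Hj: "H j x = (if j = k then W x else 0)" for j
        using k least unfolding H_def by (metis linorder_neqE_nat)
      show "(\<Sum>k<n. H k x) = W x" "(\<Sum>k<n. w k x * H k x) = (W x)\<^sup>2"
        using kn k by (simp_all add: Hj if_distrib power2_eq_square cong: if_cong)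
    qed
    let ?A = "\<lambda>k. kernel_avg (poly_kernel (2 ^ k) m)"
    have bS: "bounded_meas (\<lambda>x. \<Sum>k<n. ?A k (H k) x)"
      by (intro bounded_meas_sum bounded_meas_kernel_avg[OF kk] H) auto
    have bm2: "bounded_meas (\<lambda>x. (f x)\<^sup>2)" if "bounded_meas f" for f :: "real^'d \<Rightarrow> real"
      using bounded_meas_mult[OF that that] by (simp add: power2_eq_square)
    have p2: "f x powr 2 = (f x)\<^sup>2" if "bounded_meas f" for f :: "real^'d \<Rightarrow> real" and x
      using bounded_measD(2)[OF that, of x] by simp
    have "?I (\<lambda>x. (W x)\<^sup>2) = (\<Sum>k<n. ?I (\<lambda>x. w k x * H k x))"
      unfolding sumH(2)[symmetric] by (rule torus_integral_sum) (auto intro: bounded_meas_mult w H)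
    also have "\<dots> \<le> (\<Sum>k<n. ?I (\<lambda>x. ?A k V x * H k x))"
      using le w H by (intro sum_mono torus_integral_mono bounded_meas_mult bounded_meas_kernel_avg[OF kk] V mult_right_mono) (auto simp: bounded_measD(2))
    also have "\<dots> = (\<Sum>k<n. ?I (\<lambda>x. V x * ?A k (H k) x))"
      by (intro sum.cong refl kernel_avg_swap[OF kk V] H) auto
    also have "\<dots> = ?I (\<lambda>x. V x * (\<Sum>k<n. ?A k (H k) x))"
      unfolding sum_distrib_left
      by (rule torus_integral_sum[symmetric]) (auto intro!: bounded_meas_mult V bounded_meas_kernel_avg[OF kk] H)
    also have "\<dots> \<le> ?I (\<lambda>x. C / 2 * (V x)\<^sup>2 + 1 / (2 * C) * (\<Sum>k<n. ?A k (H k) x)\<^sup>2)"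
    proof (intro torus_integral_mono bounded_meas_mult bounded_meas_add bounded_meas_const bm2 V bS)
      fix x
      let ?v = "V x" and ?s = "\<Sum>k<n. ?A k (H k) x"
      have "0 \<le> (C * ?v - ?s)\<^sup>2 / (2 * C)" using C by simp
      also have "(C * ?v - ?s)\<^sup>2 / (2 * C) = C / 2 * ?v\<^sup>2 + 1 / (2 * C) * ?s\<^sup>2 - ?v * ?s"
        using C by (simp add: power2_eq_square field_simps)
      finally show "?v * ?s \<le> C / 2 * ?v\<^sup>2 + 1 / (2 * C) * ?s\<^sup>2" by simp
    qed (use C in auto)
    also have "\<dots> = C / 2 * ?I (\<lambda>x. (V x)\<^sup>2) + 1 / (2 * C) * ?I (\<lambda>x. (\<Sum>k<n. ?A k (H k) x)\<^sup>2)"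
      by (subst Bochner_Integration.integral_add)
         (use C in \<open>auto intro!: bounded_meas_integrable bounded_meas_cmult bm2 V bS simp del: times_divide_eq_left\<close>)
    also have "?I (\<lambda>x. (\<Sum>k<n. ?A k (H k) x)\<^sup>2) \<le> C * ?I (\<lambda>x. (W x)\<^sup>2)"
      using C(2)[of n H] H by (simp only: p2[OF bS] sumH(1) p2[OF W])
    finally have "?I (\<lambda>x. (W x)\<^sup>2) \<le> C / 2 * ?I (\<lambda>x. (V x)\<^sup>2) + 1 / 2 * ?I (\<lambda>x. (W x)\<^sup>2)"
      using C by (simp add: field_simps)
    then show ?thesis by (simp add: W_def)
  qed
  show thesis by (rule that[OF C(1) main])
qed

text \<open>
  For \<open>t \<le> 1\<close> the weight \<open>W\<^sup>t\<^sup>-\<^sup>1\<close> is a negative power of the partial sums \<open>W\<close> of the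
  averages. It varies slowly at the scale of the last average, so the kernel can again be moved to
  it. As the averages dominate the functions up to \<open>D\<close>, one may then replace \<open>W\<close> by the partial sums
  of the functions themselves, and telescope back with the concavity of the power \<open>t\<close>.
\<close>

theorem poly_average_Lp_small:
  fixes t m :: real
  assumes t: "0 < t" "t \<le> 1" and m: "m * t > real CARD('d::finite)" and D: "D > 0"
  obtains C where "C > 0" "\<And>n (v :: nat \<Rightarrow> real^'d \<Rightarrow> real).
    (\<And>k. k < n \<Longrightarrow> bounded_meas (v k)) \<Longrightarrow>
    (\<And>k x. k < n \<Longrightarrow> v k x \<le> D * kernel_avg (poly_kernel (2 ^ k) m) (v k) x) \<Longrightarrow>
    (LINT x|torus_measure. (\<Sum>k<n. kernel_avg (poly_kernel (2 ^ k) m) (v k) x) powr t)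
      \<le> C * (LINT x|torus_measure. (\<Sum>k<n. v k x) powr t)"
proof -
  have md: "m > real CARD('d)"
  proof -
    have "m > 0" using m t by (metis of_nat_0_le_iff order_le_less_trans zero_less_mult_pos2)
    then have "m * t \<le> m" using t by (simp add: mult_left_le)
    with m show ?thesis by linarith
  qed
  have m0: "m > 0" using md by linarith
  obtain K where K: "K > 0" "\<And>l. l > 0 \<Longrightarrow> sym_kernel K (poly_kernel l m :: real^'d \<Rightarrow> _)"
    using sym_kernel_poly[OF md] by blast
  obtain K' where K': "K' > 0" "\<And>l. l > 0 \<Longrightarrow> sym_kernel K' (poly_kernel l (m * t) :: real^'d \<Rightarrow> _)"
    using sym_kernel_poly[OF m] by blast
  have kk: "sym_kernel K (poly_kernel (2 ^ k) m :: real^'d \<Rightarrow> _)" for k by (rule K) simp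
  have kk': "sym_kernel K' (poly_kernel (2 ^ k) (m * t) :: real^'d \<Rightarrow> _)" for k by (rule K') simp
  let ?I = "\<lambda>f. LINT x|(torus_measure :: (real^'d) measure). f x"
  define C where "C = K' * D powr (1 - t) / t"
  have C: "C > 0" using K' D t by (simp add: C_def)
  have main: "?I (\<lambda>x. (\<Sum>k<n. kernel_avg (poly_kernel (2 ^ k) m) (v k) x) powr t) \<le> C * ?I (\<lambda>x. (\<Sum>k<n. v k x) powr t)"
    if v0: "\<And>k. k < n \<Longrightarrow> bounded_meas (v k)"
      and dom0: "\<And>k x. k < n \<Longrightarrow> v k x \<le> D * kernel_avg (poly_kernel (2 ^ k) m) (v k) x" for n v
  proof -
    define u where "u = (\<lambda>k. if k < n then v k else (\<lambda>x. 0))"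
    have u: "bounded_meas (u k)" for k using v0 by (simp add: u_def bounded_meas_const)
    let ?A = "\<lambda>k. kernel_avg (poly_kernel (2 ^ k) m)"
    have dom: "u k x \<le> D * ?A k (u k) x" for k x
      using dom0 by (simp add: u_def kernel_avg_def)
    define w where "w = (\<lambda>k. ?A k (u k))"
    have w: "bounded_meas (w k)" for k unfolding w_def by (rule bounded_meas_kernel_avg[OF kk u])
    note w0 = bounded_measD(2)[OF w] and u0 = bounded_measD(2)[OF u]
    define W where "W = (\<lambda>j x. \<Sum>k<j. w k x)"
    have W: "bounded_meas (W j)" for j unfolding W_def by (intro bounded_meas_sum w)
    note W0 = bounded_measD(2)[OF W]
    define V where "V = (\<lambda>j x. \<Sum>k<j. u k x)"
    have V: "bounded_meas (V j)" for j unfolding V_def by (intro bounded_meas_sum u)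
    note V0 = bounded_measD(2)[OF V]
    have VW: "V j x \<le> D * W j x" for j x
      unfolding V_def W_def sum_distrib_left w_def by (intro sum_mono dom)
    \<comment> \<open>the weights \<open>W\<^sub>k\<^sup>t\<^sup>-\<^sup>1\<close> are bounded by extending them by \<open>0\<close> where the numerator vanishes\<close>
    have slow: "W (Suc k) x \<le> (1 + 2 ^ k * torus_dist y x) powr m * W (Suc k) y" for k x y
    proof -
      have "w j x \<le> (1 + 2 ^ k * torus_dist y x) powr m * w j y" if "j \<le> k" for j
      proof -
        have "w j x \<le> (LINT z|torus_measure. (1 + 2 ^ k * torus_dist y x) powr m * (poly_kernel (2 ^ j) m y z * u j z))"
          unfolding w_def kernel_avg_def
        proof (intro torus_integral_mono bounded_meas_intros sym_kernel_bounded_meas[OF kk] u)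
          fix z
          have "(1 + 2 ^ j * torus_dist y x) powr m \<le> (1 + 2 ^ k * torus_dist y x) powr m"
            using that m0 by (intro powr_mono2 add_left_mono mult_right_mono power_increasing) (auto simp: add_nonneg_nonneg)
          then have "poly_kernel (2 ^ j) m x z \<le> (1 + 2 ^ k * torus_dist y x) powr m * poly_kernel (2 ^ j) m y z"
            using poly_kernel_shift[of "2 ^ j" m x z y] m0
            by (meson less_imp_le mult_right_mono order_trans poly_kernel_nonneg zero_le_numeral zero_le_power)
          from mult_right_mono[OF this u0]
          show "poly_kernel (2 ^ j) m x z * u j z \<le> (1 + 2 ^ k * torus_dist y x) powr m * (poly_kernel (2 ^ j) m y z * u j z)"
            by (simp add: mult.assoc)
        qed auto
        then show ?thesis by (simp add: w_def kernel_avg_def)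
      qed
      then show ?thesis unfolding W_def sum_distrib_left by (intro sum_mono) auto
    qed
    have fin0: "W (Suc k) x = 0 \<longleftrightarrow> W (Suc k) y = 0" for k x y
      using slow[of k x y] slow[of k y x] W0[of "Suc k" x] W0[of "Suc k" y]
      by (metis antisym mult_zero_right)
    define \<omega> where "\<omega> = (\<lambda>k x. W (Suc k) x powr (t - 1))"
    have \<omega>_slow: "\<omega> k x \<le> (1 + 2 ^ k * torus_dist x y) powr (m * (1 - t)) * \<omega> k y" for k x y
    proof (cases "W (Suc k) x = 0")
      case True
      then show ?thesis by (simp add: \<omega>_def)
    next
      case False
      then have pos: "W (Suc k) x > 0" "W (Suc k) y > 0" using fin0[of k x y] W0 by (metis less_eq_real_def)+
      let ?r = "1 + 2 ^ k * torus_dist x y"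
      have r: "?r > 0" by (simp add: add_pos_nonneg)
      have "W (Suc k) y / ?r powr m \<le> W (Suc k) x"
        using slow[of k y x] r by (simp add: pos_divide_le_eq mult.commute)
      then have "W (Suc k) x powr (t - 1) \<le> (W (Suc k) y / ?r powr m) powr (t - 1)"
        using t pos r by (intro powr_mono2') auto
      also have "\<dots> = ?r powr (m * (1 - t)) * W (Suc k) y powr (t - 1)"
        using pos r by (simp add: powr_divide powr_powr divide_powr_uminus[symmetric] powr_minus_divide algebra_simps powr_diff powr_add)
      finally show ?thesis by (simp add: \<omega>_def)
    qed
    have \<omega>: "bounded_meas (\<omega> k)" for k
    proof -
      have m1: "\<omega> k \<in> borel_measurable borel" using bounded_measD(1)[OF W] unfolding \<omega>_def by measurable
      have "\<omega> k x \<le> (1 + 2 ^ k * (2 * real CARD('d))) powr (m * (1 - t)) * \<omega> k 0" for x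
      proof -
        have "(1 + 2 ^ k * torus_dist x 0) powr (m * (1 - t)) \<le> (1 + 2 ^ k * (2 * real CARD('d))) powr (m * (1 - t))"
          using m0 t torus_dist_le[of x 0] by (intro powr_mono2 add_left_mono mult_left_mono) (auto simp: add_nonneg_nonneg)
        then show ?thesis by (intro order_trans[OF \<omega>_slow[of k x 0]] mult_right_mono) (simp_all add: \<omega>_def)
      qed
      then show ?thesis unfolding bounded_meas_def using m1 by (auto simp: \<omega>_def)
    qed
    note \<omega>0 = bounded_measD(2)[OF \<omega>]
    have W_le: "W n x powr t \<le> (\<Sum>k<n. w k x * \<omega> k x)" for x
    proof -
      have "W n x powr t = (\<Sum>k<n. W (Suc k) x powr t - W k x powr t)"
        using t by (subst sum_lessThan_telescope) (simp add: W_def)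
      also have "\<dots> \<le> (\<Sum>k<n. w k x * \<omega> k x)"
      proof (rule sum_mono)
        fix k
        let ?a = "W k x" and ?b = "W (Suc k) x"
        have ab: "0 \<le> ?a" "?b = ?a + w k x" using W0 by (simp_all add: W_def)
        show "?b powr t - ?a powr t \<le> w k x * \<omega> k x"
        proof (cases "?b = 0")
          case True
          then show ?thesis using mult_nonneg_nonneg[OF w0[of k x] \<omega>0[of k x]] powr_ge_zero[of ?a t]
            by (simp del: powr_ge_zero)
        next
          case False
          then have b: "?b > 0" using W0[of "Suc k" x] by simp
          have "?a / ?b \<le> (?a / ?b) powr t"
          proof (cases "?a = 0")
            case False
            then have "(?a / ?b) powr 1 \<le> (?a / ?b) powr t"
              using ab b t w0[of k x] by (intro powr_mono') auto
            then show ?thesis using ab b by simp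
          qed simp
          then have "?b powr t * (?a / ?b) \<le> ?b powr t * (?a / ?b) powr t" by (rule mult_left_mono) simp
          moreover have "?b powr t * (?a / ?b) powr t = ?a powr t" using b ab by (simp add: powr_divide)
          moreover have "?b powr t * (?a / ?b) = ?b powr t - w k x * \<omega> k x"
            using b ab by (simp add: \<omega>_def powr_diff field_simps)
          ultimately show ?thesis by linarith
        qed
      qed
      finally show ?thesis .
    qed
    have V_ge: "(\<Sum>k<n. u k x * \<omega> k x) \<le> D powr (1 - t) / t * V n x powr t" for x
    proof -
      have step: "u k x * \<omega> k x \<le> D powr (1 - t) / t * (V (Suc k) x powr t - V k x powr t)" for k
      proof (cases "u k x = 0")
        case True then show ?thesis by (simp add: V_def)
      next
        case False
        then have uk: "u k x > 0" using u0[of k x] by simp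
        let ?a = "V k x" and ?b = "V (Suc k) x"
        have ab: "0 \<le> ?a" "?b = ?a + u k x" using V0 by (simp_all add: V_def)
        have b: "?b > 0" using ab uk by simp
        have Wp: "W (Suc k) x > 0" using VW[of "Suc k" x] b D by (metis less_le_trans zero_less_mult_pos)
        have "?b / D \<le> W (Suc k) x" using VW[of "Suc k" x] D by (simp add: pos_divide_le_eq mult.commute)
        then have "\<omega> k x \<le> (?b / D) powr (t - 1)" unfolding \<omega>_def
          using b D t by (intro powr_mono2') auto
        also have "\<dots> = D powr (1 - t) * ?b powr (t - 1)" using b D by (simp add: powr_divide powr_diff field_simps)
        finally have 1: "\<omega> k x \<le> D powr (1 - t) * ?b powr (t - 1)" .
        \<comment> \<open>concavity: the tangent inequality for the convex power \<open>1/t\<close>\<close>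
        have "(?a powr t) powr (1 / t) \<ge> (?b powr t) powr (1 / t) + 1 / t * (?b powr t) powr (1 / t - 1) * (?a powr t - ?b powr t)"
          by (rule powr_tangent) (use t in auto)
        moreover have "(?b powr t) powr (1 / t - 1) = ?b powr (1 - t)"
          using t by (simp add: powr_powr right_diff_distrib)
        moreover have "(?a powr t) powr (1 / t) = ?a" "(?b powr t) powr (1 / t) = ?b"
          using t ab b by (simp_all add: powr_powr)
        ultimately have "?b + 1 / t * ?b powr (1 - t) * (?a powr t - ?b powr t) \<le> ?a" by simp
        then have "t * (?b + 1 / t * ?b powr (1 - t) * (?a powr t - ?b powr t)) \<le> t * ?a"
          by (rule mult_left_mono) (use t in simp)
        then have "t * (?b - ?a) \<le> ?b powr (1 - t) * (?b powr t - ?a powr t)"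
          using t by (simp add: algebra_simps)
        then have "?b powr (t - 1) * (t * (?b - ?a)) \<le> ?b powr (t - 1) * (?b powr (1 - t) * (?b powr t - ?a powr t))"
          by (rule mult_left_mono) simp
        also have "\<dots> = ?b powr t - ?a powr t" using b by (simp add: mult.assoc[symmetric] powr_add[symmetric])
        finally have 2: "u k x * ?b powr (t - 1) \<le> (?b powr t - ?a powr t) / t"
          using t ab by (simp add: pos_le_divide_eq mult_ac)
        have "u k x * \<omega> k x \<le> u k x * (D powr (1 - t) * ?b powr (t - 1))" by (rule mult_left_mono[OF 1 u0])
        also have "\<dots> = D powr (1 - t) * (u k x * ?b powr (t - 1))" by simp
        also have "\<dots> \<le> D powr (1 - t) * ((?b powr t - ?a powr t) / t)" by (rule mult_left_mono[OF 2]) simp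
        finally show ?thesis by simp
      qed
      have "(\<Sum>k<n. u k x * \<omega> k x) \<le> (\<Sum>k<n. D powr (1 - t) / t * (V (Suc k) x powr t - V k x powr t))"
        by (intro sum_mono step)
      also have "\<dots> = D powr (1 - t) / t * V n x powr t"
        using t by (subst sum_distrib_left[symmetric], subst sum_lessThan_telescope) (simp add: V_def)
      finally show ?thesis .
    qed
    have avg\<omega>: "?A k (\<omega> k) y \<le> K' * \<omega> k y" for k y
    proof -
      have "?A k (\<omega> k) y \<le> (LINT x|torus_measure. \<omega> k y * poly_kernel (2 ^ k) (m * t) y x)"
        unfolding kernel_avg_def
      proof (intro torus_integral_mono bounded_meas_mult bounded_meas_const sym_kernel_bounded_meas[OF kk] sym_kernel_bounded_meas[OF kk'] \<omega> \<omega>0)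
        fix x
        have "poly_kernel (2 ^ k) m y x * \<omega> k x \<le> poly_kernel (2 ^ k) m y x * ((1 + 2 ^ k * torus_dist x y) powr (m * (1 - t)) * \<omega> k y)"
          by (intro mult_left_mono \<omega>_slow) auto
        also have "\<dots> = \<omega> k y * poly_kernel (2 ^ k) (m * t) y x"
          by (simp add: poly_kernel_def torus_dist_commute[of x y] powr_add[symmetric] algebra_simps)
        finally show "poly_kernel (2 ^ k) m y x * \<omega> k x \<le> \<omega> k y * poly_kernel (2 ^ k) (m * t) y x" .
      qed
      also have "\<dots> = \<omega> k y * (LINT x|torus_measure. poly_kernel (2 ^ k) (m * t) y x)" by simp
      also have "\<dots> \<le> \<omega> k y * K'" by (intro mult_left_mono sym_kernelD(5)[OF kk'] \<omega>0)
      finally show ?thesis by (simp add: mult.commute)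
    qed
    have "?I (\<lambda>x. W n x powr t) \<le> ?I (\<lambda>x. \<Sum>k<n. w k x * \<omega> k x)"
      using t by (intro torus_integral_mono W_le bounded_meas_sum bounded_meas_mult bounded_meas_powr W w \<omega>) auto
    also have "\<dots> = (\<Sum>k<n. ?I (\<lambda>x. w k x * \<omega> k x))"
      by (rule torus_integral_sum) (intro bounded_meas_mult w \<omega>)
    also have "\<dots> = (\<Sum>k<n. ?I (\<lambda>x. u k x * ?A k (\<omega> k) x))"
      unfolding w_def by (intro sum.cong refl kernel_avg_swap[OF kk] u \<omega>)
    also have "\<dots> \<le> (\<Sum>k<n. ?I (\<lambda>x. K' * (u k x * \<omega> k x)))"
    proof (intro sum_mono torus_integral_mono bounded_meas_mult bounded_meas_const u \<omega> bounded_meas_kernel_avg[OF kk])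
      fix k x
      show "u k x * ?A k (\<omega> k) x \<le> K' * (u k x * \<omega> k x)"
        using mult_left_mono[OF avg\<omega>[of k x] u0[of k x]] by (simp add: mult_ac)
    qed (use K' in auto)
    also have "\<dots> = K' * ?I (\<lambda>x. \<Sum>k<n. u k x * \<omega> k x)"
      by (subst torus_integral_sum) (auto intro: bounded_meas_mult u \<omega> simp: sum_distrib_left)
    also have "\<dots> \<le> K' * ?I (\<lambda>x. D powr (1 - t) / t * V n x powr t)"
      using t K' by (intro mult_left_mono torus_integral_mono V_ge bounded_meas_sum bounded_meas_mult bounded_meas_const bounded_meas_powr u \<omega> V) auto
    also have "\<dots> = C * ?I (\<lambda>x. V n x powr t)" by (simp add: C_def)
    finally have "?I (\<lambda>x. W n x powr t) \<le> C * ?I (\<lambda>x. V n x powr t)" .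
    moreover have "W n x = (\<Sum>k<n. ?A k (v k) x)" "V n x = (\<Sum>k<n. v k x)" for x
      by (simp_all add: W_def V_def w_def u_def)
    ultimately show ?thesis by simp
  qed
  show thesis by (rule that[OF C main])
qed

section \<open>Kernels of smooth Fourier multipliers\<close>

lemma unif_smooth_affine: "unif_smooth N F \<Longrightarrow> unif_smooth N (\<lambda>a t. F (p a) (q a + c * t))"
proof (induction N arbitrary: F)
  case (Suc N)
  from Suc.prems obtain F' where F': "\<And>a t. (F a has_vector_derivative F' a t) (at t)" "unif_smooth N F'"
    by auto
  obtain B where "\<forall>a t. norm (F a t) \<le> B" using unif_smooth_bounded[OF Suc.prems] by blast
  then have B: "\<exists>B. \<forall>a t. norm (F (p a) (q a + c * t)) \<le> B" by blast
  have "((\<lambda>t. F (p a) (q a + c * t)) has_vector_derivative of_real c * F' (p a) (q a + c * t)) (at t)" for a t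
  proof -
    have "((\<lambda>t. q a + c * t) has_vector_derivative c) (at t)" by (auto intro!: derivative_eq_intros)
    from vector_diff_chain_at[OF this F'(1)] show ?thesis by (simp add: o_def scaleR_conv_of_real)
  qed
  then show ?case
    by (rule unif_smooth_SucI[OF B _ unif_smooth_cmult[OF Suc.IH[OF F'(2)], where c = "of_real c"]])
qed auto

lemma unif_smooth_line:
  assumes \<psi>: "C_infinity \<psi>" and bd: "\<And>is. \<exists>B. \<forall>x. norm (iter_partial is \<psi> x) \<le> B"
  shows "unif_smooth N (\<lambda>\<xi> t. iter_partial is \<psi> (\<xi> + t *\<^sub>R axis i 1))"
proof (induction N arbitrary: "is")
  case 0
  then show ?case using bd[of "is"] by auto
next
  case (Suc N)
  have B: "\<exists>B. \<forall>\<xi> t. norm (iter_partial is \<psi> (\<xi> + t *\<^sub>R axis i 1)) \<le> B" using bd[of "is"] by blast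
  show ?case
    by (rule unif_smooth_SucI[OF B _ Suc.IH[of "i # is"]])
       (simp add: has_vector_derivative_line C_infinity_differentiable[OF \<psi>])
qed

lemma iter_partial_eq_0:
  assumes "closed K" "\<And>x. x \<notin> K \<Longrightarrow> \<psi> x = 0" "x \<notin> K"
  shows "iter_partial is \<psi> x = 0"
  using assms(3)
proof (induction "is" arbitrary: x)
  case (Cons i "is")
  have "(iter_partial is \<psi> has_derivative (\<lambda>h. 0)) (at x)"
  proof (rule has_derivative_transform_within_open[of "\<lambda>x. 0" _ x UNIV "- K"])
    show "open (- K)" using assms(1) by auto
  qed (use Cons in auto)
  then show ?case by (simp add: partial_deriv_eqI)
qed (use assms in auto)

lemma compact_support_iter_partial_bounded:
  assumes \<psi>: "C_infinity \<psi>" and supp: "\<And>x. norm x > R \<Longrightarrow> \<psi> x = 0"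
  shows "\<exists>B. \<forall>x. norm (iter_partial is \<psi> x) \<le> B"
proof -
  have "compact (iter_partial is \<psi> ` cball 0 R)"
    by (intro compact_continuous_image C_infinity_continuous \<psi>) auto
  then obtain B where B: "\<And>x. x \<in> cball 0 R \<Longrightarrow> norm (iter_partial is \<psi> x) \<le> B"
    using compact_imp_bounded by (metis bounded_iff imageI)
  have "norm (iter_partial is \<psi> x) \<le> \<bar>B\<bar>" for x
  proof (cases "x \<in> cball 0 R")
    case False
    then show ?thesis using iter_partial_eq_0[of "cball 0 R" \<psi> x "is"] supp by auto
  qed (use B[of x] in auto)
  then show ?thesis by blast
qed

definition int_box :: "nat \<Rightarrow> (int^'d::finite) set"
  where "int_box R = {n. \<forall>i. \<bar>n $ i\<bar> \<le> int R}"

lemma finite_int_box: "finite (int_box R :: (int^'d::finite) set)"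
  and card_int_box: "card (int_box R :: (int^'d) set) = (2 * R + 1) ^ CARD('d)"
proof -
  let ?P = "PiE (UNIV :: 'd set) (\<lambda>i. {- int R..int R})"
  have eq: "(int_box R :: (int^'d) set) = vec_lambda ` ?P"
  proof (intro equalityI subsetI)
    fix n :: "int^'d" assume "n \<in> int_box R"
    then have "(\<lambda>i. n $ i) \<in> ?P" by (auto simp: int_box_def abs_le_iff) (metis minus_le_iff)
    then show "n \<in> vec_lambda ` ?P" by (metis image_eqI vec_nth_inverse)
  next
    fix n assume "n \<in> vec_lambda ` ?P"
    then obtain f where f: "n = vec_lambda f" "f \<in> ?P" by blast
    have "f i \<in> {- int R..int R}" for i using PiE_mem[OF f(2)] by simp
    with f(1) show "n \<in> int_box R" by (auto simp: int_box_def abs_le_iff minus_le_iff)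
  qed
  have inj: "inj_on (vec_lambda :: ('d \<Rightarrow> int) \<Rightarrow> int^'d) ?P" by (metis inj_onI vec_lambda_inverse UNIV_I)
  show "finite (int_box R :: (int^'d) set)" unfolding eq by (intro finite_imageI finite_PiE) auto
  have "card (int_box R :: (int^'d) set) = card ?P" unfolding eq by (rule card_image[OF inj])
  also have "\<dots> = (2 * R + 1) ^ CARD('d)" by (subst card_PiE) (auto simp: nat_add_distrib nat_mult_distrib)
  finally show "card (int_box R :: (int^'d) set) = (2 * R + 1) ^ CARD('d)" .
qed

lemma int_box_mono: "R \<le> R' \<Longrightarrow> int_box R \<subseteq> int_box R'"
  by (clarsimp simp: int_box_def) (meson of_nat_mono order_trans)

lemma in_int_boxI:
  assumes "norm (int_vec n) \<le> real R" shows "n \<in> int_box R"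
proof -
  have "\<bar>real_of_int (n $ i)\<bar> \<le> real R" for i
    using component_le_norm_cart[of "int_vec n" i] assms by simp
  then show ?thesis unfolding int_box_def by (auto simp: of_int_abs[symmetric] simp del: of_int_abs) (metis of_int_le_iff of_int_of_nat_eq)
qed

definition shift_diff :: "'d \<Rightarrow> (int^'d::finite \<Rightarrow> complex) \<Rightarrow> int^'d \<Rightarrow> complex"
  where "shift_diff i f n = f (n + axis i 1) - f n"

lemma axis_add: "axis i a + axis i b = (axis i (a + b) :: int^'d::finite)"
  by (simp add: vec_eq_iff axis_def)

lemma shift_diff_funpow:
  assumes "\<And>k::nat. f (n + axis i (int k)) = g (real k * h)"
  shows "(shift_diff i ^^ N) f (n + axis i (int k)) = (fdiff h ^^ N) g (real k * h)"
proof (induction N arbitrary: k)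
  case (Suc N)
  have "n + axis i (int k) + axis i 1 = n + axis i (int (Suc k))"
    by (simp add: add.assoc axis_add add.commute)
  then show ?case using Suc.IH[of k] Suc.IH[of "Suc k"]
    by (simp add: shift_diff_def fdiff_def algebra_simps)
qed (use assms in simp)

lemma shift_diff_support:
  assumes "\<And>n. n \<notin> int_box R \<Longrightarrow> f n = 0" "n \<notin> int_box (R + N)"
  shows "(shift_diff i ^^ N) f n = 0"
  using assms(2)
proof (induction N arbitrary: n)
  case (Suc N)
  have "n \<notin> int_box (R + N)" using Suc.prems int_box_mono[of "R + N" "R + Suc N"] by auto
  moreover have "n + axis i 1 \<notin> int_box (R + N)"
  proof
    assume a: "n + axis i 1 \<in> int_box (R + N)"
    have "\<bar>n $ j\<bar> \<le> int (R + Suc N)" for j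
    proof -
      have "\<bar>n $ j + (if j = i then 1 else 0)\<bar> \<le> int (R + N)"
        using a by (auto simp: int_box_def axis_def)
      then show ?thesis by (auto split: if_splits)
    qed
    then show False using Suc.prems by (simp add: int_box_def)
  qed
  ultimately show ?case by (simp add: shift_diff_def[of i "(shift_diff i ^^ N) f"] Suc.IH)
qed (use assms in simp)

lemma summation_by_parts_step:
  fixes f :: "int^'d::finite \<Rightarrow> complex"
  assumes f: "\<And>n. n \<notin> int_box R \<Longrightarrow> f n = 0"
  shows "(\<Sum>n\<in>int_box (Suc R). shift_diff i f n * torus_char n z)
    = (cis (- z $ i) - 1) * (\<Sum>n\<in>int_box R. f n * torus_char n z)"
proof -
  have sub: "int_box R \<subseteq> (int_box (Suc R) :: (int^'d) set)" by (rule int_box_mono) simp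
  have 1: "(\<Sum>n\<in>int_box (Suc R). f n * torus_char n z) = (\<Sum>n\<in>int_box R. f n * torus_char n z)"
    by (rule sum.mono_neutral_right[OF finite_int_box sub]) (use f in auto)
  have inj: "inj_on (\<lambda>n. n - axis i 1) A" for A :: "(int^'d) set" by (auto simp: inj_on_def)
  have img: "(\<lambda>n. n - axis i 1) ` int_box R \<subseteq> (int_box (Suc R) :: (int^'d) set)"
  proof (clarsimp simp: int_box_def)
    fix n :: "int^'d" and j assume "\<forall>i. \<bar>n $ i\<bar> \<le> int R"
    then have "\<bar>n $ j\<bar> \<le> int R" by blast
    then show "\<bar>n $ j - axis i 1 $ j\<bar> \<le> 1 + int R" by (auto simp: axis_def)
  qed
  have "(\<Sum>n\<in>int_box (Suc R). f (n + axis i 1) * torus_char n z)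
      = (\<Sum>n\<in>(\<lambda>n. n - axis i 1) ` int_box R. f (n + axis i 1) * torus_char n z)"
  proof (rule sum.mono_neutral_right[OF finite_int_box img], intro ballI)
    fix n :: "int^'d" assume n: "n \<in> int_box (Suc R) - (\<lambda>n. n - axis i 1) ` int_box R"
    have "n + axis i 1 \<notin> int_box R"
      using n by (metis DiffE add_diff_cancel_right' image_eqI)
    then show "f (n + axis i 1) * torus_char n z = 0" using f by simp
  qed
  also have "\<dots> = (\<Sum>n\<in>int_box R. f n * torus_char (n - axis i 1) z)"
    by (subst sum.reindex[OF inj]) simp
  also have "\<dots> = (\<Sum>n\<in>int_box R. cis (- z $ i) * (f n * torus_char n z))"
  proof (rule sum.cong[OF refl])
    fix n :: "int^'d"
    have "n - axis i 1 = n + axis i (- 1)" by (simp add: vec_eq_iff axis_def)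
    then have "torus_char (n - axis i 1) z = torus_char n z * cis (- z $ i)"
      using torus_char_add[of n "axis i (- 1)" z] by (simp only: torus_char_axis) simp
    then show "f n * torus_char (n - axis i 1) z = cis (- z $ i) * (f n * torus_char n z)" by simp
  qed
  finally have 2: "(\<Sum>n\<in>int_box (Suc R). f (n + axis i 1) * torus_char n z)
      = cis (- z $ i) * (\<Sum>n\<in>int_box R. f n * torus_char n z)" by (simp add: sum_distrib_left)
  show ?thesis
    unfolding shift_diff_def left_diff_distrib sum_subtractf 1 2 by simp
qed

text \<open>
  The discrete analogue of integration by parts: \<open>N\<close> differences of the coefficients cost
  \<open>N\<close> factors that are comparable to the distance on the circle.
\<close>

lemma summation_by_parts:
  fixes f :: "int^'d::finite \<Rightarrow> complex"
  assumes f: "\<And>n. n \<notin> int_box R \<Longrightarrow> f n = 0"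
  shows "(\<Sum>n\<in>int_box (R + N). (shift_diff i ^^ N) f n * torus_char n z)
    = (cis (- z $ i) - 1) ^ N * (\<Sum>n\<in>int_box R. f n * torus_char n z)"
proof (induction N)
  case (Suc N)
  have "(\<Sum>n\<in>int_box (Suc (R + N)). shift_diff i ((shift_diff i ^^ N) f) n * torus_char n z)
     = (cis (- z $ i) - 1) * (\<Sum>n\<in>int_box (R + N). (shift_diff i ^^ N) f n * torus_char n z)"
    by (rule summation_by_parts_step) (rule shift_diff_support[OF f])
  then show ?case by (simp add: Suc.IH mult.assoc)
qed simp

text \<open>
  If the symbol has differences of order \<open>N\<close> of size \<open>2\<^bsup>-jN\<^esup>\<close> in each coordinate
  direction then its kernel is concentrated at scale \<open>2\<^bsup>-j\<^esup>\<close>; mixed differences do not enter.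
\<close>

lemma multiplier_kernel_bound:
  fixes f :: "int^'d::finite \<Rightarrow> complex"
  assumes supp: "\<And>n. n \<notin> int_box (2 ^ Suc j) \<Longrightarrow> f n = 0"
    and B: "\<And>n. norm (f n) \<le> B" "\<And>i n. norm ((shift_diff i ^^ N) f n) \<le> B * (1 / 2 ^ j) ^ N"
  shows "norm (\<Sum>n\<in>int_box (2 ^ Suc j). f n * torus_char n (x - y))
    \<le> (real (Suc CARD('d)) ^ Suc N * (real (2 * N + 5) ^ CARD('d) * B)) * poly_kernel (2 ^ j) (real N) x y"
proof -
  let ?z = "x - y"
  let ?R = "2 ^ Suc j :: nat"
  let ?K = "norm (\<Sum>n\<in>int_box ?R. f n * torus_char n ?z)"
  let ?A = "real (2 * N + 5) ^ CARD('d) * (2 ^ j) ^ CARD('d) * B"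
  have B0: "0 \<le> B" using B(1) norm_ge_zero order_trans by blast
  have card: "real (card (int_box (?R + M) :: (int^'d) set)) \<le> real (2 * N + 5) ^ CARD('d) * (2 ^ j) ^ CARD('d)"
    if "M \<le> N" for M
  proof -
    have "real (2 * (?R + M) + 1) \<le> real (2 * N + 5) * 2 ^ j"
    proof -
      have "1 \<le> (2::real) ^ j" by simp
      then have "real (2 * M + 1) * 1 \<le> real (2 * N + 1) * 2 ^ j" using that by (intro mult_mono) auto
      then show ?thesis by (simp add: algebra_simps)
    qed
    then have "real (2 * (?R + M) + 1) ^ CARD('d) \<le> (real (2 * N + 5) * 2 ^ j) ^ CARD('d)"
      by (rule power_mono) simp
    then show ?thesis by (simp only: card_int_box of_nat_power power_mult_distrib)
  qed
  have K0: "?K \<le> ?A"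
  proof -
    have "?K \<le> (\<Sum>n\<in>(int_box ?R :: (int^'d) set). B)"
      by (rule sum_norm_le) (simp add: norm_mult B)
    also have "\<dots> = real (card (int_box (?R + 0) :: (int^'d) set)) * B" by simp
    also have "\<dots> \<le> ?A" by (rule mult_right_mono[OF card B0]) simp
    finally show ?thesis .
  qed
  have Ki: "(2 ^ j * norm (cis (x $ i) - cis (y $ i))) ^ N * ?K \<le> ?A" for i
  proof -
    have "norm (cis (- ?z $ i) - 1) = norm (cis (x $ i) - cis (y $ i))"
    proof -
      have "cis (y $ i) - cis (x $ i) = cis (x $ i) * (cis (- ?z $ i) - 1)"
        by (simp add: right_diff_distrib cis_mult)
      then have "norm (cis (y $ i) - cis (x $ i)) = norm (cis (- ?z $ i) - 1)"
        by (simp only: norm_mult norm_cis mult_1_left)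
      then show ?thesis by (simp only: norm_minus_commute)
    qed
    then have "norm (cis (x $ i) - cis (y $ i)) ^ N * ?K = norm ((cis (- ?z $ i) - 1) ^ N * (\<Sum>n\<in>int_box ?R. f n * torus_char n ?z))"
      by (simp add: norm_mult norm_power)
    also have "\<dots> = norm (\<Sum>n\<in>int_box (?R + N). (shift_diff i ^^ N) f n * torus_char n ?z)"
      by (subst summation_by_parts[OF supp]) auto
    also have "\<dots> \<le> (\<Sum>n\<in>(int_box (?R + N) :: (int^'d) set). B * (1 / 2 ^ j) ^ N)"
      by (rule sum_norm_le) (simp only: norm_mult norm_torus_char mult_1_right B)
    also have "\<dots> = real (card (int_box (?R + N) :: (int^'d) set)) * B * (1 / 2 ^ j) ^ N" by simp
    also have "\<dots> \<le> ?A * (1 / 2 ^ j) ^ N"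
      by (intro mult_right_mono card B0) auto
    finally have "(2 ^ j) ^ N * (norm (cis (x $ i) - cis (y $ i)) ^ N * ?K) \<le> (2 ^ j) ^ N * (?A * (1 / 2 ^ j) ^ N)"
      by (rule mult_left_mono) simp
    also have "\<dots> = ?A" by (simp add: power_one_over)
    finally show ?thesis by (simp add: power_mult_distrib mult.assoc)
  qed
  define u where "u = (\<lambda>i. case i of None \<Rightarrow> 1 | Some i \<Rightarrow> 2 ^ j * norm (cis (x $ i) - cis (y $ i)))"
  have usum: "(\<Sum>i\<in>UNIV. g (u i)) = g 1 + (\<Sum>i\<in>UNIV. g (2 ^ j * norm (cis (x $ i) - cis (y $ i))))" for g :: "real \<Rightarrow> real"
    unfolding UNIV_option_conv by (subst sum.insert) (auto simp: sum.reindex u_def)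
  have u0: "0 \<le> u i" for i by (cases i) (auto simp: u_def)
  have one: "1 + 2 ^ j * torus_dist x y = (\<Sum>i\<in>UNIV. u i)"
    using usum[of "\<lambda>t. t"] by (simp add: torus_dist_def sum_distrib_left)
  have pos: "1 + 2 ^ j * torus_dist x y > 0" by (simp add: add_pos_nonneg)
  have "(1 + 2 ^ j * torus_dist x y) powr real N \<le> real (Suc CARD('d)) powr real N * (\<Sum>i\<in>UNIV. u i powr real N)"
    unfolding one using sum_powr_le[of "UNIV :: 'd option set" u "real N"] u0 by simp
  also have "\<dots> \<le> real (Suc CARD('d)) powr real N * (\<Sum>i\<in>UNIV. u i ^ N)"
  proof (intro mult_left_mono sum_mono)
    show "u i powr real N \<le> u i ^ N" for i
      using u0[of i] by (cases "u i = 0") (auto simp: powr_realpow)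
  qed simp
  finally have "(1 + 2 ^ j * torus_dist x y) powr real N * ?K \<le> real (Suc CARD('d)) powr real N * (\<Sum>i\<in>UNIV. u i ^ N) * ?K"
    by (rule mult_right_mono) simp
  also have "\<dots> = real (Suc CARD('d)) powr real N * (?K + (\<Sum>i\<in>UNIV. (2 ^ j * norm (cis (x $ i) - cis (y $ i))) ^ N * ?K))"
    unfolding usum[of "\<lambda>t. t ^ N"] by (simp add: algebra_simps sum_distrib_left)
  also have "\<dots> \<le> real (Suc CARD('d)) powr real N * (?A + (\<Sum>i\<in>(UNIV::'d set). ?A))"
    by (intro mult_left_mono add_mono sum_mono K0 Ki) auto
  also have "\<dots> = (real (Suc CARD('d)) ^ Suc N * (real (2 * N + 5) ^ CARD('d) * B)) * (2 ^ j) ^ CARD('d)"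
    by (simp add: powr_realpow algebra_simps)
  finally have "?K \<le> (real (Suc CARD('d)) ^ Suc N * (real (2 * N + 5) ^ CARD('d) * B)) * (2 ^ j) ^ CARD('d) / (1 + 2 ^ j * torus_dist x y) powr real N"
    using pos by (simp add: pos_le_divide_eq mult.commute)
  then show ?thesis by (simp add: poly_kernel_def powr_minus_divide)
qed

section \<open>Dyadic blocks and the Peetre inequality\<close>

lemma poly_kernel_comparable:
  fixes x y :: "real^'d::finite"
  assumes l: "0 < l" "0 < l'" "l \<le> 4 * l'" "l' \<le> 4 * l" and m: "m \<ge> 0"
  shows "poly_kernel l m x y \<le> 4 ^ CARD('d) * 4 powr m * poly_kernel l' m x y"
proof -
  let ?\<rho> = "torus_dist x y"
  have "1 + l' * ?\<rho> \<le> 4 * (1 + l * ?\<rho>)"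
    using mult_right_mono[OF l(4) torus_dist_nonneg[of x y]] l by simp
  then have "(4 * (1 + l * ?\<rho>)) powr (- m) \<le> (1 + l' * ?\<rho>) powr (- m)"
    using l m by (intro powr_mono2') (auto simp: add_pos_nonneg)
  then have "4 powr m * (4 * (1 + l * ?\<rho>)) powr (- m) \<le> 4 powr m * (1 + l' * ?\<rho>) powr (- m)"
    by (rule mult_left_mono) simp
  moreover have "4 powr m * (4 * (1 + l * ?\<rho>)) powr (- m) = (1 + l * ?\<rho>) powr (- m)"
  proof -
    have "0 \<le> 1 + l * ?\<rho>" using l by (simp add: add_nonneg_nonneg)
    then have "(4 * (1 + l * ?\<rho>)) powr (- m) = 4 powr (- m) * (1 + l * ?\<rho>) powr (- m)"
      by (intro powr_mult)
    then show ?thesis by (simp add: mult.assoc[symmetric] powr_add[symmetric])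
  qed
  ultimately have 1: "(1 + l * ?\<rho>) powr (- m) \<le> 4 powr m * (1 + l' * ?\<rho>) powr (- m)" by (simp only:)
  have 2: "l ^ CARD('d) \<le> (4 * l') ^ CARD('d)" by (rule power_mono) (use l in auto)
  have "poly_kernel l m x y \<le> (4 * l') ^ CARD('d) * (4 powr m * (1 + l' * ?\<rho>) powr (- m))"
    unfolding poly_kernel_def by (rule mult_mono[OF 2 1]) (use l in auto)
  also have "\<dots> = 4 ^ CARD('d) * 4 powr m * poly_kernel l' m x y"
    by (simp add: poly_kernel_def power_mult_distrib)
  finally show ?thesis .
qed

lemma poly_kernel_antimono:
  fixes x y :: "real^'d::finite"
  assumes "0 < l" "m \<le> m'"
  shows "poly_kernel l m' x y \<le> poly_kernel l m x y"
  unfolding poly_kernel_def using assms by (intro mult_left_mono powr_mono) auto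

lemma one_plus_dist_triangle:
  fixes x y z :: "real^'d::finite"
  assumes "0 \<le> l"
  shows "1 + l * torus_dist x z \<le> (1 + l * torus_dist x y) * (1 + l * torus_dist y z)"
proof -
  have "0 \<le> (l * torus_dist x y) * (l * torus_dist y z)" using assms by simp
  then show ?thesis using mult_left_mono[OF torus_dist_triangle[of x z y] assms]
    by (simp add: algebra_simps)
qed

lemma bounded_meas_trig:
  assumes "finite B"
  shows "bounded_meas (\<lambda>x. norm (\<Sum>n\<in>B. b n * torus_char n x))"
proof -
  have "norm (\<Sum>n\<in>B. b n * torus_char n x) \<le> (\<Sum>n\<in>B. norm (b n))" for x
    by (rule sum_norm_le) (simp add: norm_mult)
  then show ?thesis unfolding bounded_meas_def by (auto intro!: borel_measurable_continuous_onI continuous_intros)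
qed

locale dyadic_partition =
  fixes \<phi>0 \<phi> :: "real^'d::finite \<Rightarrow> complex"
  assumes res: "dyadic_resolution \<phi>0 \<phi>"
begin

lemma \<phi>0_eq_0: "norm \<xi> > 2 \<Longrightarrow> \<phi>0 \<xi> = 0"
  and \<phi>_eq_0: "norm \<xi> > 2 \<or> norm \<xi> < 1 / 2 \<Longrightarrow> \<phi> \<xi> = 0"
proof -
  show "\<phi>0 \<xi> = 0" if "norm \<xi> > 2"
  proof (rule ccontr)
    assume "\<phi>0 \<xi> \<noteq> 0"
    then have "\<xi> \<in> closure {\<xi>. \<phi>0 \<xi> \<noteq> 0}" by (intro subsetD[OF closure_subset]) simp
    then show False using res that by (auto simp: dyadic_resolution_def)
  qed
  show "\<phi> \<xi> = 0" if "norm \<xi> > 2 \<or> norm \<xi> < 1 / 2"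
  proof (rule ccontr)
    assume "\<phi> \<xi> \<noteq> 0"
    then have "\<xi> \<in> closure {\<xi>. \<phi> \<xi> \<noteq> 0}" by (intro subsetD[OF closure_subset]) simp
    then have "1 / 2 \<le> norm \<xi> \<and> norm \<xi> \<le> 2" using res unfolding dyadic_resolution_def by blast
    then show False using that by linarith
  qed
qed

lemma dyadic_eq_0_large: "norm \<xi> > 2 ^ Suc j \<Longrightarrow> dyadic \<phi>0 \<phi> j \<xi> = 0"
  by (cases "j = 0") (auto simp: dyadic_def \<phi>0_eq_0 field_simps intro!: \<phi>_eq_0)

lemma dyadic_eq_0_small: "2 * norm \<xi> < 2 ^ j \<Longrightarrow> j > 0 \<Longrightarrow> dyadic \<phi>0 \<phi> j \<xi> = 0"
  by (auto simp: dyadic_def field_simps intro!: \<phi>_eq_0)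

lemma dyadic_sum_eq_1:
  assumes "norm \<xi> < 2 ^ K"
  shows "(\<Sum>k\<le>K. dyadic \<phi>0 \<phi> k \<xi>) = 1"
proof -
  have "(\<lambda>j. dyadic \<phi>0 \<phi> j \<xi>) sums (\<Sum>k\<le>K. dyadic \<phi>0 \<phi> k \<xi>)"
  proof (rule sums_finite)
    fix k assume "k \<notin> {..K}"
    then have "Suc K \<le> k" by auto
    then have "(2::real) ^ Suc K \<le> 2 ^ k" by (rule power_increasing) simp
    then show "dyadic \<phi>0 \<phi> k \<xi> = 0" using assms \<open>k \<notin> {..K}\<close> by (intro dyadic_eq_0_small) auto
  qed simp
  moreover have "(\<lambda>j. dyadic \<phi>0 \<phi> j \<xi>) sums 1" using res by (auto simp: dyadic_resolution_def)
  ultimately show ?thesis by (rule sums_unique2)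
qed

lemma \<phi>0_eq_1: "norm \<xi> < 1 \<Longrightarrow> \<phi>0 \<xi> = 1"
  using dyadic_sum_eq_1[of \<xi> 0] by (simp add: dyadic_def)

definition weight :: "nat \<Rightarrow> int^'d \<Rightarrow> complex"
  where "weight j n = dyadic \<phi>0 \<phi> j (int_vec n)"

lemma weight_outside: "n \<notin> int_box (2 ^ Suc j) \<Longrightarrow> weight j n = 0"
  using in_int_boxI[of n "2 ^ Suc j"] dyadic_eq_0_large[of j "int_vec n"]
  by (force simp: weight_def)

lemma weight_near_sum:
  assumes "weight k n \<noteq> 0"
  shows "(\<Sum>l\<in>{k - 2..k + 2}. weight l n) = 1"
proof -
  have le: "norm (int_vec n) \<le> 2 ^ Suc k"
    using assms dyadic_eq_0_large[of k "int_vec n"] by (force simp: weight_def)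
  have ge: "2 ^ k \<le> 2 * norm (int_vec n) \<or> k = 0"
    using assms dyadic_eq_0_small[of "int_vec n" k] by (force simp: weight_def)
  have "norm (int_vec n) < 2 ^ (k + 2)" using le by (rule order_le_less_trans) simp
  then have "(\<Sum>l\<le>k + 2. weight l n) = 1" unfolding weight_def by (rule dyadic_sum_eq_1)
  moreover have "(\<Sum>l\<le>k + 2. weight l n) = (\<Sum>l\<in>{k - 2..k + 2}. weight l n)"
  proof (rule sum.mono_neutral_right)
    show "\<forall>l\<in>{..k + 2} - {k - 2..k + 2}. weight l n = 0"
    proof
      fix l assume "l \<in> {..k + 2} - {k - 2..k + 2}"
      then have l: "Suc (Suc l) < k" by auto
      then have "(2::real) ^ Suc (Suc (Suc l)) \<le> 2 ^ k" by (intro power_increasing) auto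
      then have "(2::real) ^ Suc (Suc (Suc l)) \<le> 2 * norm (int_vec n)" using ge l by auto
      moreover have "(0::real) < 2 ^ l" by simp
      ultimately have "(2::real) ^ Suc l < norm (int_vec n)" unfolding power_Suc by linarith
      then show "weight l n = 0" unfolding weight_def by (rule dyadic_eq_0_large)
    qed
  qed auto
  ultimately show ?thesis by simp
qed

lemma compact_smooth:
  "C_infinity \<phi>0" "C_infinity \<phi>"
  "\<exists>B. \<forall>x. norm (iter_partial is \<phi>0 x) \<le> B" "\<exists>B. \<forall>x. norm (iter_partial is \<phi> x) \<le> B"
  using res by (auto simp: dyadic_resolution_def \<phi>0_eq_0 \<phi>_eq_0 intro!: compact_support_iter_partial_bounded[where R = 2])

definition index_sum :: "int^'d \<Rightarrow> int"
  where "index_sum n = (\<Sum>i\<in>UNIV. n $ i)"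

lemma index_sum_add_axis: "index_sum (n + axis i a) = index_sum n + a"
  by (simp add: index_sum_def axis_def sum.distrib)

definition symbol :: "(real \<Rightarrow> complex) \<Rightarrow> nat \<Rightarrow> int^'d \<Rightarrow> complex"
  where "symbol \<Theta> j n = weight j n * \<Theta> ((real_of_int (index_sum n) + real CARD('d)) / 2 ^ j)"

text \<open>
  On the line through \<open>n\<close> in a coordinate direction the localised symbol is a smooth function
  at scale \<open>2\<^sup>j\<close>, which bounds its differences and hence the kernel of the multiplier.
\<close>

lemma symbol_kernel_bound:
  assumes \<Theta>: "\<And>N. unif_smooth N (\<lambda>_::unit. \<Theta>)"
  shows "\<exists>C>0. \<forall>j x y. norm (\<Sum>n\<in>int_box (2 ^ Suc j). symbol \<Theta> j n * torus_char n (x - y))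
    \<le> C * poly_kernel (2 ^ j) (real N) x y"
proof -
  define F where "F = (\<lambda>\<psi> i (a :: (real^'d) \<times> real \<times> real) t. \<psi> (fst a + t *\<^sub>R axis i 1) * \<Theta> (fst (snd a) + t) :: complex)"
  have F: "unif_smooth M (F \<psi> i)" if "\<psi> = \<phi>0 \<or> \<psi> = \<phi>" for M \<psi> i
  proof -
    have "unif_smooth M (\<lambda>\<xi> t. iter_partial [] \<psi> (\<xi> + t *\<^sub>R axis i 1))"
      using that compact_smooth by (intro unif_smooth_line) auto
    from unif_smooth_affine[OF this, of fst "\<lambda>_. 0" 1]
    have 1: "unif_smooth M (\<lambda>(a :: (real^'d) \<times> real \<times> real) t. \<psi> (fst a + t *\<^sub>R axis i 1))" by simp
    from unif_smooth_affine[OF \<Theta>[of M], of "\<lambda>a. fst (snd a)" 1]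
    have 2: "unif_smooth M (\<lambda>(a :: (real^'d) \<times> real \<times> real) t. \<Theta> (fst (snd a) + t))" by simp
    show ?thesis unfolding F_def by (rule unif_smooth_mult[OF 1 2])
  qed
  have "\<exists>B\<ge>0. (\<forall>a t. norm (F \<psi> i a t) \<le> B) \<and> (\<forall>(a :: (real^'d) \<times> real \<times> real) t. snd (snd a) \<ge> 0 \<longrightarrow>
      norm ((fdiff (snd (snd a)) ^^ N) (F \<psi> i a) t) \<le> B * snd (snd a) ^ N)" if \<psi>: "\<psi> = \<phi>0 \<or> \<psi> = \<phi>" for \<psi> i
  proof -
    obtain B1 where B1: "\<And>a t. norm (F \<psi> i a t) \<le> B1" using unif_smooth_bounded[OF F[OF \<psi>, of 0]] by blast
    obtain B2 where B2: "B2 \<ge> 0" "\<And>(a :: (real^'d) \<times> real \<times> real) t. snd (snd a) \<ge> 0 \<Longrightarrow>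
      norm ((fdiff (snd (snd a)) ^^ N) (F \<psi> i a) t) \<le> B2 * snd (snd a) ^ N"
      using unif_smooth_fdiff[OF F[OF \<psi>, of N], where h = "\<lambda>a. snd (snd a)"] by blast
    show ?thesis
    proof (intro exI[of _ "max B1 B2"] conjI allI impI)
      fix a :: "(real^'d) \<times> real \<times> real" and t assume a: "snd (snd a) \<ge> 0"
      have "B2 * snd (snd a) ^ N \<le> max B1 B2 * snd (snd a) ^ N" by (rule mult_right_mono) (use a in auto)
      with B2(2)[OF a] show "norm ((fdiff (snd (snd a)) ^^ N) (F \<psi> i a) t) \<le> max B1 B2 * snd (snd a) ^ N"
        by (rule order_trans)
    qed (use B1 B2(1) in \<open>auto simp: le_max_iff_disj\<close>)
  qed
  then obtain Bf where Bf: "\<And>\<psi> i. \<psi> = \<phi>0 \<or> \<psi> = \<phi> \<Longrightarrow> Bf \<psi> i \<ge> 0 \<and> (\<forall>a t. norm (F \<psi> i a t) \<le> Bf \<psi> i) \<and> (\<forall>(a :: (real^'d) \<times> real \<times> real) t. snd (snd a) \<ge> 0 \<longrightarrow>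
      norm ((fdiff (snd (snd a)) ^^ N) (F \<psi> i a) t) \<le> Bf \<psi> i * snd (snd a) ^ N)"
    by metis
  define B where "B = (\<Sum>i\<in>UNIV. Bf \<phi>0 i) + (\<Sum>i\<in>UNIV. Bf \<phi> i)"
  have BfB: "Bf \<psi> i \<le> B" if "\<psi> = \<phi>0 \<or> \<psi> = \<phi>" for \<psi> i
  proof -
    have "Bf \<phi>0 i \<le> (\<Sum>i\<in>UNIV. Bf \<phi>0 i)" "Bf \<phi> i \<le> (\<Sum>i\<in>UNIV. Bf \<phi> i)"
      by (rule member_le_sum; simp add: Bf)+
    moreover have "0 \<le> (\<Sum>i\<in>UNIV. Bf \<phi>0 i)" "0 \<le> (\<Sum>i\<in>UNIV. Bf \<phi> i)"
      by (rule sum_nonneg; simp add: Bf)+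
    ultimately show ?thesis using that unfolding B_def by auto
  qed
  have B0: "0 \<le> B" using BfB[of \<phi>0] Bf[of \<phi>0] order_trans by blast
  have bounds: "norm (symbol \<Theta> j n) \<le> B \<and> norm ((shift_diff i ^^ N) (symbol \<Theta> j) n) \<le> B * (1 / 2 ^ j) ^ N" for i j n
  proof -
    define \<psi> where "\<psi> = (if j = 0 then \<phi>0 else \<phi>)"
    have \<psi>: "\<psi> = \<phi>0 \<or> \<psi> = \<phi>" by (simp add: \<psi>_def)
    let ?h = "1 / 2 ^ j :: real"
    let ?a = "(?h *\<^sub>R int_vec n, (real_of_int (index_sum n) + real CARD('d)) / 2 ^ j, ?h)"
    have sym: "symbol \<Theta> j (n + axis i (int k)) = F \<psi> i ?a (real k * ?h)" for k
    proof -
      have "?h *\<^sub>R int_vec (n + axis i (int k)) = ?h *\<^sub>R int_vec n + (real k * ?h) *\<^sub>R axis i 1"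
        by (simp add: vec_eq_iff axis_def algebra_simps)
      moreover have "dyadic \<phi>0 \<phi> j \<xi> = \<psi> (?h *\<^sub>R \<xi>)" for \<xi> by (simp add: dyadic_def \<psi>_def)
      ultimately show ?thesis
        by (simp add: symbol_def F_def weight_def index_sum_add_axis add_divide_distrib algebra_simps)
    qed
    have "n + axis i (int 0) = n" by (simp add: vec_eq_iff axis_def)
    note n0 = this
    have "norm (symbol \<Theta> j n) \<le> B"
    proof -
      have "symbol \<Theta> j n = F \<psi> i ?a (real 0 * ?h)" using sym[of 0] by (simp only: n0)
      then show ?thesis using Bf[OF \<psi>, of i] BfB[OF \<psi>, of i] order_trans by (simp only:) blast
    qed
    moreover have "(shift_diff i ^^ N) (symbol \<Theta> j) n = (fdiff ?h ^^ N) (F \<psi> i ?a) 0"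
      using shift_diff_funpow[of "symbol \<Theta> j" n i "F \<psi> i ?a" ?h N 0, OF sym] n0 by (simp only:) simp
    moreover have "norm ((fdiff ?h ^^ N) (F \<psi> i ?a) 0) \<le> Bf \<psi> i * ?h ^ N"
    proof -
      have "snd (snd ?a) \<ge> 0" by simp
      then have "norm ((fdiff (snd (snd ?a)) ^^ N) (F \<psi> i ?a) 0) \<le> Bf \<psi> i * snd (snd ?a) ^ N"
        using Bf[OF \<psi>, of i] by blast
      then show ?thesis by (simp only: snd_conv)
    qed
    moreover have "Bf \<psi> i * ?h ^ N \<le> B * ?h ^ N" by (rule mult_right_mono[OF BfB[OF \<psi>]]) simp
    ultimately show ?thesis using order_trans by (simp only:) blast
  qed
  let ?C = "real (Suc CARD('d)) ^ Suc N * (real (2 * N + 5) ^ CARD('d) * B)"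
  have "norm (\<Sum>n\<in>int_box (2 ^ Suc j). symbol \<Theta> j n * torus_char n (x - y)) \<le> ?C * poly_kernel (2 ^ j) (real N) x y" for j x y
  proof (rule multiplier_kernel_bound)
    show "symbol \<Theta> j n = 0" if "n \<notin> int_box (2 ^ Suc j)" for n
      by (simp only: symbol_def weight_outside[OF that] mult_zero_left)
  qed (use bounds in blast)+
  then have "norm (\<Sum>n\<in>int_box (2 ^ Suc j). symbol \<Theta> j n * torus_char n (x - y)) \<le> (?C + 1) * poly_kernel (2 ^ j) (real N) x y" for j x y
    by (rule order_trans) (intro mult_right_mono, auto)
  moreover have "0 \<le> ?C" using B0 by simp
  ultimately show ?thesis by (intro exI[of _ "?C + 1"]) (auto intro: add_nonneg_pos)
qed

definition block :: "nat \<Rightarrow> (int^'d \<Rightarrow> complex) \<Rightarrow> real^'d \<Rightarrow> complex"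
  where "block j a x = (\<Sum>n\<in>int_box (2 ^ Suc j). (weight j n * a n) * torus_char n x)"

lemma bounded_meas_block: "bounded_meas (\<lambda>x. norm (block j a x))"
  unfolding block_def by (rule bounded_meas_trig[OF finite_int_box])

lemma symbol_average_bound:
  assumes \<Theta>: "\<And>N. unif_smooth N (\<lambda>_::unit. \<Theta>)"
  shows "\<exists>C>0. \<forall>j b B x. finite B \<longrightarrow> (\<forall>n. n \<notin> B \<longrightarrow> b n = 0) \<longrightarrow>
    norm (\<Sum>n\<in>int_box (2 ^ Suc j). symbol \<Theta> j n * b n * torus_char n x) \<le>
    C * kernel_avg (poly_kernel (2 ^ j) (real N)) (\<lambda>y. norm (\<Sum>n\<in>B. b n * torus_char n y)) x"
proof -
  obtain C where C: "C > 0" "\<And>j x y. norm (\<Sum>n\<in>int_box (2 ^ Suc j). symbol \<Theta> j n * torus_char n (x - y))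
    \<le> C * poly_kernel (2 ^ j) (real N) x y" using symbol_kernel_bound[OF \<Theta>] by blast
  have "norm (\<Sum>n\<in>int_box (2 ^ Suc j). symbol \<Theta> j n * b n * torus_char n x) \<le>
    C * kernel_avg (poly_kernel (2 ^ j) (real N)) (\<lambda>y. norm (\<Sum>n\<in>B. b n * torus_char n y)) x"
    if B: "finite B" and b: "\<And>n. n \<notin> B \<Longrightarrow> b n = 0" for j b B x
  proof -
    let ?K = "\<lambda>y. \<Sum>n\<in>int_box (2 ^ Suc j). symbol \<Theta> j n * torus_char n (x - y)"
    let ?g = "\<lambda>y. \<Sum>n\<in>B. b n * torus_char n y"
    let ?s = "\<Sum>n\<in>int_box (2 ^ Suc j). symbol \<Theta> j n * b n * torus_char n x"
    have bp: "bounded_meas (\<lambda>y. C * (poly_kernel (2 ^ j) (real N) x y * norm (?g y)))"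
    proof (intro bounded_meas_mult bounded_meas_const bounded_meas_trig[OF B])
      have "poly_kernel (2 ^ j) (real N) x y \<le> (2 ^ j) ^ CARD('d)" for y
        using poly_kernel_antimono[of "2 ^ j" 0 "real N" x y] by (simp add: poly_kernel_def add_nonneg_nonneg split: if_splits)
      moreover have "poly_kernel (2 ^ j) (real N) x \<in> borel_measurable borel" by measurable
      ultimately show "bounded_meas (poly_kernel (2 ^ j) (real N) x)" unfolding bounded_meas_def by auto
    qed (use C in auto)
    have "1 * norm ?s \<le> (2 * pi) ^ CARD('d) * norm ?s"
      using pi_ge_two by (intro mult_right_mono one_le_power) auto
    also have "\<dots> = norm (of_real ((2 * pi) ^ CARD('d)) * ?s)" by (simp add: norm_mult norm_power)
    also have "of_real ((2 * pi) ^ CARD('d)) * ?s = (LINT y|torus_measure. ?K y * ?g y)"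
      by (rule trig_convolution[symmetric]) (use B b finite_int_box in auto)
    also have "norm \<dots> \<le> (LINT y|torus_measure. C * (poly_kernel (2 ^ j) (real N) x y * norm (?g y)))"
    proof (rule Bochner_Integration.integral_norm_bound_integral)
      show "integrable torus_measure (\<lambda>y. ?K y * ?g y)"
        by (intro integrable_torus_continuous continuous_intros)
      show "norm (?K y * ?g y) \<le> C * (poly_kernel (2 ^ j) (real N) x y * norm (?g y))" for y
        using mult_right_mono[OF C(2) norm_ge_zero, of j x y "?g y"] by (simp add: norm_mult mult.assoc)
    qed (rule bounded_meas_integrable[OF bp])
    finally show ?thesis by (simp add: kernel_avg_def)
  qed
  with C(1) show ?thesis by blast
qed

text \<open>The blocks of index between \<open>k-2\<close> and \<open>k+2\<close> reproduce the block of index \<open>k\<close>.\<close>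

lemma block_reproducing_bound:
  "\<exists>C>0. \<forall>k a y. norm (block k a y) \<le> C * kernel_avg (poly_kernel (2 ^ k) (real N)) (\<lambda>z. norm (block k a z)) y"
proof -
  have one: "unif_smooth N (\<lambda>_::unit. \<lambda>_::real. 1)" for N by (rule unif_smooth_const) simp
  obtain C where C: "C > 0" "\<And>j b B x. finite B \<Longrightarrow> (\<And>n. n \<notin> B \<Longrightarrow> b n = 0) \<Longrightarrow>
    norm (\<Sum>n\<in>int_box (2 ^ Suc j). symbol (\<lambda>_. 1) j n * b n * torus_char n x) \<le>
    C * kernel_avg (poly_kernel (2 ^ j) (real N)) (\<lambda>y. norm (\<Sum>n\<in>B. b n * torus_char n y)) x"
    using symbol_average_bound[OF one, of N] by blast
  let ?c = "4 ^ CARD('d) * 4 powr real N :: real"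
  have "norm (block k a y) \<le> (5 * C * ?c) * kernel_avg (poly_kernel (2 ^ k) (real N)) (\<lambda>z. norm (block k a z)) y" for k a y
  proof -
    let ?b = "\<lambda>n. weight k n * a n"
    let ?P = "\<lambda>l. \<Sum>n\<in>int_box (2 ^ Suc l). symbol (\<lambda>_. 1) l n * ?b n * torus_char n y"
    have "(\<Sum>l\<in>{k - 2..k + 2}. ?P l) = (\<Sum>l\<in>{k - 2..k + 2}. \<Sum>n\<in>int_box (2 ^ Suc k). weight l n * ?b n * torus_char n y)"
    proof (rule sum.cong[OF refl])
      fix l
      show "?P l = (\<Sum>n\<in>int_box (2 ^ Suc k). weight l n * ?b n * torus_char n y)"
        using weight_outside[of _ l] weight_outside[of _ k]
        by (intro sum.mono_neutral_cong finite_int_box) (auto simp: symbol_def)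
    qed
    also have "\<dots> = (\<Sum>n\<in>int_box (2 ^ Suc k). (\<Sum>l\<in>{k - 2..k + 2}. weight l n) * (?b n * torus_char n y))"
      by (subst sum.swap) (simp only: sum_distrib_right mult.assoc)
    also have "\<dots> = block k a y"
      unfolding block_def
    proof (rule sum.cong[OF refl])
      fix n
      show "(\<Sum>l\<in>{k - 2..k + 2}. weight l n) * (?b n * torus_char n y) = ?b n * torus_char n y"
      proof (cases "weight k n = 0")
        case False
        show ?thesis unfolding weight_near_sum[OF False] by simp
      qed simp
    qed
    finally have rep: "block k a y = (\<Sum>l\<in>{k - 2..k + 2}. ?P l)" by simp
    let ?A = "kernel_avg (poly_kernel (2 ^ k) (real N)) (\<lambda>z. norm (block k a z)) y"
    have Pl: "norm (?P l) \<le> C * (?c * ?A)" if l: "l \<in> {k - 2..k + 2}" for l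
    proof -
      have bmk: "bounded_meas (poly_kernel (2 ^ j) (real N) y)" for j :: nat
      proof -
        have "poly_kernel (2 ^ j) (real N) y z \<le> (2 ^ j) ^ CARD('d)" for z
          using poly_kernel_antimono[of "2 ^ j" 0 "real N" y z] by (simp add: poly_kernel_def add_nonneg_nonneg split: if_splits)
        moreover have "poly_kernel (2 ^ j) (real N) y \<in> borel_measurable borel" by measurable
        ultimately show ?thesis unfolding bounded_meas_def by auto
      qed
      have "norm (?P l) \<le> C * kernel_avg (poly_kernel (2 ^ l) (real N)) (\<lambda>z. norm (block k a z)) y"
        unfolding block_def by (rule C(2)[OF finite_int_box]) (simp add: weight_outside)
      also have "\<dots> \<le> C * (LINT z|torus_measure. ?c * (poly_kernel (2 ^ k) (real N) y z * norm (block k a z)))"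
        unfolding kernel_avg_def
      proof (intro mult_left_mono torus_integral_mono bounded_meas_mult bounded_meas_const bmk bounded_meas_block)
        fix z
        have "l \<le> k + 2" "k \<le> l + 2" using l by auto
        then have "(2::real) ^ l \<le> 2 ^ (k + 2)" "(2::real) ^ k \<le> 2 ^ (l + 2)" by (intro power_increasing; simp)+
        then have "poly_kernel (2 ^ l) (real N) y z \<le> ?c * poly_kernel (2 ^ k) (real N) y z"
          by (intro poly_kernel_comparable) (auto simp: power_add)
        then show "poly_kernel (2 ^ l) (real N) y z * norm (block k a z) \<le> ?c * (poly_kernel (2 ^ k) (real N) y z * norm (block k a z))"
          using mult_right_mono[OF _ norm_ge_zero] by (metis mult.assoc)
      qed (use C in auto)
      also have "\<dots> = C * (?c * ?A)" by (simp add: kernel_avg_def)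
      finally show ?thesis .
    qed
    have A0: "0 \<le> C * (?c * ?A)" by (rule order_trans[OF norm_ge_zero Pl[of k]]) simp
    have "norm (block k a y) \<le> (\<Sum>l\<in>{k - 2..k + 2}. C * (?c * ?A))"
      unfolding rep by (rule sum_norm_le) (rule Pl)
    also have "\<dots> = real (card {k - 2..k + 2}) * (C * (?c * ?A))" by simp
    also have "\<dots> \<le> 5 * (C * (?c * ?A))" by (rule mult_right_mono[OF _ A0]) auto
    finally show ?thesis by (simp add: mult_ac)
  qed
  then show ?thesis using C(1) by (intro exI[of _ "5 * C * ?c"]) auto
qed

end

lemma kernel_avg_le:
  assumes "bounded_meas (\<kappa> y)" "bounded_meas (\<kappa>' x)" "bounded_meas f" "bounded_meas h" "c \<ge> 0"
    and "\<And>z. \<kappa> y z * f z \<le> c * (\<kappa>' x z * h z)"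
  shows "kernel_avg \<kappa> f y \<le> c * kernel_avg \<kappa>' h x"
proof -
  have "kernel_avg \<kappa> f y \<le> (LINT z|torus_measure. c * (\<kappa>' x z * h z))"
    unfolding kernel_avg_def by (intro torus_integral_mono bounded_meas_mult bounded_meas_const assms)
  then show ?thesis by (simp add: kernel_avg_def)
qed

lemma bounded_meas_poly_kernel:
  fixes x :: "real^'d::finite"
  assumes "l > 0" "m \<ge> 0"
  shows "bounded_meas (poly_kernel l m x)"
proof -
  have "poly_kernel l m x y \<le> l ^ CARD('d)" for y
  proof -
    have "1 + l * torus_dist x y > 0" using assms by (simp add: add_pos_nonneg)
    then show ?thesis using poly_kernel_antimono[OF assms, of x y] by (simp add: poly_kernel_def)
  qed
  moreover have "poly_kernel l m x \<in> borel_measurable borel" by measurable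
  ultimately show ?thesis using assms unfolding bounded_meas_def by auto
qed

context dyadic_partition
begin

text \<open>
  A maximal function of Peetre type to the power \<open>r\<close>, in integral form, which makes it measurable and
  amenable to the inequalities for averages.
\<close>

definition peak :: "nat \<Rightarrow> real \<Rightarrow> real \<Rightarrow> (int^'d \<Rightarrow> complex) \<Rightarrow> real^'d \<Rightarrow> real"
  where "peak k r m a x = kernel_avg (poly_kernel (2 ^ k) m) (\<lambda>z. norm (block k a z) powr r) x"

text \<open>
  For \<open>r \<ge> 1\<close> this is the reproducing inequality and Jensen's inequality. For \<open>r < 1\<close> the
  weighted supremum of the block, which is finite because the block is bounded, is split off with
  the exponent \<open>1 - r\<close> under the average and then divided out.
\<close>

lemma peetre_inequality:
  assumes r: "r > 0" and m: "m > real CARD('d)"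
  shows "\<exists>C>0. \<forall>k a x y. norm (block k a y) powr r \<le> C * (1 + 2 ^ k * torus_dist x y) powr m * peak k r m a x"
proof -
  have m0: "m \<ge> 0" using m by linarith
  define N where "N = nat \<lceil>m + m / r\<rceil>"
  have N: "real N \<ge> m" "real N \<ge> m / r" "real N > real CARD('d)" "m / r \<ge> 0"
  proof -
    have "real N \<ge> m + m / r" unfolding N_def by linarith
    moreover show "m / r \<ge> 0" using m0 r by simp
    ultimately show "real N \<ge> m" "real N \<ge> m / r" "real N > real CARD('d)" using m m0 by auto
  qed
  obtain C1 where C1: "C1 > 0" "\<And>k a y. norm (block k a y) \<le> C1 * kernel_avg (poly_kernel (2 ^ k) (real N)) (\<lambda>z. norm (block k a z)) y"
    using block_reproducing_bound[of N] by blast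
  obtain K where K: "K > 0" "\<And>l. l > 0 \<Longrightarrow> sym_kernel K (poly_kernel l (real N) :: real^'d \<Rightarrow> _)"
    using sym_kernel_poly[OF N(3)] by blast
  have kN: "sym_kernel K (poly_kernel (2 ^ k) (real N) :: real^'d \<Rightarrow> _)" for k by (rule K(2)) simp
  have bmk: "bounded_meas (poly_kernel (2 ^ k) m' x)" if "m' \<ge> 0" for k m' and x :: "real^'d"
    using that by (intro bounded_meas_poly_kernel) auto
  show ?thesis
  proof (cases "r \<ge> 1")
    case True
    let ?C = "C1 powr r * K powr (r - 1)"
    have "norm (block k a y) powr r \<le> ?C * (1 + 2 ^ k * torus_dist x y) powr m * peak k r m a x" for k a x y
    proof -
      let ?g = "\<lambda>z. norm (block k a z)"
      let ?A = "kernel_avg (poly_kernel (2 ^ k) (real N))"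
      note g = bounded_meas_block[of k a]
      have gr: "bounded_meas (\<lambda>z. ?g z powr r)" by (rule bounded_meas_powr[OF g]) (use r in simp)
      have A0: "0 \<le> ?A ?g y" by (rule bounded_measD(2)[OF bounded_meas_kernel_avg[OF kN g]])
      have "?g y powr r \<le> (C1 * ?A ?g y) powr r" by (intro powr_mono2 C1) (use r in auto)
      also have "\<dots> = C1 powr r * ?A ?g y powr r" using C1 A0 by (simp add: powr_mult)
      also have "\<dots> \<le> C1 powr r * (K powr (r - 1) * ?A (\<lambda>z. ?g z powr r) y)"
        by (intro mult_left_mono kernel_avg_powr_le[OF kN K(1) g True]) auto
      also have "?A (\<lambda>z. ?g z powr r) y \<le> (1 + 2 ^ k * torus_dist x y) powr m * peak k r m a x"
        unfolding peak_def
      proof (rule kernel_avg_le)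
        fix z
        have "poly_kernel (2 ^ k) (real N) y z \<le> poly_kernel (2 ^ k) m y z" by (rule poly_kernel_antimono) (use N in auto)
        also have "\<dots> \<le> (1 + 2 ^ k * torus_dist x y) powr m * poly_kernel (2 ^ k) m x z"
          by (rule poly_kernel_shift) (use m0 in auto)
        finally show "poly_kernel (2 ^ k) (real N) y z * ?g z powr r \<le> (1 + 2 ^ k * torus_dist x y) powr m * (poly_kernel (2 ^ k) m x z * ?g z powr r)"
          unfolding mult.assoc[symmetric] by (rule mult_right_mono) simp
      qed (use bmk gr m0 in auto)
      finally show ?thesis by (simp add: mult.assoc mult_left_mono)
    qed
    then show ?thesis using C1(1) K(1) by (intro exI[of _ ?C]) auto
  next
    case False
    then have r1: "r < 1" by simp
    define \<alpha> where "\<alpha> = m / r"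
    have \<alpha>: "\<alpha> \<ge> 0" "\<alpha> * r = m" "real N \<ge> \<alpha>" using N r by (auto simp: \<alpha>_def)
    have "norm (block k a y) powr r \<le> C1 * (1 + 2 ^ k * torus_dist x y) powr m * peak k r m a x" for k a x y
    proof -
      let ?g = "\<lambda>z. norm (block k a z)"
      note g = bounded_meas_block[of k a]
      have gr: "bounded_meas (\<lambda>z. ?g z powr r)" by (rule bounded_meas_powr[OF g]) (use r in simp)
      let ?w = "\<lambda>y. 1 + 2 ^ k * torus_dist x y"
      have w1: "1 \<le> ?w y" for y by simp
      have w0: "0 < ?w y" for y using w1[of y] by linarith
      obtain B where B: "\<And>z. ?g z \<le> B" using bounded_measD(3)[OF g] by blast
      have le: "?g y / ?w y powr \<alpha> \<le> B" for y
      proof -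
        have "1 \<le> ?w y powr \<alpha>" using w1 \<alpha>(1) by (rule ge_one_powr_ge_zero)
        then have "?g y / ?w y powr \<alpha> \<le> ?g y / 1" by (intro divide_left_mono) auto
        then show ?thesis using B[of y] by simp
      qed
      then have bdd: "bdd_above (range (\<lambda>y. ?g y / ?w y powr \<alpha>))" by (rule bdd_aboveI2)
      define s where "s = (SUP y. ?g y / ?w y powr \<alpha>)"
      have gs: "?g y \<le> s * ?w y powr \<alpha>" for y
      proof -
        have "?g y / ?w y powr \<alpha> \<le> s" unfolding s_def by (rule cSUP_upper[OF UNIV_I bdd])
        then show ?thesis using w0[of y] by (simp add: pos_divide_le_eq)
      qed
      have s0: "0 \<le> s"
      proof -
        have "0 \<le> ?g x / ?w x powr \<alpha>" by simp
        also have "\<dots> \<le> s" unfolding s_def by (rule cSUP_upper[OF UNIV_I bdd])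
        finally show ?thesis .
      qed
      let ?G = "peak k r m a x"
      have step: "?g y / ?w y powr \<alpha> \<le> C1 * s powr (1 - r) * ?G" for y
      proof -
        have "kernel_avg (poly_kernel (2 ^ k) (real N)) ?g y \<le> (s powr (1 - r) * ?w y powr \<alpha>) * ?G"
          unfolding peak_def
        proof (rule kernel_avg_le)
          fix z
          have "?g z = ?g z powr (1 - r) * ?g z powr r"
            by (cases "?g z = 0") (auto simp: powr_add[symmetric])
          also have "\<dots> \<le> (s * ?w z powr \<alpha>) powr (1 - r) * ?g z powr r"
            by (intro mult_right_mono powr_mono2 gs) (use r1 in auto)
          also have "(s * ?w z powr \<alpha>) powr (1 - r) = s powr (1 - r) * ?w z powr (\<alpha> - m)"
            using s0 w0[of z] \<alpha>(2) by (simp add: powr_mult powr_powr right_diff_distrib)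
          finally have 1: "?g z \<le> s powr (1 - r) * ?w z powr (\<alpha> - m) * ?g z powr r" .
          let ?v = "1 + 2 ^ k * torus_dist y z"
          have v: "?v > 0" by (simp add: add_pos_nonneg)
          have "?w z powr \<alpha> \<le> (?w y * ?v) powr \<alpha>"
            by (intro powr_mono2 one_plus_dist_triangle \<alpha>) (use w0 in \<open>auto intro: less_imp_le\<close>)
          also have "\<dots> = ?w y powr \<alpha> * ?v powr \<alpha>" using w0[of y] v by (simp add: powr_mult)
          finally have "?v powr (- real N) * ?w z powr \<alpha> \<le> ?v powr (- real N) * (?w y powr \<alpha> * ?v powr \<alpha>)"
            by (rule mult_left_mono) simp
          also have "\<dots> = ?w y powr \<alpha> * ?v powr (\<alpha> - real N)" by (simp add: powr_add[symmetric] mult_ac)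
          also have "\<dots> \<le> ?w y powr \<alpha> * 1"
          proof (rule mult_left_mono)
            have "?v powr (\<alpha> - real N) \<le> ?v powr 0" by (rule powr_mono) (use \<alpha> in auto)
            then show "?v powr (\<alpha> - real N) \<le> 1" using v by simp
          qed simp
          finally have 2: "?v powr (- real N) * ?w z powr \<alpha> \<le> ?w y powr \<alpha>" by simp
          have 3: "poly_kernel (2 ^ k) (real N) y z * ?w z powr (\<alpha> - m) \<le> ?w y powr \<alpha> * poly_kernel (2 ^ k) m x z"
          proof -
            have "poly_kernel (2 ^ k) (real N) y z * ?w z powr (\<alpha> - m) = (2 ^ k) ^ CARD('d) * ?w z powr (- m) * (?v powr (- real N) * ?w z powr \<alpha>)"
              using powr_add[of "?w z" \<alpha> "- m"] by (simp add: poly_kernel_def mult_ac)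
            also have "\<dots> \<le> (2 ^ k) ^ CARD('d) * ?w z powr (- m) * ?w y powr \<alpha>"
              by (rule mult_left_mono[OF 2]) simp
            finally show ?thesis by (simp add: poly_kernel_def mult_ac)
          qed
          have "poly_kernel (2 ^ k) (real N) y z * ?g z \<le> poly_kernel (2 ^ k) (real N) y z * (s powr (1 - r) * ?w z powr (\<alpha> - m) * ?g z powr r)"
            by (rule mult_left_mono[OF 1]) simp
          also have "\<dots> = s powr (1 - r) * ?g z powr r * (poly_kernel (2 ^ k) (real N) y z * ?w z powr (\<alpha> - m))" by simp
          also have "\<dots> \<le> s powr (1 - r) * ?g z powr r * (?w y powr \<alpha> * poly_kernel (2 ^ k) m x z)"
            by (rule mult_left_mono[OF 3]) simp
          finally show "poly_kernel (2 ^ k) (real N) y z * ?g z \<le> s powr (1 - r) * ?w y powr \<alpha> * (poly_kernel (2 ^ k) m x z * ?g z powr r)"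
            by (simp add: mult_ac)
        qed (use bmk gr g m0 in auto)
        then have "?g y \<le> C1 * ((s powr (1 - r) * ?w y powr \<alpha>) * ?G)"
          using C1(2)[of k a y] mult_left_mono[OF _ less_imp_le[OF C1(1)]] order_trans by blast
        then show ?thesis using w0[of y] by (simp add: pos_divide_le_eq mult_ac)
      qed
      have sle: "s \<le> C1 * s powr (1 - r) * ?G"
        by (subst (1) s_def) (rule cSUP_least, simp, rule step)
      have sr: "s powr r \<le> C1 * ?G"
      proof (cases "s = 0")
        case True
        have "bounded_meas (peak k r m a)" unfolding peak_def
          using sym_kernel_poly[OF m] bounded_meas_kernel_avg[OF _ gr] by (metis zero_less_numeral zero_less_power)
        then have "0 \<le> ?G" by (rule bounded_measD(2))
        with True C1(1) show ?thesis by simp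
      next
        case False
        then have s: "s > 0" using s0 by simp
        have "s powr r = s * s powr (r - 1)" using powr_mult_base[of s "r - 1"] s by simp
        also have "\<dots> \<le> (C1 * s powr (1 - r) * ?G) * s powr (r - 1)"
          by (rule mult_right_mono[OF sle]) simp
        also have "\<dots> = C1 * ?G * (s powr (1 - r) * s powr (r - 1))" by simp
        also have "s powr (1 - r) * s powr (r - 1) = 1" using s by (simp add: powr_add[symmetric])
        finally show ?thesis by simp
      qed
      have "?g y powr r \<le> (s * ?w y powr \<alpha>) powr r" by (intro powr_mono2 gs) (use r in auto)
      also have "\<dots> = s powr r * ?w y powr m" using s0 w0[of y] \<alpha>(2) by (simp add: powr_mult powr_powr)
      also have "\<dots> \<le> (C1 * ?G) * ?w y powr m" by (rule mult_right_mono[OF sr]) simp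
      finally show ?thesis by (simp add: mult_ac)
    qed
    then show ?thesis using C1(1) by blast
  qed
qed

lemma bounded_meas_peak:
  assumes r: "r > 0" and m: "m > real CARD('d)"
  shows "bounded_meas (peak k r m a)"
proof -
  obtain K where K: "\<And>l. l > 0 \<Longrightarrow> sym_kernel K (poly_kernel l m :: real^'d \<Rightarrow> _)"
    using sym_kernel_poly[OF m] by blast
  have "bounded_meas (kernel_avg (poly_kernel (2 ^ k) m) (\<lambda>z. norm (block k a z) powr r))"
    by (rule bounded_meas_kernel_avg[OF K bounded_meas_powr[OF bounded_meas_block]]) (use r in auto)
  then show ?thesis unfolding peak_def[abs_def] by simp
qed

text \<open>
  The form of the multiplier estimate used below: \<open>b\<close> may be a shifted copy of the
  coefficients of a coarser block, which has the same modulus as a function of \<open>y\<close>.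
\<close>

lemma symbol_block_bound:
  assumes \<Theta>: "\<And>N. unif_smooth N (\<lambda>_::unit. \<Theta>)" and r: "r > 0" and m: "m > real CARD('d)"
  shows "\<exists>C>0. \<forall>j k b B a x. k \<le> j + 2 \<longrightarrow> finite B \<longrightarrow> (\<forall>n. n \<notin> B \<longrightarrow> b n = 0) \<longrightarrow>
    (\<forall>y. norm (\<Sum>n\<in>B. b n * torus_char n y) = norm (block k a y)) \<longrightarrow>
    norm (\<Sum>n\<in>int_box (2 ^ Suc j). symbol \<Theta> j n * b n * torus_char n x) \<le> C * peak k r m a x powr (1 / r)"
proof -
  have m0: "m \<ge> 0" using m by linarith
  define N where "N = nat \<lceil>m / r + CARD('d) + 1\<rceil>"
  have mr: "m / r \<ge> 0" using m0 r by simp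
  have N: "real N - m / r > real CARD('d)" unfolding N_def by linarith
  obtain C1 where C1: "C1 > 0" "\<And>j b B x. finite B \<Longrightarrow> (\<And>n. n \<notin> B \<Longrightarrow> b n = 0) \<Longrightarrow>
    norm (\<Sum>n\<in>int_box (2 ^ Suc j). symbol \<Theta> j n * b n * torus_char n x) \<le>
    C1 * kernel_avg (poly_kernel (2 ^ j) (real N)) (\<lambda>y. norm (\<Sum>n\<in>B. b n * torus_char n y)) x"
    using symbol_average_bound[OF \<Theta>, of N] by blast
  obtain C2 where C2: "C2 > 0" "\<And>k a x y. norm (block k a y) powr r \<le> C2 * (1 + 2 ^ k * torus_dist x y) powr m * peak k r m a x"
    using peetre_inequality[OF r m] by blast
  obtain K where K: "K > 0" "\<And>l. l > 0 \<Longrightarrow> sym_kernel K (poly_kernel l (real N - m / r) :: real^'d \<Rightarrow> _)"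
    using sym_kernel_poly[OF N] by blast
  let ?C = "C1 * ((C2 powr (1 / r) * 4 powr (m / r)) * K)"
  have "norm (\<Sum>n\<in>int_box (2 ^ Suc j). symbol \<Theta> j n * b n * torus_char n x) \<le> ?C * peak k r m a x powr (1 / r)"
    if k: "k \<le> j + 2" and B: "finite B" "\<And>n. n \<notin> B \<Longrightarrow> b n = 0"
      and eq: "\<And>y. norm (\<Sum>n\<in>B. b n * torus_char n y) = norm (block k a y)" for j k b B a x
  proof -
    let ?g = "\<lambda>y. norm (block k a y)"
    let ?G = "peak k r m a x"
    have G0: "0 \<le> ?G" by (rule bounded_measD(2)[OF bounded_meas_peak[OF r m]])
    have "kernel_avg (poly_kernel (2 ^ j) (real N)) ?g x \<le>
      (C2 powr (1 / r) * 4 powr (m / r) * ?G powr (1 / r)) * kernel_avg (poly_kernel (2 ^ j) (real N - m / r)) (\<lambda>_. 1) x"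
    proof (rule kernel_avg_le)
      fix y
      let ?w = "\<lambda>l. 1 + l * torus_dist x y"
      have w: "?w (2 ^ j) > 0" by (simp add: add_pos_nonneg)
      have "(2::real) ^ k \<le> 2 ^ (j + 2)" by (rule power_increasing[OF k]) simp
      then have "2 ^ k * torus_dist x y \<le> 2 ^ (j + 2) * torus_dist x y" by (rule mult_right_mono) simp
      then have "?w (2 ^ k) \<le> 4 * ?w (2 ^ j)" by (simp add: power_add)
      then have "?w (2 ^ k) powr m \<le> (4 * ?w (2 ^ j)) powr m"
        by (intro powr_mono2) (use m0 in \<open>auto simp: add_nonneg_nonneg\<close>)
      also have "\<dots> = 4 powr m * ?w (2 ^ j) powr m"
        by (rule powr_mult)
      finally have wm: "?w (2 ^ k) powr m \<le> 4 powr m * ?w (2 ^ j) powr m" .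
      have "?g y powr r \<le> C2 * ?w (2 ^ k) powr m * ?G" by (rule C2)
      also have "\<dots> \<le> C2 * (4 powr m * ?w (2 ^ j) powr m) * ?G"
        by (intro mult_right_mono mult_left_mono wm G0) (use C2 in auto)
      finally have "(?g y powr r) powr (1 / r) \<le> (C2 * (4 powr m * ?w (2 ^ j) powr m) * ?G) powr (1 / r)"
        by (intro powr_mono2) (use r in auto)
      moreover have "(?g y powr r) powr (1 / r) = ?g y" using r by (simp add: powr_powr)
      moreover have "(C2 * (4 powr m * ?w (2 ^ j) powr m) * ?G) powr (1 / r) = C2 powr (1 / r) * 4 powr (m / r) * ?G powr (1 / r) * ?w (2 ^ j) powr (m / r)"
        using C2 G0 w by (simp add: powr_mult powr_powr mult_ac)
      ultimately have g: "?g y \<le> C2 powr (1 / r) * 4 powr (m / r) * ?G powr (1 / r) * ?w (2 ^ j) powr (m / r)" by simp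
      have "poly_kernel (2 ^ j) (real N) x y * ?g y \<le> poly_kernel (2 ^ j) (real N) x y * (C2 powr (1 / r) * 4 powr (m / r) * ?G powr (1 / r) * ?w (2 ^ j) powr (m / r))"
        by (rule mult_left_mono[OF g]) simp
      also have "\<dots> = C2 powr (1 / r) * 4 powr (m / r) * ?G powr (1 / r) * (poly_kernel (2 ^ j) (real N - m / r) x y * 1)"
        using powr_add[of "?w (2 ^ j)" "- real N" "m / r"] by (simp add: poly_kernel_def mult_ac)
      finally show "poly_kernel (2 ^ j) (real N) x y * ?g y \<le> C2 powr (1 / r) * 4 powr (m / r) * ?G powr (1 / r) * (poly_kernel (2 ^ j) (real N - m / r) x y * 1)" .
    qed (use N mr in \<open>auto intro!: bounded_meas_poly_kernel bounded_meas_block bounded_meas_const\<close>)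
    also have "\<dots> \<le> (C2 powr (1 / r) * 4 powr (m / r) * ?G powr (1 / r)) * K"
      unfolding kernel_avg_def using sym_kernelD(5)[OF K(2)[of "2 ^ j"], of x] by (intro mult_left_mono) auto
    finally have "C1 * kernel_avg (poly_kernel (2 ^ j) (real N)) ?g x \<le> C1 * ((C2 powr (1 / r) * 4 powr (m / r) * ?G powr (1 / r)) * K)"
      by (rule mult_left_mono) (use C1 in simp)
    moreover have "norm (\<Sum>n\<in>int_box (2 ^ Suc j). symbol \<Theta> j n * b n * torus_char n x) \<le> C1 * kernel_avg (poly_kernel (2 ^ j) (real N)) ?g x"
      unfolding eq[symmetric] by (rule C1(2)) (use B in blast)+
    ultimately show ?thesis by (simp add: mult_ac)
  qed
  moreover have "?C > 0" using C1 C2 K by simp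
  ultimately show ?thesis by blast
qed

end

section \<open>Almost diagonal operators\<close>

definition nonneg_supp :: "(int^'d::finite \<Rightarrow> complex) \<Rightarrow> bool"
  where "nonneg_supp a \<longleftrightarrow> (\<forall>n. (\<exists>i. n $ i < 0) \<longrightarrow> a n = 0)"

lemma nonneg_suppD: "nonneg_supp a \<Longrightarrow> n $ i < 0 \<Longrightarrow> a n = 0"
  by (auto simp: nonneg_supp_def)

lemma norm_scaleR_axis: "norm (c *\<^sub>R (axis i 1 :: real^'d::finite)) = \<bar>c\<bar>"
  by (simp add: axis_in_Basis_iff)

lemma norm_axis_real: "norm (axis i c :: real^'d::finite) = \<bar>c\<bar>"
proof -
  have "(axis i c :: real^'d) = c *\<^sub>R axis i 1" by (simp add: vec_eq_iff axis_def)
  then show ?thesis by (simp only: norm_scaleR_axis)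
qed

lemma norm_int_vec_le_sum: "norm (int_vec n) \<le> (\<Sum>i\<in>UNIV. \<bar>real_of_int (n $ i)\<bar>)"
  using norm_le_l1_cart[of "int_vec n"] by simp

context dyadic_partition
begin

text \<open>
  The number \<open>\<sigma>\<close> is the order of \<open>T\<close>. Bounding block \<open>j\<close> only by blocks \<open>k \<le> j + 2\<close> reflects that the
  operators below do not lower frequencies.
\<close>

definition almost_diagonal :: "real \<Rightarrow> ((int^'d \<Rightarrow> complex) \<Rightarrow> int^'d \<Rightarrow> complex) \<Rightarrow> bool"
  where "almost_diagonal \<sigma> T \<longleftrightarrow> (\<forall>M\<ge>0. \<forall>r>0. \<forall>m>real CARD('d). \<exists>C>0. \<forall>a. nonneg_supp a \<longrightarrow> (\<forall>j x.
    norm (block j (T a) x) \<le> C * (\<Sum>k\<le>j + 2. 2 powr (\<sigma> * real k - M * \<bar>real j - real k\<bar>) * peak k r m a x powr (1 / r))))"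

lemma weight_decompose:
  assumes "norm (int_vec n) \<le> 2 ^ Suc j"
  shows "(\<Sum>k\<le>j + 2. weight k n) = 1"
proof -
  have "norm (int_vec n) < 2 ^ (j + 2)" using assms by (rule order_le_less_trans) simp
  then show ?thesis unfolding weight_def by (rule dyadic_sum_eq_1)
qed

lemma weight_norm_le: "weight j n \<noteq> 0 \<Longrightarrow> norm (int_vec n) \<le> 2 ^ Suc j"
  using dyadic_eq_0_large[of j "int_vec n"] by (force simp: weight_def)

lemma weight_norm_ge: "weight j n \<noteq> 0 \<Longrightarrow> j > 0 \<Longrightarrow> 2 ^ j \<le> 2 * norm (int_vec n)"
  using dyadic_eq_0_small[of "int_vec n" j] by (force simp: weight_def)

lemma almost_diagonal_multiplier:
  assumes \<Theta>: "\<And>N. unif_smooth N (\<lambda>_::unit. \<Theta>)"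
    and T: "\<And>a j n. nonneg_supp a \<Longrightarrow> weight j n * T a n = of_real (2 powr (\<sigma> * real j)) * (symbol \<Theta> j n * a n)"
  shows "almost_diagonal \<sigma> T"
  unfolding almost_diagonal_def
proof (intro allI impI)
  fix M r m :: real assume M: "0 \<le> M" and r: "0 < r" and m: "real CARD('d) < m"
  obtain C where C: "C > 0" "\<And>j k b B a x. k \<le> j + 2 \<Longrightarrow> finite B \<Longrightarrow> (\<And>n. n \<notin> B \<Longrightarrow> b n = 0) \<Longrightarrow>
    (\<And>y. norm (\<Sum>n\<in>B. b n * torus_char n y) = norm (block k a y)) \<Longrightarrow>
    norm (\<Sum>n\<in>int_box (2 ^ Suc j). symbol \<Theta> j n * b n * torus_char n x) \<le> C * peak k r m a x powr (1 / r)"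
    using symbol_block_bound[OF \<Theta> r m] by blast
  let ?C = "2 powr (2 * \<bar>\<sigma>\<bar> + 2 * M) * C"
  have "norm (block j (T a) x) \<le> ?C * (\<Sum>k\<le>j + 2. 2 powr (\<sigma> * real k - M * \<bar>real j - real k\<bar>) * peak k r m a x powr (1 / r))"
    if a: "nonneg_supp a" for a j x
  proof -
    let ?P = "\<lambda>k. \<Sum>n\<in>int_box (2 ^ Suc j). symbol \<Theta> j n * (weight k n * a n) * torus_char n x"
    have "block j (T a) x = (\<Sum>n\<in>int_box (2 ^ Suc j). of_real (2 powr (\<sigma> * real j)) * (\<Sum>k\<le>j + 2. symbol \<Theta> j n * (weight k n * a n) * torus_char n x))"
      unfolding block_def
    proof (rule sum.cong[OF refl])
      fix n
      have "symbol \<Theta> j n * a n = (\<Sum>k\<le>j + 2. symbol \<Theta> j n * (weight k n * a n))"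
      proof (cases "weight j n = 0")
        case True then show ?thesis by (simp add: symbol_def)
      next
        case False
        have "(\<Sum>k\<le>j + 2. symbol \<Theta> j n * (weight k n * a n)) = symbol \<Theta> j n * ((\<Sum>k\<le>j + 2. weight k n) * a n)"
          by (simp only: sum_distrib_left sum_distrib_right)
        then show ?thesis unfolding weight_decompose[OF weight_norm_le[OF False]] by simp
      qed
      then have "weight j n * T a n * torus_char n x = of_real (2 powr (\<sigma> * real j)) * (\<Sum>k\<le>j + 2. symbol \<Theta> j n * (weight k n * a n)) * torus_char n x"
        by (simp only: T[OF a])
      then show "weight j n * T a n * torus_char n x = of_real (2 powr (\<sigma> * real j)) * (\<Sum>k\<le>j + 2. symbol \<Theta> j n * (weight k n * a n) * torus_char n x)"
        by (simp only: sum_distrib_right mult.assoc)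
    qed
    also have "\<dots> = of_real (2 powr (\<sigma> * real j)) * (\<Sum>k\<le>j + 2. ?P k)"
      unfolding sum_distrib_left[symmetric] by (subst sum.swap) (rule refl)
    finally have "norm (block j (T a) x) = 2 powr (\<sigma> * real j) * norm (\<Sum>k\<le>j + 2. ?P k)"
      by (simp only: norm_mult norm_of_real) simp
    also have "\<dots> \<le> 2 powr (\<sigma> * real j) * (\<Sum>k\<le>j + 2. norm (?P k))"
      by (intro mult_left_mono norm_sum) simp
    also have "\<dots> = (\<Sum>k\<le>j + 2. 2 powr (\<sigma> * real j) * norm (?P k))" by (rule sum_distrib_left)
    also have "\<dots> \<le> (\<Sum>k\<le>j + 2. ?C * (2 powr (\<sigma> * real k - M * \<bar>real j - real k\<bar>) * peak k r m a x powr (1 / r)))"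
    proof (rule sum_mono)
      fix k assume "k \<in> {..j + 2}"
      then have k: "k \<le> j + 2" by simp
      show "2 powr (\<sigma> * real j) * norm (?P k) \<le> ?C * (2 powr (\<sigma> * real k - M * \<bar>real j - real k\<bar>) * peak k r m a x powr (1 / r))"
      proof (cases "k + 2 < j")
        case True
        have "symbol \<Theta> j n * (weight k n * a n) = 0" for n
        proof (rule ccontr)
          assume "symbol \<Theta> j n * (weight k n * a n) \<noteq> 0"
          then have w: "weight j n \<noteq> 0" "weight k n \<noteq> 0" by (auto simp: symbol_def)
          have "2 ^ j \<le> 2 * norm (int_vec n)" using True by (intro weight_norm_ge w(1)) simp
          moreover have "norm (int_vec n) \<le> 2 ^ Suc k" by (rule weight_norm_le[OF w(2)])
          ultimately have "(2::real) ^ j \<le> 2 ^ Suc (Suc k)" by simp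
          then have "j \<le> Suc (Suc k)" by (rule power_le_imp_le_exp[rotated]) simp
          then show False using True by simp
        qed
        then have "?P k = 0" by (simp only: mult_zero_left sum.neutral_const)
        then show ?thesis using C(1) by simp
      next
        case False
        have "norm (?P k) \<le> C * peak k r m a x powr (1 / r)"
          by (rule C(2)[OF k finite_int_box[of "2 ^ Suc k"]]) (simp_all add: weight_outside block_def)
        then have "2 powr (\<sigma> * real j) * norm (?P k) \<le> 2 powr (\<sigma> * real j) * (C * peak k r m a x powr (1 / r))"
          by (rule mult_left_mono) simp
        also have "\<dots> \<le> 2 powr (2 * \<bar>\<sigma>\<bar> + 2 * M + (\<sigma> * real k - M * \<bar>real j - real k\<bar>)) * (C * peak k r m a x powr (1 / r))"
        proof (intro mult_right_mono powr_mono)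
          have d: "\<bar>real j - real k\<bar> \<le> 2" using False k by linarith
          have "\<sigma> * (real j - real k) \<le> \<bar>\<sigma>\<bar> * \<bar>real j - real k\<bar>" by (metis abs_ge_self abs_mult)
          also have "\<dots> \<le> \<bar>\<sigma>\<bar> * 2" by (rule mult_left_mono[OF d]) simp
          finally have 1: "\<sigma> * real j \<le> 2 * \<bar>\<sigma>\<bar> + \<sigma> * real k" by (simp add: algebra_simps)
          have 2: "M * \<bar>real j - real k\<bar> \<le> M * 2" by (rule mult_left_mono[OF d M])
          show "\<sigma> * real j \<le> 2 * \<bar>\<sigma>\<bar> + 2 * M + (\<sigma> * real k - M * \<bar>real j - real k\<bar>)" using 1 2 by linarith
        qed (use C(1) in auto)
        finally show ?thesis unfolding powr_add by (simp add: mult_ac)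
      qed
    qed
    finally show ?thesis by (simp only: sum_distrib_left)
  qed
  moreover have "?C > 0" using C(1) by simp
  ultimately show "\<exists>C>0. \<forall>a. nonneg_supp a \<longrightarrow> (\<forall>j x.
    norm (block j (T a) x) \<le> C * (\<Sum>k\<le>j + 2. 2 powr (\<sigma> * real k - M * \<bar>real j - real k\<bar>) * peak k r m a x powr (1 / r)))"
    by blast
qed

definition J_seq :: "(int^'d \<Rightarrow> complex) \<Rightarrow> int^'d \<Rightarrow> complex"
  where "J_seq a n = (of_int (index_sum n) + of_nat CARD('d)) * a n"

definition J_inv :: "(int^'d \<Rightarrow> complex) \<Rightarrow> int^'d \<Rightarrow> complex"
  where "J_inv a n = a n / (of_int (index_sum n) + of_nat CARD('d))"

lemma index_sum_bounds:
  assumes n: "\<And>i. 0 \<le> n $ i" and w: "weight j n \<noteq> 0"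
  shows "1 / 2 \<le> (real_of_int (index_sum n) + real CARD('d)) / 2 ^ j" "(real_of_int (index_sum n) + real CARD('d)) / 2 ^ j \<le> 3 * real CARD('d)"
proof -
  have S: "real_of_int (index_sum n) = (\<Sum>i\<in>UNIV. \<bar>real_of_int (n $ i)\<bar>)"
    using n by (simp add: index_sum_def)
  have d: "1 \<le> real CARD('d)" using zero_less_card_finite[where 'a = 'd] by linarith
  have le: "norm (int_vec n) \<le> of_int (index_sum n)" unfolding S by (rule norm_int_vec_le_sum)
  have S0: "0 \<le> real_of_int (index_sum n)" unfolding S by (simp add: sum_nonneg)
  show "1 / 2 \<le> (real_of_int (index_sum n) + real CARD('d)) / 2 ^ j"
  proof (cases "j = 0")
    case True
    have "1 / 2 \<le> real_of_int (index_sum n) + real CARD('d)" using S0 d by linarith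
    with True show ?thesis by simp
  next
    case False
    then have "2 ^ j \<le> 2 * norm (int_vec n)" by (intro weight_norm_ge w) simp
    then have "2 ^ j \<le> 2 * real_of_int (index_sum n)" using le by linarith
    then have "2 ^ j \<le> 2 * (real_of_int (index_sum n) + real CARD('d))" using d by simp
    then show ?thesis by (simp add: pos_le_divide_eq)
  qed
  have "real_of_int (index_sum n) \<le> (\<Sum>i\<in>(UNIV::'d set). 2 ^ Suc j)"
    unfolding S
  proof (rule sum_mono)
    fix i show "\<bar>real_of_int (n $ i)\<bar> \<le> 2 ^ Suc j"
      using component_le_norm_cart[of "int_vec n" i] weight_norm_le[OF w] by simp
  qed
  then have "real_of_int (index_sum n) + real CARD('d) \<le> real CARD('d) * (2 ^ Suc j) + real CARD('d) * 2 ^ j"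
    by (intro add_mono) auto
  also have "\<dots> = 3 * real CARD('d) * 2 ^ j" by simp
  finally show "(real_of_int (index_sum n) + real CARD('d)) / 2 ^ j \<le> 3 * real CARD('d)" by (simp add: pos_divide_le_eq)
qed

lemma cutoff_unif_smooth: "unif_smooth N (\<lambda>_::unit. \<lambda>t. \<phi>0 ((c * t) *\<^sub>R axis i 1))"
proof -
  have "unif_smooth N (\<lambda>\<xi> t. iter_partial [] \<phi>0 (\<xi> + t *\<^sub>R axis i 1))"
    using compact_smooth by (intro unif_smooth_line) auto
  from unif_smooth_affine[OF this, of "\<lambda>_::unit. 0" "\<lambda>_. 0" c] show ?thesis by simp
qed

text \<open>
  On the indices of the \<open>j\<close>-th block the multiplier \<open>2\<^sup>-\<^sup>j(|n| + d)\<close> ranges over \<open>[1/2, 3d]\<close>,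
  so it and its inverse may be replaced by smooth functions that are cut off away from there.
\<close>

lemma almost_diagonal_J: "almost_diagonal 1 J_seq"
proof -
  let ?i = "undefined :: 'd"
  let ?c = "1 / (4 * real CARD('d))"
  have d: "0 < real CARD('d)" by simp
  define \<Theta> where "\<Theta> = (\<lambda>t. of_real t * \<phi>0 ((?c * t) *\<^sub>R axis ?i 1))"
  have "unif_smooth N (\<lambda>_::unit. \<Theta>)" for N unfolding \<Theta>_def
  proof (rule unif_smooth_times[OF cutoff_unif_smooth, of "8 * real CARD('d)"])
    show "\<phi>0 ((?c * t) *\<^sub>R axis ?i 1) = 0" if "\<bar>t\<bar> > 8 * real CARD('d)" for t
      using that d by (intro \<phi>0_eq_0) (simp add: abs_mult field_simps)
  qed (use d in simp)
  then show ?thesis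
  proof (rule almost_diagonal_multiplier)
    fix a :: "int^'d \<Rightarrow> complex" and j n assume a: "nonneg_supp a"
    show "weight j n * J_seq a n = of_real (2 powr (1 * real j)) * (symbol \<Theta> j n * a n)"
    proof (cases "weight j n = 0 \<or> a n = 0")
      case False
      then have n: "0 \<le> n $ i" for i using nonneg_suppD[OF a, of n i] by force
      let ?X = "(real_of_int (index_sum n) + real CARD('d)) / 2 ^ j"
      have X: "1 / 2 \<le> ?X" "?X \<le> 3 * real CARD('d)" using index_sum_bounds[OF n] False by auto
      have "\<phi>0 ((?c * ?X) *\<^sub>R axis ?i 1) = 1"
      proof (rule \<phi>0_eq_1)
        have "?c * ?X \<le> ?c * (3 * real CARD('d))" by (rule mult_left_mono[OF X(2)]) simp
        also have "\<dots> < 1" using d by simp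
        finally have lt: "?c * ?X < 1" .
        have "0 \<le> ?X" using X(1) by linarith
        then have "0 \<le> ?c * ?X" by (intro mult_nonneg_nonneg) auto
        with lt show "norm ((?c * ?X) *\<^sub>R (axis ?i 1 :: real^'d)) < 1"
          unfolding norm_scaleR_axis by (simp only: abs_of_nonneg)
      qed
      then have "\<Theta> ?X = of_real ?X" by (simp only: \<Theta>_def mult_1_right)
      then show ?thesis by (simp add: J_seq_def symbol_def powr_realpow)
    qed (auto simp: J_seq_def symbol_def)
  qed
qed

lemma almost_diagonal_J_inv: "almost_diagonal (-1) J_inv"
proof -
  let ?i = "undefined :: 'd"
  define \<Theta> where "\<Theta> = (\<lambda>t. (1 - \<phi>0 ((8 * t) *\<^sub>R axis ?i 1)) / of_real t)"
  have "unif_smooth N (\<lambda>_::unit. \<Theta>)" for N unfolding \<Theta>_def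
  proof (rule unif_smooth_divide[where c = "1 / 8"])
    show "unif_smooth N (\<lambda>_::unit. \<lambda>t. 1 - \<phi>0 ((8 * t) *\<^sub>R axis ?i 1))"
      by (intro unif_smooth_diff cutoff_unif_smooth unif_smooth_const) simp
    show "1 - \<phi>0 ((8 * t) *\<^sub>R axis ?i 1) = 0" if "\<bar>t\<bar> < 1 / 8" for t
      using that by (subst \<phi>0_eq_1) (simp_all add: norm_scaleR_axis abs_mult del: norm_scaleR)
  qed simp
  then show ?thesis
  proof (rule almost_diagonal_multiplier)
    fix a :: "int^'d \<Rightarrow> complex" and j n assume a: "nonneg_supp a"
    show "weight j n * J_inv a n = of_real (2 powr (- 1 * real j)) * (symbol \<Theta> j n * a n)"
    proof (cases "weight j n = 0 \<or> a n = 0")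
      case False
      then have n: "0 \<le> n $ i" for i using nonneg_suppD[OF a, of n i] by force
      let ?Y = "real_of_int (index_sum n) + real CARD('d)"
      let ?X = "?Y / 2 ^ j"
      have X: "1 / 2 \<le> ?X" using index_sum_bounds[OF n] False by auto
      have "\<phi>0 ((8 * ?X) *\<^sub>R axis ?i 1) = 0"
        by (rule \<phi>0_eq_0) (use X in \<open>simp only: norm_scaleR_axis; linarith\<close>)
      then have "\<Theta> ?X = 1 / of_real ?X" by (simp add: \<Theta>_def)
      also have "\<dots> = 2 ^ j / of_real ?Y" by simp
      finally have "symbol \<Theta> j n = weight j n * (2 ^ j / of_real ?Y)" by (simp only: symbol_def)
      then show ?thesis by (simp add: J_inv_def powr_minus powr_realpow)
    qed (auto simp: J_inv_def symbol_def)
  qed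
qed

end

text \<open>The coefficients of \<open>exp (\<lambda> z\<^sub>e) u\<close>, by the exponential series in the variable \<open>z\<^sub>e\<close>.\<close>

definition exp_seq :: "'d::finite \<Rightarrow> complex \<Rightarrow> (int^'d \<Rightarrow> complex) \<Rightarrow> int^'d \<Rightarrow> complex"
  where "exp_seq e lam a n = (\<Sum>m\<le>nat (n $ e). lam ^ m / fact m * a (n - axis e (int m)))"

lemma exp_seq_eq:
  assumes a: "nonneg_supp a" and R: "n $ e \<le> int R"
  shows "exp_seq e lam a n = (\<Sum>m\<le>R. lam ^ m / fact m * a (n - axis e (int m)))"
  unfolding exp_seq_def
proof (rule sum.mono_neutral_left)
  show "\<forall>m\<in>{..R} - {..nat (n $ e)}. lam ^ m / fact m * a (n - axis e (int m)) = 0"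
  proof
    fix m assume "m \<in> {..R} - {..nat (n $ e)}"
    then have "nat (n $ e) < m" by auto
    then have "n $ e < int m" by arith
    then have "(n - axis e (int m)) $ e < 0" by (simp add: axis_def)
    then have "a (n - axis e (int m)) = 0" by (rule nonneg_suppD[OF a])
    then show "lam ^ m / fact m * a (n - axis e (int m)) = 0" by simp
  qed
qed (use R in auto)

lemma nonneg_supp_exp_seq:
  fixes a :: "int^'d::finite \<Rightarrow> complex"
  assumes a: "nonneg_supp a" shows "nonneg_supp (exp_seq e lam a)"
  unfolding nonneg_supp_def
proof (intro allI impI)
  fix n :: "int^'d" assume "\<exists>i. n $ i < 0"
  then obtain i where i: "n $ i < 0" by blast
  have "a (n - axis e (int m)) = 0" if "m \<le> nat (n $ e)" for m
    by (rule nonneg_suppD[OF a, of _ i]) (use i in \<open>auto simp: axis_def\<close>)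
  then show "exp_seq e lam a n = 0" by (simp add: exp_seq_def)
qed

lemma exp_tail_bound:
  fixes x K :: real
  assumes "x \<ge> 0" "K \<ge> 1"
  shows "(\<Sum>m\<le>R. if m < A then 0 else x ^ m / fact m) \<le> exp (K * x) / K ^ A"
proof -
  have "(\<Sum>m\<le>R. if m < A then 0 else x ^ m / fact m) \<le> (\<Sum>m\<le>R. (K * x) ^ m / fact m / K ^ A)"
  proof (rule sum_mono)
    fix m
    show "(if m < A then 0 else x ^ m / fact m) \<le> (K * x) ^ m / fact m / K ^ A"
    proof (cases "m < A")
      case False
      then have "K ^ A \<le> K ^ m" using assms by (intro power_increasing) auto
      then have "x ^ m / fact m * K ^ A \<le> x ^ m / fact m * K ^ m" using assms by (intro mult_left_mono) auto
      then show ?thesis using False assms by (simp add: power_mult_distrib pos_le_divide_eq mult_ac)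
    qed (use assms in auto)
  qed
  also have "\<dots> = (\<Sum>m\<le>R. (K * x) ^ m / fact m) / K ^ A" by (simp add: sum_divide_distrib)
  also have "\<dots> \<le> exp (K * x) / K ^ A"
  proof (rule divide_right_mono)
    have "(\<Sum>m\<le>R. (K * x) ^ m / fact m) = (\<Sum>m<Suc R. inverse (fact m) *\<^sub>R (K * x) ^ m)"
      by (simp add: lessThan_Suc_atMost divide_inverse mult.commute)
    also have "\<dots> \<le> (\<Sum>m. inverse (fact m) *\<^sub>R (K * x) ^ m)"
      by (rule sum_le_suminf) (use assms summable_exp_generic[of "K * x"] in auto)
    finally show "(\<Sum>m\<le>R. (K * x) ^ m / fact m) \<le> exp (K * x)" by (simp add: exp_def)
  qed (use assms in auto)
  finally show ?thesis .
qed

context dyadic_partition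
begin

text \<open>
  The contribution of a block \<open>k + 2 < j\<close> to the \<open>j\<close>-th one comes from shifts of length at
  least \<open>2\<^sup>j\<^sup>-\<^sup>2\<close>. The tail of the exponential series from there on decays faster than \<open>2\<^sup>-\<^sup>M\<^sup>j\<close> for every
  \<open>M\<close>, since already its bound \<open>K\<^sup>-\<^sup>A\<close> with \<open>A = 2\<^sup>j\<^sup>-\<^sup>2\<close> does.
\<close>

lemma almost_diagonal_exp: "almost_diagonal 0 (exp_seq e lam)"
  unfolding almost_diagonal_def
proof (intro allI impI)
  fix M r m :: real assume M: "0 \<le> M" and r: "0 < r" and m: "real CARD('d) < m"
  have one: "unif_smooth N (\<lambda>_::unit. \<lambda>_::real. 1)" for N by (rule unif_smooth_const) simp
  obtain C where C: "C > 0" "\<And>j k b B a x. k \<le> j + 2 \<Longrightarrow> finite B \<Longrightarrow> (\<And>n. n \<notin> B \<Longrightarrow> b n = 0) \<Longrightarrow>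
    (\<And>y. norm (\<Sum>n\<in>B. b n * torus_char n y) = norm (block k a y)) \<Longrightarrow>
    norm (\<Sum>n\<in>int_box (2 ^ Suc j). symbol (\<lambda>_. 1) j n * b n * torus_char n x) \<le> C * peak k r m a x powr (1 / r)"
    using symbol_block_bound[OF one r m] by blast
  define M' where "M' = nat \<lceil>M\<rceil>"
  have M': "M \<le> real M'" unfolding M'_def by linarith
  define K :: real where "K = 2 ^ M'"
  have K: "K \<ge> 1" by (simp add: K_def)
  define D where "D = exp (K * norm lam) * 2 powr (2 * real M')"
  have D: "D > 0" by (simp add: D_def)
  let ?C = "D * C"
  have "norm (block j (exp_seq e lam a) x) \<le> ?C * (\<Sum>k\<le>j + 2. 2 powr (0 * real k - M * \<bar>real j - real k\<bar>) * peak k r m a x powr (1 / r))"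
    if a: "nonneg_supp a" for a j x
  proof -
    let ?R = "2 ^ Suc j :: nat"
    let ?b = "\<lambda>k l n. weight k (n - axis e (int l)) * a (n - axis e (int l))"
    let ?P = "\<lambda>k l. \<Sum>n\<in>int_box ?R. symbol (\<lambda>_. 1) j n * ?b k l n * torus_char n x"
    have "block j (exp_seq e lam a) x = (\<Sum>n\<in>int_box ?R. \<Sum>k\<le>j + 2. \<Sum>l\<le>?R. lam ^ l / fact l * (symbol (\<lambda>_. 1) j n * ?b k l n * torus_char n x))"
      unfolding block_def
    proof (rule sum.cong[OF refl])
      fix n :: "int^'d" assume n: "n \<in> int_box ?R"
      have ne: "n $ e \<le> int ?R" using n by (auto simp: int_box_def abs_le_iff)
      have dec: "weight j n * a (n - axis e (int l)) = weight j n * (\<Sum>k\<le>j + 2. ?b k l n)" for l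
      proof (cases "weight j n = 0 \<or> a (n - axis e (int l)) = 0")
        case False
        have "norm (int_vec (n - axis e (int l))) \<le> norm (int_vec n)"
        proof (rule norm_le_componentwise_cart)
          fix i
          have "0 \<le> (n - axis e (int l)) $ i" using False nonneg_suppD[OF a, of "n - axis e (int l)" i] by force
          moreover have "(n - axis e (int l)) $ i \<le> n $ i" by (simp add: axis_def)
          ultimately have "\<bar>(n - axis e (int l)) $ i\<bar> \<le> \<bar>n $ i\<bar>" by linarith
          then show "norm (int_vec (n - axis e (int l)) $ i) \<le> norm (int_vec n $ i)"
            by (simp only: int_vec_nth real_norm_def of_int_abs[symmetric] of_int_le_iff)
        qed
        also have "\<dots> \<le> 2 ^ Suc j" using False by (intro weight_norm_le) auto
        finally have "(\<Sum>k\<le>j + 2. weight k (n - axis e (int l))) = 1" by (rule weight_decompose)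
        then show ?thesis by (simp only: sum_distrib_right[symmetric] mult_1_left)
      qed auto
      have "weight j n * exp_seq e lam a n * torus_char n x = (\<Sum>l\<le>?R. lam ^ l / fact l * (weight j n * a (n - axis e (int l))) * torus_char n x)"
        unfolding exp_seq_eq[OF a ne] by (simp only: sum_distrib_left sum_distrib_right mult_ac)
      also have "\<dots> = (\<Sum>l\<le>?R. \<Sum>k\<le>j + 2. lam ^ l / fact l * (symbol (\<lambda>_. 1) j n * ?b k l n * torus_char n x))"
        unfolding dec symbol_def by (simp only: sum_distrib_left sum_distrib_right mult.assoc mult_1_right mult_1_left)
      also have "\<dots> = (\<Sum>k\<le>j + 2. \<Sum>l\<le>?R. lam ^ l / fact l * (symbol (\<lambda>_. 1) j n * ?b k l n * torus_char n x))"
        by (rule sum.swap)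
      finally show "weight j n * exp_seq e lam a n * torus_char n x = (\<Sum>k\<le>j + 2. \<Sum>l\<le>?R. lam ^ l / fact l * (symbol (\<lambda>_. 1) j n * ?b k l n * torus_char n x))" .
    qed
    also have "\<dots> = (\<Sum>k\<le>j + 2. \<Sum>n\<in>int_box ?R. \<Sum>l\<le>?R. lam ^ l / fact l * (symbol (\<lambda>_. 1) j n * ?b k l n * torus_char n x))"
      by (rule sum.swap)
    also have "\<dots> = (\<Sum>k\<le>j + 2. \<Sum>l\<le>?R. lam ^ l / fact l * ?P k l)"
      by (intro sum.cong refl, subst sum.swap) (simp only: sum_distrib_left)
    finally have "norm (block j (exp_seq e lam a) x) \<le> (\<Sum>k\<le>j + 2. norm (\<Sum>l\<le>?R. lam ^ l / fact l * ?P k l))"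
      by (simp only: norm_sum)
    also have "\<dots> \<le> (\<Sum>k\<le>j + 2. ?C * (2 powr (0 * real k - M * \<bar>real j - real k\<bar>) * peak k r m a x powr (1 / r)))"
    proof (rule sum_mono)
      fix k assume "k \<in> {..j + 2}"
      then have k: "k \<le> j + 2" by simp
      let ?G = "C * peak k r m a x powr (1 / r)"
      have G0: "0 \<le> ?G" using C(1) by simp
      define A :: nat where "A = (if k + 2 < j then 2 ^ (j - 2) else 0)"
      have Pb: "norm (?P k l) \<le> ?G" for l
      proof (rule C(2)[OF k, of "(\<lambda>n. n + axis e (int l)) ` int_box (2 ^ Suc k)"])
        show "finite ((\<lambda>n. n + axis e (int l)) ` int_box (2 ^ Suc k) :: (int^'d) set)" by (intro finite_imageI finite_int_box)
        show "?b k l n = 0" if "n \<notin> (\<lambda>n. n + axis e (int l)) ` int_box (2 ^ Suc k)" for n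
        proof -
          have "n - axis e (int l) \<notin> int_box (2 ^ Suc k)"
            using that by (metis diff_add_cancel image_eqI)
          from weight_outside[OF this] show ?thesis by (simp only: mult_zero_left)
        qed
        fix y
        have "(\<Sum>n\<in>(\<lambda>n. n + axis e (int l)) ` int_box (2 ^ Suc k). ?b k l n * torus_char n y)
          = (\<Sum>n\<in>int_box (2 ^ Suc k). torus_char (axis e (int l)) y * (weight k n * a n * torus_char n y))"
          by (subst sum.reindex) (auto simp: inj_on_def torus_char_add intro!: sum.cong)
        also have "\<dots> = torus_char (axis e (int l)) y * block k a y"
          by (simp only: block_def sum_distrib_left)
        finally show "norm (\<Sum>n\<in>(\<lambda>n. n + axis e (int l)) ` int_box (2 ^ Suc k). ?b k l n * torus_char n y) = norm (block k a y)"
          by (simp only: norm_mult norm_torus_char mult_1_left)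
      qed
      have P0: "?P k l = 0" if "l < A" for l
      proof -
        have kj: "k + 2 < j" "l < 2 ^ (j - 2)" using that by (auto simp: A_def split: if_splits)
        have "symbol (\<lambda>_. 1) j n * ?b k l n = 0" for n
        proof (rule ccontr)
          assume "symbol (\<lambda>_. 1) j n * ?b k l n \<noteq> 0"
          then have w: "weight j n \<noteq> 0" "weight k (n - axis e (int l)) \<noteq> 0" by (auto simp: symbol_def)
          have "2 ^ j \<le> 2 * norm (int_vec n)" using w(1) kj by (intro weight_norm_ge) auto
          moreover have "norm (int_vec n) \<le> norm (int_vec (n - axis e (int l))) + real l"
            using norm_triangle_ineq[of "int_vec (n - axis e (int l))" "int_vec (axis e (int l))"]
            by (simp add: int_vec_add[symmetric]) (simp add: int_vec_axis norm_axis_real)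
          moreover have "norm (int_vec (n - axis e (int l))) \<le> 2 ^ Suc k" by (rule weight_norm_le[OF w(2)])
          moreover have "(2::real) ^ Suc k \<le> 2 ^ (j - 2)" using kj by (intro power_increasing) auto
          moreover have "real l < 2 ^ (j - 2)" using kj(2) by (metis of_nat_less_iff of_nat_numeral of_nat_power)
          moreover have "(2::real) ^ j = 4 * 2 ^ (j - 2)"
          proof -
            have "j = 2 + (j - 2)" using kj by simp
            then have "(2::real) ^ j = 2 ^ (2 + (j - 2))" by (rule arg_cong)
            then show ?thesis by (simp add: power_add)
          qed
          ultimately show False by linarith
        qed
        then show ?thesis by (simp only: mult_zero_left sum.neutral_const)
      qed
      have "norm (\<Sum>l\<le>?R. lam ^ l / fact l * ?P k l) \<le> (\<Sum>l\<le>?R. (if l < A then 0 else norm lam ^ l / fact l) * ?G)"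
      proof (rule order_trans[OF norm_sum sum_mono])
        fix l
        show "norm (lam ^ l / fact l * ?P k l) \<le> (if l < A then 0 else norm lam ^ l / fact l) * ?G"
        proof (cases "l < A")
          case True then show ?thesis by (simp only: P0 if_True mult_zero_right norm_zero mult_zero_left)
        next
          case False
          have "norm lam ^ l / fact l * norm (?P k l) \<le> norm lam ^ l / fact l * ?G" by (rule mult_left_mono[OF Pb]) simp
          with False show ?thesis by (simp only: norm_mult norm_divide norm_power norm_fact if_False)
        qed
      qed
      also have "\<dots> = (\<Sum>l\<le>?R. if l < A then 0 else norm lam ^ l / fact l) * ?G" by (rule sum_distrib_right[symmetric])
      also have "\<dots> \<le> exp (K * norm lam) / K ^ A * ?G"
        by (rule mult_right_mono[OF exp_tail_bound G0]) (use K in auto)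
      also have "\<dots> \<le> D * 2 powr (- M * \<bar>real j - real k\<bar>) * ?G"
      proof (rule mult_right_mono[OF _ G0])
        have "1 / K ^ A \<le> 2 powr (2 * real M' + - M * \<bar>real j - real k\<bar>)"
        proof (cases "k + 2 < j")
          case True
          have i: "real (j - 2) \<le> real A"
          proof -
            have "A = 2 ^ (j - 2)" using True by (simp add: A_def)
            then have "j - 2 \<le> A" using less_exp[of "j - 2"] by simp
            then show ?thesis by (simp only: of_nat_le_iff)
          qed
          have "M * \<bar>real j - real k\<bar> \<le> real M' * real j"
            using M' M True by (intro mult_mono) auto
          moreover have "real M' * real j \<le> real M' * (real A + 2)"
            using i True by (intro mult_left_mono) auto
          ultimately have ex: "- (real M' * real A) \<le> 2 * real M' + - M * \<bar>real j - real k\<bar>"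
            by (simp add: algebra_simps)
          have "K ^ A = 2 powr (real M' * real A)"
            by (simp add: K_def powr_realpow[symmetric] powr_powr)
          then have "1 / K ^ A = 2 powr (- (real M' * real A))" by (simp add: powr_minus_divide)
          also have "\<dots> \<le> 2 powr (2 * real M' + - M * \<bar>real j - real k\<bar>)" by (rule powr_mono[OF ex]) simp
          finally show ?thesis .
        next
          case False
          then have "\<bar>real j - real k\<bar> \<le> 2" using k by linarith
          then have "M * \<bar>real j - real k\<bar> \<le> real M' * 2" using M M' by (intro mult_mono) auto
          then have "2 powr 0 \<le> 2 powr (2 * real M' + - M * \<bar>real j - real k\<bar>)" by (intro powr_mono) auto
          then show ?thesis using False by (simp add: A_def)
        qed
        then have "exp (K * norm lam) * (1 / K ^ A) \<le> exp (K * norm lam) * (2 powr (2 * real M') * 2 powr (- M * \<bar>real j - real k\<bar>))"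
          unfolding powr_add by (rule mult_left_mono) simp
        then show "exp (K * norm lam) / K ^ A \<le> D * 2 powr (- M * \<bar>real j - real k\<bar>)"
          by (simp add: D_def mult.assoc)
      qed
      finally show "norm (\<Sum>l\<le>?R. lam ^ l / fact l * ?P k l) \<le> ?C * (2 powr (0 * real k - M * \<bar>real j - real k\<bar>) * peak k r m a x powr (1 / r))"
        by (simp add: mult_ac)
    qed
    finally show ?thesis by (simp only: sum_distrib_left)
  qed
  moreover have "?C > 0" using C(1) D by simp
  ultimately show "\<exists>C>0. \<forall>a. nonneg_supp a \<longrightarrow> (\<forall>j x.
    norm (block j (exp_seq e lam a) x) \<le> C * (\<Sum>k\<le>j + 2. 2 powr (0 * real k - M * \<bar>real j - real k\<bar>) * peak k r m a x powr (1 / r)))"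
    by blast
qed

end

section \<open>Quasi-norm estimates for almost diagonal operators\<close>

lemma epowr_ennreal: "0 \<le> a \<Longrightarrow> epowr (ennreal a) r = ennreal (a powr r)"
  by (simp add: epowr_def)

lemma epowr_top: "epowr top r = top"
  by (simp add: epowr_def)

lemma epowr_mono:
  assumes "x \<le> y" "0 \<le> r" shows "epowr x r \<le> epowr y r"
proof (cases y)
  case (real b)
  then obtain a where a: "x = ennreal a" "0 \<le> a" using assms(1) by (cases x) (auto simp: top_unique)
  then have "a \<le> b" using assms(1) real by (simp add: ennreal_le_iff)
  then show ?thesis using a real assms(2) by (simp add: epowr_ennreal ennreal_leI powr_mono2)
qed (simp add: epowr_top)

lemma epowr_epowr:
  assumes "0 < a" "0 < b" shows "epowr (epowr x a) b = epowr x (a * b)"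
  by (cases x) (auto simp: epowr_ennreal epowr_top powr_powr)

lemma epowr_one: "epowr x 1 = x"
  by (cases x) (auto simp: epowr_ennreal epowr_top)

lemma epowr_cmult:
  assumes "0 < c" "0 < r"
  shows "epowr (ennreal c * x) r = ennreal (c powr r) * epowr x r"
proof (cases x)
  case (real a)
  then show ?thesis using assms by (simp add: epowr_ennreal ennreal_mult[symmetric] powr_mult)
next
  case top
  then show ?thesis using assms by (simp add: epowr_top ennreal_mult_top)
qed

lemma epowr_SUP:
  assumes "0 < r" "I \<noteq> {}"
  shows "epowr (SUP i\<in>I. f i) r = (SUP i\<in>I. epowr (f i) r)"
proof (rule antisym)
  let ?S = "SUP i\<in>I. epowr (f i) r"
  have "(SUP i\<in>I. f i) \<le> epowr ?S (1 / r)"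
  proof (rule SUP_least)
    fix i assume "i \<in> I"
    then have "epowr (epowr (f i) r) (1 / r) \<le> epowr ?S (1 / r)"
      by (intro epowr_mono SUP_upper) (use assms in auto)
    then show "f i \<le> epowr ?S (1 / r)" using assms by (simp add: epowr_epowr epowr_one)
  qed
  then have "epowr (SUP i\<in>I. f i) r \<le> epowr (epowr ?S (1 / r)) r" by (rule epowr_mono) (use assms in simp)
  then show "epowr (SUP i\<in>I. f i) r \<le> ?S" using assms by (simp add: epowr_epowr epowr_one)
  show "?S \<le> epowr (SUP i\<in>I. f i) r"
    by (intro SUP_least epowr_mono SUP_upper) (use assms in auto)
qed

lemma epowr_measurable [measurable (raw)]:
  assumes [measurable]: "f \<in> borel_measurable M"
  shows "(\<lambda>x. epowr (f x) r) \<in> borel_measurable M"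
  unfolding epowr_def by measurable

lemma two_sided_sum_bounded:
  fixes \<epsilon> :: real
  assumes "\<epsilon> > 0"
  obtains K where "K > 0" "\<And>j. (\<Sum>k. ennreal (2 powr (- \<epsilon> * \<bar>real j - real k\<bar>))) \<le> ennreal K"
proof -
  obtain K where K: "K > 0" "\<And>n. (\<Sum>i\<le>n. 2 powr (- \<epsilon> * real i)) \<le> K"
    using sum_powr_bounded[OF assms] by blast
  have "(\<Sum>k<n. 2 powr (- \<epsilon> * \<bar>real j - real k\<bar>)) \<le> K + K" for j n
  proof -
    have "(\<Sum>k<n. 2 powr (- \<epsilon> * \<bar>real j - real k\<bar>)) \<le> (\<Sum>k\<in>{..j} \<union> {j..j + n}. 2 powr (- \<epsilon> * \<bar>real j - real k\<bar>))"
      by (rule sum_mono2) auto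
    also have "\<dots> \<le> (\<Sum>k\<in>{..j}. 2 powr (- \<epsilon> * \<bar>real j - real k\<bar>)) + (\<Sum>k\<in>{j..j + n}. 2 powr (- \<epsilon> * \<bar>real j - real k\<bar>))"
      by (subst sum_Un) (auto intro!: sum_nonneg)
    also have "(\<Sum>k\<in>{..j}. 2 powr (- \<epsilon> * \<bar>real j - real k\<bar>)) = (\<Sum>i\<le>j. 2 powr (- \<epsilon> * real i))"
      by (rule sum.reindex_bij_witness[of _ "\<lambda>i. j - i" "\<lambda>k. j - k"]) auto
    also have "(\<Sum>k\<in>{j..j + n}. 2 powr (- \<epsilon> * \<bar>real j - real k\<bar>)) = (\<Sum>i\<le>n. 2 powr (- \<epsilon> * real i))"
      by (rule sum.reindex_bij_witness[of _ "\<lambda>i. j + i" "\<lambda>k. k - j"]) auto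
    finally show ?thesis using K(2)[of j] K(2)[of n] by linarith
  qed
  then have "(\<Sum>k. ennreal (2 powr (- \<epsilon> * \<bar>real j - real k\<bar>))) \<le> ennreal (K + K)" for j
    by (intro suminf_le_const summableI) (auto simp: sum_ennreal intro!: ennreal_leI)
  then show ?thesis using K(1) by (intro that[of "K + K"]) auto
qed

text \<open>
  For exponential weights a power of a sum is at most the sum of the powers with the exponent of the
  weight halved: estimate the sum by a supremum. This treats all exponents alike.
\<close>

lemma epowr_weighted_sum:
  fixes \<delta> p :: real
  assumes \<delta>: "\<delta> > 0" and p: "p > 0"
  obtains C where "C > 0" "\<And>j x. epowr (\<Sum>k. ennreal (2 powr (- \<delta> * \<bar>real j - real k\<bar>)) * x k) p
    \<le> ennreal C * (\<Sum>k. ennreal (2 powr (- (\<delta> * p / 2) * \<bar>real j - real k\<bar>)) * epowr (x k) p)"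
proof -
  have d2: "\<delta> / 2 > 0" using \<delta> by simp
  obtain K where K: "K > 0" "\<And>j. (\<Sum>k. ennreal (2 powr (- (\<delta> / 2) * \<bar>real j - real k\<bar>))) \<le> ennreal K"
    using two_sided_sum_bounded[OF d2] by blast
  have "epowr (\<Sum>k. ennreal (2 powr (- \<delta> * \<bar>real j - real k\<bar>)) * x k) p
    \<le> ennreal (K powr p) * (\<Sum>k. ennreal (2 powr (- (\<delta> * p / 2) * \<bar>real j - real k\<bar>)) * epowr (x k) p)" for j x
  proof -
    let ?h = "\<lambda>k. ennreal (2 powr (- (\<delta> / 2) * \<bar>real j - real k\<bar>))"
    let ?S = "SUP k. ?h k * x k"
    have "(\<Sum>k. ennreal (2 powr (- \<delta> * \<bar>real j - real k\<bar>)) * x k) \<le> (\<Sum>k. ?h k * ?S)"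
    proof (intro suminf_le allI summableI)
      fix k
      have "2 powr (- \<delta> * \<bar>real j - real k\<bar>) = 2 powr (- (\<delta> / 2) * \<bar>real j - real k\<bar>) * 2 powr (- (\<delta> / 2) * \<bar>real j - real k\<bar>)"
        by (simp add: powr_add[symmetric])
      then have "ennreal (2 powr (- \<delta> * \<bar>real j - real k\<bar>)) * x k = ?h k * (?h k * x k)"
        by (simp add: ennreal_mult mult.assoc)
      also have "\<dots> \<le> ?h k * ?S" by (intro mult_left_mono SUP_upper) auto
      finally show "ennreal (2 powr (- \<delta> * \<bar>real j - real k\<bar>)) * x k \<le> ?h k * ?S" .
    qed
    also have "\<dots> = (\<Sum>k. ?h k) * ?S" by (rule ennreal_suminf_multc)
    also have "\<dots> \<le> ennreal K * ?S" by (intro mult_right_mono K) simp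
    finally have "epowr (\<Sum>k. ennreal (2 powr (- \<delta> * \<bar>real j - real k\<bar>)) * x k) p \<le> epowr (ennreal K * ?S) p"
      by (rule epowr_mono) (use p in simp)
    also have "\<dots> = ennreal (K powr p) * (SUP k. epowr (?h k * x k) p)"
      using K p by (simp add: epowr_cmult epowr_SUP)
    also have "(SUP k. epowr (?h k * x k) p) \<le> (\<Sum>k. ennreal (2 powr (- (\<delta> * p / 2) * \<bar>real j - real k\<bar>)) * epowr (x k) p)"
    proof (rule SUP_least)
      fix k
      have "epowr (?h k * x k) p = ennreal (2 powr (- (\<delta> * p / 2) * \<bar>real j - real k\<bar>)) * epowr (x k) p"
      proof -
        have "(2 powr (- (\<delta> / 2) * \<bar>real j - real k\<bar>)) powr p = 2 powr (- (\<delta> * p / 2) * \<bar>real j - real k\<bar>)"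
          by (simp add: powr_powr mult_ac)
        then show ?thesis using epowr_cmult[OF _ p, of "2 powr (- (\<delta> / 2) * \<bar>real j - real k\<bar>)" "x k"]
          by (simp only:) simp
      qed
      also have "\<dots> = (\<Sum>k\<in>{k}. ennreal (2 powr (- (\<delta> * p / 2) * \<bar>real j - real k\<bar>)) * epowr (x k) p)" by simp
      also have "\<dots> \<le> (\<Sum>k. ennreal (2 powr (- (\<delta> * p / 2) * \<bar>real j - real k\<bar>)) * epowr (x k) p)"
        by (rule sum_le_suminf) auto
      finally show "epowr (?h k * x k) p \<le> \<dots>" .
    qed
    finally show ?thesis by (simp add: mult_left_mono)
  qed
  then show ?thesis using K(1) by (intro that[of "K powr p"]) auto
qed

lemma suminf_swap_ennreal:
  fixes f :: "nat \<Rightarrow> nat \<Rightarrow> ennreal"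
  shows "(\<Sum>j. \<Sum>k. f j k) = (\<Sum>k. \<Sum>j. f j k)"
  using nn_integral_suminf[of "\<lambda>j k. f j k" "count_space UNIV"]
  by (simp add: nn_integral_count_space_nat)

lemma lq_qnorm_mono: "0 < q \<Longrightarrow> (\<And>j. a j \<le> b j) \<Longrightarrow> lq_qnorm q a \<le> lq_qnorm q b"
  unfolding lq_qnorm_def
  by (auto intro!: SUP_mono' epowr_mono suminf_le summableI)

lemma enn2real_pos: "0 < q \<Longrightarrow> q \<noteq> (\<infinity>::ennreal) \<Longrightarrow> 0 < enn2real q"
  by (simp add: enn2real_positive_iff less_top)

lemma lq_qnorm_cmult:
  assumes q: "0 < q" and c: "0 < c"
  shows "lq_qnorm q (\<lambda>j. ennreal c * a j) = ennreal c * lq_qnorm q a"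
proof (cases "q = \<infinity>")
  case True
  then show ?thesis by (simp add: lq_qnorm_def SUP_mult_left_ennreal)
next
  case False
  then have Q: "0 < enn2real q" using q by (rule enn2real_pos[rotated])
  have "epowr (ennreal (c powr enn2real q) * (\<Sum>j. epowr (a j) (enn2real q))) (1 / enn2real q)
    = ennreal c * epowr (\<Sum>j. epowr (a j) (enn2real q)) (1 / enn2real q)"
    using c Q by (subst epowr_cmult) (auto simp: powr_powr)
  then show ?thesis using False c Q by (simp add: lq_qnorm_def epowr_cmult)
qed

lemma lq_qnorm_weighted_sum:
  fixes \<delta> :: real
  assumes q: "0 < q" and \<delta>: "\<delta> > 0"
  obtains C where "C > 0" "\<And>x. lq_qnorm q (\<lambda>j. \<Sum>k. ennreal (2 powr (- \<delta> * \<bar>real j - real k\<bar>)) * x k) \<le> ennreal C * lq_qnorm q x"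
proof (cases "q = \<infinity>")
  case True
  obtain K where K: "K > 0" "\<And>j. (\<Sum>k. ennreal (2 powr (- \<delta> * \<bar>real j - real k\<bar>))) \<le> ennreal K"
    using two_sided_sum_bounded[OF \<delta>] by blast
  have "(SUP j. \<Sum>k. ennreal (2 powr (- \<delta> * \<bar>real j - real k\<bar>)) * x k) \<le> ennreal K * (SUP k. x k)" for x
  proof (rule SUP_least)
    fix j
    have "(\<Sum>k. ennreal (2 powr (- \<delta> * \<bar>real j - real k\<bar>)) * x k) \<le> (\<Sum>k. ennreal (2 powr (- \<delta> * \<bar>real j - real k\<bar>)) * (SUP k. x k))"
      by (intro suminf_le allI summableI mult_left_mono SUP_upper) auto
    also have "\<dots> = (\<Sum>k. ennreal (2 powr (- \<delta> * \<bar>real j - real k\<bar>))) * (SUP k. x k)" by (rule ennreal_suminf_multc)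
    also have "\<dots> \<le> ennreal K * (SUP k. x k)" by (intro mult_right_mono K) simp
    finally show "(\<Sum>k. ennreal (2 powr (- \<delta> * \<bar>real j - real k\<bar>)) * x k) \<le> ennreal K * (SUP k. x k)" .
  qed
  then show ?thesis using True K(1) by (intro that[of K]) (auto simp: lq_qnorm_def)
next
  case False
  define Q where "Q = enn2real q"
  have Q: "0 < Q" using q False unfolding Q_def by (rule enn2real_pos)
  obtain C where C: "C > 0" "\<And>j x. epowr (\<Sum>k. ennreal (2 powr (- \<delta> * \<bar>real j - real k\<bar>)) * x k) Q
    \<le> ennreal C * (\<Sum>k. ennreal (2 powr (- (\<delta> * Q / 2) * \<bar>real j - real k\<bar>)) * epowr (x k) Q)"
    using epowr_weighted_sum[OF \<delta> Q] by blast
  have "\<delta> * Q / 2 > 0" using \<delta> Q by simp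
  then obtain K where K: "K > 0" "\<And>j. (\<Sum>k. ennreal (2 powr (- (\<delta> * Q / 2) * \<bar>real j - real k\<bar>))) \<le> ennreal K"
    using two_sided_sum_bounded by blast
  have "lq_qnorm q (\<lambda>j. \<Sum>k. ennreal (2 powr (- \<delta> * \<bar>real j - real k\<bar>)) * x k) \<le> ennreal ((C * K) powr (1 / Q)) * lq_qnorm q x" for x
  proof -
    let ?w = "\<lambda>j k. ennreal (2 powr (- (\<delta> * Q / 2) * \<bar>real j - real k\<bar>))"
    have "(\<Sum>j. epowr (\<Sum>k. ennreal (2 powr (- \<delta> * \<bar>real j - real k\<bar>)) * x k) Q) \<le> (\<Sum>j. ennreal C * (\<Sum>k. ?w j k * epowr (x k) Q))"
      by (intro suminf_le allI summableI C)
    also have "\<dots> = ennreal C * (\<Sum>k. \<Sum>j. ?w j k * epowr (x k) Q)"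
      by (subst suminf_swap_ennreal[symmetric]) (rule ennreal_suminf_cmult)
    also have "\<dots> = ennreal C * (\<Sum>k. (\<Sum>j. ?w k j) * epowr (x k) Q)"
      by (simp add: abs_minus_commute)
    also have "\<dots> \<le> ennreal C * (\<Sum>k. ennreal K * epowr (x k) Q)"
      by (intro mult_left_mono suminf_le allI summableI mult_right_mono K) auto
    also have "\<dots> = ennreal (C * K) * (\<Sum>k. epowr (x k) Q)"
      using C K by (simp add: ennreal_mult mult.assoc)
    finally have "epowr (\<Sum>j. epowr (\<Sum>k. ennreal (2 powr (- \<delta> * \<bar>real j - real k\<bar>)) * x k) Q) (1 / Q) \<le> epowr (ennreal (C * K) * (\<Sum>k. epowr (x k) Q)) (1 / Q)"
      by (rule epowr_mono) (use Q in simp)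
    also have "\<dots> = ennreal ((C * K) powr (1 / Q)) * epowr (\<Sum>k. epowr (x k) Q) (1 / Q)"
      by (rule epowr_cmult) (use C K Q in auto)
    finally show ?thesis using False by (simp add: lq_qnorm_def Q_def)
  qed
  then show ?thesis using C K by (intro that[of "(C * K) powr (1 / Q)"]) auto
qed

lemma lq_qnorm_measurable [measurable (raw)]:
  assumes [measurable]: "\<And>j. (\<lambda>x. f x j) \<in> borel_measurable M"
  shows "(\<lambda>x. lq_qnorm q (f x)) \<in> borel_measurable M"
  unfolding lq_qnorm_def by (cases "q = \<infinity>") (simp_all, measurable)

lemma Lp_qnorm_mono:
  assumes "0 < p" "f \<in> borel_measurable M" "\<And>x. f x \<le> g x"
  shows "Lp_qnorm p M f \<le> Lp_qnorm p M g"
  unfolding Lp_qnorm_def using assms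
  by (auto intro!: esssup_mono epowr_mono nn_integral_mono)

lemma Lp_qnorm_cmult:
  assumes p: "0 < p" and c: "0 < c" and [measurable]: "f \<in> borel_measurable M"
  shows "Lp_qnorm p M (\<lambda>x. ennreal c * f x) \<le> ennreal c * Lp_qnorm p M f"
proof (cases "p = \<infinity>")
  case True
  have "AE x in M. ennreal c * f x \<le> ennreal c * esssup M f"
    using esssup_AE[of f M] by eventually_elim (rule mult_left_mono, auto)
  then have "esssup M (\<lambda>x. ennreal c * f x) \<le> ennreal c * esssup M f" by (intro esssup_I) measurable
  then show ?thesis using True by (simp add: Lp_qnorm_def)
next
  case False
  then have P: "0 < enn2real p" using p by (rule enn2real_pos[rotated])
  have "epowr (ennreal (c powr enn2real p) * (\<integral>\<^sup>+x. epowr (f x) (enn2real p) \<partial>M)) (1 / enn2real p)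
    = ennreal c * epowr (\<integral>\<^sup>+x. epowr (f x) (enn2real p) \<partial>M) (1 / enn2real p)"
    using c P by (subst epowr_cmult) (auto simp: powr_powr)
  then show ?thesis using False c P by (simp add: Lp_qnorm_def epowr_cmult nn_integral_cmult)
qed

lemma Lp_qnorm_weighted_sum:
  fixes \<delta> :: real
  assumes p: "0 < p" and \<delta>: "\<delta> > 0"
  obtains C where "C > 0" "\<And>j f (M :: 'a measure). (\<And>k. f k \<in> borel_measurable M) \<Longrightarrow>
    Lp_qnorm p M (\<lambda>x. \<Sum>k. ennreal (2 powr (- \<delta> * \<bar>real j - real k\<bar>)) * f k x)
      \<le> ennreal C * (\<Sum>k. ennreal (2 powr (- (\<delta> / 4) * \<bar>real j - real k\<bar>)) * Lp_qnorm p M (f k))"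
proof (cases "p = \<infinity>")
  case True
  have "Lp_qnorm p M (\<lambda>x. \<Sum>k. ennreal (2 powr (- \<delta> * \<bar>real j - real k\<bar>)) * f k x)
      \<le> ennreal 1 * (\<Sum>k. ennreal (2 powr (- (\<delta> / 4) * \<bar>real j - real k\<bar>)) * Lp_qnorm p M (f k))"
    if [measurable]: "\<And>k. f k \<in> borel_measurable M" for j f and M :: "'a measure"
  proof -
    have "AE x in M. \<forall>k. f k x \<le> esssup M (f k)" by (subst AE_all_countable) (auto intro: esssup_AE)
    then have "AE x in M. (\<Sum>k. ennreal (2 powr (- \<delta> * \<bar>real j - real k\<bar>)) * f k x) \<le> (\<Sum>k. ennreal (2 powr (- (\<delta> / 4) * \<bar>real j - real k\<bar>)) * esssup M (f k))"
    proof eventually_elim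
      fix x assume x: "\<forall>k. f k x \<le> esssup M (f k)"
      show "(\<Sum>k. ennreal (2 powr (- \<delta> * \<bar>real j - real k\<bar>)) * f k x) \<le> (\<Sum>k. ennreal (2 powr (- (\<delta> / 4) * \<bar>real j - real k\<bar>)) * esssup M (f k))"
        using x \<delta> by (intro suminf_le allI summableI mult_mono ennreal_leI powr_mono mult_right_mono) auto
    qed
    then show ?thesis unfolding Lp_qnorm_def using True by (simp, intro esssup_I) auto
  qed
  then show ?thesis by (intro that[of 1]) auto
next
  case False
  define P where "P = enn2real p"
  have P: "0 < P" using p False unfolding P_def by (rule enn2real_pos)
  obtain C where C: "C > 0" "\<And>j x. epowr (\<Sum>k. ennreal (2 powr (- \<delta> * \<bar>real j - real k\<bar>)) * x k) P
    \<le> ennreal C * (\<Sum>k. ennreal (2 powr (- (\<delta> * P / 2) * \<bar>real j - real k\<bar>)) * epowr (x k) P)"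
    using epowr_weighted_sum[OF \<delta> P] by blast
  have d: "\<delta> * P / 2 > 0" "1 / P > 0" using \<delta> P by simp_all
  obtain D where D: "D > 0" "\<And>j x. epowr (\<Sum>k. ennreal (2 powr (- (\<delta> * P / 2) * \<bar>real j - real k\<bar>)) * x k) (1 / P)
    \<le> ennreal D * (\<Sum>k. ennreal (2 powr (- (\<delta> * P / 2 * (1 / P) / 2) * \<bar>real j - real k\<bar>)) * epowr (x k) (1 / P))"
    using epowr_weighted_sum[OF d] by blast
  have "Lp_qnorm p M (\<lambda>x. \<Sum>k. ennreal (2 powr (- \<delta> * \<bar>real j - real k\<bar>)) * f k x)
      \<le> ennreal (C powr (1 / P) * D) * (\<Sum>k. ennreal (2 powr (- (\<delta> / 4) * \<bar>real j - real k\<bar>)) * Lp_qnorm p M (f k))"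
    if [measurable]: "\<And>k. f k \<in> borel_measurable M" for j f and M :: "'a measure"
  proof -
    let ?w = "\<lambda>k. ennreal (2 powr (- (\<delta> * P / 2) * \<bar>real j - real k\<bar>))"
    have "(\<integral>\<^sup>+x. epowr (\<Sum>k. ennreal (2 powr (- \<delta> * \<bar>real j - real k\<bar>)) * f k x) P \<partial>M) \<le> (\<integral>\<^sup>+x. ennreal C * (\<Sum>k. ?w k * epowr (f k x) P) \<partial>M)"
      by (intro nn_integral_mono C)
    also have "\<dots> = ennreal C * (\<Sum>k. ?w k * (\<integral>\<^sup>+x. epowr (f k x) P \<partial>M))"
      by (subst nn_integral_cmult, measurable, subst nn_integral_suminf, measurable, subst nn_integral_cmult, measurable)
    finally have "epowr (\<integral>\<^sup>+x. epowr (\<Sum>k. ennreal (2 powr (- \<delta> * \<bar>real j - real k\<bar>)) * f k x) P \<partial>M) (1 / P)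
        \<le> epowr (ennreal C * (\<Sum>k. ?w k * (\<integral>\<^sup>+x. epowr (f k x) P \<partial>M))) (1 / P)"
      by (rule epowr_mono) (use P in simp)
    also have "\<dots> = ennreal (C powr (1 / P)) * epowr (\<Sum>k. ?w k * (\<integral>\<^sup>+x. epowr (f k x) P \<partial>M)) (1 / P)"
      by (rule epowr_cmult) (use C P in auto)
    also have "\<dots> \<le> ennreal (C powr (1 / P)) * (ennreal D * (\<Sum>k. ennreal (2 powr (- (\<delta> * P / 2 * (1 / P) / 2) * \<bar>real j - real k\<bar>)) * epowr (\<integral>\<^sup>+x. epowr (f k x) P \<partial>M) (1 / P)))"
      by (intro mult_left_mono D) simp
    also have "\<delta> * P / 2 * (1 / P) / 2 = \<delta> / 4" using P by simp
    finally show ?thesis using False D by (simp add: Lp_qnorm_def P_def ennreal_mult mult.assoc)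
  qed
  then show ?thesis using C D by (intro that[of "C powr (1 / P) * D"]) auto
qed

lemma nn_integral_sum_powr_le:
  fixes w v :: "nat \<Rightarrow> real^'d::finite \<Rightarrow> real" and t C :: real
  assumes w: "\<And>k. bounded_meas (w k)" and v: "\<And>k. bounded_meas (v k)" and t: "t > 0" and C: "C > 0"
    and le: "\<And>n. (LINT x|torus_measure. (\<Sum>k<n. w k x) powr t) \<le> C * (LINT x|torus_measure. (\<Sum>k<n. v k x) powr t)"
  shows "(\<integral>\<^sup>+x. epowr (\<Sum>k. ennreal (w k x)) t \<partial>torus_measure) \<le> ennreal C * (\<integral>\<^sup>+x. epowr (\<Sum>k. ennreal (v k x)) t \<partial>torus_measure)"
proof -
  note w0 = bounded_measD(2)[OF w] and v0 = bounded_measD(2)[OF v]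
  note wm = bounded_measD(1)[OF w]
  have bw: "bounded_meas (\<lambda>x. (\<Sum>k<n. w k x) powr t)" and bv: "bounded_meas (\<lambda>x. (\<Sum>k<n. v k x) powr t)" for n
    using t by (auto intro!: bounded_meas_intros w v)
  have eq: "epowr (\<Sum>k. ennreal (w k x)) t = (SUP n. ennreal ((\<Sum>k<n. w k x) powr t))" for x
    using t by (simp add: suminf_eq_SUP epowr_SUP sum_ennreal w0 epowr_ennreal sum_nonneg)
  have inc: "incseq (\<lambda>n x. ennreal ((\<Sum>k<n. w k x) powr t))"
    unfolding incseq_def le_fun_def using t w0
    by (intro allI impI ennreal_leI powr_mono2 sum_mono2) (auto intro: sum_nonneg)
  have "(\<integral>\<^sup>+x. epowr (\<Sum>k. ennreal (w k x)) t \<partial>torus_measure) = (SUP n. \<integral>\<^sup>+x. ennreal ((\<Sum>k<n. w k x) powr t) \<partial>torus_measure)"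
    unfolding eq by (rule nn_integral_monotone_convergence_SUP[OF inc])
      (use bounded_measD(1)[OF bw] in \<open>auto intro: borel_measurable_torus\<close>)
  also have "\<dots> \<le> ennreal C * (\<integral>\<^sup>+x. epowr (\<Sum>k. ennreal (v k x)) t \<partial>torus_measure)"
  proof (rule SUP_least)
    fix n
    have "(\<integral>\<^sup>+x. ennreal ((\<Sum>k<n. w k x) powr t) \<partial>torus_measure) = ennreal (LINT x|torus_measure. (\<Sum>k<n. w k x) powr t)"
      by (rule nn_integral_eq_integral[OF bounded_meas_integrable[OF bw]]) simp
    also have "\<dots> \<le> ennreal (C * (LINT x|torus_measure. (\<Sum>k<n. v k x) powr t))" by (rule ennreal_leI[OF le])
    also have "\<dots> = ennreal C * ennreal (LINT x|torus_measure. (\<Sum>k<n. v k x) powr t)"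
      using C by (intro ennreal_mult torus_integral_nonneg bv) simp
    also have "ennreal (LINT x|torus_measure. (\<Sum>k<n. v k x) powr t) = (\<integral>\<^sup>+x. ennreal ((\<Sum>k<n. v k x) powr t) \<partial>torus_measure)"
      by (rule nn_integral_eq_integral[OF bounded_meas_integrable[OF bv], symmetric]) simp
    also have "\<dots> \<le> (\<integral>\<^sup>+x. epowr (\<Sum>k. ennreal (v k x)) t \<partial>torus_measure)"
    proof (rule nn_integral_mono)
      fix x
      have "ennreal ((\<Sum>k<n. v k x) powr t) = epowr (\<Sum>k<n. ennreal (v k x)) t"
        by (simp add: sum_ennreal v0 epowr_ennreal sum_nonneg)
      also have "\<dots> \<le> epowr (\<Sum>k. ennreal (v k x)) t"
        by (intro epowr_mono sum_le_suminf) (use t in auto)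
      finally show "ennreal ((\<Sum>k<n. v k x) powr t) \<le> epowr (\<Sum>k. ennreal (v k x)) t" .
    qed
    finally show "(\<integral>\<^sup>+x. ennreal ((\<Sum>k<n. w k x) powr t) \<partial>torus_measure) \<le> ennreal C * (\<integral>\<^sup>+x. epowr (\<Sum>k. ennreal (v k x)) t \<partial>torus_measure)"
      by (simp add: mult_left_mono)
  qed
  finally show ?thesis .
qed

context dyadic_partition
begin

fun seq_qnorm :: "scale \<Rightarrow> real \<Rightarrow> ennreal \<Rightarrow> ennreal \<Rightarrow> (int^'d \<Rightarrow> complex) \<Rightarrow> ennreal" where
  "seq_qnorm Besov s p q a = lq_qnorm q (\<lambda>j. ennreal (2 powr (real j * s)) *
     Lp_qnorm p torus_measure (\<lambda>x. ennreal (norm (block j a x))))"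
| "seq_qnorm Triebel_Lizorkin s p q a = Lp_qnorm p torus_measure (\<lambda>x.
     lq_qnorm q (\<lambda>j. ennreal (2 powr (real j * s) * norm (block j a x))))"

lemma block_measurable [measurable]: "(\<lambda>x. norm (block j a x)) \<in> borel_measurable torus_measure"
  by (rule borel_measurable_torus[OF bounded_measD(1)[OF bounded_meas_block]])

lemma peak_measurable:
  assumes "r > 0" "m > real CARD('d)"
  shows "(\<lambda>x. ennreal (peak k r m a x powr (1 / r))) \<in> borel_measurable torus_measure"
proof -
  have [measurable]: "peak k r m a \<in> borel_measurable torus_measure"
    by (rule borel_measurable_torus[OF bounded_measD(1)[OF bounded_meas_peak[OF assms]]])
  show ?thesis by measurable
qed

lemma bounded_meas_block_powr: "r \<ge> 0 \<Longrightarrow> bounded_meas (\<lambda>x. norm (block k a x) powr r)"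
  by (rule bounded_meas_powr[OF bounded_meas_block])

text \<open>
  The choice of \<open>M\<close> large in terms of \<open>s\<close>, \<open>\<sigma>\<close> and \<open>\<delta>\<close> turns the off-diagonal decay into a
  convolution with \<open>2\<^bsup>-\<delta>|j - k|\<^esup>\<close> after the smoothness weights are included.
\<close>

lemma almost_diagonal_pointwise:
  assumes T: "almost_diagonal \<sigma> T" and r: "r > 0" and m: "m > real CARD('d)" and \<delta>: "\<delta> \<ge> 0"
  obtains C where "C > 0" "\<And>a j x. nonneg_supp a \<Longrightarrow>
    ennreal (2 powr (real j * s)) * ennreal (norm (block j (T a) x)) \<le>
    ennreal C * (\<Sum>k. ennreal (2 powr (- \<delta> * \<bar>real j - real k\<bar>)) * (ennreal (2 powr (real k * (s + \<sigma>))) * ennreal (peak k r m a x powr (1 / r))))"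
proof -
  have M: "\<bar>s\<bar> + \<delta> \<ge> 0" using \<delta> by simp
  obtain C where C: "C > 0" "\<And>a j x. nonneg_supp a \<Longrightarrow>
    norm (block j (T a) x) \<le> C * (\<Sum>k\<le>j + 2. 2 powr (\<sigma> * real k - (\<bar>s\<bar> + \<delta>) * \<bar>real j - real k\<bar>) * peak k r m a x powr (1 / r))"
    using T[unfolded almost_diagonal_def, rule_format, OF M r m] by blast
  have "ennreal (2 powr (real j * s)) * ennreal (norm (block j (T a) x)) \<le>
    ennreal C * (\<Sum>k. ennreal (2 powr (- \<delta> * \<bar>real j - real k\<bar>)) * (ennreal (2 powr (real k * (s + \<sigma>))) * ennreal (peak k r m a x powr (1 / r))))"
    if a: "nonneg_supp a" for a j x
  proof -
    let ?g = "\<lambda>k. peak k r m a x powr (1 / r)"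
    have "2 powr (real j * s) * norm (block j (T a) x) \<le> 2 powr (real j * s) * (C * (\<Sum>k\<le>j + 2. 2 powr (\<sigma> * real k - (\<bar>s\<bar> + \<delta>) * \<bar>real j - real k\<bar>) * ?g k))"
      by (rule mult_left_mono[OF C(2)[OF a]]) simp
    also have "\<dots> = C * (\<Sum>k\<le>j + 2. 2 powr (real j * s + (\<sigma> * real k - (\<bar>s\<bar> + \<delta>) * \<bar>real j - real k\<bar>)) * ?g k)"
      by (simp only: powr_add sum_distrib_left mult_ac)
    also have "\<dots> \<le> C * (\<Sum>k\<le>j + 2. 2 powr (- \<delta> * \<bar>real j - real k\<bar>) * (2 powr (real k * (s + \<sigma>)) * ?g k))"
      unfolding mult.assoc[symmetric] powr_add[symmetric]
    proof (intro mult_left_mono sum_mono mult_right_mono powr_mono)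
      fix k
      have "s * (real j - real k) \<le> \<bar>s\<bar> * \<bar>real j - real k\<bar>" by (metis abs_ge_self abs_mult)
      then show "real j * s + (\<sigma> * real k - (\<bar>s\<bar> + \<delta>) * \<bar>real j - real k\<bar>) \<le> - \<delta> * \<bar>real j - real k\<bar> + real k * (s + \<sigma>)"
        by (simp add: algebra_simps)
    qed (use C in auto)
    finally have 1: "ennreal (2 powr (real j * s) * norm (block j (T a) x)) \<le> ennreal (C * (\<Sum>k\<le>j + 2. 2 powr (- \<delta> * \<bar>real j - real k\<bar>) * (2 powr (real k * (s + \<sigma>)) * ?g k)))"
      by (rule ennreal_leI)
    let ?S1 = "\<Sum>k\<le>j + 2. 2 powr (- \<delta> * \<bar>real j - real k\<bar>) * (2 powr (real k * (s + \<sigma>)) * ?g k)"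
    let ?u = "\<lambda>k. ennreal (2 powr (- \<delta> * \<bar>real j - real k\<bar>)) * (ennreal (2 powr (real k * (s + \<sigma>))) * ennreal (?g k))"
    have u: "ennreal (2 powr (- \<delta> * \<bar>real j - real k\<bar>) * (2 powr (real k * (s + \<sigma>)) * ?g k)) = ?u k" for k
      by (simp add: ennreal_mult)
    have "ennreal ?S1 = (\<Sum>k\<le>j + 2. ?u k)"
      unfolding u[symmetric] by (rule sum_ennreal[symmetric]) simp
    also have "\<dots> \<le> (\<Sum>k. ?u k)" by (rule sum_le_suminf) auto
    finally have 2: "ennreal ?S1 \<le> (\<Sum>k. ?u k)" .
    have "ennreal (2 powr (real j * s)) * ennreal (norm (block j (T a) x)) = ennreal (2 powr (real j * s) * norm (block j (T a) x))"
      by (rule ennreal_mult[symmetric]) auto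
    also have "\<dots> \<le> ennreal (C * ?S1)" by (rule 1)
    also have "\<dots> = ennreal C * ennreal ?S1"
      by (rule ennreal_mult) (use C(1) in simp, rule sum_nonneg, simp)
    also have "\<dots> \<le> ennreal C * (\<Sum>k. ?u k)" by (rule mult_left_mono[OF 2]) simp
    finally show ?thesis .
  qed
  with C(1) show ?thesis by (rule that)
qed

text \<open>
  For finite \<open>p\<close> this rests on the boundedness of the mass of the averaging kernel, for
  \<open>p = \<infinity>\<close> on the essential bound for the block.
\<close>

lemma Lp_peak_le:
  assumes p: "0 < p"
  obtains r m C where "r > 0" "m > real CARD('d)" "C > 0"
    "\<And>k a. Lp_qnorm p torus_measure (\<lambda>x. ennreal (peak k r m a x powr (1 / r))) \<le> ennreal C * Lp_qnorm p torus_measure (\<lambda>x. ennreal (norm (block k a x)))"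
proof -
  define m where "m = real CARD('d) + 1"
  have m: "m > real CARD('d)" by (simp add: m_def)
  obtain K where K: "K > 0" "\<And>l. l > 0 \<Longrightarrow> sym_kernel K (poly_kernel l m :: real^'d \<Rightarrow> _)"
    using sym_kernel_poly[OF m] by blast
  have kk: "sym_kernel K (poly_kernel (2 ^ k) m :: real^'d \<Rightarrow> _)" for k by (rule K) simp
  show ?thesis
  proof (cases "p = \<infinity>")
    case True
    have "esssup torus_measure (\<lambda>x. ennreal (peak k 1 m a x powr (1 / 1))) \<le> ennreal K * esssup torus_measure (\<lambda>x. ennreal (norm (block k a x)))" for k a
    proof (cases "esssup torus_measure (\<lambda>x. ennreal (norm (block k a x)))")
      case (real e)
      have ae: "AE z in torus_measure. norm (block k a z) \<le> e"
        using esssup_AE[of "\<lambda>x. ennreal (norm (block k a x))" torus_measure] unfolding real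
        by eventually_elim (use real in \<open>simp add: ennreal_le_iff\<close>)
      have "peak k 1 m a x \<le> e * K" for x
      proof -
        have "peak k 1 m a x \<le> (LINT z|torus_measure. poly_kernel (2 ^ k) m x z * e)"
          unfolding peak_def kernel_avg_def
        proof (rule integral_mono_AE)
          show "integrable torus_measure (\<lambda>y. poly_kernel (2 ^ k) m x y * norm (block k a y) powr 1)"
            by (intro bounded_meas_integrable bounded_meas_mult sym_kernel_bounded_meas[OF kk] bounded_meas_block_powr) simp
          show "integrable torus_measure (\<lambda>y. poly_kernel (2 ^ k) m x y * e)"
            using real by (intro bounded_meas_integrable bounded_meas_mult sym_kernel_bounded_meas[OF kk] bounded_meas_const) simp
          show "AE y in torus_measure. poly_kernel (2 ^ k) m x y * norm (block k a y) powr 1 \<le> poly_kernel (2 ^ k) m x y * e"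
            using ae by eventually_elim (simp add: mult_left_mono)
        qed
        also have "\<dots> = e * (LINT z|torus_measure. poly_kernel (2 ^ k) m x z)" by (simp add: mult.commute)
        also have "\<dots> \<le> e * K" using real by (intro mult_left_mono sym_kernelD(5)[OF kk]) simp
        finally show ?thesis .
      qed
      moreover have "0 \<le> peak k 1 m a x" for x by (rule bounded_measD(2)[OF bounded_meas_peak]) (use m in auto)
      ultimately have "AE x in torus_measure. ennreal (peak k 1 m a x powr (1 / 1)) \<le> ennreal (e * K)"
        by (intro AE_I2 ennreal_leI) simp
      then have "esssup torus_measure (\<lambda>x. ennreal (peak k 1 m a x powr (1 / 1))) \<le> ennreal (e * K)"
        by (rule esssup_I[OF peak_measurable, rotated 2]) (use m in auto)
      also have "\<dots> = ennreal K * ennreal e" using real K by (simp add: ennreal_mult mult.commute)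
      finally show ?thesis using real by simp
    next
      case top
      then show ?thesis using K by (simp add: ennreal_mult_top)
    qed
    then show ?thesis using True m K(1) by (intro that[of 1 m K]) (auto simp: Lp_qnorm_def)
  next
    case False
    define P where "P = enn2real p"
    have P: "0 < P" using p False unfolding P_def by (rule enn2real_pos)
    have "Lp_qnorm p torus_measure (\<lambda>x. ennreal (peak k P m a x powr (1 / P))) \<le> ennreal (K powr (1 / P)) * Lp_qnorm p torus_measure (\<lambda>x. ennreal (norm (block k a x)))" for k a
    proof -
      have bP: "bounded_meas (\<lambda>x. norm (block k a x) powr P)" by (rule bounded_meas_block_powr) (use P in simp)
      note pk = bounded_meas_peak[OF P m, of k a]
      have "(\<integral>\<^sup>+x. epowr (ennreal (peak k P m a x powr (1 / P))) P \<partial>torus_measure) = (\<integral>\<^sup>+x. ennreal (peak k P m a x) \<partial>torus_measure)"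
        using P bounded_measD(2)[OF pk] by (simp add: epowr_ennreal powr_powr)
      also have "\<dots> = ennreal (LINT x|torus_measure. peak k P m a x)"
        by (rule nn_integral_eq_integral[OF bounded_meas_integrable[OF pk]]) (simp add: bounded_measD(2)[OF pk])
      also have "\<dots> \<le> ennreal (K * (LINT x|torus_measure. norm (block k a x) powr P))"
        unfolding peak_def by (intro ennreal_leI integral_kernel_avg_le kk bP)
      also have "\<dots> = ennreal K * ennreal (LINT x|torus_measure. norm (block k a x) powr P)"
        by (intro ennreal_mult torus_integral_nonneg bP) (use K in simp)
      also have "ennreal (LINT x|torus_measure. norm (block k a x) powr P) = (\<integral>\<^sup>+x. ennreal (norm (block k a x) powr P) \<partial>torus_measure)"
        by (rule nn_integral_eq_integral[OF bounded_meas_integrable[OF bP], symmetric]) simp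
      also have "\<dots> = (\<integral>\<^sup>+x. epowr (ennreal (norm (block k a x))) P \<partial>torus_measure)" by (simp add: epowr_ennreal)
      finally have "epowr (\<integral>\<^sup>+x. epowr (ennreal (peak k P m a x powr (1 / P))) P \<partial>torus_measure) (1 / P)
          \<le> epowr (ennreal K * (\<integral>\<^sup>+x. epowr (ennreal (norm (block k a x))) P \<partial>torus_measure)) (1 / P)"
        by (rule epowr_mono) (use P in simp)
      also have "\<dots> = ennreal (K powr (1 / P)) * epowr (\<integral>\<^sup>+x. epowr (ennreal (norm (block k a x))) P \<partial>torus_measure) (1 / P)"
        by (rule epowr_cmult) (use K P in auto)
      finally show ?thesis using False by (simp add: Lp_qnorm_def P_def)
    qed
    then show ?thesis using P m K(1) by (intro that[of P m "K powr (1 / P)"]) auto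
  qed
qed

theorem Besov_estimate:
  assumes T: "almost_diagonal \<sigma> T" and p: "0 < p" and q: "0 < q"
  obtains C where "C > 0" "\<And>a. nonneg_supp a \<Longrightarrow> seq_qnorm Besov s p q (T a) \<le> ennreal C * seq_qnorm Besov (s + \<sigma>) p q a"
proof -
  obtain r m C1 where r: "r > 0" and m: "m > real CARD('d)" and C1: "C1 > 0"
    "\<And>k a. Lp_qnorm p torus_measure (\<lambda>x. ennreal (peak k r m a x powr (1 / r))) \<le> ennreal C1 * Lp_qnorm p torus_measure (\<lambda>x. ennreal (norm (block k a x)))"
    using Lp_peak_le[OF p] by blast
  obtain C2 where C2: "C2 > 0" "\<And>a j x. nonneg_supp a \<Longrightarrow>
    ennreal (2 powr (real j * s)) * ennreal (norm (block j (T a) x)) \<le>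
    ennreal C2 * (\<Sum>k. ennreal (2 powr (- 4 * \<bar>real j - real k\<bar>)) * (ennreal (2 powr (real k * (s + \<sigma>))) * ennreal (peak k r m a x powr (1 / r))))"
    using almost_diagonal_pointwise[OF T r m zero_le_numeral, where s = s] by blast
  obtain C3 where C3: "C3 > 0" "\<And>j f (M :: (real^'d) measure). (\<And>k. f k \<in> borel_measurable M) \<Longrightarrow>
    Lp_qnorm p M (\<lambda>x. \<Sum>k. ennreal (2 powr (- 4 * \<bar>real j - real k\<bar>)) * f k x)
      \<le> ennreal C3 * (\<Sum>k. ennreal (2 powr (- (4 / 4) * \<bar>real j - real k\<bar>)) * Lp_qnorm p M (f k))"
    using Lp_qnorm_weighted_sum[OF p zero_less_numeral, where 'a = "real^'d"] by blast
  obtain C4 where C4: "C4 > 0" "\<And>x. lq_qnorm q (\<lambda>j. \<Sum>k. ennreal (2 powr (- 1 * \<bar>real j - real k\<bar>)) * x k) \<le> ennreal C4 * lq_qnorm q x"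
    using lq_qnorm_weighted_sum[OF q zero_less_one] by blast
  let ?C = "C2 * C3 * C1"
  have "seq_qnorm Besov s p q (T a) \<le> ennreal (?C * C4) * seq_qnorm Besov (s + \<sigma>) p q a" if a: "nonneg_supp a" for a
  proof -
    let ?f = "\<lambda>k x. ennreal (2 powr (real k * (s + \<sigma>))) * ennreal (peak k r m a x powr (1 / r))"
    let ?L = "\<lambda>k. Lp_qnorm p torus_measure (\<lambda>x. ennreal (norm (block k a x)))"
    have fm: "?f k \<in> borel_measurable torus_measure" for k
      by (intro borel_measurable_times_ennreal borel_measurable_const peak_measurable[OF r m])
    have bm: "(\<lambda>x. ennreal (norm (block j b x))) \<in> borel_measurable torus_measure" for j b by measurable
    have step: "ennreal (2 powr (real j * s)) * Lp_qnorm p torus_measure (\<lambda>x. ennreal (norm (block j (T a) x)))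
      \<le> ennreal ?C * (\<Sum>k. ennreal (2 powr (- 1 * \<bar>real j - real k\<bar>)) * (ennreal (2 powr (real k * (s + \<sigma>))) * ?L k))" for j
    proof -
      let ?b = "\<lambda>x. ennreal (norm (block j (T a) x))"
      let ?c = "2 powr (real j * s)"
      have "Lp_qnorm p torus_measure ?b = Lp_qnorm p torus_measure (\<lambda>x. ennreal (1 / ?c) * (ennreal ?c * ?b x))"
        by (simp add: mult.assoc[symmetric] ennreal_mult[symmetric])
      also have "\<dots> \<le> ennreal (1 / ?c) * Lp_qnorm p torus_measure (\<lambda>x. ennreal ?c * ?b x)"
        by (rule Lp_qnorm_cmult[OF p]) (use bm in auto)
      finally have "ennreal ?c * Lp_qnorm p torus_measure ?b \<le> ennreal ?c * (ennreal (1 / ?c) * Lp_qnorm p torus_measure (\<lambda>x. ennreal ?c * ?b x))"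
        by (rule mult_left_mono) simp
      also have "\<dots> = Lp_qnorm p torus_measure (\<lambda>x. ennreal ?c * ?b x)"
        by (simp add: mult.assoc[symmetric] ennreal_mult[symmetric])
      also have "\<dots> \<le> Lp_qnorm p torus_measure (\<lambda>x. ennreal C2 * (\<Sum>k. ennreal (2 powr (- 4 * \<bar>real j - real k\<bar>)) * ?f k x))"
        by (rule Lp_qnorm_mono[OF p _ C2(2)[OF a]]) (use bm in auto)
      also have "\<dots> \<le> ennreal C2 * Lp_qnorm p torus_measure (\<lambda>x. \<Sum>k. ennreal (2 powr (- 4 * \<bar>real j - real k\<bar>)) * ?f k x)"
        by (rule Lp_qnorm_cmult[OF p C2(1)]) (use fm in measurable)
      also have "\<dots> \<le> ennreal C2 * (ennreal C3 * (\<Sum>k. ennreal (2 powr (- (4 / 4) * \<bar>real j - real k\<bar>)) * Lp_qnorm p torus_measure (?f k)))"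
        by (intro mult_left_mono C3(2) fm) simp
      also have "\<dots> \<le> ennreal C2 * (ennreal C3 * (\<Sum>k. ennreal (2 powr (- 1 * \<bar>real j - real k\<bar>)) * (ennreal C1 * (ennreal (2 powr (real k * (s + \<sigma>))) * ?L k))))"
      proof (intro mult_left_mono suminf_le allI summableI)
        fix k
        have "Lp_qnorm p torus_measure (?f k) \<le> ennreal (2 powr (real k * (s + \<sigma>))) * Lp_qnorm p torus_measure (\<lambda>x. ennreal (peak k r m a x powr (1 / r)))"
          by (rule Lp_qnorm_cmult[OF p _ peak_measurable[OF r m]]) simp
        also have "\<dots> \<le> ennreal (2 powr (real k * (s + \<sigma>))) * (ennreal C1 * ?L k)"
          by (intro mult_left_mono C1) simp
        finally have "Lp_qnorm p torus_measure (?f k) \<le> ennreal C1 * (ennreal (2 powr (real k * (s + \<sigma>))) * ?L k)"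
          by (simp add: mult_ac)
        then show "ennreal (2 powr (- (4 / 4) * \<bar>real j - real k\<bar>)) * Lp_qnorm p torus_measure (?f k)
          \<le> ennreal (2 powr (- 1 * \<bar>real j - real k\<bar>)) * (ennreal C1 * (ennreal (2 powr (real k * (s + \<sigma>))) * ?L k))"
          by (simp add: mult_left_mono)
      qed auto
      also have "\<dots> = ennreal ?C * (\<Sum>k. ennreal (2 powr (- 1 * \<bar>real j - real k\<bar>)) * (ennreal (2 powr (real k * (s + \<sigma>))) * ?L k))"
        using C1 C2 C3 by (simp add: ennreal_mult mult_ac ennreal_suminf_cmult mult.left_commute[of _ "ennreal C1"])
      finally show ?thesis .
    qed
    have "seq_qnorm Besov s p q (T a) \<le> lq_qnorm q (\<lambda>j. ennreal ?C * (\<Sum>k. ennreal (2 powr (- 1 * \<bar>real j - real k\<bar>)) * (ennreal (2 powr (real k * (s + \<sigma>))) * ?L k)))"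
      unfolding seq_qnorm.simps by (rule lq_qnorm_mono[OF q step])
    also have "\<dots> = ennreal ?C * lq_qnorm q (\<lambda>j. \<Sum>k. ennreal (2 powr (- 1 * \<bar>real j - real k\<bar>)) * (ennreal (2 powr (real k * (s + \<sigma>))) * ?L k))"
      by (rule lq_qnorm_cmult[OF q]) (use C1 C2 C3 in simp)
    also have "\<dots> \<le> ennreal ?C * (ennreal C4 * lq_qnorm q (\<lambda>k. ennreal (2 powr (real k * (s + \<sigma>))) * ?L k))"
      by (intro mult_left_mono C4) simp
    also have "\<dots> = ennreal (?C * C4) * seq_qnorm Besov (s + \<sigma>) p q a"
      using C1 C2 C3 C4 by (simp add: ennreal_mult mult.assoc)
    finally show ?thesis .
  qed
  moreover have "?C * C4 > 0" using C1 C2 C3 C4 by simp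
  ultimately show ?thesis using that by blast
qed

text \<open>
  For finite \<open>q\<close> the choice \<open>r = q\<close> makes the \<open>q\<close>-th power of the \<open>\<ell>\<^sup>q\<close> norm a sum of
  averages, to be estimated in \<open>L\<^sup>t\<close> with \<open>t = p/q\<close>. For \<open>q = \<infinity>\<close> the choice \<open>r = p/2\<close> leads to
  a maximum of averages in \<open>L\<^sup>2\<close>.
\<close>

lemma Lp_lq_peak_le:
  assumes p: "0 < p" "p < \<infinity>" and q: "0 < q"
  obtains r m C where "r > 0" "m > real CARD('d)" "C > 0"
    "\<And>a s'. Lp_qnorm p torus_measure (\<lambda>x. lq_qnorm q (\<lambda>k. ennreal (2 powr (real k * s')) * ennreal (peak k r m a x powr (1 / r))))
      \<le> ennreal C * Lp_qnorm p torus_measure (\<lambda>x. lq_qnorm q (\<lambda>k. ennreal (2 powr (real k * s') * norm (block k a x))))"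
proof -
  have pf: "p \<noteq> \<infinity>" using p by auto
  define P where "P = enn2real p"
  have P: "0 < P" using p(1) pf unfolding P_def by (rule enn2real_pos)
  show ?thesis
  proof (cases "q = \<infinity>")
    case False
    define Q where "Q = enn2real q"
    have Q: "0 < Q" using q False unfolding Q_def by (rule enn2real_pos)
    define t where "t = P / Q"
    have t: "t > 0" using P Q by (simp add: t_def)
    define m where "m = (real CARD('d) + 1) * (1 + 1 / t)"
    have m: "m > real CARD('d)" "m * t > real CARD('d)"
    proof -
      have "(real CARD('d) + 1) * 1 \<le> m" unfolding m_def by (rule mult_left_mono) (use t in auto)
      then show "m > real CARD('d)" by simp
      have "m * t = (real CARD('d) + 1) * (t + 1)" using t by (simp add: m_def field_simps)
      also have "\<dots> \<ge> (real CARD('d) + 1) * 1" by (rule mult_left_mono) (use t in auto)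
      finally show "m * t > real CARD('d)" by simp
    qed
    obtain D where D: "D > 0" "\<And>k a x y. norm (block k a y) powr Q \<le> D * (1 + 2 ^ k * torus_dist x y) powr m * peak k Q m a x"
      using peetre_inequality[OF Q m(1)] by blast
    have "\<exists>C>0. \<forall>n (v :: nat \<Rightarrow> real^'d \<Rightarrow> real). (\<forall>k. bounded_meas (v k)) \<longrightarrow>
      (\<forall>k x. v k x \<le> D * kernel_avg (poly_kernel (2 ^ k) m) (v k) x) \<longrightarrow>
      (LINT x|torus_measure. (\<Sum>k<n. kernel_avg (poly_kernel (2 ^ k) m) (v k) x) powr t) \<le> C * (LINT x|torus_measure. (\<Sum>k<n. v k x) powr t)"
    proof (cases "t \<ge> 1")
      case True
      obtain C where "C > 0" "\<And>n (G :: nat \<Rightarrow> real^'d \<Rightarrow> real). (\<And>k. k < n \<Longrightarrow> bounded_meas (G k)) \<Longrightarrow>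
        (LINT x|torus_measure. (\<Sum>k<n. kernel_avg (poly_kernel (2 ^ k) m) (G k) x) powr t)
          \<le> C * (LINT x|torus_measure. (\<Sum>k<n. G k x) powr t)"
        using poly_average_Lp[OF True m(1)] by blast
      then show ?thesis by (intro exI[of _ C]) simp
    next
      case False
      then have "t \<le> 1" by simp
      obtain C where "C > 0" "\<And>n (v :: nat \<Rightarrow> real^'d \<Rightarrow> real). (\<And>k. k < n \<Longrightarrow> bounded_meas (v k)) \<Longrightarrow>
        (\<And>k x. k < n \<Longrightarrow> v k x \<le> D * kernel_avg (poly_kernel (2 ^ k) m) (v k) x) \<Longrightarrow>
        (LINT x|torus_measure. (\<Sum>k<n. kernel_avg (poly_kernel (2 ^ k) m) (v k) x) powr t)
          \<le> C * (LINT x|torus_measure. (\<Sum>k<n. v k x) powr t)"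
        using poly_average_Lp_small[OF t \<open>t \<le> 1\<close> m(2) D(1)] by blast
      then show ?thesis by (intro exI[of _ C]) simp
    qed
    then obtain C where C: "C > 0" "\<And>n (v :: nat \<Rightarrow> real^'d \<Rightarrow> real). (\<And>k. bounded_meas (v k)) \<Longrightarrow>
      (\<And>k x. v k x \<le> D * kernel_avg (poly_kernel (2 ^ k) m) (v k) x) \<Longrightarrow>
      (LINT x|torus_measure. (\<Sum>k<n. kernel_avg (poly_kernel (2 ^ k) m) (v k) x) powr t) \<le> C * (LINT x|torus_measure. (\<Sum>k<n. v k x) powr t)"
      by blast
    have "Lp_qnorm p torus_measure (\<lambda>x. lq_qnorm q (\<lambda>k. ennreal (2 powr (real k * s')) * ennreal (peak k Q m a x powr (1 / Q))))
      \<le> ennreal (C powr (1 / P)) * Lp_qnorm p torus_measure (\<lambda>x. lq_qnorm q (\<lambda>k. ennreal (2 powr (real k * s') * norm (block k a x))))" for a s'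
    proof -
      define c where "c = (\<lambda>k. 2 powr (real k * s' * Q))"
      have c0: "c k \<ge> 0" for k by (simp add: c_def)
      define v where "v = (\<lambda>k x. c k * norm (block k a x) powr Q)"
      define w where "w = (\<lambda>k x. kernel_avg (poly_kernel (2 ^ k) m) (v k) x)"
      have w_eq: "w k x = c k * peak k Q m a x" for k x
        by (simp add: w_def v_def peak_def kernel_avg_def mult.left_commute)
      have v: "bounded_meas (v k)" for k unfolding v_def by (intro bounded_meas_cmult c0 bounded_meas_block_powr) (use Q in simp)
      have w: "bounded_meas (w k)" for k unfolding w_eq[abs_def] by (intro bounded_meas_cmult c0 bounded_meas_peak Q m)
      have dom: "v k x \<le> D * kernel_avg (poly_kernel (2 ^ k) m) (v k) x" for k x
      proof -
        have "norm (block k a x) powr Q \<le> D * peak k Q m a x" using D(2)[of k a x x] by simp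
        then have "c k * norm (block k a x) powr Q \<le> c k * (D * peak k Q m a x)" by (rule mult_left_mono[OF _ c0])
        then show ?thesis using w_eq[of k x] by (simp add: v_def w_def mult_ac)
      qed
      have pk0: "0 \<le> peak k Q m a x" for k x by (rule bounded_measD(2)[OF bounded_meas_peak[OF Q m(1)]])
      have e1: "epowr (ennreal (2 powr (real k * s')) * ennreal (peak k Q m a x powr (1 / Q))) Q = ennreal (w k x)" for k x
        using Q pk0 by (simp add: epowr_cmult epowr_ennreal powr_powr w_eq c_def ennreal_mult mult_ac)
      have e2: "epowr (ennreal (2 powr (real k * s') * norm (block k a x))) Q = ennreal (v k x)" for k x
        using Q by (simp add: epowr_ennreal powr_mult powr_powr v_def c_def mult_ac)
      have conv: "epowr (epowr X (1 / Q)) P = epowr X t" for X using P Q by (simp add: epowr_epowr t_def)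
      have "(\<integral>\<^sup>+x. epowr (\<Sum>k. ennreal (w k x)) t \<partial>torus_measure) \<le> ennreal C * (\<integral>\<^sup>+x. epowr (\<Sum>k. ennreal (v k x)) t \<partial>torus_measure)"
        by (rule nn_integral_sum_powr_le[OF w v t C(1)]) (use C(2)[OF v dom] in \<open>simp add: w_def\<close>)
      then have "epowr (\<integral>\<^sup>+x. epowr (\<Sum>k. ennreal (w k x)) t \<partial>torus_measure) (1 / P) \<le> epowr (ennreal C * (\<integral>\<^sup>+x. epowr (\<Sum>k. ennreal (v k x)) t \<partial>torus_measure)) (1 / P)"
        by (rule epowr_mono) (use P in simp)
      also have "\<dots> = ennreal (C powr (1 / P)) * epowr (\<integral>\<^sup>+x. epowr (\<Sum>k. ennreal (v k x)) t \<partial>torus_measure) (1 / P)"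
        by (rule epowr_cmult) (use C P in auto)
      finally show ?thesis using pf False by (simp add: Lp_qnorm_def lq_qnorm_def P_def[symmetric] Q_def[symmetric] e1 e2 conv del: ennreal_mult')
    qed
    then show ?thesis using Q m(1) C(1) by (intro that[of Q m "C powr (1 / P)"]) auto
  next
    case True
    define r where "r = P / 2"
    have r: "r > 0" using P by (simp add: r_def)
    define m where "m = real CARD('d) + 1"
    have m: "m > real CARD('d)" by (simp add: m_def)
    obtain C where C: "C > 0" "\<And>n (V :: real^'d \<Rightarrow> real) w. bounded_meas V \<Longrightarrow>
      (\<And>k. k < n \<Longrightarrow> bounded_meas (w k)) \<Longrightarrow> (\<And>k x. k < n \<Longrightarrow> w k x \<le> kernel_avg (poly_kernel (2 ^ k) m) V x) \<Longrightarrow> n > 0 \<Longrightarrow>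
      (LINT x|torus_measure. (Max ((\<lambda>k. w k x) ` {..<n}))\<^sup>2) \<le> C * (LINT x|torus_measure. (V x)\<^sup>2)"
      using poly_average_max_L2[OF m] by blast
    obtain K where K: "\<And>l. l > 0 \<Longrightarrow> sym_kernel K (poly_kernel l m :: real^'d \<Rightarrow> _)"
      using sym_kernel_poly[OF m] by blast
    have kk: "sym_kernel K (poly_kernel (2 ^ k) m :: real^'d \<Rightarrow> _)" for k by (rule K) simp
    have "Lp_qnorm p torus_measure (\<lambda>x. lq_qnorm q (\<lambda>k. ennreal (2 powr (real k * s')) * ennreal (peak k r m a x powr (1 / r))))
      \<le> ennreal (C powr (1 / P)) * Lp_qnorm p torus_measure (\<lambda>x. lq_qnorm q (\<lambda>k. ennreal (2 powr (real k * s') * norm (block k a x))))" for a s'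
    proof -
      define c where "c = (\<lambda>k. 2 powr (real k * s' * r))"
      have c0: "c k \<ge> 0" for k by (simp add: c_def)
      define v where "v = (\<lambda>k x. c k * norm (block k a x) powr r)"
      define w where "w = (\<lambda>k x. kernel_avg (poly_kernel (2 ^ k) m) (v k) x)"
      have w_eq: "w k x = c k * peak k r m a x" for k x
        by (simp add: w_def v_def peak_def kernel_avg_def mult.left_commute)
      have v: "bounded_meas (v k)" for k unfolding v_def by (intro bounded_meas_cmult c0 bounded_meas_block_powr) (use r in simp)
      have w: "bounded_meas (w k)" for k unfolding w_eq[abs_def] by (intro bounded_meas_cmult c0 bounded_meas_peak r m)
      note v0 = bounded_measD(2)[OF v] and w0 = bounded_measD(2)[OF w]
      have pk0: "0 \<le> peak k r m a x" for k x by (rule bounded_measD(2)[OF bounded_meas_peak[OF r m]])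
      have Pr: "P = 2 * r" by (simp add: r_def)
      have e1: "epowr (ennreal (2 powr (real k * s')) * ennreal (peak k r m a x powr (1 / r))) P = ennreal ((w k x)\<^sup>2)" for k x
      proof -
        have "epowr (ennreal (2 powr (real k * s')) * ennreal (peak k r m a x powr (1 / r))) r = ennreal (w k x)"
          using r pk0 by (simp add: epowr_cmult epowr_ennreal powr_powr w_eq c_def ennreal_mult mult_ac)
        then have "epowr (epowr (ennreal (2 powr (real k * s')) * ennreal (peak k r m a x powr (1 / r))) r) 2 = ennreal ((w k x)\<^sup>2)"
          using w0 by (simp add: epowr_ennreal)
        then show ?thesis using r by (simp add: epowr_epowr Pr mult.commute)
      qed
      have e2: "epowr (ennreal (2 powr (real k * s') * norm (block k a x))) P = ennreal ((v k x)\<^sup>2)" for k x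
      proof -
        have "epowr (ennreal (2 powr (real k * s') * norm (block k a x))) r = ennreal (v k x)"
          using r by (simp add: epowr_ennreal powr_mult powr_powr v_def c_def mult_ac)
        then have "epowr (epowr (ennreal (2 powr (real k * s') * norm (block k a x))) r) 2 = ennreal ((v k x)\<^sup>2)"
          using v0 by (simp add: epowr_ennreal)
        then show ?thesis using r by (simp add: epowr_epowr Pr mult.commute)
      qed
      define WM where "WM = (\<lambda>n x. Max ((\<lambda>k. w k x) ` {..<Suc n}))"
      define VM where "VM = (\<lambda>n x. Max ((\<lambda>k. v k x) ` {..<Suc n}))"
      have bmax: "bounded_meas (\<lambda>x. Max ((\<lambda>k. f k x) ` {..<Suc n}))" if f: "\<And>k. bounded_meas (f k)" for f :: "nat \<Rightarrow> real^'d \<Rightarrow> real" and n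
      proof (rule bounded_meas_le[OF bounded_meas_sum[where I = "{..<Suc n}" and f = f, OF f]])
        show "(\<lambda>x. Max ((\<lambda>k. f k x) ` {..<Suc n})) \<in> borel_measurable borel"
          by (rule borel_measurable_Max) (auto intro: bounded_measD(1) f)
        fix x
        have "Max ((\<lambda>k. f k x) ` {..<Suc n}) \<in> (\<lambda>k. f k x) ` {..<Suc n}" by (rule Max_in) auto
        then obtain k where k: "k < Suc n" "Max ((\<lambda>k. f k x) ` {..<Suc n}) = f k x" by auto
        show "0 \<le> Max ((\<lambda>k. f k x) ` {..<Suc n})" unfolding k(2) by (rule bounded_measD(2)[OF f])
        show "Max ((\<lambda>k. f k x) ` {..<Suc n}) \<le> (\<Sum>k<Suc n. f k x)" unfolding k(2)
          by (rule member_le_sum) (use k bounded_measD(2)[OF f] in auto)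
      qed
      have WM: "bounded_meas (WM n)" and VM: "bounded_meas (VM n)" for n
        unfolding WM_def VM_def by (intro bmax w v)+
      have sq: "bounded_meas (\<lambda>x. (f x)\<^sup>2)" if "bounded_meas f" for f :: "real^'d \<Rightarrow> real"
        using bounded_meas_mult[OF that that] by (simp add: power2_eq_square)
      have supW: "(SUP k. ennreal ((w k x)\<^sup>2)) = (SUP n. ennreal ((WM n x)\<^sup>2))" for x
      proof (rule antisym)
        show "(SUP k. ennreal ((w k x)\<^sup>2)) \<le> (SUP n. ennreal ((WM n x)\<^sup>2))"
        proof (rule SUP_least)
          fix k
          have "w k x \<le> WM k x" unfolding WM_def by (rule Max_ge) auto
          then have "ennreal ((w k x)\<^sup>2) \<le> ennreal ((WM k x)\<^sup>2)" using w0 by (intro ennreal_leI power_mono)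
          also have "\<dots> \<le> (SUP n. ennreal ((WM n x)\<^sup>2))" by (rule SUP_upper) simp
          finally show "ennreal ((w k x)\<^sup>2) \<le> (SUP n. ennreal ((WM n x)\<^sup>2))" .
        qed
        show "(SUP n. ennreal ((WM n x)\<^sup>2)) \<le> (SUP k. ennreal ((w k x)\<^sup>2))"
        proof (rule SUP_least)
          fix n
          have "WM n x \<in> (\<lambda>k. w k x) ` {..<Suc n}" unfolding WM_def by (rule Max_in) auto
          then obtain k where "WM n x = w k x" by auto
          then show "ennreal ((WM n x)\<^sup>2) \<le> (SUP k. ennreal ((w k x)\<^sup>2))"
            by (simp only:) (rule SUP_upper[of k UNIV "\<lambda>k. ennreal ((w k x)\<^sup>2)"], simp)
        qed
      qed
      have inc: "incseq (\<lambda>n x. ennreal ((WM n x)\<^sup>2))"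
        unfolding incseq_def le_fun_def WM_def using bounded_measD(2)[OF WM, unfolded WM_def]
        by (intro allI impI ennreal_leI power_mono Max_mono image_mono) auto
      have "(\<integral>\<^sup>+x. (SUP k. ennreal ((w k x)\<^sup>2)) \<partial>torus_measure) = (SUP n. \<integral>\<^sup>+x. ennreal ((WM n x)\<^sup>2) \<partial>torus_measure)"
        unfolding supW by (rule nn_integral_monotone_convergence_SUP[OF inc])
          (use bounded_measD(1)[OF sq[OF WM]] in \<open>auto intro: borel_measurable_torus\<close>)
      also have "\<dots> \<le> ennreal C * (\<integral>\<^sup>+x. (SUP k. ennreal ((v k x)\<^sup>2)) \<partial>torus_measure)"
      proof (rule SUP_least)
        fix n
        have "(LINT x|torus_measure. (WM n x)\<^sup>2) \<le> C * (LINT x|torus_measure. (VM n x)\<^sup>2)"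
          unfolding WM_def
        proof (rule C(2)[OF VM w])
          fix k x assume "k < Suc n"
          then have "v k y \<le> VM n y" for y unfolding VM_def by (intro Max_ge) auto
          then show "w k x \<le> kernel_avg (poly_kernel (2 ^ k) m) (VM n) x" unfolding w_def
            by (rule kernel_avg_mono[OF kk v VM])
        qed simp
        then have "ennreal (LINT x|torus_measure. (WM n x)\<^sup>2) \<le> ennreal (C * (LINT x|torus_measure. (VM n x)\<^sup>2))" by (rule ennreal_leI)
        also have "\<dots> = ennreal C * ennreal (LINT x|torus_measure. (VM n x)\<^sup>2)"
          using C by (intro ennreal_mult torus_integral_nonneg sq VM) simp
        also have "ennreal (LINT x|torus_measure. (VM n x)\<^sup>2) = (\<integral>\<^sup>+x. ennreal ((VM n x)\<^sup>2) \<partial>torus_measure)"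
          by (rule nn_integral_eq_integral[OF bounded_meas_integrable[OF sq[OF VM]], symmetric]) simp
        also have "\<dots> \<le> (\<integral>\<^sup>+x. (SUP k. ennreal ((v k x)\<^sup>2)) \<partial>torus_measure)"
        proof (rule nn_integral_mono)
          fix x
          have "VM n x \<in> (\<lambda>k. v k x) ` {..<Suc n}" unfolding VM_def by (rule Max_in) auto
          then obtain k where "VM n x = v k x" by auto
          then show "ennreal ((VM n x)\<^sup>2) \<le> (SUP k. ennreal ((v k x)\<^sup>2))"
            by (simp only:) (rule SUP_upper[of k UNIV "\<lambda>k. ennreal ((v k x)\<^sup>2)"], simp)
        qed
        also have "ennreal (LINT x|torus_measure. (WM n x)\<^sup>2) = (\<integral>\<^sup>+x. ennreal ((WM n x)\<^sup>2) \<partial>torus_measure)"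
          by (rule nn_integral_eq_integral[OF bounded_meas_integrable[OF sq[OF WM]], symmetric]) simp
        finally show "(\<integral>\<^sup>+x. ennreal ((WM n x)\<^sup>2) \<partial>torus_measure) \<le> ennreal C * (\<integral>\<^sup>+x. (SUP k. ennreal ((v k x)\<^sup>2)) \<partial>torus_measure)"
          by (simp add: mult_left_mono)
      qed
      finally have "epowr (\<integral>\<^sup>+x. (SUP k. ennreal ((w k x)\<^sup>2)) \<partial>torus_measure) (1 / P) \<le> epowr (ennreal C * (\<integral>\<^sup>+x. (SUP k. ennreal ((v k x)\<^sup>2)) \<partial>torus_measure)) (1 / P)"
        by (rule epowr_mono) (use P in simp)
      also have "\<dots> = ennreal (C powr (1 / P)) * epowr (\<integral>\<^sup>+x. (SUP k. ennreal ((v k x)\<^sup>2)) \<partial>torus_measure) (1 / P)"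
        by (rule epowr_cmult) (use C P in auto)
      finally show ?thesis using pf True P by (simp add: Lp_qnorm_def lq_qnorm_def P_def[symmetric] epowr_SUP e1 e2 del: ennreal_mult')
    qed
    then show ?thesis using r m C(1) by (intro that[of r m "C powr (1 / P)"]) auto
  qed
qed

theorem Triebel_Lizorkin_estimate:
  assumes T: "almost_diagonal \<sigma> T" and p: "0 < p" "p < \<infinity>" and q: "0 < q"
  obtains C where "C > 0" "\<And>a. nonneg_supp a \<Longrightarrow> seq_qnorm Triebel_Lizorkin s p q (T a) \<le> ennreal C * seq_qnorm Triebel_Lizorkin (s + \<sigma>) p q a"
proof -
  obtain r m C1 where r: "r > 0" and m: "m > real CARD('d)" and C1: "C1 > 0"
    "\<And>a s'. Lp_qnorm p torus_measure (\<lambda>x. lq_qnorm q (\<lambda>k. ennreal (2 powr (real k * s')) * ennreal (peak k r m a x powr (1 / r))))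
      \<le> ennreal C1 * Lp_qnorm p torus_measure (\<lambda>x. lq_qnorm q (\<lambda>k. ennreal (2 powr (real k * s') * norm (block k a x))))"
    using Lp_lq_peak_le[OF p q] by blast
  obtain C2 where C2: "C2 > 0" "\<And>a j x. nonneg_supp a \<Longrightarrow>
    ennreal (2 powr (real j * s)) * ennreal (norm (block j (T a) x)) \<le>
    ennreal C2 * (\<Sum>k. ennreal (2 powr (- 1 * \<bar>real j - real k\<bar>)) * (ennreal (2 powr (real k * (s + \<sigma>))) * ennreal (peak k r m a x powr (1 / r))))"
    using almost_diagonal_pointwise[OF T r m zero_le_one, where s = s] by blast
  obtain C3 where C3: "C3 > 0" "\<And>x. lq_qnorm q (\<lambda>j. \<Sum>k. ennreal (2 powr (- 1 * \<bar>real j - real k\<bar>)) * x k) \<le> ennreal C3 * lq_qnorm q x"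
    using lq_qnorm_weighted_sum[OF q zero_less_one] by blast
  have "seq_qnorm Triebel_Lizorkin s p q (T a) \<le> ennreal (C2 * C3 * C1) * seq_qnorm Triebel_Lizorkin (s + \<sigma>) p q a" if a: "nonneg_supp a" for a
  proof -
    let ?f = "\<lambda>x k. ennreal (2 powr (real k * (s + \<sigma>))) * ennreal (peak k r m a x powr (1 / r))"
    have fm: "(\<lambda>x. ?f x k) \<in> borel_measurable torus_measure" for k
      by (intro borel_measurable_times_ennreal borel_measurable_const peak_measurable[OF r m])
    have lm: "(\<lambda>x. lq_qnorm q (?f x)) \<in> borel_measurable torus_measure"
      by (rule lq_qnorm_measurable[OF fm])
    have pt: "lq_qnorm q (\<lambda>j. ennreal (2 powr (real j * s) * norm (block j (T a) x))) \<le> ennreal (C2 * C3) * lq_qnorm q (?f x)" for x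
    proof -
      have "lq_qnorm q (\<lambda>j. ennreal (2 powr (real j * s) * norm (block j (T a) x))) \<le>
        lq_qnorm q (\<lambda>j. ennreal C2 * (\<Sum>k. ennreal (2 powr (- 1 * \<bar>real j - real k\<bar>)) * ?f x k))"
      proof (rule lq_qnorm_mono[OF q])
        fix j
        have "ennreal (2 powr (real j * s) * norm (block j (T a) x)) = ennreal (2 powr (real j * s)) * ennreal (norm (block j (T a) x))"
          by (rule ennreal_mult) auto
        also have "\<dots> \<le> ennreal C2 * (\<Sum>k. ennreal (2 powr (- 1 * \<bar>real j - real k\<bar>)) * ?f x k)" by (rule C2(2)[OF a])
        finally show "ennreal (2 powr (real j * s) * norm (block j (T a) x)) \<le> ennreal C2 * (\<Sum>k. ennreal (2 powr (- 1 * \<bar>real j - real k\<bar>)) * ?f x k)" .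
      qed
      also have "\<dots> = ennreal C2 * lq_qnorm q (\<lambda>j. \<Sum>k. ennreal (2 powr (- 1 * \<bar>real j - real k\<bar>)) * ?f x k)"
        by (rule lq_qnorm_cmult[OF q C2(1)])
      also have "\<dots> \<le> ennreal C2 * (ennreal C3 * lq_qnorm q (?f x))" by (intro mult_left_mono C3) simp
      finally show ?thesis using C2 C3 by (simp add: ennreal_mult mult.assoc)
    qed
    have "seq_qnorm Triebel_Lizorkin s p q (T a) \<le> Lp_qnorm p torus_measure (\<lambda>x. ennreal (C2 * C3) * lq_qnorm q (?f x))"
      unfolding seq_qnorm.simps
    proof (rule Lp_qnorm_mono[OF p(1) _ pt])
      show "(\<lambda>x. lq_qnorm q (\<lambda>j. ennreal (2 powr (real j * s) * norm (block j (T a) x)))) \<in> borel_measurable torus_measure"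
        by (rule lq_qnorm_measurable) measurable
    qed
    also have "\<dots> \<le> ennreal (C2 * C3) * Lp_qnorm p torus_measure (\<lambda>x. lq_qnorm q (?f x))"
      by (rule Lp_qnorm_cmult[OF p(1) _ lm]) (use C2 C3 in simp)
    also have "\<dots> \<le> ennreal (C2 * C3) * (ennreal C1 * seq_qnorm Triebel_Lizorkin (s + \<sigma>) p q a)"
      unfolding seq_qnorm.simps by (intro mult_left_mono C1) simp
    finally show ?thesis using C1 C2 C3 by (simp add: ennreal_mult mult.assoc)
  qed
  moreover have "C2 * C3 * C1 > 0" using C1 C2 C3 by simp
  ultimately show ?thesis using that by blast
qed

theorem seq_qnorm_estimate:
  assumes T: "almost_diagonal \<sigma> T" and "admissible A p q"
  obtains C where "C > 0" "\<And>a. nonneg_supp a \<Longrightarrow> seq_qnorm A s p q (T a) \<le> ennreal C * seq_qnorm A (s + \<sigma>) p q a"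
proof (cases A)
  case Besov
  then show ?thesis using assms that Besov_estimate[OF T, of p q s] by auto
next
  case Triebel_Lizorkin
  then show ?thesis using assms that Triebel_Lizorkin_estimate[OF T, of p q s] by auto
qed

end

section \<open>Power series with polynomially bounded coefficients\<close>

definition poly_bdd :: "(int^'d::finite \<Rightarrow> complex) \<Rightarrow> bool"
  where "poly_bdd a \<longleftrightarrow> (\<exists>C N. \<forall>n. norm (a n) \<le> C * (1 + norm (int_vec n)) ^ N)"

lemma poly_bddE:
  assumes "poly_bdd a"
  obtains C N where "C \<ge> 0" "\<And>n. norm (a n) \<le> C * (1 + norm (int_vec n)) ^ N"
proof -
  obtain C N where C: "\<And>n. norm (a n) \<le> C * (1 + norm (int_vec n)) ^ N"
    using assms unfolding poly_bdd_def by blast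
  have "norm (a 0) \<le> C" using C[of 0] by simp
  then have "C \<ge> 0" using norm_ge_zero[of "a 0"] by linarith
  then show ?thesis using C by (rule that)
qed

lemma inj_nat_vec: "inj nat_vec"
  by (auto simp: inj_on_def nat_vec_def vec_eq_iff)

lemma nat_vec_nth [simp]: "nat_vec n $ i = int (n $ i)"
  by (simp add: nat_vec_def)

lemma nat_vec_cases:
  obtains m where "n = nat_vec m" | i where "n $ i < 0"
proof (cases "\<exists>i. n $ i < 0")
  case False
  then have "n = nat_vec (\<chi> i. nat (n $ i))" by (auto simp: vec_eq_iff not_less)
  then show ?thesis by (rule that(1))
qed (use that(2) in blast)

lemma one_plus_sum_le_prod: "finite S \<Longrightarrow> 1 + (\<Sum>i\<in>S. x i) \<le> (\<Prod>i\<in>S. 1 + x i)"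
  if "\<And>i. 0 \<le> x i" for x :: "'i \<Rightarrow> real"
proof (induction S rule: finite_induct)
  case (insert i S)
  have "1 + (x i + sum x S) \<le> (1 + x i) * (1 + sum x S)"
    using that[of i] sum_nonneg[of S x, OF that] by (simp add: algebra_simps)
  also have "\<dots> \<le> (1 + x i) * (\<Prod>i\<in>S. 1 + x i)"
    using that[of i] insert.IH by (intro mult_left_mono) auto
  finally show ?case using insert.hyps by simp
qed simp

lemma norm_nat_vec_le_prod: "1 + norm (int_vec (nat_vec n)) \<le> (\<Prod>i\<in>UNIV. 1 + real (n $ i))"
proof -
  have "1 + norm (int_vec (nat_vec n)) \<le> 1 + (\<Sum>i\<in>UNIV. real (n $ i))"
    using norm_int_vec_le_sum[of "nat_vec n"] by simp
  also have "\<dots> \<le> (\<Prod>i\<in>UNIV. 1 + real (n $ i))" by (rule one_plus_sum_le_prod) auto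
  finally show ?thesis .
qed

lemma summable_on_prod_vec:
  fixes g :: "nat \<Rightarrow> real"
  assumes g: "\<And>k. 0 \<le> g k" "summable g"
  shows "(\<lambda>n::nat^'d::finite. \<Prod>i\<in>UNIV. g (n $ i)) summable_on UNIV"
proof (rule nonneg_bdd_above_summable_on)
  show "bdd_above (sum (\<lambda>n::nat^'d. \<Prod>i\<in>UNIV. g (n $ i)) ` {F. F \<subseteq> UNIV \<and> finite F})"
  proof (rule bdd_aboveI2)
    fix F :: "(nat^'d) set" assume "F \<in> {F. F \<subseteq> UNIV \<and> finite F}"
    then have F: "finite F" by simp
    have "finite (\<Union>n\<in>F. range (\<lambda>i. n $ i))" using F by auto
    then obtain R where R: "\<And>n i. n \<in> F \<Longrightarrow> n $ i < R"
      by (auto simp: finite_nat_set_iff_bounded)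
    let ?P = "PiE (UNIV :: 'd set) (\<lambda>_. {..<R})"
    have sub: "F \<subseteq> vec_lambda ` ?P"
    proof
      fix n assume n: "n \<in> F"
      then have "(\<lambda>i. n $ i) \<in> ?P" using R by auto
      then show "n \<in> vec_lambda ` ?P" by (rule rev_image_eqI) simp
    qed
    have inj: "inj_on vec_lambda ?P" by (simp add: inj_on_def vec_lambda_inject)
    have "(\<Sum>n\<in>F. \<Prod>i\<in>UNIV. g (n $ i)) \<le> (\<Sum>n\<in>vec_lambda ` ?P. \<Prod>i\<in>UNIV. g (n $ i))"
      by (rule sum_mono2[OF _ sub]) (auto intro!: finite_imageI finite_PiE prod_nonneg g)
    also have "\<dots> = (\<Sum>h\<in>?P. \<Prod>i\<in>UNIV. g (h i))" by (simp add: sum.reindex[OF inj])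
    also have "\<dots> = (\<Prod>i\<in>(UNIV::'d set). \<Sum>k<R. g k)" by (rule prod_sum_PiE[symmetric]) auto
    also have "\<dots> \<le> (\<Prod>i\<in>(UNIV::'d set). suminf g)"
      by (intro prod_mono conjI sum_nonneg sum_le_suminf g) auto
    finally show "(\<Sum>n\<in>F. \<Prod>i\<in>UNIV. g (n $ i)) \<le> (\<Prod>i\<in>(UNIV::'d set). suminf g)" .
  qed
qed (simp add: prod_nonneg g)

lemma summable_power_times_geometric:
  fixes \<rho> :: real
  assumes "0 < \<rho>" "\<rho> < 1"
  shows "summable (\<lambda>k. (1 + real k) ^ N * \<rho> ^ k)"
proof -
  have "(\<lambda>k. (1 + inverse (real (Suc k))) ^ N * \<rho>) \<longlonglongrightarrow> (1 + 0) ^ N * \<rho>"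
    by (intro tendsto_intros LIMSEQ_inverse_real_of_nat)
  then have "(\<lambda>k. (1 + inverse (real (Suc k))) ^ N * \<rho>) \<longlonglongrightarrow> \<rho>" by simp
  moreover have "\<rho> < (1 + \<rho>) / 2" using assms by simp
  ultimately have "\<forall>\<^sub>F k in sequentially. (1 + inverse (real (Suc k))) ^ N * \<rho> < (1 + \<rho>) / 2"
    by (rule order_tendstoD(2))
  then obtain K where K: "\<And>k. k \<ge> K \<Longrightarrow> (1 + inverse (real (Suc k))) ^ N * \<rho> < (1 + \<rho>) / 2"
    by (auto simp: eventually_sequentially)
  show ?thesis
  proof (rule summable_ratio_test[of "(1 + \<rho>) / 2" K])
    fix k assume k: "k \<ge> K"
    have "1 + real (Suc k) = (1 + inverse (real (Suc k))) * (1 + real k)" by (simp add: field_simps)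
    then have "(1 + real (Suc k)) ^ N * \<rho> ^ Suc k = ((1 + inverse (real (Suc k))) ^ N * \<rho>) * ((1 + real k) ^ N * \<rho> ^ k)"
      by (simp only: power_mult_distrib power_Suc mult_ac)
    also have "\<dots> \<le> (1 + \<rho>) / 2 * ((1 + real k) ^ N * \<rho> ^ k)"
      using K[OF k] assms by (intro mult_right_mono) auto
    finally show "norm ((1 + real (Suc k)) ^ N * \<rho> ^ Suc k) \<le> (1 + \<rho>) / 2 * norm ((1 + real k) ^ N * \<rho> ^ k)"
      using assms by simp
  qed (use assms in simp)
qed

text \<open>A majorant that also controls the derivatives of the monomials on the polydisc of radius \<open>\<rho>\<close>.\<close>

lemma poly_bdd_majorant:
  fixes a :: "int^'d::finite \<Rightarrow> complex"
  assumes a: "poly_bdd a" and \<rho>: "0 < \<rho>" "\<rho> < 1"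
  obtains M :: "nat^'d \<Rightarrow> real" where "M summable_on UNIV"
    "\<And>n. norm (a (nat_vec n)) * (\<Prod>i\<in>UNIV. (1 + real (n $ i)) * \<rho> ^ (n $ i)) \<le> M n"
proof -
  obtain C N where C: "C \<ge> 0" "\<And>n. norm (a n) \<le> C * (1 + norm (int_vec n)) ^ N"
    using poly_bddE[OF a] by blast
  let ?g = "\<lambda>k. (1 + real k) ^ Suc N * \<rho> ^ k"
  show ?thesis
  proof (rule that[of "\<lambda>n. C * (\<Prod>i\<in>UNIV. ?g (n $ i))"])
    show "(\<lambda>n::nat^'d. C * (\<Prod>i\<in>UNIV. ?g (n $ i))) summable_on UNIV"
      using \<rho> summable_power_times_geometric[OF \<rho>, of "Suc N"]
      by (intro summable_on_cmult_right summable_on_prod_vec) auto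
    fix n :: "nat^'d"
    have "norm (a (nat_vec n)) \<le> C * (\<Prod>i\<in>UNIV. 1 + real (n $ i)) ^ N"
      by (rule order_trans[OF C(2)]) (intro mult_left_mono power_mono norm_nat_vec_le_prod C(1), simp)
    then have "norm (a (nat_vec n)) * (\<Prod>i\<in>UNIV. (1 + real (n $ i)) * \<rho> ^ (n $ i))
      \<le> (C * (\<Prod>i\<in>UNIV. 1 + real (n $ i)) ^ N) * (\<Prod>i\<in>UNIV. (1 + real (n $ i)) * \<rho> ^ (n $ i))"
      using \<rho> by (intro mult_right_mono prod_nonneg) auto
    also have "\<dots> = C * (\<Prod>i\<in>UNIV. ?g (n $ i))"
      by (simp add: prod.distrib prod_power_distrib mult_ac)
    finally show "norm (a (nat_vec n)) * (\<Prod>i\<in>UNIV. (1 + real (n $ i)) * \<rho> ^ (n $ i)) \<le> C * (\<Prod>i\<in>UNIV. ?g (n $ i))" .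
  qed
qed

abbreviation zpow :: "complex^'d::finite \<Rightarrow> nat^'d \<Rightarrow> complex"
  where "zpow z n \<equiv> (\<Prod>i\<in>UNIV. z $ i ^ (n $ i))"

definition zpow_deriv :: "complex^'d::finite \<Rightarrow> nat^'d \<Rightarrow> complex^'d \<Rightarrow> complex"
  where "zpow_deriv z n h = (\<Sum>i\<in>UNIV. (of_nat (n $ i) * h $ i * z $ i ^ (n $ i - 1)) * (\<Prod>j\<in>UNIV - {i}. z $ j ^ (n $ j)))"

lemma zpow_has_derivative: "((\<lambda>z. zpow z n) has_derivative zpow_deriv z n) (at z within S)"
proof -
  have 1: "((\<lambda>z. z $ i ^ (n $ i)) has_derivative (\<lambda>h. of_nat (n $ i) * h $ i * z $ i ^ (n $ i - 1))) (at z within S)" for i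
    by (rule has_derivative_power[OF bounded_linear_imp_has_derivative[OF bounded_linear_vec_nth]])
  show ?thesis unfolding zpow_deriv_def[abs_def] by (rule has_derivative_prod[OF 1])
qed

lemma zpow_deriv_scale: "zpow_deriv z n (c *s h) = c * zpow_deriv z n h"
  by (simp add: zpow_deriv_def sum_distrib_left mult_ac)

lemma zpow_deriv_self: "zpow_deriv z n z = of_nat (\<Sum>i\<in>UNIV. n $ i) * zpow z n"
proof -
  have "(of_nat (n $ i) * z $ i * z $ i ^ (n $ i - 1)) * (\<Prod>j\<in>UNIV - {i}. z $ j ^ (n $ j)) = of_nat (n $ i) * zpow z n" for i
  proof -
    have "of_nat (n $ i) * z $ i * z $ i ^ (n $ i - 1) = of_nat (n $ i) * z $ i ^ (n $ i)"
      by (cases "n $ i") auto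
    moreover have "zpow z n = z $ i ^ (n $ i) * (\<Prod>j\<in>UNIV - {i}. z $ j ^ (n $ j))" by (rule prod.remove) auto
    ultimately show ?thesis by (simp only: mult.assoc)
  qed
  then show ?thesis by (simp only: zpow_deriv_def of_nat_sum sum_distrib_right)
qed

lemma norm_zpow_le:
  assumes "\<And>i. norm (z $ i) \<le> \<rho>"
  shows "norm (zpow z n) \<le> (\<Prod>i\<in>UNIV. (1 + real (n $ i)) * \<rho> ^ (n $ i))"
  unfolding prod_norm[symmetric] norm_power
proof (intro prod_mono conjI)
  fix i
  have \<rho>: "0 \<le> \<rho>" using assms[of i] norm_ge_zero order_trans by blast
  have "norm (z $ i) ^ (n $ i) \<le> \<rho> ^ (n $ i)" by (rule power_mono[OF assms]) simp
  also have "\<dots> \<le> (1 + real (n $ i)) * \<rho> ^ (n $ i)" using \<rho> by (simp add: mult_le_cancel_right1)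
  finally show "norm (z $ i) ^ (n $ i) \<le> (1 + real (n $ i)) * \<rho> ^ (n $ i)" .
qed simp

lemma norm_zpow_deriv_le:
  fixes z h :: "complex^'d::finite"
  assumes z: "\<And>i. norm (z $ i) \<le> \<rho>" and \<rho>: "0 < \<rho>"
  shows "norm (zpow_deriv z n h) \<le> real CARD('d) / \<rho> * (\<Prod>i\<in>UNIV. (1 + real (n $ i)) * \<rho> ^ (n $ i)) * norm h"
proof -
  let ?Q = "\<Prod>i\<in>UNIV. (1 + real (n $ i)) * \<rho> ^ (n $ i)"
  have "norm ((of_nat (n $ i) * h $ i * z $ i ^ (n $ i - 1)) * (\<Prod>j\<in>UNIV - {i}. z $ j ^ (n $ j))) \<le> ?Q / \<rho> * norm h" for i
  proof -
    have 1: "real (n $ i) * norm (z $ i) ^ (n $ i - 1) \<le> (1 + real (n $ i)) * \<rho> ^ (n $ i) / \<rho>"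
    proof (cases "n $ i")
      case (Suc k)
      have "real (n $ i) * norm (z $ i) ^ k \<le> (1 + real (n $ i)) * \<rho> ^ k"
        by (intro mult_mono power_mono z) (use \<rho> in auto)
      then show ?thesis using \<rho> Suc by simp
    qed (use \<rho> in simp)
    have 2: "(\<Prod>j\<in>UNIV - {i}. norm (z $ j) ^ (n $ j)) \<le> (\<Prod>j\<in>UNIV - {i}. (1 + real (n $ j)) * \<rho> ^ (n $ j))"
    proof (intro prod_mono conjI)
      fix j
      have "norm (z $ j) ^ (n $ j) \<le> \<rho> ^ (n $ j)" by (rule power_mono[OF z]) simp
      also have "\<dots> \<le> (1 + real (n $ j)) * \<rho> ^ (n $ j)" using \<rho> by (simp add: mult_le_cancel_right1)
      finally show "norm (z $ j) ^ (n $ j) \<le> (1 + real (n $ j)) * \<rho> ^ (n $ j)" .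
    qed simp
    have "norm ((of_nat (n $ i) * h $ i * z $ i ^ (n $ i - 1)) * (\<Prod>j\<in>UNIV - {i}. z $ j ^ (n $ j)))
      = (real (n $ i) * norm (z $ i) ^ (n $ i - 1)) * (\<Prod>j\<in>UNIV - {i}. norm (z $ j) ^ (n $ j)) * norm (h $ i)"
      by (simp add: norm_mult norm_power prod_norm[symmetric])
    also have "\<dots> \<le> ((1 + real (n $ i)) * \<rho> ^ (n $ i) / \<rho>) * (\<Prod>j\<in>UNIV - {i}. (1 + real (n $ j)) * \<rho> ^ (n $ j)) * norm h"
      by (intro mult_mono 1 2 mult_nonneg_nonneg prod_nonneg) (use \<rho> Finite_Cartesian_Product.norm_nth_le[of h i] in auto)
    also have "\<dots> = ?Q / \<rho> * norm h" by (subst prod.remove[of UNIV i]) auto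
    finally show ?thesis .
  qed
  then have "norm (zpow_deriv z n h) \<le> (\<Sum>i\<in>(UNIV::'d set). ?Q / \<rho> * norm h)"
    unfolding zpow_deriv_def by (intro order_trans[OF norm_sum] sum_mono)
  then show ?thesis by simp
qed

lemma polydisc_radius:
  assumes "z \<in> polydisc"
  obtains \<rho> where "0 < \<rho>" "\<rho> < 1" "\<And>i. norm (z $ i) < \<rho>"
proof -
  define m where "m = Max (range (\<lambda>i. norm (z $ i)))"
  have le: "norm (z $ i) \<le> m" for i unfolding m_def by (rule Max_ge) auto
  have m1: "m < 1" using assms unfolding m_def by (subst Max_less_iff) (auto simp: polydisc_def)
  have m0: "0 \<le> m" using le[of undefined] norm_ge_zero order_trans by blast
  show ?thesis
  proof (rule that[of "(1 + m) / 2"])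
    fix i show "norm (z $ i) < (1 + m) / 2" using le[of i] m1 by simp
  qed (use m0 m1 in auto)
qed

definition power_fun :: "(int^'d::finite \<Rightarrow> complex) \<Rightarrow> complex^'d \<Rightarrow> complex"
  where "power_fun a z = (if z \<in> polydisc then \<Sum>\<^sub>\<infinity>n. a (nat_vec n) * zpow z n else 0)"

lemma power_fun_has_sum:
  assumes a: "poly_bdd a" and z: "z \<in> polydisc"
  shows "((\<lambda>n. a (nat_vec n) * zpow z n) has_sum power_fun a z) UNIV"
proof -
  obtain \<rho> where \<rho>: "0 < \<rho>" "\<rho> < 1" "\<And>i. norm (z $ i) < \<rho>" using polydisc_radius[OF z] by blast
  obtain M where M: "M summable_on UNIV"
    "\<And>n. norm (a (nat_vec n)) * (\<Prod>i\<in>UNIV. (1 + real (n $ i)) * \<rho> ^ (n $ i)) \<le> M n"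
    using poly_bdd_majorant[OF a \<rho>(1,2)] by blast
  have "norm (a (nat_vec n) * zpow z n) \<le> M n" for n
  proof -
    have "norm (a (nat_vec n)) * norm (zpow z n) \<le> norm (a (nat_vec n)) * (\<Prod>i\<in>UNIV. (1 + real (n $ i)) * \<rho> ^ (n $ i))"
      by (intro mult_left_mono norm_zpow_le less_imp_le[OF \<rho>(3)]) simp
    then show ?thesis using M(2)[of n] by (simp only: norm_mult)
  qed
  from Infinite_Sum.abs_summable_on_comparison_test'[OF M(1) this]
  have "(\<lambda>n. a (nat_vec n) * zpow z n) summable_on UNIV" by (rule abs_summable_summable)
  then show ?thesis using z by (simp add: power_fun_def)
qed

text \<open>
  Termwise differentiation on a smaller polydisc, along an enumeration of the exponents, with
  the majorant above.
\<close>

lemma power_fun_has_derivative: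
  fixes a :: "int^'d::finite \<Rightarrow> complex"
  assumes a: "poly_bdd a" and z: "z \<in> polydisc"
  obtains D where "(power_fun a has_derivative D) (at z)"
    "\<And>h. ((\<lambda>n. a (nat_vec n) * zpow_deriv z n h) has_sum D h) UNIV"
proof -
  obtain \<rho> where \<rho>: "0 < \<rho>" "\<rho> < 1" "\<And>i. norm (z $ i) < \<rho>" using polydisc_radius[OF z] by blast
  obtain M where M: "M summable_on UNIV"
    "\<And>n. norm (a (nat_vec n)) * (\<Prod>i\<in>UNIV. (1 + real (n $ i)) * \<rho> ^ (n $ i)) \<le> M n"
    using poly_bdd_majorant[OF a \<rho>(1,2)] by blast
  define S where "S = {y :: complex^'d. \<forall>i. norm (y $ i) < \<rho>}"
  have zS: "z \<in> S" using \<rho> by (simp add: S_def)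
  have Sd: "S \<subseteq> polydisc" using \<rho>(2) by (auto simp: S_def polydisc_def intro: less_trans)
  have "S = (\<Inter>i. {y. norm (y $ i) < \<rho>})" by (auto simp: S_def)
  also have "open \<dots>" by (intro open_INT ballI finite open_Collect_less continuous_intros)
  finally have Sopen: "open S" .
  have Sconv: "convex S"
  proof (rule convexI)
    fix x y :: "complex^'d" and u v :: real assume *: "x \<in> S" "y \<in> S" "0 \<le> u" "0 \<le> v" "u + v = 1"
    have "norm ((u *\<^sub>R x + v *\<^sub>R y) $ i) < \<rho>" for i
    proof -
      have "norm (u *\<^sub>R (x $ i) + v *\<^sub>R (y $ i)) \<le> u * norm (x $ i) + v * norm (y $ i)"
        using * by (intro order_trans[OF norm_triangle_ineq]) simp
      also have "\<dots> < \<rho>" using * by (intro convex_bound_lt) (auto simp: S_def)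
      finally show ?thesis by simp
    qed
    then show "u *\<^sub>R x + v *\<^sub>R y \<in> S" by (simp add: S_def)
  qed
  define b where "b = from_nat_into (UNIV :: (nat^'d) set)"
  have "infinite (UNIV :: (nat^'d) set)"
    using finite_imageD[of "\<lambda>k::nat. \<chi> i::'d. k" UNIV] finite_subset[of "range (\<lambda>k::nat. \<chi> i::'d. k)" UNIV]
    by (auto simp: inj_on_def vec_eq_iff)
  then have b: "bij_betw b UNIV UNIV" unfolding b_def by (intro bij_betw_from_nat_into) auto
  let ?t = "\<lambda>y h n. a (nat_vec n) * zpow_deriv y n h"
  let ?L = "\<lambda>n. real CARD('d) / \<rho> * M n"
  have L: "norm (?t y h n) \<le> ?L n * norm h" if "y \<in> S" for y h n
  proof -
    have "norm (a (nat_vec n)) * norm (zpow_deriv y n h) \<le> norm (a (nat_vec n)) * (real CARD('d) / \<rho> * (\<Prod>i\<in>UNIV. (1 + real (n $ i)) * \<rho> ^ (n $ i)) * norm h)"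
      using that by (intro mult_left_mono norm_zpow_deriv_le \<rho>) (auto simp: S_def less_imp_le)
    also have "\<dots> = real CARD('d) / \<rho> * (norm (a (nat_vec n)) * (\<Prod>i\<in>UNIV. (1 + real (n $ i)) * \<rho> ^ (n $ i))) * norm h"
      by (simp only: mult_ac times_divide_eq_left times_divide_eq_right)
    also have "\<dots> \<le> ?L n * norm h" using \<rho> by (intro mult_right_mono mult_left_mono M(2)) auto
    finally show ?thesis by (simp only: norm_mult)
  qed
  have Lsum: "?L summable_on UNIV" by (rule summable_on_cmult_right[OF M(1)])
  have Lb: "summable (\<lambda>k. ?L (b k))"
    using Lsum by (intro summable_on_imp_summable) (simp only: summable_on_reindex_bij_betw[OF b, of ?L])
  have enum: "(\<lambda>k. f (b k)) sums l" if "(f has_sum l) UNIV" for f :: "nat^'d \<Rightarrow> complex" and l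
    using that by (intro has_sum_imp_sums) (simp only: has_sum_reindex_bij_betw[OF b, of f])
  have tsum: "(?t y h has_sum infsum (?t y h) UNIV) UNIV" if "y \<in> S" for y h
    by (rule has_sum_infsum[OF abs_summable_summable[OF Infinite_Sum.abs_summable_on_comparison_test'[OF summable_on_cmult_left[OF Lsum, of "norm h"] L[OF that]]]])
  have tsums: "(\<lambda>k. ?t y h (b k)) sums infsum (?t y h) UNIV" if "y \<in> S" for y h
    by (rule enum[OF tsum[OF that]])
  have "\<exists>g. \<forall>y\<in>S. (\<lambda>k. a (nat_vec (b k)) * zpow y (b k)) sums g y \<and> (g has_derivative (\<lambda>h. infsum (?t y h) UNIV)) (at y within S)"
  proof (rule has_derivative_series[where f' = "\<lambda>k y h. ?t y h (b k)", OF Sconv _ _ zS])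
    show "((\<lambda>y. a (nat_vec (b k)) * zpow y (b k)) has_derivative (\<lambda>h. ?t y h (b k))) (at y within S)" for k y
      by (rule has_derivative_mult_right[OF zpow_has_derivative])
    show "(\<lambda>k. a (nat_vec (b k)) * zpow z (b k)) sums power_fun a z"
      by (rule enum[OF power_fun_has_sum[OF a z]])
    fix e :: real assume e: "e > 0"
    obtain K where K: "\<And>k. k \<ge> K \<Longrightarrow> norm (\<Sum>i. ?L (b (i + k))) < e"
      using suminf_exist_split[OF e Lb] by blast
    have "norm ((\<Sum>i<k. ?t y h (b i)) - infsum (?t y h) UNIV) \<le> e * norm h" if k: "k \<ge> K" and y: "y \<in> S" for k y h
    proof -
      have "(\<lambda>i. ?t y h (b (i + k))) sums (infsum (?t y h) UNIV - (\<Sum>i<k. ?t y h (b i)))"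
        by (rule sums_split_initial_segment[OF tsums[OF y]])
      then have "(\<Sum>i. ?t y h (b (i + k))) = infsum (?t y h) UNIV - (\<Sum>i<k. ?t y h (b i))" by (rule sums_unique[symmetric])
      then have "norm ((\<Sum>i<k. ?t y h (b i)) - infsum (?t y h) UNIV) = norm (\<Sum>i. ?t y h (b (i + k)))"
        by (simp only: norm_minus_commute)
      also have "\<dots> \<le> (\<Sum>i. ?L (b (i + k)) * norm h)"
        by (intro norm_suminf_le L[OF y] summable_mult2 summable_ignore_initial_segment[OF Lb])
      also have "\<dots> = (\<Sum>i. ?L (b (i + k))) * norm h"
        by (intro suminf_mult2[symmetric] summable_ignore_initial_segment[OF Lb])
      also have "\<dots> \<le> e * norm h"
        using K[OF k] by (intro mult_right_mono) auto
      finally show ?thesis .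
    qed
    then show "\<forall>\<^sub>F k in sequentially. \<forall>y\<in>S. \<forall>h. norm ((\<Sum>i<k. ?t y h (b i)) - infsum (?t y h) UNIV) \<le> e * norm h"
      unfolding eventually_sequentially by blast
  qed
  then obtain g where g: "\<And>y. y \<in> S \<Longrightarrow> (\<lambda>k. a (nat_vec (b k)) * zpow y (b k)) sums g y"
    "\<And>y. y \<in> S \<Longrightarrow> (g has_derivative (\<lambda>h. infsum (?t y h) UNIV)) (at y within S)" by blast
  have geq: "g y = power_fun a y" if "y \<in> S" for y
  proof -
    have "(\<lambda>k. a (nat_vec (b k)) * zpow y (b k)) sums power_fun a y"
      by (rule enum[OF power_fun_has_sum[OF a subsetD[OF Sd that]]])
    with g(1)[OF that] show ?thesis by (rule sums_unique2)
  qed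
  have "(g has_derivative (\<lambda>h. infsum (?t z h) UNIV)) (at z)"
    using g(2)[OF zS] by (simp only: at_within_open[OF zS Sopen])
  then have "(power_fun a has_derivative (\<lambda>h. infsum (?t z h) UNIV)) (at z)"
    by (rule has_derivative_transform_within_open[OF _ Sopen zS]) (rule geq)
  then show ?thesis using tsum[OF zS] by (rule that)
qed

lemma power_fun_has_derivative_complex:
  fixes a :: "int^'d::finite \<Rightarrow> complex"
  assumes a: "poly_bdd a" and z: "z \<in> polydisc"
  shows "\<exists>D. (power_fun a has_derivative D) (at z) \<and> (\<forall>c v. D (c *s v) = c * D v) \<and>
    (\<forall>h. ((\<lambda>n. a (nat_vec n) * zpow_deriv z n h) has_sum D h) UNIV)"
proof -
  obtain D where D: "(power_fun a has_derivative D) (at z)"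
    "\<And>h. ((\<lambda>n. a (nat_vec n) * zpow_deriv z n h) has_sum D h) UNIV"
    using power_fun_has_derivative[OF a z] by blast
  have hom: "D (c *s v) = c * D v" for c v
  proof (rule has_sum_unique[OF D(2)])
    have "((\<lambda>n. c * (a (nat_vec n) * zpow_deriv z n v)) has_sum c * D v) UNIV" by (rule has_sum_cmult_right[OF D(2)])
    then show "((\<lambda>n. a (nat_vec n) * zpow_deriv z n (c *s v)) has_sum c * D v) UNIV"
      by (simp only: zpow_deriv_scale mult.left_commute)
  qed
  show ?thesis by (intro exI[of _ D] conjI allI D hom)
qed

lemma power_fun_holomorphic:
  fixes a :: "int^'d::finite \<Rightarrow> complex"
  assumes "poly_bdd a"
  shows "power_fun a \<in> holomorphic_polydisc"
  unfolding holomorphic_polydisc_def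
proof (intro CollectI conjI ballI allI impI)
  fix z :: "complex^'d" assume z: "z \<in> polydisc"
  obtain D where D: "(power_fun a has_derivative D) (at z) \<and> (\<forall>c v. D (c *s v) = c * D v) \<and>
    (\<forall>h. ((\<lambda>n. a (nat_vec n) * zpow_deriv z n h) has_sum D h) UNIV)"
    using power_fun_has_derivative_complex[OF assms z] ..
  then show "\<exists>D. (power_fun a has_derivative D) (at z) \<and> (\<forall>a v. D (a *s v) = a * D v)"
    by (intro exI[of _ D] conjI) (erule conjunct1, erule conjunct2[THEN conjunct1])
qed (simp add: power_fun_def)

lemma complex_partial_eq:
  fixes u :: "complex^'d::finite \<Rightarrow> complex"
  assumes D: "(u has_derivative D) (at z)" "\<And>c v. D (c *s v) = c * D v"
  shows "complex_partial j u z = D (axis j 1)"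
proof -
  let ?s = "\<lambda>w. \<chi> i. if i = j then w else z $ i"
  have eq: "?s w = z + (w - z $ j) *s axis j 1" for w by (auto simp: vec_eq_iff axis_def)
  have "bounded_linear (\<lambda>w::complex. w *s (axis j 1 :: complex^'d))"
  proof (rule linear_conv_bounded_linear[THEN iffD1], rule linearI)
    show "(x + y) *s axis j 1 = x *s axis j 1 + y *s (axis j 1 :: complex^'d)" for x y by (rule vector_sadd_rdistrib)
    show "(r *\<^sub>R x) *s axis j 1 = r *\<^sub>R (x *s (axis j 1 :: complex^'d))" for r x by (auto simp: vec_eq_iff axis_def)
  qed
  then have "((\<lambda>w::complex. w *s (axis j 1 :: complex^'d)) has_derivative (\<lambda>w. w *s axis j 1)) F" for F
    by (rule bounded_linear_imp_has_derivative)
  moreover have "((\<lambda>w. w - z $ j) has_derivative (\<lambda>w. w)) (at (z $ j))" by (auto intro!: derivative_eq_intros)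
  ultimately have "((\<lambda>w. (w - z $ j) *s (axis j 1 :: complex^'d)) has_derivative (\<lambda>w. w *s axis j 1)) (at (z $ j))"
    using has_derivative_compose[of "\<lambda>w. w - z $ j" "\<lambda>w. w" "z $ j" UNIV "\<lambda>w. w *s (axis j 1 :: complex^'d)" "\<lambda>w. w *s axis j 1"] by blast
  from has_derivative_add[OF has_derivative_const[of z] this]
  have s: "(?s has_derivative (\<lambda>w. w *s axis j 1)) (at (z $ j))" unfolding eq by simp
  have "?s (z $ j) = z" by (auto simp: vec_eq_iff)
  then have "(u has_derivative D) (at (?s (z $ j)))" using D(1) by (simp only:)
  from has_derivative_compose[OF s this]
  have "((\<lambda>w. u (?s w)) has_derivative (\<lambda>w. D (axis j 1) * w)) (at (z $ j))"
    by (simp only: D(2) mult.commute)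
  then have "((\<lambda>w. u (?s w)) has_field_derivative D (axis j 1)) (at (z $ j))"
    by (simp only: has_field_derivative_def)
  then show ?thesis unfolding complex_partial_def by (rule DERIV_imp_deriv)
qed

lemma J_op_power_fun:
  fixes a :: "int^'d::finite \<Rightarrow> complex"
  assumes a: "poly_bdd a" and z: "z \<in> polydisc"
  shows "((\<lambda>n. (of_nat (\<Sum>i\<in>UNIV. n $ i) + of_nat CARD('d)) * a (nat_vec n) * zpow z n) has_sum J_op (power_fun a) z) UNIV"
proof -
  obtain D where D0: "(power_fun a has_derivative D) (at z) \<and> (\<forall>c v. D (c *s v) = c * D v) \<and>
    (\<forall>h. ((\<lambda>n. a (nat_vec n) * zpow_deriv z n h) has_sum D h) UNIV)"
    using power_fun_has_derivative_complex[OF a z] ..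
  note D = D0[THEN conjunct1] D0[THEN conjunct2, THEN conjunct1, rule_format] D0[THEN conjunct2, THEN conjunct2, rule_format]
  have lin: "linear D" using D(1) by (rule has_derivative_linear)
  have "z = (\<Sum>j\<in>UNIV. z $ j *s axis j 1)" by (rule basis_expansion[symmetric])
  then have "D z = D (\<Sum>j\<in>UNIV. z $ j *s axis j 1)" by (rule arg_cong)
  also have "\<dots> = (\<Sum>j\<in>UNIV. z $ j * complex_partial j (power_fun a) z)"
    by (simp only: linear_sum[OF lin] D(2) complex_partial_eq[OF D(1,2)])
  finally have "J_op (power_fun a) z = of_nat CARD('d) * power_fun a z + D z" by (simp only: J_op_def)
  moreover have "((\<lambda>n. of_nat CARD('d) * (a (nat_vec n) * zpow z n) + a (nat_vec n) * zpow_deriv z n z) has_sum of_nat CARD('d) * power_fun a z + D z) UNIV"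
    by (intro has_sum_add has_sum_cmult_right power_fun_has_sum[OF a z] D(3))
  ultimately show ?thesis by (simp add: zpow_deriv_self algebra_simps)
qed

text \<open>
  On the torus of radius \<open>1/2\<close> the difference of the two series vanishes identically, and its
  coefficients are recovered by integration against characters. Finite partial sums with a small
  absolutely convergent tail are integrated instead of the series.
\<close>

lemma power_series_of_unique:
  fixes u :: "complex^'d::finite \<Rightarrow> complex"
  assumes c: "power_series_of u c" and c': "power_series_of u c'"
  shows "c = c'"
proof
  fix m
  let ?\<Pi> = "(2 * pi) ^ CARD('d)"
  define w where "w n = (c n - c' n) * (1 / 2) ^ (\<Sum>i\<in>UNIV. n $ i)" for n
  have w: "((\<lambda>n. w n * torus_char (nat_vec n) x) has_sum 0) UNIV" for x
  proof -
    define z :: "complex^'d" where "z = (\<chi> i. 1 / 2 * cis (x $ i))"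
    have z: "z \<in> polydisc" by (simp add: z_def polydisc_def norm_mult)
    have "zpow z n = (1 / 2) ^ (\<Sum>i\<in>UNIV. n $ i) * torus_char (nat_vec n) x" for n
    proof -
      have "torus_char (nat_vec n) x = (\<Prod>i\<in>UNIV. cis (x $ i) ^ (n $ i))"
        by (simp add: torus_char_def inner_vec_def cis_conv_exp sum_distrib_left exp_sum exp_of_nat_mult[symmetric] mult_ac)
      then show ?thesis by (simp only: z_def vec_lambda_beta power_mult_distrib prod.distrib power_sum)
    qed
    moreover have "((\<lambda>n. c n * zpow z n - c' n * zpow z n) has_sum u z - u z) UNIV"
      
    proof -
      have "((\<lambda>n. c n * zpow z n) has_sum u z) UNIV" "((\<lambda>n. c' n * zpow z n) has_sum u z) UNIV"
        using c c' z unfolding power_series_of_def by blast+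
      from has_sum_add[OF this(1) has_sum_uminusI[OF this(2)]] show ?thesis by simp
    qed
    ultimately show ?thesis by (simp add: w_def algebra_simps)
  qed
  have "(\<lambda>n. w n * torus_char (nat_vec n) 0) summable_on UNIV" using w has_sum_imp_summable by blast
  then have ws: "(\<lambda>n. norm (w n)) summable_on UNIV"
    by (simp add: summable_on_iff_abs_summable_on_complex norm_mult)
  have "norm (w m) \<le> \<epsilon>" if \<epsilon>: "\<epsilon> > 0" for \<epsilon>
  proof -
    obtain F where F: "finite F" "dist (\<Sum>n\<in>F. norm (w n)) (\<Sum>\<^sub>\<infinity>n. norm (w n)) \<le> \<epsilon>"
      using has_sum_finite_approximation[OF has_sum_infsum[OF ws] \<epsilon>] by blast
    let ?G = "insert m F"
    have split: "infsum f UNIV = (\<Sum>n\<in>?G. f n) + infsum f (- ?G)" if "f summable_on UNIV" for f :: "nat^'d \<Rightarrow> 'b::banach"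
      using infsum_Un_disjoint[of f ?G "- ?G"] summable_on_subset_banach[OF that, of "- ?G"] F(1) by simp
    have "(\<Sum>n\<in>F. norm (w n)) \<le> (\<Sum>n\<in>?G. norm (w n))" using F(1) by (intro sum_mono2) auto
    moreover have "(\<Sum>\<^sub>\<infinity>n. norm (w n)) = (\<Sum>n\<in>?G. norm (w n)) + (\<Sum>\<^sub>\<infinity>n\<in>- ?G. norm (w n))" by (rule split[OF ws])
    ultimately have tail: "(\<Sum>\<^sub>\<infinity>n\<in>- ?G. norm (w n)) \<le> \<epsilon>" using F(2) by (auto simp: dist_real_def)
    have small: "norm (\<Sum>n\<in>?G. w n * torus_char (nat_vec n) x) \<le> \<epsilon>" for x
    proof -
      let ?f = "\<lambda>n. w n * torus_char (nat_vec n) x"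
      have "infsum ?f UNIV = 0" by (rule infsumI[OF w])
      then have "(\<Sum>n\<in>?G. ?f n) + infsum ?f (- ?G) = 0"
        using split[OF has_sum_imp_summable[OF w, of x]] by (simp only:)
      then have "(\<Sum>n\<in>?G. ?f n) = - infsum ?f (- ?G)" by (rule add_eq_0_iff2[THEN iffD1])
      then have "norm (\<Sum>n\<in>?G. ?f n) = norm (infsum ?f (- ?G))" by (simp only: norm_minus_cancel)
      also have "\<dots> \<le> (\<Sum>\<^sub>\<infinity>n\<in>- ?G. norm (?f n))"
        using summable_on_subset_banach[OF ws, of "- ?G"] by (intro norm_infsum_bound) (simp add: norm_mult)
      also have "\<dots> \<le> \<epsilon>" using tail by (simp add: norm_mult)
      finally show ?thesis .
    qed
    have "w m * of_real ?\<Pi> = (\<Sum>n\<in>?G. if n = m then w n * of_real ?\<Pi> else 0)" using F(1) by (simp add: sum.delta)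
    also have "\<dots> = (\<Sum>n\<in>?G. LINT x|torus_measure. w n * torus_char (nat_vec n - nat_vec m) x)"
      by (rule sum.cong) (auto simp: integral_torus_char inj_eq[OF inj_nat_vec])
    also have "\<dots> = (LINT x|torus_measure. (\<Sum>n\<in>?G. w n * torus_char (nat_vec n - nat_vec m) x))"
      by (rule integral_torus_sum[symmetric]) (intro continuous_intros)
    also have "\<dots> = (LINT x|torus_measure. (\<Sum>n\<in>?G. w n * torus_char (nat_vec n) x) * torus_char (- nat_vec m) x)"
      using torus_char_add[of _ "- nat_vec m"] by (simp add: sum_distrib_right mult.assoc del: sum.insert)
    finally have "norm (w m * of_real ?\<Pi>) = norm (LINT x|torus_measure. (\<Sum>n\<in>?G. w n * torus_char (nat_vec n) x) * torus_char (- nat_vec m) x)"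
      by (rule arg_cong)
    then have "norm (w m) * ?\<Pi> = norm (LINT x|torus_measure. (\<Sum>n\<in>?G. w n * torus_char (nat_vec n) x) * torus_char (- nat_vec m) x)"
      by (simp only: norm_mult norm_of_real) simp
    also have "\<dots> \<le> (LINT x|(torus_measure :: (real^'d) measure). \<epsilon>)"
    proof (rule Bochner_Integration.integral_norm_bound_integral)
      show "integrable torus_measure (\<lambda>x. (\<Sum>n\<in>?G. w n * torus_char (nat_vec n) x) * torus_char (- nat_vec m) x)"
        by (intro integrable_torus_continuous continuous_intros)
      show "norm ((\<Sum>n\<in>?G. w n * torus_char (nat_vec n) x) * torus_char (- nat_vec m) x) \<le> \<epsilon>" for x
        using small[of x] by (simp only: norm_mult norm_torus_char mult_1_right)
    qed simp
    also have "\<dots> = \<epsilon> * ?\<Pi>" by (simp add: measure_def emeasure_torus)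
    finally show ?thesis by simp
  qed
  then have "norm (w m) \<le> 0" by (rule field_le_epsilon[of _ 0, simplified])
  then show "c m = c' m" by (simp add: w_def)
qed

section \<open>Distributional boundary values\<close>

definition test_seminorm :: "nat \<Rightarrow> (real^'d::finite \<Rightarrow> complex) \<Rightarrow> real"
  where "test_seminorm N \<phi> = (\<Sum>is | length is \<le> N. SUP x. norm (iter_partial is \<phi> x))"

lemma finite_short_lists: "finite {is :: 'd::finite list. length is \<le> N}"
  using finite_lists_length_le[of "UNIV :: 'd set" N] by simp

lemma SUP_norm_nonneg: "\<phi> \<in> torus_test \<Longrightarrow> 0 \<le> (SUP x. norm (\<phi> x))"
  using order_trans[OF norm_ge_zero torus_test_le_SUP] by blast

lemma SUP_le_test_seminorm:
  assumes \<phi>: "\<phi> \<in> torus_test" and l: "length is \<le> N"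
  shows "(SUP x. norm (iter_partial is \<phi> x)) \<le> test_seminorm N \<phi>"
  unfolding test_seminorm_def
  by (rule member_le_sum[where f = "\<lambda>is. SUP x. norm (iter_partial is \<phi> x)"])
    (use l finite_short_lists SUP_norm_nonneg[OF torus_test_iter_partial[OF \<phi>]] in auto)

lemma test_seminorm_nonneg: "\<phi> \<in> torus_test \<Longrightarrow> 0 \<le> test_seminorm N \<phi>"
  unfolding test_seminorm_def by (intro sum_nonneg SUP_norm_nonneg torus_test_iter_partial)

text \<open>A distribution has finite order, and derivatives of order \<open>N\<close> of a character grow like \<open>|n|\<^sup>N\<close>.\<close>

lemma fourier_coeff_poly_bdd:
  fixes T :: "(real^'d::finite \<Rightarrow> complex) \<Rightarrow> complex"
  assumes "T \<in> torus_distributions"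
  shows "poly_bdd (fourier_coeff T)"
proof -
  let ?\<Pi> = "(2 * pi) ^ CARD('d)"
  obtain C N where C: "\<And>\<phi>. \<phi> \<in> torus_test \<Longrightarrow> norm (T \<phi>) \<le> C * test_seminorm N \<phi>"
    using assms unfolding torus_distributions_def test_seminorm_def by blast
  let ?L = "{is :: 'd list. length is \<le> N}"
  have "norm (fourier_coeff T n) \<le> (\<bar>C\<bar> * real (card ?L) / ?\<Pi>) * (1 + norm (int_vec n)) ^ N" for n
  proof -
    have b: "(SUP x. norm (iter_partial is (torus_char (- n)) x)) \<le> (1 + norm (int_vec n)) ^ N" if "length is \<le> N" for "is"
    proof (rule cSUP_least)
      fix x
      have "norm (\<Prod>i\<leftarrow>is. \<i> * of_int ((- n) $ i)) \<le> (1 + norm (int_vec n)) ^ length is"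
      proof (induction "is")
        case (Cons i js)
        have "\<bar>real_of_int (n $ i)\<bar> \<le> 1 + norm (int_vec n)"
          using component_le_norm_cart[of "int_vec n" i] by simp
        then have "\<bar>real_of_int (n $ i)\<bar> * norm (\<Prod>i\<leftarrow>js. \<i> * of_int ((- n) $ i)) \<le> (1 + norm (int_vec n)) * (1 + norm (int_vec n)) ^ length js"
          using Cons.IH by (intro mult_mono) auto
        then show ?case by (simp add: norm_mult)
      qed simp
      also have "\<dots> \<le> (1 + norm (int_vec n)) ^ N" using that by (intro power_increasing) auto
      finally show "norm (iter_partial is (torus_char (- n)) x) \<le> (1 + norm (int_vec n)) ^ N"
        by (simp only: iter_partial_torus_char norm_mult norm_torus_char mult_1_right)
    qed simp
    have "norm (T (torus_char (- n))) \<le> C * test_seminorm N (torus_char (- n))" by (rule C[OF torus_char_test])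
    also have "\<dots> \<le> \<bar>C\<bar> * test_seminorm N (torus_char (- n))"
      by (intro mult_right_mono test_seminorm_nonneg torus_char_test) simp
    also have "\<dots> \<le> \<bar>C\<bar> * (\<Sum>is\<in>?L. (1 + norm (int_vec n)) ^ N)"
      unfolding test_seminorm_def using b by (intro mult_left_mono sum_mono) auto
    also have "\<dots> = \<bar>C\<bar> * real (card ?L) * (1 + norm (int_vec n)) ^ N" by simp
    finally have "norm (T (torus_char (- n))) / ?\<Pi> \<le> \<bar>C\<bar> * real (card ?L) * (1 + norm (int_vec n)) ^ N / ?\<Pi>"
      by (rule divide_right_mono) simp
    moreover have "norm (fourier_coeff T n) = norm (T (torus_char (- n))) / ?\<Pi>"
      by (simp only: fourier_coeff_def norm_divide norm_of_real) simp
    ultimately show ?thesis by simp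
  qed
  then show ?thesis unfolding poly_bdd_def by blast
qed

lemma norm_integral_char_le:
  fixes \<psi> :: "real^'d::finite \<Rightarrow> complex"
  assumes \<psi>: "\<psi> \<in> torus_test"
  shows "norm (LINT x|torus_measure. torus_char n x * \<psi> x) \<le> (2 * pi) ^ CARD('d) * (SUP x. norm (\<psi> x))"
proof -
  have "norm (LINT x|torus_measure. torus_char n x * \<psi> x) \<le> (LINT x|(torus_measure :: (real^'d) measure). (SUP x. norm (\<psi> x)))"
  proof (rule Bochner_Integration.integral_norm_bound_integral)
    show "integrable torus_measure (\<lambda>x. torus_char n x * \<psi> x)"
      by (intro integrable_torus_continuous continuous_intros torus_test_continuous \<psi>)
    show "norm (torus_char n x * \<psi> x) \<le> (SUP x. norm (\<psi> x))" for x
      using torus_test_le_SUP[OF \<psi>, of x] by (simp only: norm_mult norm_torus_char mult_1_left)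
  qed simp
  also have "\<dots> = (2 * pi) ^ CARD('d) * (SUP x. norm (\<psi> x))" by (simp add: measure_def emeasure_torus)
  finally show ?thesis .
qed

lemma integral_char_by_parts:
  fixes \<psi> :: "real^'d::finite \<Rightarrow> complex"
  assumes \<psi>: "\<psi> \<in> torus_test"
  shows "(LINT x|torus_measure. torus_char n x * partial_deriv i \<psi> x) = - (\<i> * of_int (n $ i)) * (LINT x|torus_measure. torus_char n x * \<psi> x)"
proof -
  have \<psi>': "partial_deriv i \<psi> \<in> torus_test" using torus_test_iter_partial[OF \<psi>, of "[i]"] by simp
  let ?F' = "\<lambda>x. torus_char n x * partial_deriv i \<psi> x + \<i> * of_int (n $ i) * (torus_char n x * \<psi> x)"
  have int: "integrable torus_measure (\<lambda>x. torus_char n x * partial_deriv i \<psi> x)" "integrable torus_measure (\<lambda>x. torus_char n x * \<psi> x)"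
    by (intro integrable_torus_continuous continuous_intros torus_test_continuous \<psi> \<psi>')+
  have "(LINT x|torus_measure. ?F' x) = 0"
  proof (rule integral_torus_periodic_derivative[where F = "\<lambda>x. torus_char n x * \<psi> x" and i = i])
    show "continuous_on UNIV ?F'" by (intro continuous_intros torus_test_continuous \<psi> \<psi>')
    fix x :: "real^'d" and t
    have "\<psi> differentiable (at y)" for y
      using \<psi> C_infinity_differentiable[of \<psi> "[]" y] by (auto simp: torus_test_def)
    from has_vector_derivative_mult[OF has_vector_derivative_torus_char has_vector_derivative_line[OF this]]
    show "((\<lambda>t. torus_char n (x + t *\<^sub>R axis i 1) * \<psi> (x + t *\<^sub>R axis i 1)) has_vector_derivative ?F' (x + t *\<^sub>R axis i 1)) (at t)"
      by (simp add: mult_ac)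
    have "(2 * pi) *\<^sub>R axis i 1 = (2 * pi) *\<^sub>R (int_vec (axis i 1) :: real^'d)" by (simp add: int_vec_axis)
    then show "torus_char n (x + (2 * pi) *\<^sub>R axis i 1) * \<psi> (x + (2 * pi) *\<^sub>R axis i 1) = torus_char n x * \<psi> x"
      using \<psi> by (simp only: torus_char_periodic) (simp add: torus_test_def)
  qed
  also have "(LINT x|torus_measure. ?F' x) = (LINT x|torus_measure. torus_char n x * partial_deriv i \<psi> x)
    + \<i> * of_int (n $ i) * (LINT x|torus_measure. torus_char n x * \<psi> x)"
    using int by (subst Bochner_Integration.integral_add) (simp_all only: integral_mult_right_zero integrable_mult_right)
  finally show ?thesis by (simp add: eq_neg_iff_add_eq_0)
qed

lemma norm_integral_char_power:
  assumes \<phi>: "\<phi> \<in> torus_test"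
  shows "\<bar>real_of_int (n $ i)\<bar> ^ M * norm (LINT x|torus_measure. torus_char n x * \<phi> x)
    = norm (LINT x|torus_measure. torus_char n x * iter_partial (replicate M i) \<phi> x)"
proof (induction M)
  case (Suc M)
  show ?case
    using integral_char_by_parts[OF torus_test_iter_partial[OF \<phi>], of n i "replicate M i"]
    by (simp add: norm_mult Suc.IH[symmetric] mult.assoc)
qed simp

text \<open>Repeated integration by parts in the direction of the largest component of the frequency.\<close>

lemma integral_char_decay:
  fixes \<phi> :: "real^'d::finite \<Rightarrow> complex"
  assumes \<phi>: "\<phi> \<in> torus_test"
  shows "(1 + norm (int_vec n)) ^ M * norm (LINT x|torus_measure. torus_char n x * \<phi> x)
    \<le> (1 + real CARD('d)) ^ M * (2 * pi) ^ CARD('d) * test_seminorm M \<phi>"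
proof -
  let ?I = "norm (LINT x|torus_measure. torus_char n x * \<phi> x)"
  have key: "\<bar>real_of_int (n $ i)\<bar> ^ K * ?I \<le> (2 * pi) ^ CARD('d) * test_seminorm M \<phi>" if "K \<le> M" for i K
  proof -
    have "\<bar>real_of_int (n $ i)\<bar> ^ K * ?I \<le> (2 * pi) ^ CARD('d) * (SUP x. norm (iter_partial (replicate K i) \<phi> x))"
      unfolding norm_integral_char_power[OF \<phi>] by (rule norm_integral_char_le[OF torus_test_iter_partial[OF \<phi>]])
    also have "\<dots> \<le> (2 * pi) ^ CARD('d) * test_seminorm M \<phi>"
      using that by (intro mult_left_mono SUP_le_test_seminorm[OF \<phi>]) auto
    finally show ?thesis .
  qed
  have "Max (range (\<lambda>i. \<bar>n $ i\<bar>)) \<in> range (\<lambda>i. \<bar>n $ i\<bar>)" by (rule Max_in) auto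
  then obtain i where i: "Max (range (\<lambda>i. \<bar>n $ i\<bar>)) = \<bar>n $ i\<bar>" by blast
  have max: "\<bar>n $ j\<bar> \<le> \<bar>n $ i\<bar>" for j unfolding i[symmetric] by (rule Max_ge) auto
  have "norm (int_vec n) \<le> (\<Sum>j\<in>(UNIV::'d set). \<bar>real_of_int (n $ i)\<bar>)"
    using max by (intro order_trans[OF norm_int_vec_le_sum] sum_mono) (metis of_int_abs of_int_le_iff)
  then have le: "norm (int_vec n) \<le> real CARD('d) * \<bar>real_of_int (n $ i)\<bar>" by simp
  show ?thesis
  proof (cases "n $ i = 0")
    case True
    then have "norm (int_vec n) \<le> 0" using le by simp
    then have "(1 + norm (int_vec n)) ^ M * ?I = 1 * ?I" by simp
    also have "\<dots> \<le> (2 * pi) ^ CARD('d) * test_seminorm M \<phi>" using key[of 0 i] by simp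
    also have "\<dots> = 1 * ((2 * pi) ^ CARD('d) * test_seminorm M \<phi>)" by simp
    also have "\<dots> \<le> (1 + real CARD('d)) ^ M * ((2 * pi) ^ CARD('d) * test_seminorm M \<phi>)"
      by (intro mult_right_mono one_le_power mult_nonneg_nonneg test_seminorm_nonneg[OF \<phi>]) auto
    finally show ?thesis by (simp only: mult.assoc)
  next
    case False
    then have "1 \<le> \<bar>real_of_int (n $ i)\<bar>" by simp
    then have "1 + norm (int_vec n) \<le> (1 + real CARD('d)) * \<bar>real_of_int (n $ i)\<bar>"
      unfolding distrib_right using le by simp
    then have "(1 + norm (int_vec n)) ^ M \<le> (1 + real CARD('d)) ^ M * \<bar>real_of_int (n $ i)\<bar> ^ M"
      unfolding power_mult_distrib[symmetric] by (rule power_mono) simp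
    then have "(1 + norm (int_vec n)) ^ M * ?I \<le> (1 + real CARD('d)) ^ M * \<bar>real_of_int (n $ i)\<bar> ^ M * ?I"
      by (rule mult_right_mono) simp
    also have "\<dots> \<le> (1 + real CARD('d)) ^ M * ((2 * pi) ^ CARD('d) * test_seminorm M \<phi>)"
      unfolding mult.assoc by (rule mult_left_mono[OF key]) simp_all
    finally show ?thesis by (simp only: mult.assoc)
  qed
qed

lemma summable_on_decay:
  "(\<lambda>n::nat^'d::finite. inverse ((1 + norm (int_vec (nat_vec n))) ^ (2 * CARD('d)))) summable_on UNIV"
proof -
  have "summable (\<lambda>k. inverse (real (Suc k) ^ 2))"
    using inverse_power_summable[of 2, where 'a = real] by (subst summable_Suc_iff[of "\<lambda>k. inverse (real k ^ 2)"]) simp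
  then have "(\<lambda>n::nat^'d. \<Prod>i\<in>UNIV. inverse (real (Suc (n $ i)) ^ 2)) summable_on UNIV"
    by (intro summable_on_prod_vec) auto
  then show ?thesis
  proof (rule summable_on_comparison_test)
    fix n :: "nat^'d"
    have "(\<Prod>i\<in>UNIV. real (Suc (n $ i)) ^ 2) \<le> (\<Prod>i\<in>(UNIV::'d set). (1 + norm (int_vec (nat_vec n))) ^ 2)"
    proof (intro prod_mono conjI power_mono)
      fix i show "real (Suc (n $ i)) \<le> 1 + norm (int_vec (nat_vec n))"
        using component_le_norm_cart[of "int_vec (nat_vec n)" i] by simp
    qed auto
    also have "\<dots> = (1 + norm (int_vec (nat_vec n))) ^ (2 * CARD('d))" by (simp add: power_mult)
    finally show "inverse ((1 + norm (int_vec (nat_vec n))) ^ (2 * CARD('d))) \<le> (\<Prod>i\<in>UNIV. inverse (real (Suc (n $ i)) ^ 2))"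
      unfolding prod_inversef[of "\<lambda>i. real (Suc (n $ i)) ^ 2" UNIV, unfolded comp_def] by (intro le_imp_inverse_le prod_pos) auto
  qed auto
qed

definition dist_of :: "(int^'d::finite \<Rightarrow> complex) \<Rightarrow> (real^'d \<Rightarrow> complex) \<Rightarrow> complex"
  where "dist_of a \<phi> = (if \<phi> \<in> torus_test
    then \<Sum>\<^sub>\<infinity>n. a (nat_vec n) * (LINT x|torus_measure. torus_char (nat_vec n) x * \<phi> x) else 0)"

lemma dist_of_bounds:
  fixes a :: "int^'d::finite \<Rightarrow> complex"
  assumes a: "poly_bdd a"
  obtains C N where
    "\<And>\<phi>. \<phi> \<in> torus_test \<Longrightarrow> ((\<lambda>n. a (nat_vec n) * (LINT x|torus_measure. torus_char (nat_vec n) x * \<phi> x)) has_sum dist_of a \<phi>) UNIV"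
    "\<And>\<phi>. \<phi> \<in> torus_test \<Longrightarrow> norm (dist_of a \<phi>) \<le> C * test_seminorm N \<phi>"
proof -
  obtain C N where C: "C \<ge> 0" "\<And>n. norm (a n) \<le> C * (1 + norm (int_vec n)) ^ N"
    using poly_bddE[OF a] by blast
  let ?M = "N + 2 * CARD('d)"
  let ?K = "C * ((1 + real CARD('d)) ^ ?M * (2 * pi) ^ CARD('d))"
  let ?w = "\<lambda>n::nat^'d. inverse ((1 + norm (int_vec (nat_vec n))) ^ (2 * CARD('d)))"
  let ?t = "\<lambda>\<phi> n. a (nat_vec n) * (LINT x|torus_measure. torus_char (nat_vec n) x * \<phi> x)"
  have t: "norm (?t \<phi> n) \<le> ?K * test_seminorm ?M \<phi> * ?w n" if \<phi>: "\<phi> \<in> torus_test" for \<phi> n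
  proof -
    let ?b = "1 + norm (int_vec (nat_vec n))" and ?I = "norm (LINT x|torus_measure. torus_char (nat_vec n) x * \<phi> x)"
    have b: "?b > 0" by (simp add: add_pos_nonneg)
    have "norm (?t \<phi> n) \<le> C * ?b ^ N * ?I"
      unfolding norm_mult by (rule mult_right_mono[OF C(2)]) simp
    also have "?b ^ N = ?b ^ ?M * ?w n" using b by (simp add: power_add)
    also have "C * (?b ^ ?M * ?w n) * ?I = C * (?b ^ ?M * ?I) * ?w n" by (simp only: mult_ac)
    also have "\<dots> \<le> C * ((1 + real CARD('d)) ^ ?M * (2 * pi) ^ CARD('d) * test_seminorm ?M \<phi>) * ?w n"
      using b by (intro mult_right_mono mult_left_mono integral_char_decay[OF \<phi>] C(1)) simp
    finally show ?thesis by (simp only: mult.assoc)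
  qed
  have sm: "(\<lambda>n. ?K * test_seminorm ?M \<phi> * ?w n) summable_on UNIV" for \<phi> :: "real^'d \<Rightarrow> complex"
    by (rule summable_on_cmult_right[OF summable_on_decay])
  have nt: "(\<lambda>n. norm (?t \<phi> n)) summable_on UNIV" if "\<phi> \<in> torus_test" for \<phi>
    by (rule Infinite_Sum.abs_summable_on_comparison_test'[OF sm t[OF that]])
  show ?thesis
  proof (rule that[of "?K * infsum ?w UNIV" ?M])
    fix \<phi> :: "real^'d \<Rightarrow> complex" assume \<phi>: "\<phi> \<in> torus_test"
    show "(?t \<phi> has_sum dist_of a \<phi>) UNIV"
      using has_sum_infsum[OF abs_summable_summable[OF nt[OF \<phi>]]] \<phi> by (simp only: dist_of_def if_True)
    have "norm (dist_of a \<phi>) \<le> (\<Sum>\<^sub>\<infinity>n. norm (?t \<phi> n))"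
      using norm_infsum_bound[OF nt[OF \<phi>]] \<phi> by (simp only: dist_of_def if_True)
    also have "\<dots> \<le> (\<Sum>\<^sub>\<infinity>n. ?K * test_seminorm ?M \<phi> * ?w n)"
      by (rule infsum_mono[OF nt[OF \<phi>] sm]) (rule t[OF \<phi>])
    also have "\<dots> = ?K * test_seminorm ?M \<phi> * infsum ?w UNIV" by (rule infsum_cmult_right')
    finally show "norm (dist_of a \<phi>) \<le> ?K * infsum ?w UNIV * test_seminorm ?M \<phi>" by (simp only: mult_ac)
  qed
qed

lemma dist_of_has_sum:
  assumes "poly_bdd a" "\<phi> \<in> torus_test"
  shows "((\<lambda>n. a (nat_vec n) * (LINT x|torus_measure. torus_char (nat_vec n) x * \<phi> x)) has_sum dist_of a \<phi>) UNIV"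
  by (rule dist_of_bounds[OF assms(1)]) (use assms(2) in blast)

lemma dist_of_distribution:
  fixes a :: "int^'d::finite \<Rightarrow> complex"
  assumes a: "poly_bdd a"
  shows "dist_of a \<in> torus_distributions"
  unfolding torus_distributions_def mem_Collect_eq
proof (intro conjI ballI allI impI)
  fix \<phi> \<psi> :: "real^'d \<Rightarrow> complex" assume t: "\<phi> \<in> torus_test" "\<psi> \<in> torus_test"
  have "integrable torus_measure (\<lambda>x. torus_char n x * \<phi> x)" "integrable torus_measure (\<lambda>x. torus_char n x * \<psi> x)" for n
    by (intro integrable_torus_continuous continuous_intros torus_test_continuous t)+
  then have "(LINT x|torus_measure. torus_char n x * (\<phi> x + \<psi> x)) = (LINT x|torus_measure. torus_char n x * \<phi> x) + (LINT x|torus_measure. torus_char n x * \<psi> x)" for n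
    unfolding distrib_left by (rule Bochner_Integration.integral_add)
  with has_sum_add[OF dist_of_has_sum[OF a t(1)] dist_of_has_sum[OF a t(2)]]
  have "((\<lambda>n. a (nat_vec n) * (LINT x|torus_measure. torus_char (nat_vec n) x * (\<phi> x + \<psi> x))) has_sum dist_of a \<phi> + dist_of a \<psi>) UNIV"
    by (simp only: distrib_left)
  from has_sum_unique[OF dist_of_has_sum[OF a torus_test_add[OF t]] this]
  show "dist_of a (\<lambda>x. \<phi> x + \<psi> x) = dist_of a \<phi> + dist_of a \<psi>" .
next
  fix c and \<phi> :: "real^'d \<Rightarrow> complex" assume t: "\<phi> \<in> torus_test"
  have "(LINT x|torus_measure. torus_char n x * (c * \<phi> x)) = c * (LINT x|torus_measure. torus_char n x * \<phi> x)" for n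
    by (simp only: mult.left_commute[of _ c] integral_mult_right_zero)
  with has_sum_cmult_right[OF dist_of_has_sum[OF a t], of c]
  have "((\<lambda>n. a (nat_vec n) * (LINT x|torus_measure. torus_char (nat_vec n) x * (c * \<phi> x))) has_sum c * dist_of a \<phi>) UNIV"
    by (simp only: mult.left_commute[of c])
  from has_sum_unique[OF dist_of_has_sum[OF a torus_test_cmult[OF t]] this]
  show "dist_of a (\<lambda>x. c * \<phi> x) = c * dist_of a \<phi>" .
next
  show "\<exists>C N. \<forall>\<phi>\<in>torus_test. norm (dist_of a \<phi>) \<le> C * (\<Sum>is | length is \<le> N. SUP x. norm (iter_partial is \<phi> x))"
    unfolding test_seminorm_def[symmetric] by (rule dist_of_bounds[OF a]) blast
qed (simp add: dist_of_def)

lemma fourier_coeff_series: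
  fixes T :: "(real^'d::finite \<Rightarrow> complex) \<Rightarrow> complex"
  assumes T: "\<And>\<phi>. \<phi> \<in> torus_test \<Longrightarrow> ((\<lambda>n. c n * (LINT x|torus_measure. torus_char (nat_vec n) x * \<phi> x)) has_sum T \<phi>) UNIV"
  shows "fourier_coeff T (nat_vec m) = c m" and "nonneg_supp (fourier_coeff T)"
proof -
  let ?\<Pi> = "complex_of_real ((2 * pi) ^ CARD('d))"
  have I: "(LINT x|torus_measure. torus_char k x * torus_char (- n) x) = (if k = n then ?\<Pi> else 0)" for k n :: "int^'d"
    using integral_torus_char[of "k + - n"] by (simp add: torus_char_add[symmetric] del: of_real_power)
  have S: "((\<lambda>k. c k * (if nat_vec k = n then ?\<Pi> else 0)) has_sum T (torus_char (- n))) UNIV" for n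
    using T[OF torus_char_test, of "- n"] by (simp only: I)
  have "((\<lambda>k. c k * (if nat_vec k = nat_vec m then ?\<Pi> else 0)) has_sum (c m * ?\<Pi>)) {m}"
    by (rule has_sum_finiteI) simp_all
  then have "((\<lambda>k. c k * (if nat_vec k = nat_vec m then ?\<Pi> else 0)) has_sum (c m * ?\<Pi>)) UNIV"
    by (rule has_sum_cong_neutral[THEN iffD1, rotated -1]) (auto simp: inj_eq[OF inj_nat_vec])
  from has_sum_unique[OF S this] show "fourier_coeff T (nat_vec m) = c m"
    by (simp add: fourier_coeff_def)
  show "nonneg_supp (fourier_coeff T)" unfolding nonneg_supp_def
  proof (intro allI impI)
    fix n :: "int^'d" assume "\<exists>i. n $ i < 0"
    then have "nat_vec k \<noteq> n" for k by force
    then have "((\<lambda>k::nat^'d. 0) has_sum T (torus_char (- n))) UNIV" using S[of n] by simp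
    then have "T (torus_char (- n)) = 0" by (rule has_sum_unique) (rule has_sum_0, rule refl)
    then show "fourier_coeff T n = 0" by (simp add: fourier_coeff_def)
  qed
qed

lemma nonneg_supp_eqI:
  assumes "nonneg_supp a" "nonneg_supp b" "\<And>n. a (nat_vec n) = b (nat_vec n)"
  shows "a = b"
proof
  fix n show "a n = b n"
  proof (rule nat_vec_cases[of n])
    fix i assume "n $ i < 0"
    then show "a n = b n" using assms(1,2)[THEN nonneg_suppD] by simp
  qed (simp add: assms(3))
qed

text \<open>
  Testing the boundary value with characters identifies the Taylor coefficients with its
  Fourier coefficients.
\<close>

lemma boundary_value_coefficients:
  fixes u :: "complex^'d::finite \<Rightarrow> complex"
  assumes u: "u \<in> holomorphic_polydisc" and T: "is_boundary_value u T"
  shows "nonneg_supp (fourier_coeff T)" "poly_bdd (fourier_coeff T)" "u = power_fun (fourier_coeff T)"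
proof -
  from T obtain c where T': "T \<in> torus_distributions" and c: "power_series_of u c"
    and S: "\<And>\<phi>. \<phi> \<in> torus_test \<Longrightarrow> ((\<lambda>n. c n * (LINT x|torus_measure. torus_char (nat_vec n) x * \<phi> x)) has_sum T \<phi>) UNIV"
    unfolding is_boundary_value_def by blast
  show "nonneg_supp (fourier_coeff T)" by (rule fourier_coeff_series(2)[OF S])
  show p: "poly_bdd (fourier_coeff T)" by (rule fourier_coeff_poly_bdd[OF T'])
  show "u = power_fun (fourier_coeff T)"
  proof
    fix z show "u z = power_fun (fourier_coeff T) z"
    proof (cases "z \<in> polydisc")
      case True
      then have "((\<lambda>n. c n * zpow z n) has_sum u z) UNIV" using c unfolding power_series_of_def by blast
      moreover have "((\<lambda>n. c n * zpow z n) has_sum power_fun (fourier_coeff T) z) UNIV"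
        using power_fun_has_sum[OF p True] by (simp only: fourier_coeff_series(1)[OF S])
      ultimately show ?thesis by (rule has_sum_unique)
    next
      case False then show ?thesis using u by (simp add: holomorphic_polydisc_def power_fun_def)
    qed
  qed
qed

lemma power_series_of_power_fun: "poly_bdd a \<Longrightarrow> power_series_of (power_fun a) (\<lambda>n. a (nat_vec n))"
  unfolding power_series_of_def using power_fun_has_sum by blast

lemma is_boundary_value_power_fun:
  assumes a: "poly_bdd a"
  shows "is_boundary_value (power_fun a) T \<longleftrightarrow> T = dist_of a"
proof
  assume "T = dist_of a"
  then show "is_boundary_value (power_fun a) T"
    unfolding is_boundary_value_def
    using dist_of_distribution[OF a] power_series_of_power_fun[OF a] dist_of_has_sum[OF a] by blast
next
  assume "is_boundary_value (power_fun a) T"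
  then obtain c where T: "T \<in> torus_distributions" and c: "power_series_of (power_fun a) c"
    and S: "\<And>\<phi>. \<phi> \<in> torus_test \<Longrightarrow> ((\<lambda>n. c n * (LINT x|torus_measure. torus_char (nat_vec n) x * \<phi> x)) has_sum T \<phi>) UNIV"
    unfolding is_boundary_value_def by blast
  have ca: "c = (\<lambda>n. a (nat_vec n))" by (rule power_series_of_unique[OF c power_series_of_power_fun[OF a]])
  show "T = dist_of a"
  proof
    fix \<phi> show "T \<phi> = dist_of a \<phi>"
    proof (cases "\<phi> \<in> torus_test")
      case True
      from has_sum_unique[OF S[OF True, unfolded ca] dist_of_has_sum[OF a True]] show ?thesis .
    next
      case False then show ?thesis using T by (simp add: torus_distributions_def dist_of_def)
    qed
  qed
qed

lemma boundary_value_power_fun: "poly_bdd a \<Longrightarrow> boundary_value (power_fun a) = dist_of a"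
  unfolding boundary_value_def by (rule the_equality) (simp_all add: is_boundary_value_power_fun)

lemma fourier_coeff_dist_of:
  assumes "poly_bdd a" "nonneg_supp a"
  shows "fourier_coeff (dist_of a) = a"
  by (rule nonneg_supp_eqI[OF fourier_coeff_series(2)[OF dist_of_has_sum[OF assms(1)]] assms(2)
    fourier_coeff_series(1)[OF dist_of_has_sum[OF assms(1)]]])

lemma power_fun_inject:
  assumes "poly_bdd a" "nonneg_supp a" "poly_bdd b" "nonneg_supp b" "power_fun a = power_fun b"
  shows "a = b"
proof -
  have "dist_of a = dist_of b" using assms boundary_value_power_fun by metis
  then show ?thesis using assms fourier_coeff_dist_of by metis
qed

lemma poly_bdd_lin:
  assumes "poly_bdd a" "poly_bdd b"
  shows "poly_bdd (\<lambda>n. x * a n + y * b n)"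
proof -
  obtain C N where C: "C \<ge> 0" "\<And>n. norm (a n) \<le> C * (1 + norm (int_vec n)) ^ N" using poly_bddE[OF assms(1)] by blast
  obtain D M where D: "D \<ge> 0" "\<And>n. norm (b n) \<le> D * (1 + norm (int_vec n)) ^ M" using poly_bddE[OF assms(2)] by blast
  have "norm (x * a n + y * b n) \<le> (norm x * C + norm y * D) * (1 + norm (int_vec n)) ^ (N + M)" for n
  proof -
    let ?b = "1 + norm (int_vec n)"
    have "norm (x * a n + y * b n) \<le> norm x * norm (a n) + norm y * norm (b n)"
      by (rule order_trans[OF norm_triangle_ineq]) (simp add: norm_mult)
    also have "\<dots> \<le> norm x * (C * ?b ^ (N + M)) + norm y * (D * ?b ^ (N + M))"
      by (intro add_mono mult_left_mono order_trans[OF C(2)] order_trans[OF D(2)] C(1) D(1) power_increasing) auto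
    finally show ?thesis by (simp add: algebra_simps)
  qed
  then show ?thesis unfolding poly_bdd_def by blast
qed

lemma nonneg_supp_lin: "nonneg_supp a \<Longrightarrow> nonneg_supp b \<Longrightarrow> nonneg_supp (\<lambda>n. x * a n + y * b n)"
  by (simp add: nonneg_supp_def)

lemma power_fun_lin:
  assumes a: "poly_bdd a" and b: "poly_bdd b"
  shows "power_fun (\<lambda>n. x * a n + y * b n) z = x * power_fun a z + y * power_fun b z"
proof (cases "z \<in> polydisc")
  case True
  have "((\<lambda>n. x * (a (nat_vec n) * zpow z n) + y * (b (nat_vec n) * zpow z n)) has_sum x * power_fun a z + y * power_fun b z) UNIV"
    by (intro has_sum_add has_sum_cmult_right power_fun_has_sum a b True)
  then have "((\<lambda>n. (x * a (nat_vec n) + y * b (nat_vec n)) * zpow z n) has_sum x * power_fun a z + y * power_fun b z) UNIV"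
    by (simp only: distrib_right mult.assoc)
  from has_sum_unique[OF power_fun_has_sum[OF poly_bdd_lin[OF a b] True] this] show ?thesis .
qed (simp add: power_fun_def)

context dyadic_partition
begin

lemma LP_block_eq: "LP_block \<phi>0 \<phi> j T = block j (fourier_coeff T)"
proof
  fix x
  have "LP_block \<phi>0 \<phi> j T x = (\<Sum>\<^sub>\<infinity>n\<in>int_box (2 ^ Suc j). weight j n * fourier_coeff T n * torus_char n x)"
    unfolding LP_block_def weight_def[symmetric] by (rule infsum_cong_neutral) (auto dest: weight_outside simp del: power_Suc)
  also have "\<dots> = block j (fourier_coeff T) x"
    unfolding block_def by (rule infsum_finite[OF finite_int_box])
  finally show "LP_block \<phi>0 \<phi> j T x = block j (fourier_coeff T) x" .
qed

lemma torus_qnorm_eq: "torus_qnorm A \<phi>0 \<phi> s p q T = seq_qnorm A s p q (fourier_coeff T)"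
  by (cases A) (simp_all only: torus_qnorm.simps seq_qnorm.simps LP_block_eq)

lemma disc_qnorm_power_fun:
  assumes "poly_bdd a" "nonneg_supp a"
  shows "disc_qnorm A \<phi>0 \<phi> s p q (power_fun a) = seq_qnorm A s p q a"
  by (simp only: disc_qnorm_def torus_qnorm_eq boundary_value_power_fun[OF assms(1)] fourier_coeff_dist_of[OF assms])

definition seq_space :: "scale \<Rightarrow> real \<Rightarrow> ennreal \<Rightarrow> ennreal \<Rightarrow> (int^'d \<Rightarrow> complex) set"
  where "seq_space A s p q = {a. poly_bdd a \<and> nonneg_supp a \<and> seq_qnorm A s p q a < \<infinity>}"

text \<open>
  This reduces every assertion about the spaces on the polydisc to one about coefficient
  sequences.
\<close>

lemma disc_space_eq: "disc_space A \<phi>0 \<phi> s p q = power_fun ` seq_space A s p q"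
proof (intro set_eqI iffI)
  fix u assume "u \<in> disc_space A \<phi>0 \<phi> s p q"
  then obtain T where u: "u \<in> holomorphic_polydisc" and T: "is_boundary_value u T"
    and n: "torus_qnorm A \<phi>0 \<phi> s p q T < \<infinity>"
    by (auto simp: disc_space_def torus_space_plus_def)
  show "u \<in> power_fun ` seq_space A s p q"
    using boundary_value_coefficients[OF u T] n by (auto simp: seq_space_def torus_qnorm_eq)
next
  fix u assume "u \<in> power_fun ` seq_space A s p q"
  then obtain a where a: "poly_bdd a" "nonneg_supp a" "seq_qnorm A s p q a < \<infinity>" and u: "u = power_fun a"
    by (auto simp: seq_space_def)
  have "dist_of a \<in> torus_space_plus A \<phi>0 \<phi> s p q"
    using a dist_of_distribution[OF a(1)]
    by (auto simp: torus_space_plus_def torus_distributions_plus_def torus_qnorm_eq fourier_coeff_dist_of nonneg_suppD)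
  then show "u \<in> disc_space A \<phi>0 \<phi> s p q"
    using power_fun_holomorphic[OF a(1)] is_boundary_value_power_fun[OF a(1)] by (auto simp: disc_space_def u)
qed

end

section \<open>The operator on the level of coefficients\<close>

lemma sum_exp_le: "0 \<le> x \<Longrightarrow> (\<Sum>m\<le>R. x ^ m / fact m) \<le> exp x" for x :: real
proof -
  assume "0 \<le> x"
  then have "(\<Sum>m\<le>R. x ^ m /\<^sub>R fact m) \<le> exp x"
    unfolding exp_def by (intro sum_le_suminf summable_exp_generic) auto
  then show ?thesis by (simp add: divide_inverse mult.commute)
qed

lemma poly_bdd_exp_seq:
  fixes a :: "int^'d::finite \<Rightarrow> complex"
  assumes a: "poly_bdd a" and n0: "nonneg_supp a"
  shows "poly_bdd (exp_seq e lam a)"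
proof -
  obtain C N where C: "C \<ge> 0" "\<And>n. norm (a n) \<le> C * (1 + norm (int_vec n)) ^ N" using poly_bddE[OF a] by blast
  have "norm (exp_seq e lam a n) \<le> (exp (norm lam) * C) * (1 + norm (int_vec n)) ^ N" for n
  proof (cases "\<exists>i. n $ i < 0")
    case True
    then have "exp_seq e lam a n = 0" using nonneg_suppD[OF nonneg_supp_exp_seq[OF n0]] by blast
    then show ?thesis using C(1) by simp
  next
    case False
    let ?B = "C * (1 + norm (int_vec n)) ^ N"
    have le: "norm (a (n - axis e (int m))) \<le> ?B" if m: "m \<le> nat (n $ e)" for m
    proof -
      have "norm (int_vec (n - axis e (int m))) \<le> norm (int_vec n)"
      proof (rule norm_le_componentwise_cart)
        fix i
        have "\<bar>(n - axis e (int m)) $ i\<bar> \<le> \<bar>n $ i\<bar>" using m False by (auto simp: axis_def not_less le_nat_iff)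
        then show "norm (int_vec (n - axis e (int m)) $ i) \<le> norm (int_vec n $ i)"
          by (simp only: int_vec_nth real_norm_def of_int_abs[symmetric] of_int_le_iff)
      qed
      then have "C * (1 + norm (int_vec (n - axis e (int m)))) ^ N \<le> ?B"
        by (intro mult_left_mono power_mono C(1)) auto
      then show ?thesis using C(2)[of "n - axis e (int m)"] by linarith
    qed
    have "norm (exp_seq e lam a n) \<le> (\<Sum>m\<le>nat (n $ e). norm lam ^ m / fact m * ?B)"
      unfolding exp_seq_def
    proof (rule order_trans[OF norm_sum sum_mono])
      fix m assume "m \<in> {..nat (n $ e)}"
      then show "norm (lam ^ m / fact m * a (n - axis e (int m))) \<le> norm lam ^ m / fact m * ?B"
        unfolding norm_mult norm_divide norm_power norm_fact by (intro mult_left_mono le) auto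
    qed
    also have "\<dots> = (\<Sum>m\<le>nat (n $ e). norm lam ^ m / fact m) * ?B" by (rule sum_distrib_right[symmetric])
    also have "\<dots> \<le> exp (norm lam) * ?B" using C(1) by (intro mult_right_mono sum_exp_le) auto
    finally show ?thesis by (simp only: mult.assoc)
  qed
  then show ?thesis unfolding poly_bdd_def by blast
qed

text \<open>
  The coefficients of \<open>exp (- \<lambda> z\<^sub>e) exp (\<lambda> z\<^sub>e)\<close>: the Cauchy product of the two exponential
  series is the series of \<open>exp 0\<close>.
\<close>

lemma exp_seq_inverse:
  fixes a :: "int^'d::finite \<Rightarrow> complex"
  assumes a: "nonneg_supp a" and lm: "lam + mu = 0"
  shows "exp_seq e lam (exp_seq e mu a) = a"
proof
  fix n :: "int^'d"
  define R where "R = nat (n $ e)"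
  have R: "n $ e \<le> int R" by (simp add: R_def)
  let ?f = "\<lambda>m l. lam ^ m / fact m * (mu ^ l / fact l * a (n - axis e (int (m + l))))"
  have "exp_seq e lam (exp_seq e mu a) n = (\<Sum>m\<le>R. lam ^ m / fact m * exp_seq e mu a (n - axis e (int m)))"
    by (rule exp_seq_eq[OF nonneg_supp_exp_seq[OF a] R])
  also have "\<dots> = (\<Sum>m\<le>R. \<Sum>l\<le>R - m. ?f m l)"
  proof (rule sum.cong[OF refl])
    fix m assume "m \<in> {..R}"
    then have "(n - axis e (int m)) $ e \<le> int (R - m)" using R by (simp add: axis_def)
    moreover have "n - axis e (int m) - axis e (int l) = n - axis e (int (m + l))" for l
      by (simp add: vec_eq_iff axis_def)
    ultimately show "lam ^ m / fact m * exp_seq e mu a (n - axis e (int m)) = (\<Sum>l\<le>R - m. ?f m l)"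
      by (simp only: exp_seq_eq[OF a] sum_distrib_left)
  qed
  also have "\<dots> = (\<Sum>(m, l)\<in>(SIGMA m:{..R}. {..R - m}). ?f m l)" by (rule sum.Sigma) auto
  also have "(SIGMA m:{..R}. {..R - m}) = {(m, l). m + l \<le> R}" by auto
  also have "(\<Sum>(m, l)\<in>{(m, l). m + l \<le> R}. ?f m l) = (\<Sum>k\<le>R. \<Sum>i\<le>k. ?f i (k - i))"
    by (rule sum.triangle_reindex_eq)
  also have "\<dots> = (\<Sum>k\<le>R. if k = 0 then a n else 0)"
  proof (rule sum.cong[OF refl])
    fix k
    have "(\<Sum>i\<le>k. lam ^ i / fact i * (mu ^ (k - i) / fact (k - i))) = (lam + mu) ^ k / fact k"
      using exp_series_add_commuting[of lam mu k] by (simp add: scaleR_conv_of_real divide_inverse mult_ac)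
    moreover have "(\<Sum>i\<le>k. ?f i (k - i)) = (\<Sum>i\<le>k. lam ^ i / fact i * (mu ^ (k - i) / fact (k - i))) * a (n - axis e (int k))"
      unfolding sum_distrib_right by (rule sum.cong) simp_all
    ultimately have "(\<Sum>i\<le>k. ?f i (k - i)) = (lam + mu) ^ k / fact k * a (n - axis e (int k))"
      by (simp only:)
    moreover have "a (n - axis e (int 0)) = a n" by (rule arg_cong[where f = a]) (simp add: vec_eq_iff axis_def)
    ultimately show "(\<Sum>i\<le>k. ?f i (k - i)) = (if k = 0 then a n else 0)" by (cases k) (simp_all add: lm)
  qed
  also have "\<dots> = a n" by simp
  finally show "exp_seq e lam (exp_seq e mu a) n = a n" .
qed

context dyadic_partition
begin

definition L_seq :: "'d \<Rightarrow> complex \<Rightarrow> (int^'d \<Rightarrow> complex) \<Rightarrow> int^'d \<Rightarrow> complex"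
  where "L_seq k lam a n = J_seq a n + lam * a (n - axis k 1)"

definition L_inv :: "'d \<Rightarrow> complex \<Rightarrow> (int^'d \<Rightarrow> complex) \<Rightarrow> int^'d \<Rightarrow> complex"
  where "L_inv k lam a = exp_seq k (- lam) (J_inv (exp_seq k lam a))"

lemma L_seq_lin: "L_seq k lam (\<lambda>n. x * a n + y * b n) = (\<lambda>n. x * L_seq k lam a n + y * L_seq k lam b n)"
  by (simp add: L_seq_def J_seq_def fun_eq_iff algebra_simps)

lemma nonneg_supp_J_seq: "nonneg_supp a \<Longrightarrow> nonneg_supp (J_seq a)"
  by (simp add: nonneg_supp_def J_seq_def)

lemma nonneg_supp_J_inv: "nonneg_supp a \<Longrightarrow> nonneg_supp (J_inv a)"
  by (simp add: nonneg_supp_def J_inv_def)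

lemma nonneg_supp_L_seq:
  assumes "nonneg_supp a"
  shows "nonneg_supp (L_seq k lam a)"
  unfolding nonneg_supp_def
proof (intro allI impI)
  fix n :: "int^'d" assume "\<exists>i. n $ i < 0"
  then obtain i where i: "n $ i < 0" by blast
  then have "(n - axis k 1) $ i < 0" by (auto simp: axis_def)
  then show "L_seq k lam a n = 0" using nonneg_suppD[OF assms] i by (simp add: L_seq_def J_seq_def)
qed

text \<open>
  The operators \<open>L\<^sub>\<lambda>\<close> and \<open>J\<^sub>d\<close> are conjugate, because \<open>exp (\<lambda> z\<^sub>k)\<close> is an integrating factor:
  \<open>J\<^sub>d (exp (\<lambda> z\<^sub>k) u) = exp (\<lambda> z\<^sub>k) (J\<^sub>d u + \<lambda> z\<^sub>k u)\<close>.
\<close>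

lemma J_seq_exp_seq:
  assumes a: "nonneg_supp a"
  shows "J_seq (exp_seq k lam a) = exp_seq k lam (L_seq k lam a)"
proof
  fix n :: "int^'d"
  define R where "R = nat (n $ k)"
  have R: "n $ k \<le> int R" by (simp add: R_def)
  let ?s = "of_int (index_sum n) + of_nat CARD('d) :: complex"
  let ?a = "\<lambda>m. a (n - axis k (int m))"
  let ?h = "\<lambda>m. lam ^ m / fact m * of_nat m * ?a m"
  have shift: "(\<Sum>m\<le>R. lam ^ m / fact m * (lam * ?a (Suc m))) = (\<Sum>m\<le>R. ?h m)"
  proof -
    have "?a (Suc R) = 0" by (rule nonneg_suppD[OF a, of _ k]) (use R in \<open>simp add: axis_def\<close>)
    then have "(\<Sum>m\<le>R. ?h m) = (\<Sum>m\<le>Suc R. ?h m)" by (simp only: sum.atMost_Suc mult_zero_right add_0_right)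
    also have "\<dots> = ?h 0 + (\<Sum>m\<le>R. ?h (Suc m))" by (rule sum.atMost_Suc_shift)
    also have "\<dots> = (\<Sum>m\<le>R. ?h (Suc m))" by simp
    also have "\<dots> = (\<Sum>m\<le>R. lam ^ m / fact m * (lam * ?a (Suc m)))"
    proof (rule sum.cong[OF refl])
      fix m
      have "lam ^ Suc m / fact (Suc m) * of_nat (Suc m) = lam ^ m / fact m * lam"
        by (simp add: field_simps del: of_nat_Suc)
      then show "?h (Suc m) = lam ^ m / fact m * (lam * ?a (Suc m))" by (simp only: mult.assoc[symmetric])
    qed
    finally show ?thesis by (rule sym)
  qed
  have "exp_seq k lam (L_seq k lam a) n = (\<Sum>m\<le>R. lam ^ m / fact m * L_seq k lam a (n - axis k (int m)))"
    by (rule exp_seq_eq[OF nonneg_supp_L_seq[OF a] R])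
  also have "\<dots> = (\<Sum>m\<le>R. (?s * (lam ^ m / fact m * ?a m) - ?h m) + lam ^ m / fact m * (lam * ?a (Suc m)))"
  proof (rule sum.cong[OF refl])
    fix m
    have "index_sum (n - axis k (int m)) = index_sum n - int m"
      using index_sum_add_axis[of "n - axis k (int m)" k "int m"] by simp
    moreover have "n - axis k (int m) - axis k 1 = n - axis k (int (Suc m))" by (simp add: vec_eq_iff axis_def)
    ultimately show "lam ^ m / fact m * L_seq k lam a (n - axis k (int m))
      = (?s * (lam ^ m / fact m * ?a m) - ?h m) + lam ^ m / fact m * (lam * ?a (Suc m))"
      by (simp only: L_seq_def J_seq_def of_int_diff of_int_of_nat_eq) (simp only: algebra_simps)
  qed
  also have "\<dots> = ?s * (\<Sum>m\<le>R. lam ^ m / fact m * ?a m)"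
    by (simp only: sum.distrib sum_subtractf shift sum_distrib_left) simp
  also have "\<dots> = J_seq (exp_seq k lam a) n" by (simp only: J_seq_def exp_seq_eq[OF a R])
  finally show "J_seq (exp_seq k lam a) n = exp_seq k lam (L_seq k lam a) n" by (rule sym)
qed

lemma L_seq_conjugate:
  assumes "nonneg_supp a"
  shows "L_seq k lam a = exp_seq k (- lam) (J_seq (exp_seq k lam a))"
  unfolding J_seq_exp_seq[OF assms] by (rule exp_seq_inverse[OF nonneg_supp_L_seq[OF assms], symmetric]) simp

lemma index_sum_ge:
  assumes "\<And>i. 0 \<le> n $ i"
  shows "1 \<le> real_of_int (index_sum n) + real CARD('d)"
proof -
  have "0 \<le> index_sum n" unfolding index_sum_def by (rule sum_nonneg) (rule assms)
  moreover have "1 \<le> CARD('d)" using zero_less_card_finite[where 'a = 'd] by linarith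
  ultimately have "1 \<le> index_sum n + int CARD('d)" by linarith
  then have "real_of_int 1 \<le> real_of_int (index_sum n + int CARD('d))" by (simp only: of_int_le_iff)
  then show ?thesis by simp
qed

lemma symbol_J_norm: "norm (of_int (index_sum n) + of_nat CARD('d) :: complex) = \<bar>real_of_int (index_sum n) + real CARD('d)\<bar>"
proof -
  have "(of_int (index_sum n) + of_nat CARD('d) :: complex) = of_real (real_of_int (index_sum n) + real CARD('d))" by simp
  then show ?thesis by (simp only: norm_of_real)
qed

lemma symbol_J_nonzero:
  assumes "\<And>i. 0 \<le> n $ i"
  shows "(of_int (index_sum n) + of_nat CARD('d) :: complex) \<noteq> 0"
proof -
  have "norm (of_int (index_sum n) + of_nat CARD('d) :: complex) \<noteq> 0"
    unfolding symbol_J_norm using index_sum_ge[OF assms] by linarith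
  then show ?thesis by (simp only: norm_eq_zero not_False_eq_True)
qed

lemma J_seq_J_inv: "nonneg_supp a \<Longrightarrow> J_seq (J_inv a) = a"
  and J_inv_J_seq: "nonneg_supp a \<Longrightarrow> J_inv (J_seq a) = a"
proof -
  assume a: "nonneg_supp a"
  have *: "(of_int (index_sum n) + of_nat CARD('d) :: complex) \<noteq> 0 \<or> a n = 0" for n
    using symbol_J_nonzero[of n] nonneg_suppD[OF a, of n] not_le by blast
  have "J_seq (J_inv a) n = a n" "J_inv (J_seq a) n = a n" for n
    using *[of n] by (auto simp: J_seq_def J_inv_def)
  then show "J_seq (J_inv a) = a" "J_inv (J_seq a) = a" by (simp_all only: fun_eq_iff) blast+
qed

lemma nonneg_supp_L_inv: "nonneg_supp a \<Longrightarrow> nonneg_supp (L_inv k lam a)"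
  unfolding L_inv_def by (intro nonneg_supp_exp_seq nonneg_supp_J_inv)

lemma L_seq_L_inv:
  assumes a: "nonneg_supp a"
  shows "L_seq k lam (L_inv k lam a) = a"
proof -
  have b: "nonneg_supp (J_inv (exp_seq k lam a))" by (intro nonneg_supp_J_inv nonneg_supp_exp_seq a)
  have "L_seq k lam (L_inv k lam a) = exp_seq k (- lam) (J_seq (exp_seq k lam (L_inv k lam a)))"
    by (rule L_seq_conjugate[OF nonneg_supp_L_inv[OF a]])
  also have "exp_seq k lam (L_inv k lam a) = J_inv (exp_seq k lam a)"
    unfolding L_inv_def by (rule exp_seq_inverse[OF b]) simp
  also have "J_seq (J_inv (exp_seq k lam a)) = exp_seq k lam a" by (rule J_seq_J_inv[OF nonneg_supp_exp_seq[OF a]])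
  also have "exp_seq k (- lam) (exp_seq k lam a) = a" by (rule exp_seq_inverse[OF a]) simp
  finally show ?thesis .
qed

lemma L_inv_L_seq:
  assumes a: "nonneg_supp a"
  shows "L_inv k lam (L_seq k lam a) = a"
proof -
  have "L_inv k lam (L_seq k lam a) = exp_seq k (- lam) (J_inv (J_seq (exp_seq k lam a)))"
    by (simp only: L_inv_def J_seq_exp_seq[OF a])
  also have "J_inv (J_seq (exp_seq k lam a)) = exp_seq k lam a" by (rule J_inv_J_seq[OF nonneg_supp_exp_seq[OF a]])
  also have "exp_seq k (- lam) (exp_seq k lam a) = a" by (rule exp_seq_inverse[OF a]) simp
  finally show ?thesis .
qed

lemma poly_bdd_J_seq:
  assumes "poly_bdd a"
  shows "poly_bdd (J_seq a)"
proof -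
  obtain C N where C: "C \<ge> 0" "\<And>n. norm (a n) \<le> C * (1 + norm (int_vec n)) ^ N" using poly_bddE[OF assms] by blast
  have "norm (J_seq a n) \<le> real CARD('d) * C * (1 + norm (int_vec n)) ^ Suc N" for n
  proof -
    have "\<bar>real_of_int (index_sum n)\<bar> \<le> (\<Sum>i\<in>UNIV. \<bar>real_of_int (n $ i)\<bar>)"
      unfolding index_sum_def of_int_sum by (rule sum_abs)
    also have "\<dots> \<le> (\<Sum>i\<in>(UNIV::'d set). norm (int_vec n))"
      using component_le_norm_cart[of "int_vec n"] by (intro sum_mono) simp
    finally have "\<bar>real_of_int (index_sum n) + real CARD('d)\<bar> \<le> real CARD('d) * (1 + norm (int_vec n))"
      by (simp add: distrib_left)
    then have "norm (J_seq a n) \<le> real CARD('d) * (1 + norm (int_vec n)) * (C * (1 + norm (int_vec n)) ^ N)"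
      unfolding J_seq_def norm_mult symbol_J_norm by (intro mult_mono C(2)) auto
    then show ?thesis by (simp add: mult_ac)
  qed
  then show ?thesis unfolding poly_bdd_def by blast
qed

lemma poly_bdd_J_inv:
  assumes a: "poly_bdd a" and n0: "nonneg_supp a"
  shows "poly_bdd (J_inv a)"
proof -
  have "norm (J_inv a n) \<le> norm (a n)" for n
  proof (cases "\<exists>i. n $ i < 0")
    case True then show ?thesis using nonneg_suppD[OF nonneg_supp_J_inv[OF n0]] by auto
  next
    case False
    then have "1 \<le> real_of_int (index_sum n) + real CARD('d)" by (intro index_sum_ge) (simp add: not_less)
    then show ?thesis unfolding J_inv_def norm_divide symbol_J_norm
      by (intro divide_le_eq[THEN iffD2]) (auto simp: mult_le_cancel_left1)
  qed
  then show ?thesis using a unfolding poly_bdd_def by (meson order_trans)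
qed

lemma poly_bdd_L_seq: "poly_bdd a \<Longrightarrow> nonneg_supp a \<Longrightarrow> poly_bdd (L_seq k lam a)"
  by (simp add: L_seq_conjugate poly_bdd_exp_seq poly_bdd_J_seq nonneg_supp_J_seq nonneg_supp_exp_seq)

lemma poly_bdd_L_inv: "poly_bdd a \<Longrightarrow> nonneg_supp a \<Longrightarrow> poly_bdd (L_inv k lam a)"
  by (simp add: L_inv_def poly_bdd_exp_seq poly_bdd_J_inv nonneg_supp_J_inv nonneg_supp_exp_seq)

text \<open>
  Multiplication by the integrating factor preserves every order of smoothness, so the
  conjugate of \<open>T\<close> inherits the order of \<open>T\<close>.
\<close>

lemma conjugate_estimate:
  assumes T: "almost_diagonal \<sigma> T" "\<And>a. nonneg_supp a \<Longrightarrow> nonneg_supp (T a)" and A: "admissible A p q"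
  obtains C where "C > 0" "\<And>a. nonneg_supp a \<Longrightarrow>
    seq_qnorm A s p q (exp_seq k (- lam) (T (exp_seq k lam a))) \<le> ennreal C * seq_qnorm A (s + \<sigma>) p q a"
proof -
  obtain C1 where C1: "C1 > 0" "\<And>a. nonneg_supp a \<Longrightarrow> seq_qnorm A s p q (exp_seq k (- lam) a) \<le> ennreal C1 * seq_qnorm A (s + 0) p q a"
    using seq_qnorm_estimate[OF almost_diagonal_exp A] by blast
  obtain C2 where C2: "C2 > 0" "\<And>a. nonneg_supp a \<Longrightarrow> seq_qnorm A s p q (T a) \<le> ennreal C2 * seq_qnorm A (s + \<sigma>) p q a"
    using seq_qnorm_estimate[OF T(1) A] by blast
  obtain C3 where C3: "C3 > 0" "\<And>a. nonneg_supp a \<Longrightarrow> seq_qnorm A (s + \<sigma>) p q (exp_seq k lam a) \<le> ennreal C3 * seq_qnorm A (s + \<sigma> + 0) p q a"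
    using seq_qnorm_estimate[OF almost_diagonal_exp A] by blast
  show ?thesis
  proof (rule that[of "C1 * (C2 * C3)"])
    fix a :: "int^'d \<Rightarrow> complex" assume a: "nonneg_supp a"
    let ?b = "exp_seq k lam a"
    have b: "nonneg_supp ?b" by (rule nonneg_supp_exp_seq[OF a])
    have "seq_qnorm A s p q (exp_seq k (- lam) (T ?b)) \<le> ennreal C1 * seq_qnorm A s p q (T ?b)"
      using C1(2)[OF T(2)[OF b]] by (simp only: add_0_right)
    also have "\<dots> \<le> ennreal C1 * (ennreal C2 * (ennreal C3 * seq_qnorm A (s + \<sigma>) p q a))"
      using C3(2)[OF a] by (intro mult_left_mono order_trans[OF C2(2)[OF b]]) simp_all
    also have "\<dots> = ennreal (C1 * (C2 * C3)) * seq_qnorm A (s + \<sigma>) p q a"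
      using C1(1) C2(1) C3(1) by (simp add: ennreal_mult mult.assoc)
    finally show "seq_qnorm A s p q (exp_seq k (- lam) (T ?b)) \<le> ennreal (C1 * (C2 * C3)) * seq_qnorm A (s + \<sigma>) p q a" .
  qed (use C1(1) C2(1) C3(1) in simp)
qed

lemma L_seq_estimate:
  assumes "admissible A p q"
  obtains C where "C > 0" "\<And>a. nonneg_supp a \<Longrightarrow> seq_qnorm A s p q (L_seq k lam a) \<le> ennreal C * seq_qnorm A (s + 1) p q a"
proof -
  obtain C where C: "C > 0" "\<And>a. nonneg_supp a \<Longrightarrow>
    seq_qnorm A s p q (exp_seq k (- lam) (J_seq (exp_seq k lam a))) \<le> ennreal C * seq_qnorm A (s + 1) p q a"
    using conjugate_estimate[OF almost_diagonal_J nonneg_supp_J_seq assms] by blast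
  show ?thesis by (rule that[OF C(1)]) (simp only: L_seq_conjugate C(2))
qed

lemma L_inv_estimate:
  assumes "admissible A p q"
  obtains C where "C > 0" "\<And>a. nonneg_supp a \<Longrightarrow> seq_qnorm A (s + 1) p q (L_inv k lam a) \<le> ennreal C * seq_qnorm A s p q a"
proof -
  obtain C where C: "C > 0" "\<And>a. nonneg_supp a \<Longrightarrow>
    seq_qnorm A (s + 1) p q (exp_seq k (- lam) (J_inv (exp_seq k lam a))) \<le> ennreal C * seq_qnorm A (s + 1 + - 1) p q a"
    using conjugate_estimate[OF almost_diagonal_J_inv nonneg_supp_J_inv assms] by blast
  have "s + 1 + - 1 = s" by simp
  then show ?thesis using C(2) by (intro that[OF C(1)]) (simp only: L_inv_def)
qed

lemma mult_coordinate_power_fun: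
  fixes a :: "int^'d \<Rightarrow> complex"
  assumes a: "poly_bdd a" "nonneg_supp a" and z: "z \<in> polydisc"
  shows "((\<lambda>n. a (nat_vec n - axis k 1) * zpow z n) has_sum z $ k * power_fun a z) UNIV"
proof -
  let ?g = "\<lambda>n. a (nat_vec n - axis k 1) * zpow z n"
  let ?h = "\<lambda>n :: nat^'d. n + axis k 1"
  have inj: "inj ?h" by (simp add: inj_on_def)
  have h: "?g (?h n) = z $ k * (a (nat_vec n) * zpow z n)" for n
  proof -
    have "nat_vec (?h n) - axis k 1 = nat_vec n" by (simp add: vec_eq_iff axis_def)
    moreover have "zpow z (?h n) = zpow z n * (\<Prod>i\<in>UNIV. if i = k then z $ i else 1)"
      by (simp add: power_add prod.distrib axis_def if_distrib[of "power _"] cong: if_cong)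
    moreover have "(\<Prod>i\<in>UNIV. if i = k then z $ i else 1) = z $ k" by simp
    ultimately show ?thesis by (simp only: mult_ac)
  qed
  have "((?g \<circ> ?h) has_sum z $ k * power_fun a z) UNIV"
    unfolding comp_def h by (intro has_sum_cmult_right power_fun_has_sum a z)
  then have *: "(?g has_sum z $ k * power_fun a z) (range ?h)" by (simp only: has_sum_reindex[OF inj])
  show ?thesis
  proof (rule has_sum_cong_neutral[THEN iffD1, OF _ _ _ *])
    fix n assume "n \<in> UNIV - range ?h"
    then have "n \<notin> range ?h" by simp
    have "n $ k = 0"
    proof (rule ccontr)
      assume "n $ k \<noteq> 0"
      then have "n = ?h (\<chi> i. if i = k then n $ k - 1 else n $ i)" by (auto simp: vec_eq_iff axis_def)
      with \<open>n \<notin> range ?h\<close> show False by blast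
    qed
    then have "(nat_vec n - axis k 1) $ k < 0" by (simp add: axis_def)
    then have "a (nat_vec n - axis k 1) = 0" by (rule nonneg_suppD[OF a(2)])
    then show "?g n = 0" by simp
  qed auto
qed

lemma L_op_power_fun:
  assumes a: "poly_bdd a" "nonneg_supp a"
  shows "L_op k lam (power_fun a) = power_fun (L_seq k lam a)"
proof
  fix z show "L_op k lam (power_fun a) z = power_fun (L_seq k lam a) z"
  proof (cases "z \<in> polydisc")
    case True
    have s: "(of_int (index_sum (nat_vec n)) :: complex) = of_nat (\<Sum>i\<in>UNIV. n $ i)" for n :: "nat^'d"
      by (simp add: index_sum_def)
    have "((\<lambda>n. (of_nat (\<Sum>i\<in>UNIV. n $ i) + of_nat CARD('d)) * a (nat_vec n) * zpow z n + lam * (a (nat_vec n - axis k 1) * zpow z n))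
      has_sum J_op (power_fun a) z + lam * (z $ k * power_fun a z)) UNIV"
      by (intro has_sum_add has_sum_cmult_right J_op_power_fun mult_coordinate_power_fun a True)
    then have "((\<lambda>n. L_seq k lam a (nat_vec n) * zpow z n) has_sum J_op (power_fun a) z + lam * (z $ k * power_fun a z)) UNIV"
      by (simp only: L_seq_def J_seq_def s distrib_right mult.assoc)
    from infsumI[OF this] show ?thesis using True by (simp add: L_op_def power_fun_def[of "L_seq k lam a"])
  qed (simp add: L_op_def power_fun_def)
qed

lemma L_op_diff:
  assumes a: "poly_bdd a" "nonneg_supp a" and b: "poly_bdd b" "nonneg_supp b"
  shows "(\<lambda>z. power_fun b z - power_fun a z) = power_fun (\<lambda>n. 1 * b n + (- 1) * a n)"
    and "(\<lambda>z. L_op k lam (power_fun b) z - L_op k lam (power_fun a) z) = power_fun (L_seq k lam (\<lambda>n. 1 * b n + (- 1) * a n))"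
proof -
  show "(\<lambda>z. power_fun b z - power_fun a z) = power_fun (\<lambda>n. 1 * b n + (- 1) * a n)"
    by (simp add: fun_eq_iff power_fun_lin[OF b(1) a(1), of 1 "- 1", simplified])
  show "(\<lambda>z. L_op k lam (power_fun b) z - L_op k lam (power_fun a) z) = power_fun (L_seq k lam (\<lambda>n. 1 * b n + (- 1) * a n))"
    unfolding L_seq_lin L_op_power_fun[OF a] L_op_power_fun[OF b]
    by (simp add: fun_eq_iff power_fun_lin[OF poly_bdd_L_seq[OF b, of k lam] poly_bdd_L_seq[OF a, of k lam], of 1 "- 1", simplified])
qed

lemma L_op_bij_betw:
  assumes "admissible A p q"
  shows "bij_betw (L_op k lam) (disc_space A \<phi>0 \<phi> (s + 1) p q) (disc_space A \<phi>0 \<phi> s p q)"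
proof -
  obtain C where C: "\<And>a. nonneg_supp a \<Longrightarrow> seq_qnorm A s p q (L_seq k lam a) \<le> ennreal C * seq_qnorm A (s + 1) p q a"
    using L_seq_estimate[OF assms] by blast
  obtain D where D: "\<And>a. nonneg_supp a \<Longrightarrow> seq_qnorm A (s + 1) p q (L_inv k lam a) \<le> ennreal D * seq_qnorm A s p q a"
    using L_inv_estimate[OF assms] by blast
  have fin: "x < \<infinity>" if "x \<le> ennreal c * y" "y < \<infinity>" for x y and c :: real
    using that by (metis ennreal_less_top ennreal_mult_less_top infinity_ennreal_def order_le_less_trans)
  have 1: "L_seq k lam a \<in> seq_space A s p q" if "a \<in> seq_space A (s + 1) p q" for a
    using that fin[OF C] by (auto simp: seq_space_def poly_bdd_L_seq nonneg_supp_L_seq)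
  have 2: "L_inv k lam a \<in> seq_space A (s + 1) p q" if "a \<in> seq_space A s p q" for a
    using that fin[OF D] by (auto simp: seq_space_def poly_bdd_L_inv nonneg_supp_L_inv)
  show ?thesis
    unfolding bij_betw_def
  proof (intro conjI inj_onI equalityI subsetI)
    fix u v assume "u \<in> disc_space A \<phi>0 \<phi> (s + 1) p q" "v \<in> disc_space A \<phi>0 \<phi> (s + 1) p q" and eq: "L_op k lam u = L_op k lam v"
    then obtain a b where a: "poly_bdd a" "nonneg_supp a" "u = power_fun a" and b: "poly_bdd b" "nonneg_supp b" "v = power_fun b"
      by (auto simp: disc_space_eq seq_space_def)
    have "L_seq k lam a = L_seq k lam b"
      using eq unfolding a(3) b(3) L_op_power_fun[OF a(1,2)] L_op_power_fun[OF b(1,2)]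
      by (rule power_fun_inject[rotated -1]) (simp_all add: poly_bdd_L_seq nonneg_supp_L_seq a b)
    then have "L_inv k lam (L_seq k lam a) = L_inv k lam (L_seq k lam b)" by (rule arg_cong)
    then show "u = v" by (simp only: L_inv_L_seq a b)
  next
    fix f assume "f \<in> L_op k lam ` disc_space A \<phi>0 \<phi> (s + 1) p q"
    then obtain a where a: "a \<in> seq_space A (s + 1) p q" "f = L_op k lam (power_fun a)" by (auto simp: disc_space_eq)
    then have "f = power_fun (L_seq k lam a)" using L_op_power_fun[of a] by (simp add: seq_space_def)
    then show "f \<in> disc_space A \<phi>0 \<phi> s p q" using 1[OF a(1)] by (simp add: disc_space_eq)
  next
    fix f assume "f \<in> disc_space A \<phi>0 \<phi> s p q"
    then obtain a where a: "a \<in> seq_space A s p q" "f = power_fun a" by (auto simp: disc_space_eq)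
    have "f = L_op k lam (power_fun (L_inv k lam a))"
      using a 2[OF a(1)] L_op_power_fun[of "L_inv k lam a"] L_seq_L_inv[of a] by (simp add: seq_space_def)
    then show "f \<in> L_op k lam ` disc_space A \<phi>0 \<phi> (s + 1) p q" using 2[OF a(1)] by (auto simp: disc_space_eq)
  qed
qed

lemma L_op_two_sided_estimate:
  assumes "admissible A p q"
  obtains C where "C > 0"
    "\<And>u v. u \<in> disc_space A \<phi>0 \<phi> (s + 1) p q \<Longrightarrow> v \<in> disc_space A \<phi>0 \<phi> (s + 1) p q \<Longrightarrow>
      disc_qnorm A \<phi>0 \<phi> s p q (\<lambda>z. L_op k lam v z - L_op k lam u z) \<le> ennreal C * disc_qnorm A \<phi>0 \<phi> (s + 1) p q (\<lambda>z. v z - u z)"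
    "\<And>u v. u \<in> disc_space A \<phi>0 \<phi> (s + 1) p q \<Longrightarrow> v \<in> disc_space A \<phi>0 \<phi> (s + 1) p q \<Longrightarrow>
      disc_qnorm A \<phi>0 \<phi> (s + 1) p q (\<lambda>z. v z - u z) \<le> ennreal C * disc_qnorm A \<phi>0 \<phi> s p q (\<lambda>z. L_op k lam v z - L_op k lam u z)"
proof -
  obtain C where C: "C > 0" "\<And>a. nonneg_supp a \<Longrightarrow> seq_qnorm A s p q (L_seq k lam a) \<le> ennreal C * seq_qnorm A (s + 1) p q a"
    using L_seq_estimate[OF assms] by blast
  obtain D where D: "D > 0" "\<And>a. nonneg_supp a \<Longrightarrow> seq_qnorm A (s + 1) p q (L_inv k lam a) \<le> ennreal D * seq_qnorm A s p q a"
    using L_inv_estimate[OF assms] by blast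
  let ?E = "max C D"
  have E: "ennreal C * x \<le> ennreal ?E * x" "ennreal D * x \<le> ennreal ?E * x" for x
    by (intro mult_right_mono ennreal_leI; simp)+
  have up: "seq_qnorm A s p q (L_seq k lam a) \<le> ennreal ?E * seq_qnorm A (s + 1) p q a" if "nonneg_supp a" for a
    by (rule order_trans[OF C(2)[OF that] E(1)])
  have down: "seq_qnorm A (s + 1) p q a \<le> ennreal ?E * seq_qnorm A s p q (L_seq k lam a)" if "nonneg_supp a" for a
    using order_trans[OF D(2)[OF nonneg_supp_L_seq[OF that, of k lam]] E(2)] by (simp only: L_inv_L_seq[OF that])
  show ?thesis
  proof (rule that[of ?E])
    fix u v assume "u \<in> disc_space A \<phi>0 \<phi> (s + 1) p q" "v \<in> disc_space A \<phi>0 \<phi> (s + 1) p q"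
    then obtain a b where a: "poly_bdd a" "nonneg_supp a" "u = power_fun a" and b: "poly_bdd b" "nonneg_supp b" "v = power_fun b"
      by (auto simp: disc_space_eq seq_space_def)
    let ?c = "\<lambda>n. 1 * b n + (- 1) * a n"
    have c: "poly_bdd ?c" "nonneg_supp ?c" by (rule poly_bdd_lin[OF b(1) a(1)], rule nonneg_supp_lin[OF b(2) a(2)])
    note eqs = a(3) b(3) L_op_diff[OF a(1,2) b(1,2)] disc_qnorm_power_fun[OF c]
      disc_qnorm_power_fun[OF poly_bdd_L_seq[OF c] nonneg_supp_L_seq[OF c(2)]]
    show "disc_qnorm A \<phi>0 \<phi> s p q (\<lambda>z. L_op k lam v z - L_op k lam u z) \<le> ennreal ?E * disc_qnorm A \<phi>0 \<phi> (s + 1) p q (\<lambda>z. v z - u z)"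
      unfolding eqs by (rule up[OF c(2)])
    show "disc_qnorm A \<phi>0 \<phi> (s + 1) p q (\<lambda>z. v z - u z) \<le> ennreal ?E * disc_qnorm A \<phi>0 \<phi> s p q (\<lambda>z. L_op k lam v z - L_op k lam u z)"
      unfolding eqs by (rule down[OF c(2)])
  qed (use C(1) in simp)
qed

lemma L_op_norm_estimate:
  assumes "admissible A p q"
  shows "\<exists>C::real. C \<ge> 0 \<and> (\<forall>f\<in>disc_space A \<phi>0 \<phi> s p q. \<forall>u\<in>disc_space A \<phi>0 \<phi> (s + 1) p q. L_op k lam u = f \<longrightarrow>
    disc_qnorm A \<phi>0 \<phi> (s + 1) p q u \<le> ennreal C * disc_qnorm A \<phi>0 \<phi> s p q f)"
proof -
  obtain D where D: "D > 0" "\<And>a. nonneg_supp a \<Longrightarrow> seq_qnorm A (s + 1) p q (L_inv k lam a) \<le> ennreal D * seq_qnorm A s p q a"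
    using L_inv_estimate[OF assms] by blast
  have est: "disc_qnorm A \<phi>0 \<phi> (s + 1) p q u \<le> ennreal D * disc_qnorm A \<phi>0 \<phi> s p q (L_op k lam u)"
    if u: "u \<in> disc_space A \<phi>0 \<phi> (s + 1) p q" for u
  proof -
    obtain a where a: "poly_bdd a" "nonneg_supp a" "u = power_fun a" using u by (auto simp: disc_space_eq seq_space_def)
    have *: "seq_qnorm A (s + 1) p q a \<le> ennreal D * seq_qnorm A s p q (L_seq k lam a)"
      using D(2)[OF nonneg_supp_L_seq[OF a(2), of k lam]] by (simp only: L_inv_L_seq[OF a(2)])
    show ?thesis
      unfolding a(3) L_op_power_fun[OF a(1,2)] disc_qnorm_power_fun[OF a(1,2)]
        disc_qnorm_power_fun[OF poly_bdd_L_seq[OF a(1,2)] nonneg_supp_L_seq[OF a(2)]] by (rule *)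
  qed
  show ?thesis
  proof (intro exI[of _ D] conjI ballI impI)
    show "0 \<le> D" using D(1) by simp
    fix f u assume u: "u \<in> disc_space A \<phi>0 \<phi> (s + 1) p q" and eq: "L_op k lam u = f"
    show "disc_qnorm A \<phi>0 \<phi> (s + 1) p q u \<le> ennreal D * disc_qnorm A \<phi>0 \<phi> s p q f"
      using est[OF u] by (simp only: eq)
  qed
qed

lemma L_op_linear:
  assumes "u \<in> disc_space A \<phi>0 \<phi> s p q" "v \<in> disc_space A \<phi>0 \<phi> s p q"
  shows "L_op k lam (\<lambda>z. x * u z + y * v z) = (\<lambda>z. x * L_op k lam u z + y * L_op k lam v z)"
proof -
  obtain a b where a: "poly_bdd a" "nonneg_supp a" "u = power_fun a" and b: "poly_bdd b" "nonneg_supp b" "v = power_fun b"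
    using assms by (auto simp: disc_space_eq seq_space_def)
  have "L_op k lam (\<lambda>z. x * u z + y * v z) = L_op k lam (power_fun (\<lambda>n. x * a n + y * b n))"
    unfolding a(3) b(3) power_fun_lin[OF a(1) b(1)] by (rule refl)
  also have "\<dots> = power_fun (\<lambda>n. x * L_seq k lam a n + y * L_seq k lam b n)"
    unfolding L_seq_lin[symmetric] by (rule L_op_power_fun[OF poly_bdd_lin[OF a(1) b(1)] nonneg_supp_lin[OF a(2) b(2)]])
  also have "\<dots> = (\<lambda>z. x * L_op k lam u z + y * L_op k lam v z)"
    unfolding a(3) b(3) L_op_power_fun[OF a(1,2)] L_op_power_fun[OF b(1,2)]
      power_fun_lin[OF poly_bdd_L_seq[OF a(1,2)] poly_bdd_L_seq[OF b(1,2)], symmetric] by (rule refl)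
  finally show ?thesis .
qed

lemma ennreal_scaled_less:
  assumes "y \<le> ennreal C * x" "x < ennreal (\<epsilon> / C)" "C > 0" "\<epsilon> > 0"
  shows "y < ennreal \<epsilon>"
proof -
  have "ennreal C * x < ennreal C * ennreal (\<epsilon> / C)"
    using assms by (intro ennreal_mult_strict_left_mono) auto
  also have "\<dots> = ennreal \<epsilon>" using assms by (simp add: ennreal_mult[symmetric])
  finally show ?thesis using assms(1) by (rule order_le_less_trans[rotated])
qed

text \<open>
  Both topologies are defined through quasi-norms of differences, and the operator maps
  differences to differences. The two-sided estimate therefore compares the neighbourhoods directly,
  without the quasi-triangle inequality.
\<close>

lemma L_op_homeomorphic_map:
  assumes A: "admissible A p q"
  shows "homeomorphic_map (disc_topology A \<phi>0 \<phi> (s + 1) p q) (disc_topology A \<phi>0 \<phi> s p q) (L_op k lam)"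
proof -
  let ?X = "disc_space A \<phi>0 \<phi> (s + 1) p q" and ?Y = "disc_space A \<phi>0 \<phi> s p q" and ?L = "L_op k lam"
  let ?N = "\<lambda>u v. disc_qnorm A \<phi>0 \<phi> (s + 1) p q (\<lambda>z. v z - u z)" and ?M = "\<lambda>u v. disc_qnorm A \<phi>0 \<phi> s p q (\<lambda>z. v z - u z)"
  obtain C where C: "C > 0" "\<And>u v. u \<in> ?X \<Longrightarrow> v \<in> ?X \<Longrightarrow> ?M (?L u) (?L v) \<le> ennreal C * ?N u v"
    "\<And>u v. u \<in> ?X \<Longrightarrow> v \<in> ?X \<Longrightarrow> ?N u v \<le> ennreal C * ?M (?L u) (?L v)"
    by (rule L_op_two_sided_estimate[OF A, where k = k and lam = lam and s = s]) (rule that)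
  have bij: "bij_betw ?L ?X ?Y" by (rule L_op_bij_betw[OF A])
  then have im: "?L ` ?X = ?Y" and inj: "inj_on ?L ?X" by (auto simp: bij_betw_def)
  show ?thesis
  proof (rule bijective_open_imp_homeomorphic_map)
    show "continuous_map (disc_topology A \<phi>0 \<phi> (s + 1) p q) (disc_topology A \<phi>0 \<phi> s p q) ?L"
      unfolding continuous_map_def topspace_disc_topology
    proof (intro conjI allI impI)
      show "?L \<in> ?X \<rightarrow> ?Y" using im by blast
      fix U assume U: "openin (disc_topology A \<phi>0 \<phi> s p q) U"
      show "openin (disc_topology A \<phi>0 \<phi> (s + 1) p q) {u \<in> ?X. ?L u \<in> U}"
        unfolding openin_disc_topology
      proof (intro conjI ballI)
        fix u assume u: "u \<in> {u \<in> ?X. ?L u \<in> U}"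
        then obtain \<epsilon> where \<epsilon>: "\<epsilon> > 0" "\<And>w. w \<in> ?Y \<Longrightarrow> ?M (?L u) w < ennreal \<epsilon> \<Longrightarrow> w \<in> U"
          using U unfolding openin_disc_topology by blast
        have "?L v \<in> U" if v: "v \<in> ?X" "?N u v < ennreal (\<epsilon> / C)" for v
        proof (rule \<epsilon>(2))
          show "?L v \<in> ?Y" using im v(1) by blast
          show "?M (?L u) (?L v) < ennreal \<epsilon>"
            by (rule ennreal_scaled_less[OF C(2) v(2) C(1) \<epsilon>(1)]) (use u v in auto)
        qed
        then show "\<exists>\<epsilon>>0. \<forall>v\<in>?X. ?N u v < ennreal \<epsilon> \<longrightarrow> v \<in> {u \<in> ?X. ?L u \<in> U}"
          using \<epsilon>(1) C(1) by (intro exI[of _ "\<epsilon> / C"]) simp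
      qed simp
    qed
    show "open_map (disc_topology A \<phi>0 \<phi> (s + 1) p q) (disc_topology A \<phi>0 \<phi> s p q) ?L"
      unfolding open_map_def
    proof (intro allI impI)
      fix U assume U: "openin (disc_topology A \<phi>0 \<phi> (s + 1) p q) U"
      then have UX: "U \<subseteq> ?X" by (simp add: openin_disc_topology)
      show "openin (disc_topology A \<phi>0 \<phi> s p q) (?L ` U)"
        unfolding openin_disc_topology
      proof (intro conjI ballI)
        show "?L ` U \<subseteq> ?Y" using UX im by blast
        fix f assume "f \<in> ?L ` U"
        then obtain u where u: "u \<in> U" "f = ?L u" by blast
        then obtain \<epsilon> where \<epsilon>: "\<epsilon> > 0" "\<And>v. v \<in> ?X \<Longrightarrow> ?N u v < ennreal \<epsilon> \<Longrightarrow> v \<in> U"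
          using U unfolding openin_disc_topology by blast
        have "w \<in> ?L ` U" if w: "w \<in> ?Y" "?M f w < ennreal (\<epsilon> / C)" for w
        proof -
          obtain v where v: "v \<in> ?X" "w = ?L v" using w(1) im by blast
          have "?N u v < ennreal \<epsilon>"
            by (rule ennreal_scaled_less[OF C(3) w(2)[unfolded u(2) v(2)] C(1) \<epsilon>(1)]) (use u v UX in auto)
          then show ?thesis using \<epsilon>(2) v by blast
        qed
        then show "\<exists>\<epsilon>>0. \<forall>w\<in>?Y. ?M f w < ennreal \<epsilon> \<longrightarrow> w \<in> ?L ` U"
          using \<epsilon>(1) C(1) by (intro exI[of _ "\<epsilon> / C"]) simp
      qed
    qed
  qed (simp_all only: topspace_disc_topology im inj)
qed

end

theorem proposition6p1:
  fixes k :: "'d::finite"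
    and \<phi>0 \<phi> :: "real^'d \<Rightarrow> complex"
    and lam :: complex and s :: real and p q :: ennreal and A :: scale
  assumes "dyadic_resolution \<phi>0 \<phi>"
    and "admissible A p q"
  shows "(\<forall>u\<in>disc_space A \<phi>0 \<phi> (s + 1) p q. \<forall>v\<in>disc_space A \<phi>0 \<phi> (s + 1) p q. \<forall>a b.
            L_op k lam (\<lambda>z. a * u z + b * v z) = (\<lambda>z. a * L_op k lam u z + b * L_op k lam v z))
       \<and> homeomorphic_map (disc_topology A \<phi>0 \<phi> (s + 1) p q) (disc_topology A \<phi>0 \<phi> s p q)
           (L_op k lam)
       \<and> (\<forall>f\<in>disc_space A \<phi>0 \<phi> s p q. \<exists>!u. u \<in> disc_space A \<phi>0 \<phi> (s + 1) p q \<and> L_op k lam u = f)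
       \<and> (\<exists>C::real. C \<ge> 0 \<and>
            (\<forall>f\<in>disc_space A \<phi>0 \<phi> s p q. \<forall>u\<in>disc_space A \<phi>0 \<phi> (s + 1) p q. L_op k lam u = f \<longrightarrow>
               disc_qnorm A \<phi>0 \<phi> (s + 1) p q u \<le> ennreal C * disc_qnorm A \<phi>0 \<phi> s p q f))"
proof -
  interpret dyadic_partition \<phi>0 \<phi> by (rule dyadic_partition.intro[OF assms(1)])
  let ?X = "disc_space A \<phi>0 \<phi> (s + 1) p q" and ?Y = "disc_space A \<phi>0 \<phi> s p q"
  have bij: "bij_betw (L_op k lam) ?X ?Y" by (rule L_op_bij_betw[OF assms(2)])
  show ?thesis
  proof (intro conjI ballI allI)
    fix u v a b assume "u \<in> ?X" "v \<in> ?X"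
    then show "L_op k lam (\<lambda>z. a * u z + b * v z) = (\<lambda>z. a * L_op k lam u z + b * L_op k lam v z)"
      by (rule L_op_linear)
  next
    show "homeomorphic_map (disc_topology A \<phi>0 \<phi> (s + 1) p q) (disc_topology A \<phi>0 \<phi> s p q) (L_op k lam)"
      by (rule L_op_homeomorphic_map[OF assms(2)])
  next
    fix f assume "f \<in> ?Y"
    then have "f \<in> L_op k lam ` ?X" by (simp only: bij_betw_imp_surj_on[OF bij])
    then obtain u where u: "f = L_op k lam u" "u \<in> ?X" by (rule imageE)
    show "\<exists>!u. u \<in> ?X \<and> L_op k lam u = f"
    proof (rule ex1I[of _ u])
      show "u \<in> ?X \<and> L_op k lam u = f" by (intro conjI u(2) u(1)[symmetric])
      fix w assume w: "w \<in> ?X \<and> L_op k lam w = f"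
      have "L_op k lam w = L_op k lam u" by (rule trans[OF conjunct2[OF w] u(1)])
      then show "w = u" by (rule inj_onD[OF bij_betw_imp_inj_on[OF bij] _ conjunct1[OF w] u(2)])
    qed
  next
    show "\<exists>C::real. C \<ge> 0 \<and> (\<forall>f\<in>?Y. \<forall>u\<in>?X. L_op k lam u = f \<longrightarrow>
      disc_qnorm A \<phi>0 \<phi> (s + 1) p q u \<le> ennreal C * disc_qnorm A \<phi>0 \<phi> s p q f)"
      by (rule L_op_norm_estimate[OF assms(2)])
  qed
qed

end
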